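(* Let $E\subset\mathbb{R}^{n+1}$ be an ($n$-dimensional) Ahlfors-David regular set, $\Omega:=\mathbb{R}^{n+1}\setminus E$, and let $\Theta f(X)=\int_E\psi(X,y)f(y)\,d\sigma(y)$, $X\in\Omega$, where, for some $C_\psi>0$ and $\alpha>0$, the kernel $\psi$ satisfies $$|\psi(X,y)|\le C_\psi\frac{\delta(X)^\alpha}{|X-y|^{n+\alpha}}\qquad (y\in E,\ X\in\Omega),$$ $$|\psi(X,y)-\psi(X,y')|\le C_\psi\frac{|y-y'|^\alpha}{|X-y|^{n+\alpha}}\qquad (y,y'\in E,\ X\in\Omega,\ 2|y-y'|\le|X-y|).$$ Suppose that there exist a constant $C_0>0$, an exponent $p\in(1,\infty)$ and a system $\{b_Q\}$ of functions on $E$ indexed by the dyadic cubes $Q\in\mathbb{D}(E)$ such that for each $Q\in\mathbb{D}(E)$, $$\left|\int_Q b_Q(x)\,d\sigma(x)\right|\ge\frac1{C_0}\sigma(Q),$$ $$\int_E|b_Q(x)|^p\,d\sigma(x)\le C_0\,\sigma(Q),$$ $$\int_Q\left(\iint_{\Gamma_Q(x)}|\Theta b_Q(Y)|^2\frac{dY}{\delta(Y)^{n+1}}\right)^{p/2}d\sigma(x)\le C_0\,\sigma(Q).$$ Then there exists a positive constant $C$ such that for all $f\in L^2(E,\sigma)$, $$\iint_\Omega|\Theta f(Y)|^2\frac{dY}{\delta(Y)}\le C\int_E|f(x)|^2\,d\sigma(x).$$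
   Context: Ahlfors-David regular (ADR): a closed set $E\subset\mathbb{R}^{n+1}$ such that, with $\sigma:=\mathcal{H}^n|_E$ ($n$-dimensional Hausdorff measure restricted to $E$), there is a constant $C>0$ with $C^{-1}r^n\le\sigma(B(x,r))\le Cr^n$ for all $x\in E$ and $0<r<\operatorname{diam}(E)$. The set $E$ may be bounded or unbounded. We put $\Omega=\mathbb{R}^{n+1}\setminus E$ (so $E=\partial\Omega$; $\Omega$ need not be connected) and $\delta(X)=\operatorname{dist}(X,E)$. Functions and kernels may be complex-valued and are measurable; $dY$ is Lebesgue measure on $\mathbb{R}^{n+1}$. Dyadic grid: there exist constants $a_0>0$, $\eta_0>0$, $c_1,c_2<\infty$, depending only on dimension and the ADR constants, and for each $k\in\mathbb{Z}$ a collection of Borel sets ("cubes") $\mathbb{D}_k=\{Q_j^k\subset E: j\in\mathcal{I}_k\}$ such that: (1) $E=\bigcup_jQ_j^k$ for each $k$; (2) if $k<k'$ then either $Q_\ell^{k'}\cap Q_j^k=\emptyset$ or $Q_\ell^{k'}\subset Q_j^k$; (3) for each $(\ell,k')$ and each $k<k'$ there is a unique $j$ with $Q_\ell^{k'}\subset Q_j^k$; (4) $c_1^{-1}2^{-k}\le\operatorname{diam}(Q_j^k)\le c_12^{-k}$ and $c_1^{-1}2^{-kn}\le\sigma(Q_j^k)\le c_12^{-kn}$; (5) each $Q_j^k$ contains some $B(x_j^k,a_02^{-k})\cap E$; (6) $\sigma(\{x\in Q_j^k:\operatorname{dist}(x,E\setminus Q_j^k)\le\tau2^{-k}\})\le c_2\tau^{\eta_0}\sigma(Q_j^k)$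 for all $\tau\in(0,a_0)$. Such a grid is fixed, and $\mathbb{D}(E)=\bigcup_k\mathbb{D}_k$; if $\operatorname{diam}(E)<\infty$, only those $k$ with $2^{-k}\lesssim\operatorname{diam}(E)$ are considered. For $Q\in\mathbb{D}_k$ set $\ell(Q)=2^{-k}$. Whitney cubes: $\mathcal{W}$ is a fixed collection of pairwise non-overlapping dyadic cubes $I\subset\mathbb{R}^{n+1}$ (side length $\ell(I)$) covering $\Omega$, with $4\operatorname{diam}(I)\le\operatorname{dist}(4I,E)\le\operatorname{dist}(I,E)\le40\operatorname{diam}(I)$ for all $I\in\mathcal{W}$ and $\frac14\operatorname{diam}(I_1)\le\operatorname{diam}(I_2)\le4\operatorname{diam}(I_1)$ whenever $I_1,I_2\in\mathcal{W}$ touch. Whitney regions and cones: for $Q\in\mathbb{D}(E)$ let $\mathcal{C}_Q=\{I\in\mathcal{W}:\ell(I)/8\le\ell(Q)\le8\ell(I),\ \operatorname{dist}(Q,I)\le\beta\,\ell(Q)\}$ and $\mathcal{U}_Q=\bigcup_{I\in\mathcal{C}_Q}I$. Here $\beta>0$ is a fixed constant chosen sufficiently large depending on the dimension and the ADR constants (in particular so that $\mathcal{C}_Q\ne\emptyset$ for every $Q$). For $x\in Q$ the $Q$-truncated cone is $\Gamma_Q(x)=\bigcup_{Q'\in\mathbb{D}(E),\,x\in Q'\subseteq Q}\mathcal{U}_{Q'}$. Convention: constants $C$ in conclusions depend only on dimension and the constants appearing in the hypotheses. *)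

theory Defs
  imports "HOL-Analysis.Analysis"
begin

section \<open>Hausdorff measure\<close>

text \<open>The measure \<open>H\<^sup>n\<close> is taken without the factor \<open>\<omega>\<^sub>n / 2\<^sup>n\<close>; a different normalization only
  changes constants by a dimensional factor.  The empty set is singled out so that it does not
  contribute \<open>0 ^ 0 = 1\<close> when \<open>n = 0\<close>.\<close>

definition hausdorff_gauge :: "nat \<Rightarrow> 'a::metric_space set \<Rightarrow> ennreal" where
  "hausdorff_gauge n S = (if S = {} then 0 else ennreal (diameter S ^ n))"

definition hausdorff_content :: "nat \<Rightarrow> real \<Rightarrow> 'a::metric_space set \<Rightarrow> ennreal" where
  "hausdorff_content n \<epsilon> A =
     (INF S \<in> {S :: nat \<Rightarrow> 'a set. A \<subseteq> (\<Union>i. S i) \<and> (\<forall>i. bounded (S i) \<and> diameter (S i) \<le> \<epsilon>)}.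
        \<Sum>i. hausdorff_gauge n (S i))"

definition hausdorff_outer :: "nat \<Rightarrow> 'a::metric_space set \<Rightarrow> ennreal" where
  "hausdorff_outer n A = (SUP \<epsilon> \<in> {0<..}. hausdorff_content n \<epsilon> A)"

definition hausdorff_measure :: "nat \<Rightarrow> 'a::metric_space measure" where
  "hausdorff_measure n = measure_of UNIV (sets borel) (hausdorff_outer n)"

text \<open>Caratheodory's criterion, so that \<^const>\<open>measure_of\<close> above does not collapse to zero.\<close>

lemma hausdorff_gauge_empty [simp]: "hausdorff_gauge n {} = 0"
  by (simp add: hausdorff_gauge_def)

lemma hausdorff_content_lower:
  assumes "A \<subseteq> (\<Union>i. S i)" "\<And>i. bounded (S i)" "\<And>i. diameter (S i) \<le> \<epsilon>"
  shows "hausdorff_content n \<epsilon> A \<le> (\<Sum>i. hausdorff_gauge n (S i))"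
  unfolding hausdorff_content_def by (rule INF_lower) (use assms in auto)

lemma hausdorff_content_mono: "A \<subseteq> B \<Longrightarrow> hausdorff_content n \<epsilon> A \<le> hausdorff_content n \<epsilon> B"
  unfolding hausdorff_content_def by (rule INF_superset_mono) auto

lemma hausdorff_content_antimono:
  "\<epsilon> \<le> \<epsilon>' \<Longrightarrow> hausdorff_content n \<epsilon>' A \<le> hausdorff_content n \<epsilon> A"
  unfolding hausdorff_content_def by (rule INF_superset_mono) (auto intro: order_trans)

lemma hausdorff_content_le_outer: "0 < \<epsilon> \<Longrightarrow> hausdorff_content n \<epsilon> A \<le> hausdorff_outer n A"
  unfolding hausdorff_outer_def by (rule SUP_upper) auto

lemma hausdorff_content_UN:
  "hausdorff_content n \<epsilon> (\<Union>i. A i) \<le> (\<Sum>i::nat. hausdorff_content n \<epsilon> (A i))"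
proof (rule ennreal_le_epsilon)
  fix e :: real
  assume "0 < e" "(\<Sum>i. hausdorff_content n \<epsilon> (A i)) < top"
  then have *: "\<And>i. hausdorff_content n \<epsilon> (A i) < hausdorff_content n \<epsilon> (A i) + e * (1/2)^Suc i"
    by (auto simp add: less_top dest!: ennreal_suminf_lessD)
  have "\<exists>S. A i \<subseteq> (\<Union>j. S j) \<and> (\<forall>j. bounded (S j) \<and> diameter (S j) \<le> \<epsilon>) \<and>
      (\<Sum>j::nat. hausdorff_gauge n (S j)) < hausdorff_content n \<epsilon> (A i) + e * (1/2)^Suc i" for i
    using *[of i] by (subst (asm) hausdorff_content_def) (auto simp: INF_less_iff)
  then obtain S where
    S: "\<And>i. A i \<subseteq> (\<Union>j. S i j)" "\<And>i j. bounded (S i j)" "\<And>i j. diameter (S i j) \<le> \<epsilon>"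
    and le: "\<And>i. (\<Sum>j::nat. hausdorff_gauge n (S i j)) < hausdorff_content n \<epsilon> (A i) + e * (1/2)^Suc i"
    by metis
  define T where "T = case_prod S o prod_decode"
  have "(\<Union>i. A i) \<subseteq> (\<Union>i. T i)"
    using S(1) by (auto simp add: T_def subset_eq) (metis prod.case prod_encode_inverse)
  then have "hausdorff_content n \<epsilon> (\<Union>i. A i) \<le> (\<Sum>i. hausdorff_gauge n (T i))"
    by (rule hausdorff_content_lower) (auto simp: T_def split_def S)
  also have "\<dots> = (\<Sum>i. \<Sum>j. hausdorff_gauge n (S i j))"
    unfolding T_def comp_def by (intro suminf_ennreal_2dimen[where f="\<lambda>p. hausdorff_gauge n (case_prod S p)"]) auto
  also have "\<dots> \<le> (\<Sum>i. hausdorff_content n \<epsilon> (A i) + e * (1/2) ^ Suc i)"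
    by (intro suminf_le less_imp_le[OF le]) auto
  also have "\<dots> = (\<Sum>i. hausdorff_content n \<epsilon> (A i)) + (\<Sum>i. ennreal e * ennreal ((1/2) ^ Suc i))"
    using \<open>0 < e\<close> by (subst suminf_add[symmetric])
      (auto simp del: ennreal_suminf_cmult simp add: ennreal_mult[symmetric])
  also have "\<dots> = (\<Sum>i. hausdorff_content n \<epsilon> (A i)) + e"
    unfolding ennreal_suminf_cmult
    by (subst suminf_ennreal_eq[OF zero_le_power power_half_series]) auto
  finally show "hausdorff_content n \<epsilon> (\<Union>i. A i) \<le> (\<Sum>i. hausdorff_content n \<epsilon> (A i)) + e" .
qed

lemma hausdorff_content_empty: "0 < \<epsilon> \<Longrightarrow> hausdorff_content n \<epsilon> {} = 0"
  using hausdorff_content_lower[of "{}" "\<lambda>_. {}" \<epsilon> n] by simp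

lemma hausdorff_outer_UN: "hausdorff_outer n (\<Union>i. A i) \<le> (\<Sum>i::nat. hausdorff_outer n (A i))"
  unfolding hausdorff_outer_def[of n "\<Union>i. A i"]
proof (rule SUP_least)
  fix \<epsilon> :: real assume "\<epsilon> \<in> {0<..}"
  then have "(\<Sum>i. hausdorff_content n \<epsilon> (A i)) \<le> (\<Sum>i. hausdorff_outer n (A i))"
    by (intro suminf_le hausdorff_content_le_outer) auto
  with hausdorff_content_UN[of n \<epsilon> A]
  show "hausdorff_content n \<epsilon> (\<Union>i. A i) \<le> (\<Sum>i. hausdorff_outer n (A i))" by simp
qed

lemma outer_measure_space_hausdorff_outer: "outer_measure_space UNIV (hausdorff_outer n)"
  unfolding outer_measure_space_def
proof (intro conjI)
  show "positive UNIV (hausdorff_outer n)"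
    by (auto simp: positive_def hausdorff_outer_def hausdorff_content_empty)
  show "increasing UNIV (hausdorff_outer n)"
    unfolding increasing_def hausdorff_outer_def by (auto intro!: SUP_mono hausdorff_content_mono)
  show "countably_subadditive UNIV (hausdorff_outer n)"
    unfolding countably_subadditive_def by (auto intro: hausdorff_outer_UN)
qed

lemma hausdorff_outer_mono: "A \<subseteq> B \<Longrightarrow> hausdorff_outer n A \<le> hausdorff_outer n B"
  using outer_measure_space_hausdorff_outer by (auto simp: outer_measure_space_def increasing_def)

lemma hausdorff_outer_empty [simp]: "hausdorff_outer n {} = 0"
  using outer_measure_space_hausdorff_outer by (auto simp: outer_measure_space_def positive_def)

lemma hausdorff_outer_Un: "hausdorff_outer n (A \<union> B) \<le> hausdorff_outer n A + hausdorff_outer n B"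
proof -
  have "hausdorff_outer n (A \<union> B) = hausdorff_outer n (\<Union>i. binaryset A B i)"
    by (simp add: UN_binaryset_eq)
  also have "\<dots> \<le> (\<Sum>i. hausdorff_outer n (binaryset A B i))"
    by (rule hausdorff_outer_UN)
  also have "\<dots> = hausdorff_outer n A + hausdorff_outer n B"
    by (rule suminf_binaryset_eq) simp
  finally show ?thesis .
qed

lemma hausdorff_content_separated:
  assumes sep: "\<And>x y. x \<in> A \<Longrightarrow> y \<in> B \<Longrightarrow> d \<le> dist x y" and "\<epsilon> < d"
  shows "hausdorff_content n \<epsilon> A + hausdorff_content n \<epsilon> B \<le> hausdorff_content n \<epsilon> (A \<union> B)"
  unfolding hausdorff_content_def[of n \<epsilon> "A \<union> B"]
proof (rule INF_greatest)
  fix S :: "nat \<Rightarrow> 'a set"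
  assume "S \<in> {S. A \<union> B \<subseteq> (\<Union>i. S i) \<and> (\<forall>i. bounded (S i) \<and> diameter (S i) \<le> \<epsilon>)}"
  then have S: "A \<subseteq> (\<Union>i. S i)" "B \<subseteq> (\<Union>i. S i)" "\<And>i. bounded (S i)" "\<And>i. diameter (S i) \<le> \<epsilon>"
    by auto
  have \<epsilon>0: "0 \<le> \<epsilon>"
    using S(3,4)[of 0] diameter_ge_0 order_trans by blast
  define SA where "SA i = (if S i \<inter> A = {} then {} else S i)" for i
  define SB where "SB i = (if S i \<inter> B = {} then {} else S i)" for i
  have disj: "S i \<inter> A = {} \<or> S i \<inter> B = {}" for i
  proof (rule ccontr)
    assume "\<not> ?thesis"
    then obtain x y where "x \<in> S i" "x \<in> A" "y \<in> S i" "y \<in> B" by auto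
    then show False
      using sep[of x y] diameter_bounded_bound[OF S(3), of x i y] S(4)[of i] \<open>\<epsilon> < d\<close> by auto
  qed
  have "hausdorff_content n \<epsilon> A \<le> (\<Sum>i. hausdorff_gauge n (SA i))"
    using S \<epsilon>0 by (intro hausdorff_content_lower) (auto simp: SA_def, blast)
  moreover have "hausdorff_content n \<epsilon> B \<le> (\<Sum>i. hausdorff_gauge n (SB i))"
    using S \<epsilon>0 by (intro hausdorff_content_lower) (auto simp: SB_def, blast)
  ultimately have "hausdorff_content n \<epsilon> A + hausdorff_content n \<epsilon> B
      \<le> (\<Sum>i. hausdorff_gauge n (SA i)) + (\<Sum>i. hausdorff_gauge n (SB i))"
    by (rule add_mono)
  also have "\<dots> = (\<Sum>i. hausdorff_gauge n (SA i) + hausdorff_gauge n (SB i))"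
    by (intro suminf_add) auto
  also have "\<dots> \<le> (\<Sum>i. hausdorff_gauge n (S i))"
    using disj by (intro suminf_le) (auto simp: SA_def SB_def)
  finally show "hausdorff_content n \<epsilon> A + hausdorff_content n \<epsilon> B \<le> (\<Sum>i. hausdorff_gauge n (S i))" .
qed

lemma hausdorff_outer_separated:
  assumes sep: "\<And>x y. x \<in> A \<Longrightarrow> y \<in> B \<Longrightarrow> d \<le> dist x y" and "0 < d"
  shows "hausdorff_outer n A + hausdorff_outer n B \<le> hausdorff_outer n (A \<union> B)"
proof -
  have "hausdorff_content n s A + hausdorff_content n t B \<le> hausdorff_outer n (A \<union> B)"
    if "0 < s" "0 < t" for s t
  proof -
    define m where "m = Min {s, t, d/2}"
    have m: "0 < m" "m \<le> s" "m \<le> t" "m < d" using that \<open>0 < d\<close> by (auto simp: m_def min_def)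
    have "hausdorff_content n s A + hausdorff_content n t B
        \<le> hausdorff_content n m A + hausdorff_content n m B"
      using m by (intro add_mono hausdorff_content_antimono)
    also have "\<dots> \<le> hausdorff_content n m (A \<union> B)"
      using sep m by (intro hausdorff_content_separated) auto
    also have "\<dots> \<le> hausdorff_outer n (A \<union> B)"
      using m by (intro hausdorff_content_le_outer)
    finally show ?thesis .
  qed
  note le = this
  have "hausdorff_outer n A + hausdorff_content n t B \<le> hausdorff_outer n (A \<union> B)" if "0 < t" for t
  proof -
    have "hausdorff_outer n A + hausdorff_content n t B
        = (SUP s\<in>{0<..}. hausdorff_content n s A + hausdorff_content n t B)"
      unfolding hausdorff_outer_def[of n A] by (rule ennreal_SUP_add_left[symmetric]) simp
    also have "\<dots> \<le> hausdorff_outer n (A \<union> B)"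
      using le that by (intro SUP_least) auto
    finally show ?thesis .
  qed
  note le' = this
  have "hausdorff_outer n A + hausdorff_outer n B
      = (SUP t\<in>{0<..}. hausdorff_outer n A + hausdorff_content n t B)"
    unfolding hausdorff_outer_def[of n B]
    by (subst (1 2) add.commute, rule ennreal_SUP_add_left[symmetric]) simp
  also have "\<dots> \<le> hausdorff_outer n (A \<union> B)"
    using le' by (intro SUP_least) auto
  finally show ?thesis .
qed

lemma closed_in_lambda_system_hausdorff_outer:
  fixes F :: "'a::metric_space set"
  assumes "closed F"
  shows "F \<in> lambda_system UNIV UNIV (hausdorff_outer n)"
proof (cases "F = {}")
  case True
  then show ?thesis by (simp add: lambda_system_def)
next
  case False
  let ?H = "hausdorff_outer n"
  have "?H (X \<inter> F) + ?H (X - F) \<le> ?H X" for X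
  proof (cases "?H X = top")
    case fin: False
    define A where "A k = {x \<in> X - F. 1 / real (k + 1) \<le> infdist x F}" for k
    define R where
      "R k = {x \<in> X - F. 1 / real (k + 2) \<le> infdist x F \<and> infdist x F < 1 / real (k + 1)}" for k
    have lip: "a - b \<le> dist x y" if "a \<le> infdist x F" "infdist y F < b" for a b x y
      using infdist_triangle[of x F y] that by linarith
    have part: "(\<Sum>j<N. ?H (R (2 * j + r))) \<le> ?H (\<Union>j<N. R (2 * j + r))" for N r
    proof (induction N)
      case (Suc N)
      have "?H (\<Union>j<N. R (2 * j + r)) + ?H (R (2 * N + r)) \<le> ?H ((\<Union>j<N. R (2 * j + r)) \<union> R (2 * N + r))"
      proof (rule hausdorff_outer_separated)
        let ?a = "1 / (real (2 * N + r))" and ?b = "1 / real (2 * N + r + 1)"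
        show "(if N = 0 then 1 else ?a - ?b) \<le> dist x y"
          if x: "x \<in> (\<Union>j<N. R (2 * j + r))" and y: "y \<in> R (2 * N + r)" for x y
        proof -
          from x obtain j where j: "j < N" "1 / real (2 * j + r + 2) \<le> infdist x F"
            by (auto simp: R_def)
          have "?a \<le> 1 / real (2 * j + r + 2)"
            using j(1) by (intro divide_left_mono mult_pos_pos) (auto simp: of_nat_less_iff)
          with j y show ?thesis by (auto intro!: lip simp: R_def)
        qed
        show "0 < (if N = 0 then 1 else ?a - ?b)"
        proof (cases "N = 0")
          case False
          then have "?b < ?a"
            by (intro divide_strict_left_mono mult_pos_pos) (simp_all add: of_nat_add[symmetric] del: of_nat_add)
          then show ?thesis by simp
        qed simp
      qed
      moreover have "(\<Union>j<Suc N. R (2 * j + r)) = (\<Union>j<N. R (2 * j + r)) \<union> R (2 * N + r)"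
        by (auto simp: lessThan_Suc)
      ultimately show ?case
        using Suc.IH by (simp) (blast intro: add_right_mono order_trans)
    qed simp
    have half: "(\<Sum>j. ?H (R (2 * j + r))) \<le> ?H X" for r
    proof (rule suminf_le_const[OF summableI])
      fix N
      have "(\<Union>j<N. R (2 * j + r)) \<subseteq> X" by (auto simp: R_def)
      then show "(\<Sum>j<N. ?H (R (2 * j + r))) \<le> ?H X"
        using part[of r N] hausdorff_outer_mono order_trans by blast
    qed
    have sums: "(\<Sum>j<2*N. ?H (R j)) = (\<Sum>j<N. ?H (R (2 * j + 0))) + (\<Sum>j<N. ?H (R (2 * j + 1)))" for N
      by (induction N) (auto simp: algebra_simps)
    have "(\<Sum>j. ?H (R j)) \<le> ?H X + ?H X"
    proof (rule suminf_le_const[OF summableI])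
      fix N
      have "(\<Sum>j<N. ?H (R j)) \<le> (\<Sum>j<2*N. ?H (R j))"
        by (rule sum_mono2) auto
      also have "\<dots> \<le> (\<Sum>j. ?H (R (2 * j + 0))) + (\<Sum>j. ?H (R (2 * j + 1)))"
        unfolding sums by (intro add_mono sum_le_suminf) auto
      also have "\<dots> \<le> ?H X + ?H X"
        by (intro add_mono half)
      finally show "(\<Sum>j<N. ?H (R j)) \<le> ?H X + ?H X" .
    qed
    then have fin_R: "(\<Sum>j. ?H (R j)) \<noteq> top"
      using fin by (metis ennreal_add_eq_top neq_top_trans)
    have cover: "X - F \<subseteq> A k \<union> (\<Union>j. R (j + k))" for k
    proof
      fix x assume x: "x \<in> X - F"
      then have pos: "0 < infdist x F"
        using in_closed_iff_infdist_zero[OF assms False, of x] infdist_nonneg[of x F] by auto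
      show "x \<in> A k \<union> (\<Union>j. R (j + k))"
      proof (cases "1 / real (k + 1) \<le> infdist x F")
        case le: False
        obtain m where m: "1 / real (Suc m) < infdist x F"
          using reals_Archimedean[OF pos] by (auto simp: inverse_eq_divide)
        define l where "l = (LEAST l. 1 / real (l + 1) \<le> infdist x F)"
        have l: "1 / real (l + 1) \<le> infdist x F"
          unfolding l_def by (rule LeastI[of _ m]) (use m in auto)
        have "k < l"
        proof (rule ccontr)
          assume "\<not> k < l"
          then have "1 / real (k + 1) \<le> 1 / real (l + 1)"
            by (intro divide_left_mono) auto
          with l le show False by linarith
        qed
        then obtain j where j: "l = Suc (j + k)"
          by (metis add.commute less_natE)
        have "\<not> 1 / real (j + k + 1) \<le> infdist x F"
          using not_less_Least[of "j + k" "\<lambda>l. 1 / real (l + 1) \<le> infdist x F"] j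
          by (auto simp: l_def)
        with l j x have "x \<in> R (j + k)" by (auto simp: R_def add.commute)
        then show ?thesis by auto
      qed (use x in \<open>auto simp: A_def\<close>)
    qed
    have step: "(\<Sum>j<k. ?H (R j)) + (?H (X \<inter> F) + ?H (X - F)) \<le> ?H X + (\<Sum>j. ?H (R j))" for k
    proof -
      have "?H (X \<inter> F) + ?H (A k) \<le> ?H ((X \<inter> F) \<union> A k)"
      proof (rule hausdorff_outer_separated)
        show "1 / real (k + 1) \<le> dist x y" if "x \<in> X \<inter> F" "y \<in> A k" for x y
          using that infdist_le[of x F y] by (auto simp: A_def dist_commute intro: order_trans)
      qed auto
      also have "\<dots> \<le> ?H X"
        by (rule hausdorff_outer_mono) (auto simp: A_def)
      finally have 1: "?H (X \<inter> F) + ?H (A k) \<le> ?H X" .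
      have "?H (X - F) \<le> ?H (A k) + ?H (\<Union>j. R (j + k))"
        using hausdorff_outer_mono[OF cover] hausdorff_outer_Un order_trans by blast
      also have "\<dots> \<le> ?H (A k) + (\<Sum>j. ?H (R (j + k)))"
        by (intro add_left_mono hausdorff_outer_UN)
      finally have 2: "?H (X - F) \<le> ?H (A k) + (\<Sum>j. ?H (R (j + k)))" .
      have "(\<Sum>j<k. ?H (R j)) + (?H (X \<inter> F) + ?H (X - F))
          \<le> (\<Sum>j<k. ?H (R j)) + (?H (X \<inter> F) + (?H (A k) + (\<Sum>j. ?H (R (j + k)))))"
        by (intro add_left_mono 2)
      also have "\<dots> = (?H (X \<inter> F) + ?H (A k)) + ((\<Sum>j. ?H (R (j + k))) + (\<Sum>j<k. ?H (R j)))"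
        by (simp add: ac_simps)
      also have "(\<Sum>j. ?H (R (j + k))) + (\<Sum>j<k. ?H (R j)) = (\<Sum>j. ?H (R j))"
        using suminf_offset[of "\<lambda>j. ?H (R j)" k] by (simp add: summableI add.commute)
      also have "?H (X \<inter> F) + ?H (A k) + (\<Sum>j. ?H (R j)) \<le> ?H X + (\<Sum>j. ?H (R j))"
        by (intro add_right_mono 1)
      finally show ?thesis .
    qed
    have "(\<Sum>j. ?H (R j)) + (?H (X \<inter> F) + ?H (X - F)) \<le> ?H X + (\<Sum>j. ?H (R j))"
      by (intro ennreal_suminf_bound_add step)
    then show ?thesis
      using fin_R by (simp add: add.commute[of "?H X"] ennreal_add_left_cancel_le)
  qed simp
  moreover have "?H X \<le> ?H (X \<inter> F) + ?H (X - F)" for X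
    using hausdorff_outer_Un[of n "X \<inter> F" "X - F"] by (simp add: Int_Diff_Un)
  ultimately have "?H (X \<inter> F) + ?H (X - F) = ?H X" for X
    by (intro antisym)
  then show ?thesis
    by (simp add: lambda_system_def Int_commute Diff_eq)
qed

lemma sets_hausdorff_measure [simp, measurable_cong]: "sets (hausdorff_measure n) = sets borel"
  unfolding hausdorff_measure_def by (simp add: sets.sigma_sets_eq[of borel, simplified])

lemma emeasure_hausdorff_measure:
  fixes A :: "'a::metric_space set"
  assumes "A \<in> sets borel"
  shows "emeasure (hausdorff_measure n) A = hausdorff_outer n A"
proof -
  interpret U: sigma_algebra UNIV "UNIV :: 'a set set"
    using sigma_algebra_Pow[of "UNIV :: 'a set"] by simp
  let ?L = "lambda_system UNIV UNIV (hausdorff_outer n) :: 'a set set"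
  have L: "measure_space UNIV ?L (hausdorff_outer n)"
    by (rule U.caratheodory_lemma[OF outer_measure_space_hausdorff_outer])
  then interpret L: sigma_algebra UNIV ?L
    by (simp add: measure_space_def)
  have sub: "sets borel \<subseteq> ?L"
    unfolding borel_eq_closed using closed_in_lambda_system_hausdorff_outer
    by (auto intro!: L.sigma_sets_subset)
  have "measure_space UNIV (sets borel) (hausdorff_outer n :: 'a set \<Rightarrow> ennreal)"
    using sets.sigma_algebra_axioms[of "borel :: 'a measure"] by (intro measure_down[OF L _ sub]) simp
  then show ?thesis
    unfolding hausdorff_measure_def measure_space_def
    by (intro emeasure_measure_of_sigma) (auto simp: assms)
qed


section \<open>Ahlfors--David regular sets\<close>

text \<open>The measure \<open>\<sigma> = H\<^sup>n|\<^sub>E\<close>, as a measure on the Borel subsets of \<open>E\<close>.\<close>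

definition surface_measure :: "nat \<Rightarrow> 'a::metric_space set \<Rightarrow> 'a measure" where
  "surface_measure n E = restrict_space (hausdorff_measure n) E"

text \<open>\<^const>\<open>diameter\<close> is only meaningful for bounded sets; an unbounded set has infinite diameter.\<close>

definition ahlfors_david_regular :: "nat \<Rightarrow> real \<Rightarrow> 'a::metric_space set \<Rightarrow> bool" where
  "ahlfors_david_regular n C E \<longleftrightarrow> closed E \<and>
     (\<forall>x\<in>E. \<forall>r>0. (bounded E \<longrightarrow> r < diameter E) \<longrightarrow>
        ennreal (r ^ n / C) \<le> emeasure (surface_measure n E) (ball x r \<inter> E) \<and>
        emeasure (surface_measure n E) (ball x r \<inter> E) \<le> ennreal (C * r ^ n))"


section \<open>Dyadic cubes on \<open>E\<close>\<close>

text \<open>\<open>D k\<close> is the collection of cubes of generation \<open>k\<close>, relevant only for \<open>k\<close> in the set of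
  admissible generations.  The constant \<open>c\<^sub>3\<close> is the implicit constant in \<open>2\<^sup>-\<^sup>k \<lesssim> diam E\<close>.\<close>

definition generations :: "real \<Rightarrow> 'a::metric_space set \<Rightarrow> int set" where
  "generations c\<^sub>3 E = {k. bounded E \<longrightarrow> 2 powi (- k) \<le> c\<^sub>3 * diameter E}"

text \<open>In the last clause \<open>dist (x, \<emptyset>) = \<infinity>\<close>, whereas \<open>infdist x {} = 0\<close>.\<close>

definition dyadic_grid ::
    "nat \<Rightarrow> real \<Rightarrow> real \<Rightarrow> real \<Rightarrow> real \<Rightarrow> real \<Rightarrow> 'a::metric_space set \<Rightarrow> (int \<Rightarrow> 'a set set) \<Rightarrow> bool" where
  "dyadic_grid n a\<^sub>0 \<eta>\<^sub>0 c\<^sub>1 c\<^sub>2 c\<^sub>3 E D \<longleftrightarrow>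
     (let \<sigma> = surface_measure n E; K = generations c\<^sub>3 E in
       (\<forall>k\<in>K. \<forall>Q\<in>D k. Q \<in> sets borel \<and> Q \<subseteq> E) \<and>
       (\<forall>k\<in>K. E = \<Union>(D k)) \<and>
       (\<forall>k\<in>K. \<forall>k'\<in>K. k < k' \<longrightarrow> (\<forall>Q\<in>D k. \<forall>Q'\<in>D k'. Q' \<inter> Q = {} \<or> Q' \<subseteq> Q)) \<and>
       (\<forall>k\<in>K. \<forall>k'\<in>K. k < k' \<longrightarrow> (\<forall>Q'\<in>D k'. \<exists>!Q. Q \<in> D k \<and> Q' \<subseteq> Q)) \<and>
       (\<forall>k\<in>K. \<forall>Q\<in>D k.
          bounded Q \<and> 2 powi (- k) / c\<^sub>1 \<le> diameter Q \<and> diameter Q \<le> c\<^sub>1 * 2 powi (- k) \<and>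
          ennreal (2 powi (- k * int n) / c\<^sub>1) \<le> emeasure \<sigma> Q \<and>
          emeasure \<sigma> Q \<le> ennreal (c\<^sub>1 * 2 powi (- k * int n))) \<and>
       (\<forall>k\<in>K. \<forall>Q\<in>D k. \<exists>x\<in>E. ball x (a\<^sub>0 * 2 powi (- k)) \<inter> E \<subseteq> Q) \<and>
       (\<forall>k\<in>K. \<forall>Q\<in>D k. \<forall>\<tau>. 0 < \<tau> \<and> \<tau> < a\<^sub>0 \<longrightarrow>
          emeasure \<sigma> {x\<in>Q. E - Q \<noteq> {} \<and> infdist x (E - Q) \<le> \<tau> * 2 powi (- k)}
            \<le> ennreal (c\<^sub>2 * \<tau> powr \<eta>\<^sub>0) * emeasure \<sigma> Q))"

definition dyadic_cubes :: "real \<Rightarrow> 'a::metric_space set \<Rightarrow> (int \<Rightarrow> 'a set set) \<Rightarrow> 'a set set" where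
  "dyadic_cubes c\<^sub>3 E D = (\<Union>k\<in>generations c\<^sub>3 E. D k)"


section \<open>Whitney cubes\<close>

definition cube :: "'a::euclidean_space \<Rightarrow> real \<Rightarrow> 'a set" where
  "cube c s = cbox (c - (s / 2) *\<^sub>R One) (c + (s / 2) *\<^sub>R One)"  \<comment> \<open>centre \<open>c\<close>, side length \<open>s\<close>\<close>

definition euclidean_dyadic_cubes :: "'a::euclidean_space set set" where
  "euclidean_dyadic_cubes =
     {cbox (2 powi j *\<^sub>R m) (2 powi j *\<^sub>R (m + One)) | j m. \<forall>i\<in>Basis. m \<bullet> i \<in> \<int>}"

text \<open>Members of \<open>W\<close> are written as \<open>I = cube c s\<close>, so that \<open>4I = cube c (4 * s)\<close> and \<open>\<ell>(I) = s\<close>.\<close>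

definition whitney_decomposition :: "'a::euclidean_space set \<Rightarrow> 'a set set \<Rightarrow> bool" where
  "whitney_decomposition E W \<longleftrightarrow>
     W \<subseteq> euclidean_dyadic_cubes \<and>
     \<Union>W = - E \<and>
     (\<forall>I\<in>W. \<forall>J\<in>W. I \<noteq> J \<longrightarrow> interior I \<inter> interior J = {}) \<and>
     (\<forall>c s. 0 < s \<and> cube c s \<in> W \<longrightarrow>
        4 * diameter (cube c s) \<le> setdist (cube c (4 * s)) E \<and>
        setdist (cube c (4 * s)) E \<le> setdist (cube c s) E \<and>
        setdist (cube c s) E \<le> 40 * diameter (cube c s)) \<and>
     (\<forall>I\<in>W. \<forall>J\<in>W. I \<inter> J \<noteq> {} \<longrightarrow>
        diameter I / 4 \<le> diameter J \<and> diameter J \<le> 4 * diameter I)"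

definition whitney_region ::
    "'a::euclidean_space set set \<Rightarrow> real \<Rightarrow> int \<Rightarrow> 'a set \<Rightarrow> 'a set" where
  "whitney_region W \<beta> k Q =
     \<Union>{cube c s | c s. 0 < s \<and> cube c s \<in> W \<and>
         s / 8 \<le> 2 powi (- k) \<and> 2 powi (- k) \<le> 8 * s \<and>
         setdist Q (cube c s) \<le> \<beta> * 2 powi (- k)}"

text \<open>The same set may be a cube of several generations; then all of them contribute.\<close>

definition truncated_cone ::
    "real \<Rightarrow> 'a::euclidean_space set \<Rightarrow> (int \<Rightarrow> 'a set set) \<Rightarrow> 'a set set \<Rightarrow> real \<Rightarrow> 'a set \<Rightarrow> 'a \<Rightarrow> 'a set" where
  "truncated_cone c\<^sub>3 E D W \<beta> Q x =
     \<Union>{whitney_region W \<beta> k Q' | k Q'. k \<in> generations c\<^sub>3 E \<and> Q' \<in> D k \<and> x \<in> Q' \<and> Q' \<subseteq> Q}"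


section \<open>The operator \<open>\<Theta>\<close> and the testing conditions\<close>

definition square_function_kernel ::
    "nat \<Rightarrow> real \<Rightarrow> real \<Rightarrow> 'a::euclidean_space set \<Rightarrow> ('a \<Rightarrow> 'a \<Rightarrow> complex) \<Rightarrow> bool" where
  "square_function_kernel n C\<^sub>\<psi> \<alpha> E \<psi> \<longleftrightarrow>
     (\<lambda>(X, y). \<psi> X y) \<in> borel_measurable (restrict_space lebesgue (- E) \<Otimes>\<^sub>M surface_measure n E) \<and>
     (\<forall>X\<in>-E. \<forall>y\<in>E.
        norm (\<psi> X y) \<le> C\<^sub>\<psi> * infdist X E powr \<alpha> / dist X y powr (real n + \<alpha>)) \<and>
     (\<forall>X\<in>-E. \<forall>y\<in>E. \<forall>y'\<in>E. 2 * dist y y' \<le> dist X y \<longrightarrow>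
        norm (\<psi> X y - \<psi> X y') \<le> C\<^sub>\<psi> * dist y y' powr \<alpha> / dist X y powr (real n + \<alpha>))"

definition Theta ::
    "nat \<Rightarrow> 'a::euclidean_space set \<Rightarrow> ('a \<Rightarrow> 'a \<Rightarrow> complex) \<Rightarrow> ('a \<Rightarrow> complex) \<Rightarrow> 'a \<Rightarrow> complex" where
  "Theta n E \<psi> f X = (\<integral>y. \<psi> X y * f y \<partial>surface_measure n E)"

definition ennreal_powr :: "ennreal \<Rightarrow> real \<Rightarrow> ennreal" where
  "ennreal_powr t a = (if t = \<infinity> then \<infinity> else ennreal (enn2real t powr a))"  \<comment> \<open>for \<open>a > 0\<close>\<close>

definition testing_system ::
    "nat \<Rightarrow> real \<Rightarrow> 'a::euclidean_space set \<Rightarrow> (int \<Rightarrow> 'a set set) \<Rightarrow> 'a set set \<Rightarrow> real \<Rightarrow>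
     ('a \<Rightarrow> 'a \<Rightarrow> complex) \<Rightarrow> real \<Rightarrow> real \<Rightarrow> ('a set \<Rightarrow> 'a \<Rightarrow> complex) \<Rightarrow> bool" where
  "testing_system n c\<^sub>3 E D W \<beta> \<psi> C\<^sub>0 p b \<longleftrightarrow>
     (let \<sigma> = surface_measure n E in
      \<forall>Q\<in>dyadic_cubes c\<^sub>3 E D.
        b Q \<in> borel_measurable \<sigma> \<and>
        norm (LINT x:Q|\<sigma>. b Q x) \<ge> measure \<sigma> Q / C\<^sub>0 \<and>
        (\<integral>\<^sup>+x. ennreal (norm (b Q x) powr p) \<partial>\<sigma>) \<le> ennreal C\<^sub>0 * emeasure \<sigma> Q \<and>
        (\<integral>\<^sup>+x\<in>Q. ennreal_powr
             (\<integral>\<^sup>+Y\<in>truncated_cone c\<^sub>3 E D W \<beta> Q x.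
                ennreal ((norm (Theta n E \<psi> (b Q) Y))\<^sup>2 / infdist Y E ^ (n + 1)) \<partial>lebesgue)
             (p / 2) \<partial>\<sigma>)
          \<le> ennreal C\<^sub>0 * emeasure \<sigma> Q)"

end

(*
The estimate splits along scales: on the Whitney region of a cube Q of generation k write Theta f
= (Theta 1) E_k f + Theta (f - E_k f), where E_k is the conditional expectation.

The second term is handled by quasi-orthogonality: expand f - E_k f in martingale differences.
Fine differences are small because of the smoothness of the kernel; for a difference d living on
coarser cubes of generation j <= k one uses that d is constant on these cubes, so that only the
part of the kernel crossing their boundaries matters, and the small boundary property makes this
part decay geometrically in k - j.

The first term is bounded by the Carleson embedding theorem (proved with a Bellman function) once
|Theta 1|^2 dY / delta(Y) is known to be a Carleson measure.  By a John-Nirenberg argument it is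
enough to bound the sum of the energies of Theta 1 on a subset of proportional measure of every
cube Q.  There the averages of b_Q are bounded below in absolute value and its maximal function is
bounded, hence the energies of Theta 1 are controlled by those of (Theta 1) E_k b_Q, that is, by
the testing condition and the error Theta (b_Q - E_k b_Q).  Stopping at the maximal cubes on which
|b_Q|^p has a large average gives b_Q = g + beta with g bounded and beta of mean zero on the
stopping cubes; g is treated as before, and the contributions of beta are summed in L^1 outside
the stopping cubes.  Two shortcuts avoid Hoelder's inequality and vector valued maximal functions
in the last step: |b| <= s + s^(1-p) |b|^p with s depending on the scale, and sum h_k^2 <= (sum
h_k)^2 for h_k >= 0.

If E is bounded, points far away from E belong to no Whitney region; there the size of the kernel
suffices.  If E is empty or a single point, it has measure zero and Theta f = 0.
*)

theory Submission
  imports Defs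
begin

section \<open>Dyadic martingales\<close>

text \<open>The obstacle is that \<open>b_Q\<close> lies only in L^p, possibly with p < 2, so the
  L^2 estimates do not apply to it. What saves the argument is that its errors are needed only in
  L^1 and only outside a small exceptional set. Across d generations the boundary mass gains q^d;
  splitting |b| <= s + s^(1-p) |b|^p with s = q^(-d/2) leaves q^(d/2) from the bounded part and q^(d
  (p-1)/2) from the other, both summable in d. The testing condition enters only through Chebyshev's
  inequality, which also disposes of the exponent p/2. All sums over generations run over a finite
  window {m..N}. Inductions descend from the finest generation, expansions are finite and need no
  convergence theorem, and only the last estimate exhausts the generations. Energies are regarded as
  functions constant on cells, so that sums over subcubes become integrals of sums over generations.
  The abstract part sees the Whitney geometry only through a symmetric majorant \<open>P\<close> of
  the kernel, its mass across cell boundaries, the measures of the Whitney regions and the doubling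
  of cells.\<close>

locale dyadic_system = sigma_finite_measure \<sigma> for \<sigma> :: "'a measure" +
  fixes D :: "int \<Rightarrow> 'a set set" and K :: "int set"
  assumes K_up: "k \<in> K \<Longrightarrow> k \<le> k' \<Longrightarrow> k' \<in> K"
    and D_sets: "k \<in> K \<Longrightarrow> Q \<in> D k \<Longrightarrow> Q \<in> sets \<sigma>"
    and D_countable: "k \<in> K \<Longrightarrow> countable (D k)"
    and D_cover: "k \<in> K \<Longrightarrow> \<Union>(D k) = space \<sigma>"
    and D_nested: "k \<in> K \<Longrightarrow> k \<le> k' \<Longrightarrow> Q \<in> D k \<Longrightarrow> R \<in> D k' \<Longrightarrow> Q \<inter> R \<noteq> {} \<Longrightarrow> R \<subseteq> Q"
    and D_pos: "k \<in> K \<Longrightarrow> Q \<in> D k \<Longrightarrow> emeasure \<sigma> Q \<noteq> 0"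
    and D_fin: "k \<in> K \<Longrightarrow> Q \<in> D k \<Longrightarrow> emeasure \<sigma> Q \<noteq> \<infinity>"
begin

text \<open>Cells are addressed through their points, so that functions constant on cells replace
  families indexed by cubes. Outside \<open>space \<sigma>\<close> the value is unspecified.\<close>

definition cell :: "int \<Rightarrow> 'a \<Rightarrow> 'a set" where
  "cell k x = (THE Q. Q \<in> D k \<and> x \<in> Q)"

text \<open>For equal generations \<open>D_nested\<close> says that two cells which meet contain
  each other.\<close>

lemma D_unique: "k \<in> K \<Longrightarrow> Q \<in> D k \<Longrightarrow> R \<in> D k \<Longrightarrow> x \<in> Q \<Longrightarrow> x \<in> R \<Longrightarrow> Q = R"
  using D_nested[of k k Q R] D_nested[of k k R Q] by blast

lemma cell_eq: "k \<in> K \<Longrightarrow> Q \<in> D k \<Longrightarrow> x \<in> Q \<Longrightarrow> cell k x = Q"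
  unfolding cell_def by (rule the_equality) (auto dest: D_unique)

lemma cell_props:
  assumes "k \<in> K" "x \<in> space \<sigma>"
  shows cell_in_D: "cell k x \<in> D k" and cell_self: "x \<in> cell k x"
proof -
  obtain Q where "Q \<in> D k" "x \<in> Q" using D_cover[OF assms(1)] assms(2) by blast
  then show "cell k x \<in> D k" "x \<in> cell k x" using cell_eq[OF assms(1)] by auto
qed

lemma D_subset: "k \<in> K \<Longrightarrow> Q \<in> D k \<Longrightarrow> Q \<subseteq> space \<sigma>"
  using D_cover by blast

lemma cell_subset: "k \<in> K \<Longrightarrow> x \<in> space \<sigma> \<Longrightarrow> cell k x \<subseteq> space \<sigma>"
  using D_subset cell_in_D by blast

lemma cell_sets [measurable]: "k \<in> K \<Longrightarrow> x \<in> space \<sigma> \<Longrightarrow> cell k x \<in> sets \<sigma>"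
  using D_sets cell_in_D by blast

lemma cell_pos: "k \<in> K \<Longrightarrow> x \<in> space \<sigma> \<Longrightarrow> emeasure \<sigma> (cell k x) \<noteq> 0"
  using D_pos cell_in_D by blast

lemma cell_fin: "k \<in> K \<Longrightarrow> x \<in> space \<sigma> \<Longrightarrow> emeasure \<sigma> (cell k x) \<noteq> \<infinity>"
  using D_fin cell_in_D by blast

lemma cell_mpos: "k \<in> K \<Longrightarrow> x \<in> space \<sigma> \<Longrightarrow> measure \<sigma> (cell k x) > 0"
  using cell_pos[of k x] cell_fin[of k x]
  by (simp add: measure_def enn2real_positive_iff less_top zero_less_iff_neq_zero)

lemma cell_cong: "k \<in> K \<Longrightarrow> x \<in> space \<sigma> \<Longrightarrow> y \<in> cell k x \<Longrightarrow> cell k y = cell k x"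
  using cell_eq cell_in_D by blast

lemma cell_mono: "k \<in> K \<Longrightarrow> k \<le> k' \<Longrightarrow> x \<in> space \<sigma> \<Longrightarrow> cell k' x \<subseteq> cell k x"
  using D_nested[of k k' "cell k x" "cell k' x"] cell_in_D cell_self K_up by blast

lemma cell_sym:
  "k \<in> K \<Longrightarrow> x \<in> space \<sigma> \<Longrightarrow> y \<in> space \<sigma> \<Longrightarrow> y \<in> cell k x \<longleftrightarrow> x \<in> cell k y"
  using cell_cong cell_self by metis

text \<open>Preimages are unions of cells, and a generation has only countably many of them.\<close>

lemma measurable_cellwise:
  assumes k: "k \<in> K" and c: "\<And>x y. x \<in> space \<sigma> \<Longrightarrow> y \<in> cell k x \<Longrightarrow> F y = F x"
    and sp: "\<And>x. x \<in> space \<sigma> \<Longrightarrow> F x \<in> space N"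
  shows "F \<in> measurable \<sigma> N"
proof (rule measurableI)
  fix A assume "A \<in> sets N"
  have "F -` A \<inter> space \<sigma> = \<Union>{Q \<in> D k. \<exists>x\<in>Q. F x \<in> A}" (is "?L = ?R")
  proof (intro equalityI subsetI)
    fix x assume "x \<in> ?L" then show "x \<in> ?R" using cell_in_D[OF k] cell_self[OF k] by blast
  next
    fix y assume "y \<in> ?R"
    then obtain Q x where Q: "Q \<in> D k" "x \<in> Q" "F x \<in> A" "y \<in> Q" by auto
    then have "cell k x = Q" "x \<in> space \<sigma>" "y \<in> space \<sigma>" using cell_eq[OF k] D_subset[OF k Q(1)]
      by auto
    then show "y \<in> ?L" using c[of x y] Q(3,4) by simp
  qed
  also have "\<dots> \<in> sets \<sigma>"
  proof (rule sets.countable_Union)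
    show "countable {Q \<in> D k. \<exists>x\<in>Q. F x \<in> A}"
      by (rule countable_subset[OF _ D_countable[OF k]]) blast
  qed (use D_sets[OF k] in blast)
  finally show "F -` A \<inter> space \<sigma> \<in> sets \<sigma>" .
qed (rule sp)

text \<open>Countable additivity of the measure with density \<open>f\<close>;
  \<open>count_space\<close> expresses the sum over the cells.\<close>

lemma nn_integral_cells:
  assumes k: "k \<in> K" and [measurable]: "f \<in> borel_measurable \<sigma>"
  shows "(\<integral>\<^sup>+x. f x \<partial>\<sigma>) = (\<integral>\<^sup>+Q. (\<integral>\<^sup>+x. f x * indicator Q x \<partial>\<sigma>) \<partial>count_space (D k))"
proof -
  have "(\<integral>\<^sup>+x. f x \<partial>\<sigma>) = emeasure (density \<sigma> f) (space \<sigma>)"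
    by (subst emeasure_density) (auto intro!: nn_integral_cong)
  also have "space \<sigma> = (\<Union>Q\<in>D k. Q)" using D_cover[OF k] by simp
  also have "emeasure (density \<sigma> f) (\<Union>Q\<in>D k. Q)
    = (\<integral>\<^sup>+Q. emeasure (density \<sigma> f) Q \<partial>count_space (D k))"
    proof (intro emeasure_UN_countable)
    show "disjoint_family_on (\<lambda>Q. Q) (D k)"
      unfolding disjoint_family_on_def using D_unique[OF k] by blast
  qed (use D_sets[OF k] D_countable[OF k] in auto)
  also have "\<dots> = (\<integral>\<^sup>+Q. (\<integral>\<^sup>+x. f x * indicator Q x \<partial>\<sigma>) \<partial>count_space (D k))"
    using k D_sets by (intro nn_integral_cong) (auto simp: emeasure_density)
  finally show ?thesis .
qed

text \<open>For \<open>k \<in> K\<close> these are the unions of cells of generation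
  \<open>k\<close>. The pointwise form avoids naming the family of cells.\<close>

definition saturated :: "int \<Rightarrow> 'a set \<Rightarrow> bool" where
  "saturated k A \<longleftrightarrow> A \<subseteq> space \<sigma> \<and> (\<forall>x\<in>A. cell k x \<subseteq> A)"

lemma saturated_space: "k \<in> K \<Longrightarrow> saturated k (space \<sigma>)"
  using cell_subset by (auto simp: saturated_def)

lemma saturated_cell: "k \<in> K \<Longrightarrow> k \<le> k' \<Longrightarrow> x \<in> space \<sigma> \<Longrightarrow> saturated k' (cell k x)"
  unfolding saturated_def using cell_subset cell_mono cell_cong by blast

lemma saturatedD: "saturated k A \<Longrightarrow> x \<in> A \<Longrightarrow> y \<in> cell k x \<Longrightarrow> y \<in> A"
  by (auto simp: saturated_def)

lemma saturated_iff: "k \<in> K \<Longrightarrow> saturated k A \<Longrightarrow> x \<in> space \<sigma> \<Longrightarrow> y \<in> cell k x \<Longrightarrow> y \<in> A \<longleftrightarrow> x \<in> A"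
  using saturatedD cell_cong cell_self by (metis cell_subset subsetD)

lemma saturated_sets: "k \<in> K \<Longrightarrow> saturated k A \<Longrightarrow> A \<in> sets \<sigma>"
proof -
  assume k: "k \<in> K" and A: "saturated k A"
  have "(\<lambda>x. x \<in> A) \<in> measurable \<sigma> (count_space UNIV)"
    by (rule measurable_cellwise[OF k]) (auto simp: saturated_iff[OF k A])
  then have "{x \<in> space \<sigma>. x \<in> A} \<in> sets \<sigma>" by (rule predE)
  moreover have "{x \<in> space \<sigma>. x \<in> A} = A" using A by (auto simp: saturated_def)
  ultimately show ?thesis by simp
qed

text \<open>The device behind all inductions over generations: an inequality on each cell is summed
  over the cells in \<open>A\<close>. Cells that miss \<open>A\<close> contribute nothing, and cells
  that meet it are contained in it.\<close>

lemma nn_integral_cells_mono: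
  assumes k: "k \<in> K" and A: "saturated k A"
    and [measurable]: "f \<in> borel_measurable \<sigma>" "g \<in> borel_measurable \<sigma>"
    and le: "\<And>x. x \<in> A \<Longrightarrow> (\<integral>\<^sup>+y. f y * indicator (cell k x) y \<partial>\<sigma>)
      \<le> (\<integral>\<^sup>+y. g y * indicator (cell k x) y \<partial>\<sigma>)"
  shows "(\<integral>\<^sup>+x. f x * indicator A x \<partial>\<sigma>) \<le> (\<integral>\<^sup>+x. g x * indicator A x \<partial>\<sigma>)"
proof -
  have [measurable]: "A \<in> sets \<sigma>" using saturated_sets[OF k A] .
  show ?thesis
    unfolding nn_integral_cells[OF k, of "\<lambda>x. f x * indicator A x", simplified]
      nn_integral_cells[OF k, of "\<lambda>x. g x * indicator A x", simplified]
  proof (rule nn_integral_mono, simp)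
    fix Q assume Q: "Q \<in> D k"
    show "(\<integral>\<^sup>+x. f x * indicator A x * indicator Q x \<partial>\<sigma>)
      \<le> (\<integral>\<^sup>+x. g x * indicator A x * indicator Q x \<partial>\<sigma>)"
    proof (cases "Q \<inter> A = {}")
      case True
      then have "(\<lambda>x. f x * indicator A x * indicator Q x) = (\<lambda>x. 0)"
        using True by (intro ext) (auto split: split_indicator)
      then show ?thesis by (simp only:) simp
    next
      case False
      then obtain x where x: "x \<in> Q" "x \<in> A" by auto
      then have cQ: "cell k x = Q" using cell_eq k Q by auto
      then have "Q \<subseteq> A" using A x by (auto simp: saturated_def)
      then have "h x * indicator A x * indicator Q x = h x * indicator Q x" for x
        and h :: "'a \<Rightarrow> ennreal"
        by (auto simp: indicator_def)
      then show ?thesis using le[OF x(2)] cQ by simp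
    qed
  qed
qed

lemma nn_integral_cells_eq:
  assumes k: "k \<in> K" and A: "saturated k A"
    and "f \<in> borel_measurable \<sigma>" "g \<in> borel_measurable \<sigma>"
    and eq: "\<And>x. x \<in> A \<Longrightarrow> (\<integral>\<^sup>+y. f y * indicator (cell k x) y \<partial>\<sigma>)
      = (\<integral>\<^sup>+y. g y * indicator (cell k x) y \<partial>\<sigma>)"
  shows "(\<integral>\<^sup>+x. f x * indicator A x \<partial>\<sigma>) = (\<integral>\<^sup>+x. g x * indicator A x \<partial>\<sigma>)"
  by (intro antisym nn_integral_cells_mono[OF k A] assms) (auto simp: eq)

lemma nn_integral_space_indicator:
  "(\<integral>\<^sup>+x. f x * indicator (space \<sigma>) x \<partial>\<sigma>) = (\<integral>\<^sup>+x. f x \<partial>\<sigma>)"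
  by (intro nn_integral_cong) auto

text \<open>Positive and negative part have equal finite integrals on every cell, hence equal
  integrals. Summing them separately avoids series of Bochner integrals.\<close>

lemma integral_cells_zero_real:
  fixes u :: "'a \<Rightarrow> real"
  assumes k: "k \<in> K" and u: "integrable \<sigma> u"
    and z: "\<And>x. x \<in> space \<sigma> \<Longrightarrow> (LINT y:cell k x|\<sigma>. u y) = 0"
  shows "(\<integral>x. u x \<partial>\<sigma>) = 0"
proof -
  have [measurable]: "u \<in> borel_measurable \<sigma>" using u by auto
  have "(\<integral>\<^sup>+y. ennreal (u y) * indicator (cell k x) y \<partial>\<sigma>)
    = (\<integral>\<^sup>+y. ennreal (- u y) * indicator (cell k x) y \<partial>\<sigma>)"
    if x: "x \<in> space \<sigma>" for x
  proof -
    have i: "integrable \<sigma> (\<lambda>y. indicator (cell k x) y *\<^sub>R u y)"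
      using integrable_mult_indicator[OF cell_sets[OF k x] u] .
    have *: "(\<integral>\<^sup>+y. ennreal (v y) * indicator (cell k x) y \<partial>\<sigma>)
      = (\<integral>\<^sup>+y. ennreal (indicator (cell k x) y *\<^sub>R v y) \<partial>\<sigma>)"
      for v by (intro nn_integral_cong) (auto simp: indicator_def)
    have fin: "(\<integral>\<^sup>+y. ennreal (indicator (cell k x) y *\<^sub>R u y) \<partial>\<sigma>) \<noteq> \<infinity>"
         "(\<integral>\<^sup>+y. ennreal (- (indicator (cell k x) y *\<^sub>R u y)) \<partial>\<sigma>) \<noteq> \<infinity>"
      using i by (auto simp: real_integrable_def)
    have "(LINT y:cell k x|\<sigma>. u y) = enn2real (\<integral>\<^sup>+y. ennreal (indicator (cell k x) y *\<^sub>R u y) \<partial>\<sigma>)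
        - enn2real (\<integral>\<^sup>+y. ennreal (- (indicator (cell k x) y *\<^sub>R u y)) \<partial>\<sigma>)"
      unfolding set_lebesgue_integral_def by (rule real_lebesgue_integral_def[OF i])
    then have "enn2real (\<integral>\<^sup>+y. ennreal (indicator (cell k x) y *\<^sub>R u y) \<partial>\<sigma>) =
         enn2real (\<integral>\<^sup>+y. ennreal (- (indicator (cell k x) y *\<^sub>R u y)) \<partial>\<sigma>)" using z[OF x] by linarith
    then have "(\<integral>\<^sup>+y. ennreal (indicator (cell k x) y *\<^sub>R u y) \<partial>\<sigma>) =
         (\<integral>\<^sup>+y. ennreal (- (indicator (cell k x) y *\<^sub>R u y)) \<partial>\<sigma>)"
      using fin by (cases "\<integral>\<^sup>+y. ennreal (indicator (cell k x) y *\<^sub>R u y) \<partial>\<sigma>";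
          cases "\<integral>\<^sup>+y. ennreal (- (indicator (cell k x) y *\<^sub>R u y)) \<partial>\<sigma>") (simp_all only:
            infinity_ennreal_def enn2real_ennreal simp_thms)
    then show ?thesis unfolding * by simp
  qed
  then have "(\<integral>\<^sup>+y. ennreal (u y) * indicator (space \<sigma>) y \<partial>\<sigma>)
    = (\<integral>\<^sup>+y. ennreal (- u y) * indicator (space \<sigma>) y \<partial>\<sigma>)"
    by (intro nn_integral_cells_eq[OF k saturated_space[OF k]]) auto
  then have "(\<integral>\<^sup>+y. ennreal (u y) \<partial>\<sigma>) = (\<integral>\<^sup>+y. ennreal (- u y) \<partial>\<sigma>)"
    unfolding nn_integral_space_indicator .
  then show ?thesis using real_lebesgue_integral_def[OF u] by simp
qed

lemma integral_cells_zero: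
  fixes u :: "'a \<Rightarrow> complex"
  assumes k: "k \<in> K" and u: "integrable \<sigma> u"
    and z: "\<And>x. x \<in> space \<sigma> \<Longrightarrow> (LINT y:cell k x|\<sigma>. u y) = 0"
  shows "(\<integral>x. u x \<partial>\<sigma>) = 0"
proof (rule complex_eqI)
  have i: "integrable \<sigma> (\<lambda>y. indicator (cell k x) y *\<^sub>R u y)" if "x \<in> space \<sigma>" for x
    using integrable_mult_indicator[OF cell_sets[OF k that] u] .
  have "(\<integral>x. Re (u x) \<partial>\<sigma>) = 0"
  proof (rule integral_cells_zero_real[OF k])
    fix x assume x: "x \<in> space \<sigma>"
    show "(LINT y:cell k x|\<sigma>. Re (u y)) = 0"
      using z[OF x] integral_Re[OF i[OF x]] by (simp add: set_lebesgue_integral_def)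
  qed (use u in auto)
  then show "Re (\<integral>x. u x \<partial>\<sigma>) = Re 0" using u by simp
  have "(\<integral>x. Im (u x) \<partial>\<sigma>) = 0"
  proof (rule integral_cells_zero_real[OF k])
    fix x assume x: "x \<in> space \<sigma>"
    show "(LINT y:cell k x|\<sigma>. Im (u y)) = 0"
      using z[OF x] integral_Im[OF i[OF x]] by (simp add: set_lebesgue_integral_def)
  qed (use u in auto)
  then show "Im (\<integral>x. u x \<partial>\<sigma>) = Im 0" using u by simp
qed

section \<open>Averages of nonnegative functions over cells\<close>

definition navg :: "int \<Rightarrow> ('a \<Rightarrow> ennreal) \<Rightarrow> 'a \<Rightarrow> ennreal" where
  "navg k h x = (\<integral>\<^sup>+y. h y * indicator (cell k x) y \<partial>\<sigma>) / emeasure \<sigma> (cell k x)"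

lemma navg_cong: "k \<in> K \<Longrightarrow> x \<in> space \<sigma> \<Longrightarrow> y \<in> cell k x \<Longrightarrow> navg k h y = navg k h x"
  by (simp add: navg_def cell_cong)

lemma navg_measurable [measurable]: "k \<in> K \<Longrightarrow> navg k h \<in> borel_measurable \<sigma>"
  by (rule measurable_cellwise) (auto simp: navg_cong)

lemma nn_integral_const_cell:
  assumes k: "k \<in> K" "x \<in> space \<sigma>" and c: "\<And>y. y \<in> cell k x \<Longrightarrow> F y = c"
  shows "(\<integral>\<^sup>+y. F y * indicator (cell k x) y \<partial>\<sigma>) = c * emeasure \<sigma> (cell k x)"
proof -
  have "(\<integral>\<^sup>+y. F y * indicator (cell k x) y \<partial>\<sigma>) = (\<integral>\<^sup>+y. c * indicator (cell k x) y \<partial>\<sigma>)"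
    using c by (intro nn_integral_cong) (auto simp: indicator_def)
  then show ?thesis using k by (simp add: nn_integral_cmult_indicator)
qed

lemma navg_mult:
  assumes "k \<in> K" "x \<in> space \<sigma>"
  shows "navg k h x * emeasure \<sigma> (cell k x) = (\<integral>\<^sup>+y. h y * indicator (cell k x) y \<partial>\<sigma>)"
  using cell_pos[OF assms] cell_fin[OF assms]
  by (simp add: navg_def ennreal_divide_times ennreal_divide_self less_top[symmetric])

lemma nn_integral_navg:
  assumes k: "k \<in> K" and A: "saturated k A" and h: "h \<in> borel_measurable \<sigma>"
  shows "(\<integral>\<^sup>+x. navg k h x * indicator A x \<partial>\<sigma>) = (\<integral>\<^sup>+x. h x * indicator A x \<partial>\<sigma>)"
proof (rule nn_integral_cells_eq[OF k A navg_measurable[OF k] h])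
  fix x assume "x \<in> A" then have x: "x \<in> space \<sigma>" using A by (auto simp: saturated_def)
  show "(\<integral>\<^sup>+y. navg k h y * indicator (cell k x) y \<partial>\<sigma>) = (\<integral>\<^sup>+y. h y * indicator (cell k x) y \<partial>\<sigma>)"
    using nn_integral_const_cell[OF k x, of "navg k h" "navg k h x"] navg_cong[OF k x] navg_mult[OF
      k x] by simp
qed

end

section \<open>Carleson measures\<close>

text \<open>Expand (X - t d)^2 / d >= 0. This is a lower bound for X^2 / d that is linear in X and
  in d, hence can be integrated, with equality at t = X / d.\<close>

lemma young_ennreal:
  fixes X :: ennreal and t d :: real
  assumes "0 < d" "0 \<le> t"
  shows "ennreal (2 * t) * X \<le> X\<^sup>2 / ennreal d + ennreal (t\<^sup>2 * d)"
proof (cases X)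
  case (real x)
  have "0 \<le> (x - t * d)\<^sup>2 / d" using assms by simp
  also have "(x - t * d)\<^sup>2 / d = x\<^sup>2 / d + t\<^sup>2 * d - 2 * t * x"
    using assms by (simp add: power2_eq_square field_simps)
  finally have "2 * t * x \<le> x\<^sup>2 / d + t\<^sup>2 * d" by simp
  then have "ennreal (2 * t * x) \<le> ennreal (x\<^sup>2 / d + t\<^sup>2 * d)" by (rule ennreal_leI)
  moreover have "ennreal (2 * t) * X = ennreal (2 * t * x)"
    using real assms by (subst real(2), subst ennreal_mult[symmetric]) auto
  moreover have "X\<^sup>2 / ennreal d = ennreal (x\<^sup>2 / d)"
    using real assms by (simp add: ennreal_power divide_ennreal)
  moreover have "ennreal (x\<^sup>2 / d + t\<^sup>2 * d) = ennreal (x\<^sup>2 / d) + ennreal (t\<^sup>2 * d)"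
    using assms by (intro ennreal_plus) auto
  ultimately show ?thesis by simp
next
  case top
  then show ?thesis using assms by (simp add: ennreal_top_divide power2_eq_square)
qed

text \<open>The concavity of the Bellman function. Put u = c + A and v = u - \<alpha>. Both are at
  most 2 c, so 1 / v - 1 / u = \<alpha> / (u v) is at least \<alpha> / (4 c^2).\<close>

lemma bellman_real:
  fixes x s c A \<alpha> W :: real
  assumes "0 < c" "0 \<le> \<alpha>" "\<alpha> \<le> A" "A \<le> c" "0 \<le> s" "x\<^sup>2 * s / (c + A - \<alpha>) \<le> W"
  shows "\<alpha> * x\<^sup>2 * s + 4 * c\<^sup>2 * (x\<^sup>2 / (c + A) * s) \<le> 4 * c\<^sup>2 * W"
proof -
  let ?v = "c + A - \<alpha>" let ?u = "c + A" let ?y = "x\<^sup>2 * s"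
  have v: "0 < ?v" "0 < ?u" using assms by auto
  have "?u * ?v \<le> (2 * c) * (2 * c)" using assms by (intro mult_mono) auto
  then have "\<alpha> * (?u * ?v) \<le> \<alpha> * (4 * c\<^sup>2)" using assms
    by (intro mult_left_mono) (auto simp: power2_eq_square)
  then have "\<alpha> \<le> 4 * c\<^sup>2 * \<alpha> / (?u * ?v)" using v
    by (subst pos_le_divide_eq) (auto simp: mult.commute)
  also have "\<dots> = 4 * c\<^sup>2 * ((?u - ?v) / (?u * ?v))" by simp
  also have "(?u - ?v) / (?u * ?v) = 1 / ?v - 1 / ?u"
  proof -
    have "(u - w) / (u * w) = 1 / w - 1 / u" if "0 < u" "0 < w" for u w :: real
      using that by (simp add: field_simps)
    from this[OF v(2,1)] show ?thesis .
  qed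
  finally have "\<alpha> \<le> 4 * c\<^sup>2 * (1 / ?v - 1 / ?u)" .
  then have "?y * \<alpha> \<le> ?y * (4 * c\<^sup>2 * (1 / ?v - 1 / ?u))"
    using assms by (intro mult_left_mono) auto
  moreover have "4 * c\<^sup>2 * (?y / ?v) \<le> 4 * c\<^sup>2 * W" using assms by (intro mult_left_mono) auto
  ultimately show ?thesis by (simp add: algebra_simps)
qed

section \<open>Carleson's condition from good subsets, and the embedding theorem\<close>

context dyadic_system
begin

text \<open>Stop at the maximal subcells on which the partial sums first exceed \<Lambda>. They miss
  \<open>F\<close>; the generation of stopping adds at most C, and the later generations are bounded
  by induction with M = (\<Lambda> + C) / \<eta>. Hence the integral over a cell Q is at most
  (\<Lambda> + C) |Q| + M |Q - F|, which is at most M |Q| because |F| >= \<eta> |Q|.\<close>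

lemma john_nirenberg:
  fixes \<alpha> :: "int \<Rightarrow> 'a \<Rightarrow> ennreal" and C \<Lambda> \<eta> :: real
  assumes m: "m \<in> K" and pos: "0 \<le> C" "0 \<le> \<Lambda>" "0 < \<eta>"
    and \<alpha>: "\<And>k x y. k \<in> K \<Longrightarrow> x \<in> space \<sigma> \<Longrightarrow> y \<in> cell k x \<Longrightarrow> \<alpha> k y = \<alpha> k x"
    and \<alpha>C: "\<And>k x. k \<in> K \<Longrightarrow> x \<in> space \<sigma> \<Longrightarrow> \<alpha> k x \<le> ennreal C"
    and big: "\<And>k x. m \<le> k \<Longrightarrow> k \<le> N \<Longrightarrow> x \<in> space \<sigma> \<Longrightarrow>
      \<exists>F\<in>sets \<sigma>. F \<subseteq> cell k x \<and> ennreal \<eta> * emeasure \<sigma> (cell k x) \<le> emeasure \<sigma> F \<and>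
        (\<forall>y\<in>F. (\<Sum>i\<in>{k..N}. \<alpha> i y) \<le> ennreal \<Lambda>)"
    and k: "m \<le> k" and x: "x \<in> space \<sigma>"
  shows "(\<integral>\<^sup>+y. (\<Sum>i\<in>{k..N}. \<alpha> i y) * indicator (cell k x) y \<partial>\<sigma>)
      \<le> ennreal ((\<Lambda> + C) / \<eta>) * emeasure \<sigma> (cell k x)"
  using k x
proof (induction "nat (N + 1 - k)" arbitrary: k x rule: less_induct)
  case (less k x)
  have kK: "k \<in> K" using K_up[OF m] less.prems by simp
  have \<alpha>m[measurable]: "\<alpha> i \<in> borel_measurable \<sigma>" if "k \<le> i" for i
    using K_up[OF kK that] by (intro measurable_cellwise[of i]) (auto simp: \<alpha>)
  show ?case
  proof (cases "k \<le> N")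
    case False
    then show ?thesis by simp
  next
    case kN: True
    let ?m0 = "ennreal ((\<Lambda> + C) / \<eta>)"
    obtain F where F[measurable]: "F \<in> sets \<sigma>" and FQ: "F \<subseteq> cell k x"
      and F\<eta>: "ennreal \<eta> * emeasure \<sigma> (cell k x) \<le> emeasure \<sigma> F"
      and F\<Lambda>: "\<And>y. y \<in> F \<Longrightarrow> (\<Sum>i\<in>{k..N}. \<alpha> i y) \<le> ennreal \<Lambda>"
      using big[OF less.prems(1) kN less.prems(2)] by blast
    define S where "S y = (\<Sum>i\<in>{k..N}. \<alpha> i y)" for y
    have S[measurable]: "S \<in> borel_measurable \<sigma>"
      unfolding S_def by (intro borel_measurable_sum) auto
    \<comment> \<open>The majorant: \<Lambda> + C everywhere, and outside \<open>F\<close> also the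
      price of the generations after stopping.\<close>
    define g where "g y = ennreal (\<Lambda> + C) + ?m0 * indicator (space \<sigma> - F) y" for y
    have g[measurable]: "g \<in> borel_measurable \<sigma>" unfolding g_def by measurable
    have sub: "z \<in> cell l y" if "k \<le> l" "l \<le> i" "y \<in> space \<sigma>" "z \<in> cell i y" for l i y z
      using cell_mono[OF K_up[OF kK that(1)] that(2,3)] that(4) by blast
    \<comment> \<open>Descent from \<open>cell k x\<close> through cells whose partial sums before
      generation i have not exceeded \<Lambda>.\<close>
    have claim: "(\<integral>\<^sup>+z. S z * indicator (cell i y) z \<partial>\<sigma>) \<le> (\<integral>\<^sup>+z. g z * indicator (cell i y) z \<partial>\<sigma>)"
      if "k \<le> i" "i \<le> N + 1" "y \<in> space \<sigma>" "(\<Sum>l\<in>{k..<i}. \<alpha> l y) \<le> ennreal \<Lambda>" for i y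
      using that
    proof (induction "nat (N + 1 - i)" arbitrary: i y)
      case 0
      \<comment> \<open>All generations have been passed without stopping, so the full sum is at
        most \<Lambda>.\<close>
      then have i: "i = N + 1" by simp
      then have iset: "{k..<i} = {k..N}" by auto
      have iK: "i \<in> K" using K_up[OF kK] 0 by simp
      show ?case
      proof (rule nn_integral_mono)
        fix z
        show "S z * indicator (cell i y) z \<le> g z * indicator (cell i y) z"
        proof (cases "z \<in> cell i y")
          case True
          have "\<alpha> l z = \<alpha> l y" if "l \<in> {k..N}" for l
            using that sub[of l i y z] True K_up[OF kK] i 0 by (intro \<alpha>) auto
          then have "S z = (\<Sum>l\<in>{k..<i}. \<alpha> l y)" unfolding S_def iset by (intro sum.cong) auto
          also have "\<dots> \<le> ennreal (\<Lambda> + C)" using 0(5) pos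
            by (rule_tac order_trans) (auto intro: ennreal_leI)
          also have "\<dots> \<le> g z" by (simp add: g_def)
          finally show ?thesis using True by simp
        qed simp
      qed
    next
      case (Suc d)
      then have iN: "i \<le> N" by simp
      have iK: "i \<in> K" "i + 1 \<in> K" using K_up[OF kK] Suc by auto
      have sat: "saturated (i + 1) (cell i y)" using saturated_cell iK Suc by simp
      have csp: "z \<in> space \<sigma>" if "z \<in> cell i y" for z using cell_subset iK Suc that by blast
      \<comment> \<open>The partial sum including generation i. It is constant on the cell and
        decides whether the cell stops.\<close>
      define s' where "s' = (\<Sum>l\<in>{k..<i+1}. \<alpha> l y)"
      have s'z: "(\<Sum>l\<in>{k..<i+1}. \<alpha> l z) = s'" if "z \<in> cell i y" for z
        unfolding s'_def
        by (intro sum.cong \<alpha>) (use that K_up[OF kK] Suc.prems sub[of _ i y z] in auto)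
      show ?case
      proof (cases "s' \<le> ennreal \<Lambda>")
        case True
        show ?thesis
        proof (rule nn_integral_cells_mono[OF iK(2) sat S g])
          fix z assume z: "z \<in> cell i y"
          show "(\<integral>\<^sup>+u. S u * indicator (cell (i+1) z) u \<partial>\<sigma>)
            \<le> (\<integral>\<^sup>+u. g u * indicator (cell (i+1) z) u \<partial>\<sigma>)"
            using Suc(2) Suc.prems iN csp[OF z] s'z[OF z] True by (intro Suc(1)) auto
        qed
      next
        case False
        \<comment> \<open>On \<open>F\<close> the full sum, hence each partial sum, is at most
          \<Lambda>.\<close>
        have disj: "F \<inter> cell i y = {}"
        proof (rule ccontr)
          assume "F \<inter> cell i y \<noteq> {}"
          then obtain z where z: "z \<in> F" "z \<in> cell i y" by auto
          have "s' \<le> (\<Sum>l\<in>{k..N}. \<alpha> l z)"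
            unfolding s'z[OF z(2), symmetric] by (rule sum_mono2) (use iN in auto)
          also have "\<dots> \<le> ennreal \<Lambda>" using F\<Lambda> z by simp
          finally show False using False by simp
        qed
        define R where "R z = (\<Sum>l\<in>{i+1..N}. \<alpha> l z)" for z
        have R[measurable]: "R \<in> borel_measurable \<sigma>"
          unfolding R_def using Suc.prems by (intro borel_measurable_sum) auto
        have SR: "S z \<le> ennreal (\<Lambda> + C) + R z" if z: "z \<in> cell i y" for z
        proof -
          have "{k..N} = {k..<i} \<union> {i} \<union> {i+1..N}" using Suc.prems iN by auto
          then have "S z = (\<Sum>l\<in>{k..<i} \<union> {i} \<union> {i+1..N}. \<alpha> l z)" by (simp add: S_def)
          also have "\<dots> = (\<Sum>l\<in>{k..<i}. \<alpha> l z) + \<alpha> i z + R z"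
            unfolding R_def by (subst sum.union_disjoint; auto)+
          also have "(\<Sum>l\<in>{k..<i}. \<alpha> l z) = (\<Sum>l\<in>{k..<i}. \<alpha> l y)"
            by (intro sum.cong \<alpha>) (use z K_up[OF kK] Suc.prems sub[of _ i y z] in auto)
          finally have "S z \<le> ennreal \<Lambda> + ennreal C + R z"
            using Suc.prems(4) \<alpha>C[OF iK(1) csp[OF z]] by (metis add_mono order_refl)
          then show ?thesis using pos by simp
        qed
        have "(\<integral>\<^sup>+u. R u * indicator (cell i y) u \<partial>\<sigma>) \<le> (\<integral>\<^sup>+u. ?m0 * indicator (cell i y) u \<partial>\<sigma>)"
        \<comment> \<open>The outer induction applies to the subcells of generation i + 1, which are
          finer than generation k.\<close>
        proof (rule nn_integral_cells_mono[OF iK(2) sat R])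
          fix z assume z: "z \<in> cell i y"
          have "(\<integral>\<^sup>+u. R u * indicator (cell (i+1) z) u \<partial>\<sigma>) \<le> ?m0 * emeasure \<sigma> (cell (i+1) z)"
            unfolding R_def using Suc.prems iN csp[OF z] less.prems by (intro less.hyps) auto
          then show "(\<integral>\<^sup>+u. R u * indicator (cell (i+1) z) u \<partial>\<sigma>)
            \<le> (\<integral>\<^sup>+u. ?m0 * indicator (cell (i+1) z) u \<partial>\<sigma>)"
            using cell_sets[OF iK(2) csp[OF z]] by (simp add: nn_integral_cmult_indicator)
        qed simp
        have ci[measurable]: "cell i y \<in> sets \<sigma>" using cell_sets iK Suc.prems by simp
        have "(\<integral>\<^sup>+z. S z * indicator (cell i y) z \<partial>\<sigma>) \<le>
            (\<integral>\<^sup>+z. ennreal (\<Lambda> + C) * indicator (cell i y) z + R z * indicator (cell i y) z \<partial>\<sigma>)"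
          using SR by (intro nn_integral_mono) (auto split: split_indicator)
        also have "\<dots> = (\<integral>\<^sup>+z. ennreal (\<Lambda> + C) * indicator (cell i y) z \<partial>\<sigma>)
          + (\<integral>\<^sup>+z. R z * indicator (cell i y) z \<partial>\<sigma>)"
          by (intro nn_integral_add) auto
        also have "\<dots> \<le> (\<integral>\<^sup>+z. ennreal (\<Lambda> + C) * indicator (cell i y) z \<partial>\<sigma>)
          + (\<integral>\<^sup>+u. ?m0 * indicator (cell i y) u \<partial>\<sigma>)"
          by (intro add_left_mono) fact
        also have "\<dots> = (\<integral>\<^sup>+z. ennreal (\<Lambda> + C) * indicator (cell i y) z
          + ?m0 * indicator (cell i y) z \<partial>\<sigma>)"
          by (intro nn_integral_add[symmetric]) auto
        also have "\<dots> = (\<integral>\<^sup>+z. g z * indicator (cell i y) z \<partial>\<sigma>)"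
          unfolding g_def using disj csp by (intro nn_integral_cong) (auto split: split_indicator)
        finally show ?thesis .
      qed
    qed
    have cx[measurable]: "cell k x \<in> sets \<sigma>" using cell_sets kK less.prems by simp
    have "(\<integral>\<^sup>+z. S z * indicator (cell k x) z \<partial>\<sigma>) \<le> (\<integral>\<^sup>+z. g z * indicator (cell k x) z \<partial>\<sigma>)"
      using claim[of k x] kN less.prems by simp
    also have "\<dots> = (\<integral>\<^sup>+z. ennreal (\<Lambda> + C) * indicator (cell k x) z
      + ?m0 * indicator (cell k x - F) z \<partial>\<sigma>)"
      unfolding g_def using sets.sets_into_space[OF cx]
        by (intro nn_integral_cong) (auto split: split_indicator)
    also have "\<dots> = ennreal (\<Lambda> + C) * emeasure \<sigma> (cell k x) + ?m0 * emeasure \<sigma> (cell k x - F)"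
      by (subst nn_integral_add) (auto simp: nn_integral_cmult_indicator)
    \<comment> \<open>This is why the bound carries 1 / \<eta>: the first term becomes the bound
      times \<eta> |Q|, which the measure of \<open>F\<close> pays for.\<close>
    also have "ennreal (\<Lambda> + C) * emeasure \<sigma> (cell k x) = ?m0 * (ennreal \<eta> * emeasure \<sigma> (cell k x))"
      using pos by (simp add: mult.assoc[symmetric] ennreal_mult[symmetric])
    also have "\<dots> + ?m0 * emeasure \<sigma> (cell k x - F)
      \<le> ?m0 * emeasure \<sigma> F + ?m0 * emeasure \<sigma> (cell k x - F)"
      by (intro add_right_mono mult_left_mono F\<eta>) auto
    also have "\<dots> = ?m0 * (emeasure \<sigma> (cell k x - F) + emeasure \<sigma> F)"
      by (simp add: distrib_left add.commute)
    also have "emeasure \<sigma> (cell k x - F) + emeasure \<sigma> F = emeasure \<sigma> (cell k x)"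
      using FQ by (subst plus_emeasure) (auto simp: Un_absorb2)
    finally show ?thesis by (simp add: S_def)
  qed
qed

text \<open>The Bellman function of the Carleson embedding theorem is
  \<open>4 c (F - c X\<^sup>2 / (c + A))\<close>; here its subtracted part is moved to the left.\<close>

lemma carleson_embedding_aux:
  fixes \<alpha> :: "int \<Rightarrow> 'a \<Rightarrow> ennreal" and c :: real and f :: "'a \<Rightarrow> ennreal"
  assumes m: "m \<in> K" and c: "0 < c" and f[measurable]: "f \<in> borel_measurable \<sigma>"
    and \<alpha>: "\<And>k x y. k \<in> K \<Longrightarrow> x \<in> space \<sigma> \<Longrightarrow> y \<in> cell k x \<Longrightarrow> \<alpha> k y = \<alpha> k x"
    and carl: "\<And>k x. m \<le> k \<Longrightarrow> x \<in> space \<sigma> \<Longrightarrow>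
       (\<integral>\<^sup>+y. (\<Sum>i\<in>{k..N}. \<alpha> i y) * indicator (cell k x) y \<partial>\<sigma>) \<le> ennreal c * emeasure \<sigma> (cell k x)"
    and k: "m \<le> k" "k \<le> N + 1" and x: "x \<in> space \<sigma>"
  shows "(\<integral>\<^sup>+y. ((\<Sum>i\<in>{k..N}. \<alpha> i y * (navg i f y)\<^sup>2) +
        ennreal (4 * c\<^sup>2) * ((navg k f y)\<^sup>2 / (ennreal c + navg k (\<lambda>z. \<Sum>i\<in>{k..N}. \<alpha> i z) y))) *
          indicator (cell k x) y \<partial>\<sigma>)
    \<le> ennreal (4 * c) * (\<integral>\<^sup>+y. (f y)\<^sup>2 * indicator (cell k x) y \<partial>\<sigma>)"
  using k x
proof (induction "nat (N + 1 - k)" arbitrary: k x)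
  case 0
  then have k: "k = N + 1" by simp
  have kK: "k \<in> K" using K_up[OF m] 0 by simp
  have cx[measurable]: "cell k x \<in> sets \<sigma>" using cell_sets kK 0 by simp
  \<comment> \<open>At generation N + 1 the sum of the \<open>\<alpha> i\<close> is empty, so the
    Bellman term is 4 c times the squared average, and Cauchy-Schwarz finishes this case.\<close>
  have navg0: "navg k (\<lambda>z. \<Sum>i\<in>{k..N}. \<alpha> i z) y = 0" for y using k by (simp add: navg_def)
  define X where "X = navg k f x"
  have "ennreal (4 * c\<^sup>2) * (X\<^sup>2 / ennreal c) = ennreal (4 * c) * X\<^sup>2"
  proof -
    have "ennreal (4 * c\<^sup>2) = ennreal (4 * c) * ennreal c" using c
      by (simp add: ennreal_mult[symmetric] power2_eq_square)
    moreover have "ennreal c * (X\<^sup>2 / ennreal c) = X\<^sup>2"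
      using c by (simp add: ennreal_times_divide mult.commute[of
        "ennreal c"] ennreal_mult_divide_eq)
    ultimately show ?thesis by (simp only: mult.assoc)
  qed
  then have "(\<integral>\<^sup>+y. ((\<Sum>i\<in>{k..N}. \<alpha> i y * (navg i f y)\<^sup>2) +
        ennreal (4 * c\<^sup>2) * ((navg k f y)\<^sup>2 / (ennreal c + navg k (\<lambda>z. \<Sum>i\<in>{k..N}. \<alpha> i z) y))) *
          indicator (cell k x) y \<partial>\<sigma>)
     = ennreal (4 * c) * X\<^sup>2 * emeasure \<sigma> (cell k x)"
    unfolding navg0 using navg_cong[OF kK 0(4), of _ f] k
    by (intro nn_integral_const_cell[OF kK 0(4)]) (simp add: X_def)
  also have "\<dots> = ennreal (4 * c) * (X\<^sup>2 * emeasure \<sigma> (cell k x))" by (simp add: mult.assoc)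
  also have "X\<^sup>2 * emeasure \<sigma> (cell k x) \<le> (\<integral>\<^sup>+y. (f y)\<^sup>2 * indicator (cell k x) y \<partial>\<sigma>)"
  proof -
    have "(\<integral>\<^sup>+y. (f y * indicator (cell k x) y) * indicator (cell k x) y \<partial>\<sigma>)\<^sup>2 \<le>
      (\<integral>\<^sup>+y. (f y * indicator (cell k x) y)\<^sup>2 \<partial>\<sigma>) * (\<integral>\<^sup>+y. (indicator (cell k x) y)\<^sup>2 \<partial>\<sigma>)"
      by (rule Cauchy_Schwarz_nn_integral) auto
    also have "(\<lambda>y. (f y * indicator (cell k x) y) * indicator (cell k x) y)
      = (\<lambda>y. f y * indicator (cell k x) y)"
      by (auto split: split_indicator)
    also have "(\<lambda>y. (f y * indicator (cell k x) y)\<^sup>2) = (\<lambda>y. (f y)\<^sup>2 * indicator (cell k x) y)"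
      by (auto split: split_indicator simp: power2_eq_square)
    also have "(\<lambda>y. (indicator (cell k x) y)\<^sup>2 :: ennreal) = indicator (cell k x)"
      by (auto split: split_indicator simp: power2_eq_square)
    finally have "(X * emeasure \<sigma> (cell k x))\<^sup>2
      \<le> (\<integral>\<^sup>+y. (f y)\<^sup>2 * indicator (cell k x) y \<partial>\<sigma>) * emeasure \<sigma> (cell k x)"
      using navg_mult[OF kK 0(4), of f] by (simp add: X_def)
    then have "(X\<^sup>2 * emeasure \<sigma> (cell k x)) * emeasure \<sigma> (cell k x)
       \<le> (\<integral>\<^sup>+y. (f y)\<^sup>2 * indicator (cell k x) y \<partial>\<sigma>) * emeasure \<sigma> (cell k x)"
      by (simp add: power2_eq_square ac_simps)
    then show ?thesis
      using cell_pos[OF kK 0(4)] cell_fin[OF kK 0(4)]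
      by (simp add: mult.commute[of _ "emeasure \<sigma> (cell k x)"] ennreal_mult_le_mult_iff)
  qed
  finally show ?case by (simp add: mult_left_mono)
next
  case (Suc d)
  then have kN: "k \<le> N" by simp
  have kK: "k \<in> K" "k + 1 \<in> K" using K_up[OF m] Suc by auto
  have \<alpha>m[measurable]: "\<alpha> i \<in> borel_measurable \<sigma>" if "k \<le> i" for i
    using K_up[OF kK(1) that] by (intro measurable_cellwise[of i]) (auto simp: \<alpha>)
  have nm[measurable]: "navg i f \<in> borel_measurable \<sigma>" if "k \<le> i" for i
    using K_up[OF kK(1) that] by simp
  have xs: "x \<in> space \<sigma>" using Suc by simp
  have cx[measurable]: "cell k x \<in> sets \<sigma>" using cell_sets kK Suc by simp
  have sat: "saturated (k + 1) (cell k x)" using saturated_cell kK xs by simp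
  have csp: "z \<in> space \<sigma>" if "z \<in> cell k x" for z using cell_subset kK xs that by blast
  let ?R = "\<lambda>z. \<Sum>i\<in>{k+1..N}. \<alpha> i z"
  have Rm[measurable]: "?R \<in> borel_measurable \<sigma>" by (intro borel_measurable_sum) auto
  define A1 where "A1 = navg (k+1) ?R"
  define X1 where "X1 = navg (k+1) f"
  have A1m[measurable]: "A1 \<in> borel_measurable \<sigma>" and X1m[measurable]: "X1 \<in> borel_measurable \<sigma>"
    using kK by (auto simp: A1_def X1_def)
  \<comment> \<open>The Bellman terms of the subcells. The induction hypothesis becomes
    \<open>ih\<close>, and the inductive step reduces to the comparison \<open>key\<close> of
    \<open>W\<close> with the Bellman term of the cell itself.\<close>
  define W where "W = (\<integral>\<^sup>+y. ((X1 y)\<^sup>2 / (ennreal c + A1 y)) * indicator (cell k x) y \<partial>\<sigma>)"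
  have ih: "(\<integral>\<^sup>+y. (\<Sum>i\<in>{k+1..N}. \<alpha> i y * (navg i f y)\<^sup>2) * indicator (cell k x) y \<partial>\<sigma>)
    + ennreal (4 * c\<^sup>2) * W
     \<le> ennreal (4 * c) * (\<integral>\<^sup>+y. (f y)\<^sup>2 * indicator (cell k x) y \<partial>\<sigma>)"
  proof -
    have "(\<integral>\<^sup>+y. ((\<Sum>i\<in>{k+1..N}. \<alpha> i y * (navg i f y)\<^sup>2)
      + ennreal (4 * c\<^sup>2) * ((X1 y)\<^sup>2 / (ennreal c + A1 y))) * indicator (cell k x) y \<partial>\<sigma>)
       \<le> (\<integral>\<^sup>+y. (ennreal (4 * c) * (f y)\<^sup>2) * indicator (cell k x) y \<partial>\<sigma>)"
    proof (rule nn_integral_cells_mono[OF kK(2) sat])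
      fix z assume z: "z \<in> cell k x"
      have [measurable]: "cell (k+1) z \<in> sets \<sigma>" using cell_sets[OF kK(2) csp[OF z]] .
      have "(\<integral>\<^sup>+y. ((\<Sum>i\<in>{k+1..N}. \<alpha> i y * (navg i f y)\<^sup>2)
        + ennreal (4 * c\<^sup>2) * ((X1 y)\<^sup>2 / (ennreal c + A1 y))) * indicator (cell (k+1) z) y \<partial>\<sigma>)
         \<le> ennreal (4 * c) * (\<integral>\<^sup>+y. (f y)\<^sup>2 * indicator (cell (k+1) z) y \<partial>\<sigma>)"
        unfolding A1_def X1_def by (rule Suc.hyps(1)) (use Suc kN csp[OF z] in auto)
      also have "\<dots> = (\<integral>\<^sup>+y. (ennreal (4 * c) * (f y)\<^sup>2) * indicator (cell (k+1) z) y \<partial>\<sigma>)"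
        by (simp add: nn_integral_cmult[symmetric] mult.assoc)
      finally show "(\<integral>\<^sup>+y. ((\<Sum>i\<in>{k+1..N}. \<alpha> i y * (navg i f y)\<^sup>2)
        + ennreal (4 * c\<^sup>2) * ((X1 y)\<^sup>2 / (ennreal c + A1 y))) * indicator (cell (k+1) z) y \<partial>\<sigma>)
         \<le> (\<integral>\<^sup>+y. (ennreal (4 * c) * (f y)\<^sup>2) * indicator (cell (k+1) z) y \<partial>\<sigma>)" .
    qed measurable
    then show ?thesis unfolding W_def
      by (simp add: nn_integral_cmult[symmetric] nn_integral_add[symmetric] distrib_right
        mult.assoc)
  qed
  define S where "S = emeasure \<sigma> (cell k x)"
  have S0: "S \<noteq> 0" "S \<noteq> top" using cell_pos cell_fin kK xs by (auto simp: S_def)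
  then obtain s where s: "S = ennreal s" "0 < s"
    by (cases S) (auto simp: ennreal_eq_0_iff zero_less_iff_neq_zero le_less)
  define A where "A = navg k (\<lambda>z. \<Sum>i\<in>{k..N}. \<alpha> i z) x"
  have AS: "A * S = (\<integral>\<^sup>+y. (\<Sum>i\<in>{k..N}. \<alpha> i y) * indicator (cell k x) y \<partial>\<sigma>)"
    unfolding A_def S_def by (rule navg_mult[OF kK(1) xs])
  also have "\<dots> \<le> ennreal c * S" unfolding S_def using carl Suc by simp
  finally have "A \<le> ennreal c" using S0 by (simp add: mult.commute[of _ S] ennreal_mult_le_mult_iff)
  then obtain a where a: "A = ennreal a" "0 \<le> a" "a \<le> c" using c
    by (cases A) (auto simp: top_unique)
  have A1c: "A1 z \<le> ennreal c" if "z \<in> cell k x" for z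
  proof -
    have "A1 z * emeasure \<sigma> (cell (k+1) z) \<le> ennreal c * emeasure \<sigma> (cell (k+1) z)"
      unfolding A1_def navg_mult[OF kK(2) csp[OF that]] using carl csp[OF that] Suc by simp
    then show ?thesis using cell_pos[OF kK(2) csp[OF that]] cell_fin[OF kK(2) csp[OF that]]
      by (simp add: mult.commute[of _ "emeasure \<sigma> _"] ennreal_mult_le_mult_iff)
  qed
  \<comment> \<open>The mass of generation k splits off: the mean of \<open>A1\<close> over the cell
    is A minus \<alpha>.\<close>
  have R1: "(\<integral>\<^sup>+y. A1 y * indicator (cell k x) y \<partial>\<sigma>) + \<alpha> k x * S = A * S"
  proof -
    have "{k..N} = insert k {k+1..N}" using kN by auto
    then have "(\<Sum>i\<in>{k..N}. \<alpha> i y) = \<alpha> k y + ?R y" for y by simp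
    then have "A * S = (\<integral>\<^sup>+y. (\<alpha> k y + ?R y) * indicator (cell k x) y \<partial>\<sigma>)" unfolding AS by simp
    also have "\<dots> = (\<integral>\<^sup>+y. \<alpha> k y * indicator (cell k x) y \<partial>\<sigma>)
      + (\<integral>\<^sup>+y. ?R y * indicator (cell k x) y \<partial>\<sigma>)"
      unfolding distrib_right by (rule nn_integral_add) auto
    also have "(\<integral>\<^sup>+y. \<alpha> k y * indicator (cell k x) y \<partial>\<sigma>) = \<alpha> k x * S"
      unfolding S_def using \<alpha>[OF kK(1) xs] by (rule nn_integral_const_cell[OF kK(1) xs])
    also have "(\<integral>\<^sup>+y. ?R y * indicator (cell k x) y \<partial>\<sigma>) = (\<integral>\<^sup>+y. A1 y * indicator (cell k x) y \<partial>\<sigma>)"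
      unfolding A1_def by (rule nn_integral_navg[OF kK(2) sat Rm, symmetric])
    finally show ?thesis by (simp add: add.commute)
  qed
  have "\<alpha> k x * S \<le> (\<integral>\<^sup>+y. A1 y * indicator (cell k x) y \<partial>\<sigma>) + \<alpha> k x * S"
    by (rule add_increasing) auto
  also note R1
  finally have "\<alpha> k x * S \<le> A * S" .
  then have "\<alpha> k x \<le> A" using S0 by (simp add: mult.commute[of _ S] ennreal_mult_le_mult_iff)
  then obtain \<alpha>0 where \<alpha>0: "\<alpha> k x = ennreal \<alpha>0" "0 \<le> \<alpha>0" "\<alpha>0 \<le> a" using a
    by (cases "\<alpha> k x") (auto simp: top_unique)
  have R2: "(\<integral>\<^sup>+y. (ennreal c + A1 y) * indicator (cell k x) y \<partial>\<sigma>) = ennreal ((c + a - \<alpha>0) * s)"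
  proof -
    have "(\<integral>\<^sup>+y. A1 y * indicator (cell k x) y \<partial>\<sigma>) + ennreal (\<alpha>0 * s) = ennreal (a * s)"
      using R1 a s \<alpha>0 by (simp add: ennreal_mult)
    moreover have "ennreal (a * s) = ennreal ((a - \<alpha>0) * s) + ennreal (\<alpha>0 * s)"
      using \<alpha>0 s by (subst ennreal_plus[symmetric]) (auto simp: algebra_simps intro!:
        mult_nonneg_nonneg)
    ultimately have "(\<integral>\<^sup>+y. A1 y * indicator (cell k x) y \<partial>\<sigma>) = ennreal ((a - \<alpha>0) * s)" by simp
    then have "(\<integral>\<^sup>+y. (ennreal c + A1 y) * indicator (cell k x) y \<partial>\<sigma>)
      = ennreal c * S + ennreal ((a - \<alpha>0) * s)"
      unfolding distrib_right by (subst nn_integral_add) (auto simp: nn_integral_cmult_indicator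
        S_def)
    also have "\<dots> = ennreal ((c + a - \<alpha>0) * s)"
      using s c \<alpha>0 by (simp add: ennreal_mult[symmetric] ennreal_plus[symmetric] algebra_simps del:
        ennreal_plus)
    finally show ?thesis .
  qed
  define X where "X = navg k f x"
  have XS: "X * S = (\<integral>\<^sup>+y. X1 y * indicator (cell k x) y \<partial>\<sigma>)"
    unfolding X_def S_def X1_def navg_mult[OF kK(1) xs]
      by (rule nn_integral_navg[OF kK(2) sat f, symmetric])
  \<comment> \<open>Jensen's inequality for the convex function X^2 / Y, in linearised form. The
    parameter t is optimised only after the integration.\<close>
  have young: "ennreal (2 * t) * (X * S) \<le> W + ennreal (t\<^sup>2 * ((c + a - \<alpha>0) * s))" if "0 \<le> t" for t
  proof -
    have "ennreal (2 * t) * (X * S) = (\<integral>\<^sup>+y. ennreal (2 * t) * (X1 y * indicator (cell k x) y) \<partial>\<sigma>)"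
      unfolding XS by (rule nn_integral_cmult[symmetric]) auto
    also have "\<dots> \<le> (\<integral>\<^sup>+y. ((X1 y)\<^sup>2 / (ennreal c + A1 y)) * indicator (cell k x) y
         + ennreal (t\<^sup>2) * ((ennreal c + A1 y) * indicator (cell k x) y) \<partial>\<sigma>)"
    proof (rule nn_integral_mono)
      fix y
      show "ennreal (2 * t) * (X1 y * indicator (cell k x) y)
        \<le> ((X1 y)\<^sup>2 / (ennreal c + A1 y)) * indicator (cell k x) y
         + ennreal (t\<^sup>2) * ((ennreal c + A1 y) * indicator (cell k x) y)"
      proof (cases "y \<in> cell k x")
        case True
        then obtain a1 where a1: "A1 y = ennreal a1" "0 \<le> a1" using A1c[OF True]
          by (cases "A1 y") (auto simp: top_unique)
        then have "ennreal c + A1 y = ennreal (c + a1)" using c by simp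
        then show ?thesis using True young_ennreal[of "c + a1" t "X1 y"] a1 c \<open>0 \<le> t\<close>
          by (simp add: ennreal_mult del: ennreal_plus)
      qed simp
    qed
    also have "\<dots> = W + ennreal (t\<^sup>2) * ennreal ((c + a - \<alpha>0) * s)"
      unfolding W_def R2[symmetric] by (subst nn_integral_add) (auto simp: nn_integral_cmult)
    finally show ?thesis using \<alpha>0 a c s by (simp add: ennreal_mult)
  qed
  have key: "ennreal \<alpha>0 * X\<^sup>2 * S + ennreal (4 * c\<^sup>2) * (X\<^sup>2 / ennreal (c + a) * S)
    \<le> ennreal (4 * c\<^sup>2) * W"
  proof (cases W)
    case top
    then show ?thesis using c by (simp add: ennreal_mult_top)
  next
    case (real w)
    have "X \<noteq> top"
    proof
      assume "X = top"
      then have "top \<le> W + ennreal (1\<^sup>2 * ((c + a - \<alpha>0) * s))"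
        using young[of 1] S0 by (simp add: ennreal_top_mult ennreal_mult_top)
      then show False using real by (simp add: top_unique)
    qed
    then obtain xx where xx: "X = ennreal xx" "0 \<le> xx" by (cases X) auto
    have v: "0 < c + a - \<alpha>0" using \<alpha>0 c by simp
    have "2 * t * (xx * s) \<le> w + t\<^sup>2 * ((c + a - \<alpha>0) * s)" if "0 \<le> t" for t
    proof -
      have "ennreal (2 * t * (xx * s)) \<le> ennreal (w + t\<^sup>2 * ((c + a - \<alpha>0) * s))"
        using young[OF that] xx s real v that by (simp add: ennreal_mult)
      then show ?thesis using real s v by (subst (asm) ennreal_le_iff) auto
    qed
    \<comment> \<open>The optimal parameter, with which the linearised inequality becomes the
      quadratic one.\<close>
    from this[of "xx / (c + a - \<alpha>0)"] have "xx\<^sup>2 * s / (c + a - \<alpha>0) \<le> w"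
    proof -
      assume *: "0 \<le> xx / (c + a - \<alpha>0) \<Longrightarrow> 2 * (xx / (c + a - \<alpha>0)) * (xx * s)
          \<le> w + (xx / (c + a - \<alpha>0))\<^sup>2 * ((c + a - \<alpha>0) * s)"
      have "2 * (xx / u) * (xx * s) = 2 * (xx\<^sup>2 * s / u)" "(xx / u)\<^sup>2 * (u * s) = xx\<^sup>2 * s / u"
        if "0 < u" for u using that by (auto simp: power2_eq_square field_simps)
      from this[OF v] *[OF divide_nonneg_pos[OF xx(2) v]] show ?thesis by linarith
    qed
    then have "\<alpha>0 * xx\<^sup>2 * s + 4 * c\<^sup>2 * (xx\<^sup>2 / (c + a) * s) \<le> 4 * c\<^sup>2 * w"
      using c \<alpha>0 a s by (intro bellman_real) auto
    then have "ennreal (\<alpha>0 * xx\<^sup>2 * s + 4 * c\<^sup>2 * (xx\<^sup>2 / (c + a) * s)) \<le> ennreal (4 * c\<^sup>2 * w)"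
      by (rule ennreal_leI)
    moreover have "X\<^sup>2 / ennreal (c + a) = ennreal (xx\<^sup>2 / (c + a))"
      using xx c a by (simp add: ennreal_power divide_ennreal del: ennreal_plus)
    moreover have "ennreal \<alpha>0 * X\<^sup>2 * S = ennreal (\<alpha>0 * xx\<^sup>2 * s)"
      using xx s \<alpha>0 by (simp add: ennreal_power ennreal_mult[symmetric])
    moreover have "ennreal (4 * c\<^sup>2) * (ennreal (xx\<^sup>2 / (c + a)) * S)
      = ennreal (4 * c\<^sup>2 * (xx\<^sup>2 / (c + a) * s))"
      using s c a by (simp only: s(1)) (subst ennreal_mult[symmetric]; simp)+
    moreover have "ennreal (4 * c\<^sup>2) * W = ennreal (4 * c\<^sup>2 * w)"
      using real by (simp only: real(2)) (subst ennreal_mult[symmetric]; simp)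
    moreover have "0 \<le> \<alpha>0 * xx\<^sup>2 * s" "0 \<le> 4 * c\<^sup>2 * (xx\<^sup>2 / (c + a) * s)"
      using s c a \<alpha>0 by auto
    ultimately show ?thesis by (simp only: ennreal_plus)
  qed
  let ?T = "\<lambda>y. \<Sum>i\<in>{k+1..N}. \<alpha> i y * (navg i f y)\<^sup>2"
  have T[measurable]: "?T \<in> borel_measurable \<sigma>" by (intro borel_measurable_sum) auto
  have kset: "{k..N} = insert k {k+1..N}" using kN by auto
  define cc where "cc = ennreal \<alpha>0 * X\<^sup>2 + ennreal (4 * c\<^sup>2) * (X\<^sup>2 / ennreal (c + a))"
  have "(\<integral>\<^sup>+y. ((\<Sum>i\<in>{k..N}. \<alpha> i y * (navg i f y)\<^sup>2) +
        ennreal (4 * c\<^sup>2) * ((navg k f y)\<^sup>2 / (ennreal c + navg k (\<lambda>z. \<Sum>i\<in>{k..N}. \<alpha> i z) y))) *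
          indicator (cell k x) y \<partial>\<sigma>)
      = (\<integral>\<^sup>+y. ?T y * indicator (cell k x) y + cc * indicator (cell k x) y \<partial>\<sigma>)"
  proof (rule nn_integral_cong)
    fix y
    show "((\<Sum>i\<in>{k..N}. \<alpha> i y * (navg i f y)\<^sup>2) +
        ennreal (4 * c\<^sup>2) * ((navg k f y)\<^sup>2 / (ennreal c + navg k (\<lambda>z. \<Sum>i\<in>{k..N}. \<alpha> i z) y))) *
          indicator (cell k x) y
       = ?T y * indicator (cell k x) y + cc * indicator (cell k x) y"
    proof (cases "y \<in> cell k x")
      case True
      have 1: "navg k f y = X" "\<alpha> k y = ennreal \<alpha>0"
        using navg_cong[OF kK(1) xs True] \<alpha>[OF kK(1) xs True] \<alpha>0 by (auto simp: X_def)
      have 2: "ennreal c + navg k (\<lambda>z. \<Sum>i\<in>{k..N}. \<alpha> i z) y = ennreal (c + a)"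
        unfolding navg_cong[OF kK(1) xs True] using a c by (simp add: A_def)
      have 3: "(\<Sum>i\<in>{k..N}. \<alpha> i y * (navg i f y)\<^sup>2) = \<alpha> k y * (navg k f y)\<^sup>2 + ?T y"
        unfolding kset by simp
      show ?thesis unfolding 2 3 1 cc_def using True by (simp add: ac_simps)
    qed simp
  qed
  also have "\<dots> = (\<integral>\<^sup>+y. ?T y * indicator (cell k x) y \<partial>\<sigma>) + cc * S"
    by (subst nn_integral_add) (auto simp: nn_integral_cmult_indicator S_def)
  also have "\<dots> \<le> (\<integral>\<^sup>+y. ?T y * indicator (cell k x) y \<partial>\<sigma>) + ennreal (4 * c\<^sup>2) * W"
    using key by (intro add_left_mono) (simp add: cc_def distrib_right mult.assoc)
  also note ih
  finally show ?case .
qed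

text \<open>The cells of the coarsest generation are summed, and the nonnegative Bellman term is
  dropped.\<close>

lemma carleson_embedding:
  fixes \<alpha> :: "int \<Rightarrow> 'a \<Rightarrow> ennreal" and c :: real and f :: "'a \<Rightarrow> ennreal"
  assumes m: "m \<in> K" and c: "0 < c" and f[measurable]: "f \<in> borel_measurable \<sigma>"
    and \<alpha>: "\<And>k x y. k \<in> K \<Longrightarrow> x \<in> space \<sigma> \<Longrightarrow> y \<in> cell k x \<Longrightarrow> \<alpha> k y = \<alpha> k x"
    and carl: "\<And>k x. m \<le> k \<Longrightarrow> x \<in> space \<sigma> \<Longrightarrow>
       (\<integral>\<^sup>+y. (\<Sum>i\<in>{k..N}. \<alpha> i y) * indicator (cell k x) y \<partial>\<sigma>) \<le> ennreal c * emeasure \<sigma> (cell k x)"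
    and mN: "m \<le> N"
  shows "(\<Sum>i\<in>{m..N}. \<integral>\<^sup>+y. \<alpha> i y * (navg i f y)\<^sup>2 \<partial>\<sigma>) \<le> ennreal (4 * c) * (\<integral>\<^sup>+y. (f y)\<^sup>2 \<partial>\<sigma>)"
proof -
  have \<alpha>m[measurable]: "\<alpha> i \<in> borel_measurable \<sigma>" if "m \<le> i" for i
    using K_up[OF m that] by (intro measurable_cellwise[of i]) (auto simp: \<alpha>)
  have nm[measurable]: "navg i f \<in> borel_measurable \<sigma>" if "m \<le> i" for i
    using K_up[OF m that] by simp
  let ?T = "\<lambda>y. \<Sum>i\<in>{m..N}. \<alpha> i y * (navg i f y)\<^sup>2"
  have T[measurable]: "?T \<in> borel_measurable \<sigma>" by (intro borel_measurable_sum) auto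
  have "(\<Sum>i\<in>{m..N}. \<integral>\<^sup>+y. \<alpha> i y * (navg i f y)\<^sup>2 \<partial>\<sigma>) = (\<integral>\<^sup>+y. ?T y \<partial>\<sigma>)"
    by (rule nn_integral_sum[symmetric]) auto
  also have "\<dots> = (\<integral>\<^sup>+y. ?T y * indicator (space \<sigma>) y \<partial>\<sigma>)"
    by (simp only: nn_integral_space_indicator)
  also have "\<dots> \<le> (\<integral>\<^sup>+y. (ennreal (4 * c) * (f y)\<^sup>2) * indicator (space \<sigma>) y \<partial>\<sigma>)"
  proof (rule nn_integral_cells_mono[OF m saturated_space[OF m]])
    fix x assume x: "x \<in> space \<sigma>"
    have [measurable]: "cell m x \<in> sets \<sigma>" using cell_sets[OF m x] .
    have "(\<integral>\<^sup>+y. ?T y * indicator (cell m x) y \<partial>\<sigma>) \<le> (\<integral>\<^sup>+y. (?T y +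
        ennreal (4 * c\<^sup>2) * ((navg m f y)\<^sup>2 / (ennreal c + navg m (\<lambda>z. \<Sum>i\<in>{m..N}. \<alpha> i z) y))) *
          indicator (cell m x) y \<partial>\<sigma>)"
      by (intro nn_integral_mono mult_right_mono) auto
    also have "\<dots> \<le> ennreal (4 * c) * (\<integral>\<^sup>+y. (f y)\<^sup>2 * indicator (cell m x) y \<partial>\<sigma>)"
      using mN by (intro carleson_embedding_aux[OF m c f \<alpha> carl]) (auto simp: x)
    also have "\<dots> = (\<integral>\<^sup>+y. (ennreal (4 * c) * (f y)\<^sup>2) * indicator (cell m x) y \<partial>\<sigma>)"
      by (simp add: nn_integral_cmult[symmetric] mult.assoc)
    finally show "(\<integral>\<^sup>+y. ?T y * indicator (cell m x) y \<partial>\<sigma>) \<le>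
       (\<integral>\<^sup>+y. (ennreal (4 * c) * (f y)\<^sup>2) * indicator (cell m x) y \<partial>\<sigma>)" .
  qed measurable
  also have "\<dots> = ennreal (4 * c) * (\<integral>\<^sup>+y. (f y)\<^sup>2 \<partial>\<sigma>)"
    unfolding nn_integral_space_indicator by (rule nn_integral_cmult) auto
  finally show ?thesis .
qed

section \<open>Conditional expectations of complex functions\<close>

definition avg :: "int \<Rightarrow> ('a \<Rightarrow> complex) \<Rightarrow> 'a \<Rightarrow> complex" where
  "avg k f x = (LINT y:cell k x|\<sigma>. f y) / complex_of_real (measure \<sigma> (cell k x))"

definition locint :: "('a \<Rightarrow> complex) \<Rightarrow> bool" where
  "locint f \<longleftrightarrow> f \<in> borel_measurable \<sigma> \<and>
     (\<forall>k\<in>K. \<forall>x\<in>space \<sigma>. (\<integral>\<^sup>+y. ennreal (norm (f y)) * indicator (cell k x) y \<partial>\<sigma>) < \<infinity>)"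

lemma set_integrableI_nn:
  fixes f :: "'a \<Rightarrow> complex"
  assumes [measurable]: "f \<in> borel_measurable \<sigma>" "A \<in> sets \<sigma>"
    and "(\<integral>\<^sup>+y. ennreal (norm (f y)) * indicator A y \<partial>\<sigma>) < \<infinity>"
  shows "set_integrable \<sigma> A f"
  unfolding set_integrable_def
proof (rule integrableI_bounded)
  have "(\<integral>\<^sup>+y. ennreal (norm (indicat_real A y *\<^sub>R f y)) \<partial>\<sigma>)
    = (\<integral>\<^sup>+y. ennreal (norm (f y)) * indicator A y \<partial>\<sigma>)"
    by (intro nn_integral_cong) (auto split: split_indicator)
  then show "(\<integral>\<^sup>+y. ennreal (norm (indicat_real A y *\<^sub>R f y)) \<partial>\<sigma>) < \<infinity>" using assms(3) by simp
qed measurable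

lemma locint_set_integrable:
  "locint f \<Longrightarrow> k \<in> K \<Longrightarrow> x \<in> space \<sigma> \<Longrightarrow> set_integrable \<sigma> (cell k x) f"
  by (rule set_integrableI_nn) (auto simp: locint_def)

lemma avg_cong: "k \<in> K \<Longrightarrow> x \<in> space \<sigma> \<Longrightarrow> y \<in> cell k x \<Longrightarrow> avg k f y = avg k f x"
  by (simp add: avg_def cell_cong)

lemma avg_measurable [measurable]: "k \<in> K \<Longrightarrow> avg k f \<in> borel_measurable \<sigma>"
  by (rule measurable_cellwise) (auto simp: avg_cong)

lemma norm_set_integral_le:
  fixes f :: "'a \<Rightarrow> complex"
  assumes "set_integrable \<sigma> A f"
  shows "ennreal (norm (LINT y:A|\<sigma>. f y)) \<le> (\<integral>\<^sup>+y. ennreal (norm (f y)) * indicator A y \<partial>\<sigma>)"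
proof -
  have "ennreal (norm (LINT y:A|\<sigma>. f y)) \<le> (\<integral>\<^sup>+y. ennreal (norm (indicat_real A y *\<^sub>R f y)) \<partial>\<sigma>)"
    using assms unfolding set_lebesgue_integral_def set_integrable_def
      by (rule integral_norm_bound_ennreal)
  also have "\<dots> = (\<integral>\<^sup>+y. ennreal (norm (f y)) * indicator A y \<partial>\<sigma>)"
    by (intro nn_integral_cong) (auto split: split_indicator)
  finally show ?thesis .
qed

lemma emeasure_cell: "k \<in> K \<Longrightarrow> x \<in> space \<sigma> \<Longrightarrow> emeasure \<sigma> (cell k x) = ennreal (measure \<sigma> (cell k x))"
  using cell_fin by (simp add: emeasure_eq_ennreal_measure)

lemma norm_avg_le:
  assumes f: "locint f" and k: "k \<in> K" "x \<in> space \<sigma>"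
  shows "ennreal (norm (avg k f x)) \<le> navg k (\<lambda>y. ennreal (norm (f y))) x"
proof -
  have "ennreal (norm (avg k f x))
    = ennreal (norm (LINT y:cell k x|\<sigma>. f y)) / emeasure \<sigma> (cell k x)"
    using cell_mpos[OF k] by (simp add: avg_def norm_divide emeasure_cell[OF k] divide_ennreal)
  also have "\<dots> \<le> navg k (\<lambda>y. ennreal (norm (f y))) x"
    unfolding navg_def by (intro divide_right_mono_ennreal norm_set_integral_le
      locint_set_integrable f k)
  finally show ?thesis .
qed

lemma nn_integral_norm_avg_le:
  assumes f: "locint f" and k: "k \<in> K" and A: "saturated k A"
  shows "(\<integral>\<^sup>+y. ennreal (norm (avg k f y)) * indicator A y \<partial>\<sigma>)
    \<le> (\<integral>\<^sup>+y. ennreal (norm (f y)) * indicator A y \<partial>\<sigma>)"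
proof -
  have "(\<integral>\<^sup>+y. ennreal (norm (avg k f y)) * indicator A y \<partial>\<sigma>)
    \<le> (\<integral>\<^sup>+y. navg k (\<lambda>y. ennreal (norm (f y))) y * indicator A y \<partial>\<sigma>)"
    using A by (intro nn_integral_mono) (auto split: split_indicator intro!: norm_avg_le f k simp:
      saturated_def)
  also have "\<dots> = (\<integral>\<^sup>+y. ennreal (norm (f y)) * indicator A y \<partial>\<sigma>)"
    by (rule nn_integral_navg[OF k A]) (use f in \<open>auto simp: locint_def\<close>)
  finally show ?thesis .
qed

lemma avg_const:
  assumes k: "k \<in> K" "x \<in> space \<sigma>" and c: "\<And>y. y \<in> cell k x \<Longrightarrow> F y = c"
  shows "avg k F x = c"
proof -
  have "(LINT y:cell k x|\<sigma>. F y) = (LINT y:cell k x|\<sigma>. c)"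
    by (intro set_lebesgue_integral_cong) (use c k in auto)
  also have "\<dots> = of_real (measure \<sigma> (cell k x)) * c"
    using cell_fin[OF k] k by (subst set_integral_const) (auto simp: scaleR_conv_of_real)
  finally show ?thesis using cell_mpos[OF k] by (simp add: avg_def)
qed

text \<open>On cells at least as large averaging contracts the L^1 norm; on smaller cells the
  average is constant.\<close>

lemma locint_avg:
  assumes f: "locint f" and k: "k \<in> K"
  shows "locint (avg k f)"
  unfolding locint_def
proof (intro conjI ballI)
  fix j x assume j: "j \<in> K" and x: "x \<in> space \<sigma>"
  show "(\<integral>\<^sup>+y. ennreal (norm (avg k f y)) * indicator (cell j x) y \<partial>\<sigma>) < \<infinity>"
  proof (cases "j \<le> k")
    case True
    have "(\<integral>\<^sup>+y. ennreal (norm (avg k f y)) * indicator (cell j x) y \<partial>\<sigma>)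
      \<le> (\<integral>\<^sup>+y. ennreal (norm (f y)) * indicator (cell j x) y \<partial>\<sigma>)"
      by (rule nn_integral_norm_avg_le[OF f k saturated_cell[OF j True x]])
    also have "\<dots> < \<infinity>" using f j x by (simp add: locint_def)
    finally show ?thesis .
  next
    case False
    then have "avg k f y = avg k f x" if "y \<in> cell j x" for y
      using avg_cong[OF k x] cell_mono[OF k _ x, of j] that by auto
    then have "(\<integral>\<^sup>+y. ennreal (norm (avg k f y)) * indicator (cell j x) y \<partial>\<sigma>)
      = ennreal (norm (avg k f x)) * emeasure \<sigma> (cell j x)"
      by (intro nn_integral_const_cell[OF j x]) simp
    also have "\<dots> < \<infinity>" using cell_fin[OF j x] by (simp add: ennreal_mult_less_top less_top)
    finally show ?thesis .
  qed
qed (use k in measurable)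

lemma locint_le:
  assumes f: "f \<in> borel_measurable \<sigma>" and g: "locint g" and h: "locint h"
    and le: "\<And>x. x \<in> space \<sigma> \<Longrightarrow> norm (f x) \<le> norm (g x) + norm (h x)"
  shows "locint f"
  unfolding locint_def
proof (intro conjI ballI f)
  fix j x assume j: "j \<in> K" and x: "x \<in> space \<sigma>"
  have [measurable]: "cell j x \<in> sets \<sigma>" "g \<in> borel_measurable \<sigma>" "h \<in> borel_measurable \<sigma>"
    using cell_sets[OF j x] g h by (auto simp: locint_def)
  have "(\<integral>\<^sup>+y. ennreal (norm (f y)) * indicator (cell j x) y \<partial>\<sigma>) \<le>
     (\<integral>\<^sup>+y. ennreal (norm (g y)) * indicator (cell j x) y + ennreal (norm (h y)) * indicator
       (cell j x) y \<partial>\<sigma>)"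
    by (intro nn_integral_mono) (use le in \<open>auto split: split_indicator simp:
      ennreal_plus[symmetric] simp del: ennreal_plus intro!: ennreal_leI\<close>)
  also have "\<dots> = (\<integral>\<^sup>+y. ennreal (norm (g y)) * indicator (cell j x) y \<partial>\<sigma>)
    + (\<integral>\<^sup>+y. ennreal (norm (h y)) * indicator (cell j x) y \<partial>\<sigma>)"
    by (intro nn_integral_add) auto
  also have "\<dots> < \<infinity>" using g h j x by (simp add: locint_def)
  finally show "(\<integral>\<^sup>+y. ennreal (norm (f y)) * indicator (cell j x) y \<partial>\<sigma>) < \<infinity>" .
qed

lemma locint_diff: "locint f \<Longrightarrow> locint g \<Longrightarrow> locint (\<lambda>x. f x - g x)"
  by (rule locint_le[of _ f g]) (auto simp: locint_def norm_triangle_ineq4)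

lemma locint_add: "locint f \<Longrightarrow> locint g \<Longrightarrow> locint (\<lambda>x. f x + g x)"
  by (rule locint_le[of _ f g]) (auto simp: locint_def norm_triangle_ineq)

lemma locint_const: "locint (\<lambda>x. c)"
  unfolding locint_def
  using cell_fin by (auto simp: nn_integral_cmult_indicator ennreal_mult_less_top less_top)

lemma locint_of_bound:
  assumes f[measurable]: "f \<in> borel_measurable \<sigma>" and h[measurable]: "h \<in> borel_measurable \<sigma>"
    and fin: "(\<integral>\<^sup>+x. h x \<partial>\<sigma>) < \<infinity>" and le: "\<And>x. x \<in> space \<sigma> \<Longrightarrow> ennreal (norm (f x)) \<le> 1 + h x"
  shows "locint f"
  unfolding locint_def
proof (intro conjI ballI f)
  fix j x assume j: "j \<in> K" and x: "x \<in> space \<sigma>"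
  have [measurable]: "cell j x \<in> sets \<sigma>" using cell_sets[OF j x] .
  have "(\<integral>\<^sup>+y. ennreal (norm (f y)) * indicator (cell j x) y \<partial>\<sigma>)
    \<le> (\<integral>\<^sup>+y. indicator (cell j x) y + h y \<partial>\<sigma>)"
    using le by (intro nn_integral_mono) (auto split: split_indicator)
  also have "\<dots> = emeasure \<sigma> (cell j x) + (\<integral>\<^sup>+y. h y \<partial>\<sigma>)"
    by (subst nn_integral_add) auto
  also have "\<dots> < \<infinity>" using fin cell_fin[OF j x] by (simp add: less_top)
  finally show "(\<integral>\<^sup>+y. ennreal (norm (f y)) * indicator (cell j x) y \<partial>\<sigma>) < \<infinity>" .
qed

lemma set_integral_cells_zero:
  fixes u :: "'a \<Rightarrow> complex"
  assumes k: "k \<in> K" and A: "saturated k A" and u: "set_integrable \<sigma> A u"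
    and z: "\<And>x. x \<in> A \<Longrightarrow> (LINT y:cell k x|\<sigma>. u y) = 0"
  shows "(LINT y:A|\<sigma>. u y) = 0"
  unfolding set_lebesgue_integral_def
proof (rule integral_cells_zero[OF k])
  show "integrable \<sigma> (\<lambda>y. indicat_real A y *\<^sub>R u y)" using u by (simp add: set_integrable_def)
  fix x assume x: "x \<in> space \<sigma>"
  show "(LINT y:cell k x|\<sigma>. indicat_real A y *\<^sub>R u y) = 0"
  proof (cases "x \<in> A")
    case True
    then have "cell k x \<subseteq> A" using A by (auto simp: saturated_def)
    then have "(LINT y:cell k x|\<sigma>. indicat_real A y *\<^sub>R u y) = (LINT y:cell k x|\<sigma>. u y)"
      unfolding set_lebesgue_integral_def
        by (intro Bochner_Integration.integral_cong) (auto split: split_indicator)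
    then show ?thesis using z[OF True] by simp
  next
    case False
    then have "y \<notin> A" if "y \<in> cell k x" for y using saturated_iff[OF k A x that] by simp
    then have "(LINT y:cell k x|\<sigma>. indicat_real A y *\<^sub>R u y) = (LINT y:cell k x|\<sigma>. 0)"
      unfolding set_lebesgue_integral_def
        by (intro Bochner_Integration.integral_cong) (auto split: split_indicator)
    then show ?thesis by (simp add: set_lebesgue_integral_def)
  qed
qed

lemma set_integral_cell:
  "k \<in> K \<Longrightarrow> x \<in> space \<sigma> \<Longrightarrow> (LINT y:cell k x|\<sigma>. f y) = avg k f x * measure \<sigma> (cell k x)"
  using cell_mpos[of k x] by (simp add: avg_def)

lemma avg_diff:
  assumes "locint f" "locint g" "k \<in> K" "x \<in> space \<sigma>"
  shows "avg k (\<lambda>y. f y - g y) x = avg k f x - avg k g x"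
  unfolding avg_def
  by (subst set_integral_diff) (auto intro!: locint_set_integrable assms simp: diff_divide_distrib)

lemma avg_add:
  assumes "locint f" "locint g" "k \<in> K" "x \<in> space \<sigma>"
  shows "avg k (\<lambda>y. f y + g y) x = avg k f x + avg k g x"
  unfolding avg_def
  by (subst set_integral_add) (auto intro!: locint_set_integrable assms simp: add_divide_distrib)

lemma avg_self:
  assumes "k \<in> K" "x \<in> space \<sigma>"
  shows "avg k (avg k f) x = avg k f x"
  by (rule avg_const) (auto intro: avg_cong assms)

lemma avg_zero_iff:
  assumes "k \<in> K" "x \<in> space \<sigma>"
  shows "(LINT y:cell k x|\<sigma>. u y) = 0 \<longleftrightarrow> avg k u x = 0"
  using cell_mpos[OF assms] by (simp add: avg_def)

lemma avg_cells_zero: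
  assumes f: "locint u" and j: "j \<in> K" "j \<le> k" and x: "x \<in> space \<sigma>"
    and z: "\<And>y. y \<in> cell j x \<Longrightarrow> avg k u y = 0"
  shows "avg j u x = 0"
proof -
  have k: "k \<in> K" using K_up j by blast
  have "(LINT y:cell j x|\<sigma>. u y) = 0"
  proof (rule set_integral_cells_zero[OF k saturated_cell[OF j x] locint_set_integrable[OF f j(1)
    x]])
    fix y assume "y \<in> cell j x"
    then show "(LINT y:cell k y|\<sigma>. u y) = 0"
      using avg_zero_iff[OF k, of y] z cell_subset[OF j(1) x] by auto
  qed
  then show ?thesis using avg_zero_iff[OF j(1) x] by simp
qed

text \<open>The tower property: \<open>f - avg k f\<close> has mean zero on the cells of generation
  k, hence on every coarser cell.\<close>

lemma avg_avg:
  assumes f: "locint f" and j: "j \<in> K" "j \<le> k" and x: "x \<in> space \<sigma>"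
  shows "avg j (avg k f) x = avg j f x"
proof -
  have k: "k \<in> K" using K_up j by blast
  have "avg j (\<lambda>y. f y - avg k f y) x = 0"
  proof (rule avg_cells_zero[OF locint_diff[OF f locint_avg[OF f k]] j x])
    fix y assume "y \<in> cell j x"
    then have "y \<in> space \<sigma>" using cell_subset[OF j(1) x] by auto
    then show "avg k (\<lambda>y. f y - avg k f y) y = 0"
      by (simp add: avg_diff[OF f locint_avg[OF f k] k] avg_self[OF k])
  qed
  then show ?thesis by (simp add: avg_diff[OF f locint_avg[OF f k] j(1) x])
qed

abbreviation sq :: "('a \<Rightarrow> complex) \<Rightarrow> 'a \<Rightarrow> ennreal" where
  "sq f x \<equiv> ennreal ((norm (f x))\<^sup>2)"

text \<open>The cross term vanishes on every cell. The inequality is all that is needed, and in this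
  form a cell on which \<open>f\<close> is not square integrable is trivial.\<close>

lemma pythagoras:
  assumes f: "locint f" and k: "k \<in> K"
  shows "(\<integral>\<^sup>+x. sq (\<lambda>x. f x - avg k f x) x \<partial>\<sigma>) + (\<integral>\<^sup>+x. sq (avg k f) x \<partial>\<sigma>) \<le> (\<integral>\<^sup>+x. sq f x \<partial>\<sigma>)"
proof -
  have [measurable]: "f \<in> borel_measurable \<sigma>" "avg k f \<in> borel_measurable \<sigma>"
    using f k by (auto simp: locint_def)
  have "(\<integral>\<^sup>+x. (sq (\<lambda>x. f x - avg k f x) x + sq (avg k f) x) * indicator (space \<sigma>) x \<partial>\<sigma>)
      \<le> (\<integral>\<^sup>+x. sq f x * indicator (space \<sigma>) x \<partial>\<sigma>)"
  proof (rule nn_integral_cells_mono[OF k saturated_space[OF k]])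
    fix x assume x: "x \<in> space \<sigma>"
    define c where "c = avg k f x"
    let ?Q = "cell k x" and ?i = "\<lambda>y. indicat_real (cell k x) y"
    have [measurable]: "?Q \<in> sets \<sigma>" using cell_sets[OF k x] .
    show "(\<integral>\<^sup>+y. (sq (\<lambda>x. f x - avg k f x) y + sq (avg k f) y) * indicator ?Q y \<partial>\<sigma>)
      \<le> (\<integral>\<^sup>+y. sq f y * indicator ?Q y \<partial>\<sigma>)"
    proof (cases "(\<integral>\<^sup>+y. sq f y * indicator ?Q y \<partial>\<sigma>) < \<infinity>")
      case False
      then show ?thesis by (simp add: top_unique not_less)
    next
      case True
      have i1: "integrable \<sigma> (\<lambda>y. ?i y * (norm (f y))\<^sup>2)"
      proof (rule integrableI_bounded)
        have "(\<integral>\<^sup>+y. ennreal (norm (?i y * (norm (f y))\<^sup>2)) \<partial>\<sigma>)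
          = (\<integral>\<^sup>+y. sq f y * indicator ?Q y \<partial>\<sigma>)"
          by (intro nn_integral_cong) (auto split: split_indicator)
        then show "(\<integral>\<^sup>+y. ennreal (norm (?i y * (norm (f y))\<^sup>2)) \<partial>\<sigma>) < \<infinity>" using True by simp
      qed measurable
      have i2: "set_integrable \<sigma> ?Q (\<lambda>y. f y - c)"
        by (intro locint_set_integrable locint_diff f locint_const k x)
      have "avg k (\<lambda>y. f y - c) x = 0"
        using avg_diff[OF f locint_const k x, of c] avg_const[OF k x, of "\<lambda>_. c" c]
          by (simp add: c_def)
      then have z: "(LINT y:?Q|\<sigma>. f y - c) = 0" using avg_zero_iff[OF k x] by blast
      \<comment> \<open>Its real part is the cross term in |f|^2 = |f - c|^2 + |c|^2 + 2 Re (cnj c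
        (f - c)).\<close>
      define v where "v y = cnj c * (?i y *\<^sub>R (f y - c))" for y
      have i3: "integrable \<sigma> v" unfolding v_def
        by (intro integrable_mult_right) (use i2 in \<open>simp add: set_integrable_def\<close>)
      have "integral\<^sup>L \<sigma> v = cnj c * (LINT y:?Q|\<sigma>. f y - c)"
        unfolding v_def set_lebesgue_integral_def by (intro integral_mult_right_zero)
      then have z3: "(\<integral>y. Re (v y) \<partial>\<sigma>) = 0" using z i3 by simp
      have eq: "?i y * ((norm (f y - c))\<^sup>2 + (norm c)\<^sup>2) = ?i y * (norm (f y))\<^sup>2 - 2 * Re (v y)"
        for y
        unfolding v_def cmod_power2
        by (cases "y \<in> ?Q") (auto simp: power2_eq_square algebra_simps)
      have i4: "integrable \<sigma> (\<lambda>y. ?i y * ((norm (f y - c))\<^sup>2 + (norm c)\<^sup>2))"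
        unfolding eq using i1 i3 by (intro Bochner_Integration.integrable_diff
          integrable_mult_right) auto
      have "(\<integral>\<^sup>+y. (sq (\<lambda>x. f x - avg k f x) y + sq (avg k f) y) * indicator ?Q y \<partial>\<sigma>)
        = (\<integral>\<^sup>+y. ennreal (?i y * ((norm (f y - c))\<^sup>2 + (norm c)\<^sup>2)) \<partial>\<sigma>)"
        using avg_cong[OF k x] by (intro nn_integral_cong) (auto split: split_indicator simp: c_def)
      also have "\<dots> = ennreal (\<integral>y. ?i y * ((norm (f y - c))\<^sup>2 + (norm c)\<^sup>2) \<partial>\<sigma>)"
        by (rule nn_integral_eq_integral[OF i4]) auto
      also have "(\<integral>y. ?i y * ((norm (f y - c))\<^sup>2 + (norm c)\<^sup>2) \<partial>\<sigma>) = (\<integral>y. ?i y * (norm (f y))\<^sup>2 \<partial>\<sigma>)"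
        unfolding eq using i1 i3 z3 by (subst Bochner_Integration.integral_diff) auto
      also have "ennreal \<dots> = (\<integral>\<^sup>+y. ennreal (?i y * (norm (f y))\<^sup>2) \<partial>\<sigma>)"
        by (rule nn_integral_eq_integral[OF i1, symmetric]) auto
      also have "\<dots> = (\<integral>\<^sup>+y. sq f y * indicator ?Q y \<partial>\<sigma>)"
        by (intro nn_integral_cong) (auto split: split_indicator)
      finally show ?thesis by simp
    qed
  qed measurable
  then have "(\<integral>\<^sup>+x. sq (\<lambda>x. f x - avg k f x) x + sq (avg k f) x \<partial>\<sigma>) \<le> (\<integral>\<^sup>+x. sq f x \<partial>\<sigma>)"
    unfolding nn_integral_space_indicator .
  then show ?thesis by (subst (asm) nn_integral_add) auto
qed

text \<open>A martingale expansion with two end terms: i = m carries everything coarse and i = N + 1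
  everything fine. The finite sum is therefore exactly \<open>f\<close>, with no convergence to
  discuss.\<close>

definition piece :: "int \<Rightarrow> int \<Rightarrow> ('a \<Rightarrow> complex) \<Rightarrow> int \<Rightarrow> 'a \<Rightarrow> complex" where
  "piece m N f i x =
     (if i = m then avg m f x else if i \<le> N then avg i f x - avg (i - 1) f x else f x - avg N f x)"

lemma atLeastAtMost_int_last: "m \<le> N + 1 \<Longrightarrow> {m..N + 1} = insert (N + 1) {m..N::int}"
  by auto

lemma sum_piece_avg:
  assumes "m \<le> k" "k \<le> N"
  shows "(\<Sum>i\<in>{m..k}. piece m N f i x) = avg k f x"
  using assms
proof (induction k rule: int_ge_induct)
  case base
  then show ?case by (simp add: piece_def)
next
  case (step i)
  then show ?case by (simp add: atLeastAtMost_int_last piece_def)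
qed

lemma sum_piece:
  assumes "m \<le> N"
  shows "(\<Sum>i\<in>{m..N+1}. piece m N f i x) = f x"
  using assms sum_piece_avg[of m N N f x] by (simp add: atLeastAtMost_int_last piece_def)

text \<open>Bessel's inequality: \<open>pythagoras\<close> is applied repeatedly to
  \<open>avg (i+1) f\<close> at generation i, and at last to \<open>f\<close> at generation
  N.\<close>

lemma sum_norm_piece:
  assumes f: "locint f" and m: "m \<in> K" "m \<le> N"
  shows "(\<Sum>i\<in>{m..N+1}. \<integral>\<^sup>+x. sq (piece m N f i) x \<partial>\<sigma>) \<le> (\<integral>\<^sup>+x. sq f x \<partial>\<sigma>)"
proof -
  have "(\<Sum>i\<in>{m..k}. \<integral>\<^sup>+x. sq (piece m N f i) x \<partial>\<sigma>) \<le> (\<integral>\<^sup>+x. sq (avg k f) x \<partial>\<sigma>)" if "m \<le> k" "k \<le> N"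
    for k
    using that
  proof (induction k rule: int_ge_induct)
    case base
    then show ?case by (simp add: piece_def)
  next
    case (step i)
    have K: "i \<in> K" "i + 1 \<in> K" using K_up m step by auto
    have "(\<Sum>j\<in>{m..i+1}. \<integral>\<^sup>+x. sq (piece m N f j) x \<partial>\<sigma>)
       = (\<integral>\<^sup>+x. sq (\<lambda>x. avg (i+1) f x - avg i f x) x \<partial>\<sigma>) + (\<Sum>j\<in>{m..i}. \<integral>\<^sup>+x. sq (piece m N f j) x
         \<partial>\<sigma>)"
      using step by (simp add: atLeastAtMost_int_last piece_def)
    also have "\<dots> \<le> (\<integral>\<^sup>+x. sq (\<lambda>x. avg (i+1) f x - avg i f x) x \<partial>\<sigma>) + (\<integral>\<^sup>+x. sq (avg i f) x \<partial>\<sigma>)"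
      using step by (intro add_left_mono) simp
    also have "\<dots> = (\<integral>\<^sup>+x. sq (\<lambda>x. avg (i+1) f x - avg i (avg (i+1) f) x) x \<partial>\<sigma>)
      + (\<integral>\<^sup>+x. sq (avg i (avg (i+1) f)) x \<partial>\<sigma>)"
      using avg_avg[OF f K(1)] by (intro arg_cong2[of _ _ _ _ "(+)"] nn_integral_cong) auto
    also have "\<dots> \<le> (\<integral>\<^sup>+x. sq (avg (i+1) f) x \<partial>\<sigma>)"
      by (rule pythagoras[OF locint_avg[OF f K(2)] K(1)])
    finally show ?case .
  qed
  from this[of N] have le: "(\<Sum>i\<in>{m..N}. \<integral>\<^sup>+x. sq (piece m N f i) x \<partial>\<sigma>) \<le> (\<integral>\<^sup>+x. sq (avg N f) x \<partial>\<sigma>)"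
    using m by simp
  have NK: "N \<in> K" using K_up m by auto
  have "(\<Sum>i\<in>{m..N+1}. \<integral>\<^sup>+x. sq (piece m N f i) x \<partial>\<sigma>)
     = (\<integral>\<^sup>+x. sq (\<lambda>x. f x - avg N f x) x \<partial>\<sigma>) + (\<Sum>j\<in>{m..N}. \<integral>\<^sup>+x. sq (piece m N f j) x \<partial>\<sigma>)"
    using m by (simp add: atLeastAtMost_int_last piece_def)
  also have "\<dots> \<le> (\<integral>\<^sup>+x. sq (\<lambda>x. f x - avg N f x) x \<partial>\<sigma>) + (\<integral>\<^sup>+x. sq (avg N f) x \<partial>\<sigma>)"
    using le by (rule add_left_mono)
  also have "\<dots> \<le> (\<integral>\<^sup>+x. sq f x \<partial>\<sigma>)" by (rule pythagoras[OF f NK])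
  finally show ?thesis .
qed

lemma piece_const:
  assumes "m \<in> K" "m \<le> i" "i \<le> N" "x \<in> space \<sigma>" "y \<in> cell i x"
  shows "piece m N f i y = piece m N f i x"
proof -
  have K: "i \<in> K" using K_up assms by blast
  show ?thesis
  proof (cases "i = m")
    case False
    then have "i - 1 \<in> K" using K_up[OF assms(1)] assms by simp
    moreover have "y \<in> cell (i - 1) x" using cell_mono[OF \<open>i - 1 \<in> K\<close>, of i x] assms by auto
    ultimately show ?thesis using False assms K by (simp add: piece_def avg_cong)
  qed (use assms in \<open>simp add: piece_def avg_cong\<close>)
qed

lemma locint_piece:
  assumes f: "locint f" and m: "m \<in> K" "m \<le> N" "m \<le> i"
  shows "locint (piece m N f i)"
proof -
  have "i = m \<or> i - 1 \<in> K \<and> i \<in> K"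
    using K_up[OF m(1), of "i - 1"] K_up[OF m(1), of i] m(3) by (cases "m < i") auto
  moreover have "N \<in> K" by (rule K_up[OF m(1,2)])
  ultimately show ?thesis
    unfolding piece_def using m(1) f
    by (cases "i = m"; cases "i \<le> N") (auto intro!: locint_diff locint_avg)
qed

lemma avg_piece_zero:
  assumes f: "locint f" and m: "m \<in> K" "m \<le> N" "m < i" "i \<le> N + 1" and x: "x \<in> space \<sigma>"
  shows "avg (i - 1) (piece m N f i) x = 0"
proof (cases "i \<le> N")
  case True
  have K: "i - 1 \<in> K" "i \<in> K" using K_up[OF m(1)] m by auto
  have "piece m N f i = (\<lambda>y. avg i f y - avg (i - 1) f y)" using True m by (auto simp: piece_def)
  then show ?thesis
    using avg_diff[OF locint_avg[OF f K(2)] locint_avg[OF f K(1)] K(1) x] avg_avg[OF f K(1) _ x, of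
      i]
      avg_self[OF K(1) x] by simp
next
  case False
  then have i: "i = N + 1" using m by simp
  have K: "N \<in> K" using K_up[OF m(1)] m by auto
  have "piece m N f i = (\<lambda>y. f y - avg N f y)" using i m by (auto simp: piece_def)
  then show ?thesis
    using avg_diff[OF f locint_avg[OF f K] K x] avg_self[OF K x] i by simp
qed

end

section \<open>Quasi-orthogonality\<close>

text \<open>On either side of k the exponents are distinct, so each half is part of one geometric
  series.\<close>

lemma sum_power_abs_diff_le:
  fixes s :: real and k :: int
  assumes s: "0 < s" "s < 1" and "finite I"
  shows "(\<Sum>i\<in>I. s ^ nat \<bar>i - k\<bar>) \<le> 2 / (1 - s)"
proof -
  have geo: "(\<Sum>i\<in>J. s ^ g i) \<le> 1 / (1 - s)" if "finite J" "inj_on g J" for J and g :: "int \<Rightarrow> nat"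
  proof -
    have "(\<Sum>i\<in>J. s ^ g i) = (\<Sum>n\<in>g ` J. s ^ n)" using that by (simp add: sum.reindex)
    also have "\<dots> \<le> (\<Sum>n. s ^ n)"
      using that s by (intro sum_le_suminf summable_geometric) auto
    also have "\<dots> = 1 / (1 - s)" using s by (intro suminf_geometric) auto
    finally show ?thesis .
  qed
  let ?g = "\<lambda>i. nat \<bar>i - k\<bar>"
  have "I = {i\<in>I. i \<le> k} \<union> {i\<in>I. k < i}" by auto
  then have "(\<Sum>i\<in>I. s ^ ?g i) = (\<Sum>i\<in>{i\<in>I. i \<le> k} \<union> {i\<in>I. k < i}. s ^ ?g i)" by (rule arg_cong)
  also have "\<dots> = (\<Sum>i\<in>{i\<in>I. i \<le> k}. s ^ ?g i) + (\<Sum>i\<in>{i\<in>I. k < i}. s ^ ?g i)"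
    using assms by (intro sum.union_disjoint) auto
  also have "\<dots> \<le> 1 / (1 - s) + 1 / (1 - s)"
    using assms by (intro add_mono geo) (auto simp: inj_on_def)
  finally show ?thesis by simp
qed

text \<open>Cauchy-Schwarz for counting measure, with \<open>r i\<close> written as sqrt (w i) times
  r i / sqrt (w i).\<close>

lemma weighted_Cauchy_Schwarz_sum:
  fixes r :: "'i \<Rightarrow> ennreal" and w :: "'i \<Rightarrow> real"
  assumes "finite I" and w: "\<And>i. i \<in> I \<Longrightarrow> 0 < w i"
  shows "(\<Sum>i\<in>I. r i)\<^sup>2 \<le> (\<Sum>i\<in>I. ennreal (w i)) * (\<Sum>i\<in>I. ennreal (1 / w i) * (r i)\<^sup>2)"
proof -
  have "(\<integral>\<^sup>+i. ennreal (sqrt (w i)) * (ennreal (1 / sqrt (w i)) * r i) \<partial>count_space I)\<^sup>2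
     \<le> (\<integral>\<^sup>+i. (ennreal (sqrt (w i)))\<^sup>2 \<partial>count_space I) * (\<integral>\<^sup>+i. (ennreal (1 / sqrt (w i)) * r i)\<^sup>2
       \<partial>count_space I)"
    by (rule Cauchy_Schwarz_nn_integral) auto
  also have "(\<integral>\<^sup>+i. ennreal (sqrt (w i)) * (ennreal (1 / sqrt (w i)) * r i) \<partial>count_space I)
    = (\<Sum>i\<in>I. r i)"
  proof -
    have "ennreal (sqrt (w i)) * (ennreal (1 / sqrt (w i)) * r i) = r i" if "i \<in> I" for i
      using w[OF that] by (simp add: mult.assoc[symmetric] ennreal_mult[symmetric])
    then have "(\<integral>\<^sup>+i. ennreal (sqrt (w i)) * (ennreal (1 / sqrt (w i)) * r i) \<partial>count_space I)
      = (\<integral>\<^sup>+i. r i \<partial>count_space I)"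
      by (intro nn_integral_cong) simp
    then show ?thesis using assms(1) by (simp add: nn_integral_count_space_finite)
  qed
  also have "(\<integral>\<^sup>+i. (ennreal (sqrt (w i)))\<^sup>2 \<partial>count_space I) = (\<Sum>i\<in>I. ennreal (w i))"
    using w assms(1) by (simp add: nn_integral_count_space_finite ennreal_power less_imp_le)
  also have "(\<integral>\<^sup>+i. (ennreal (1 / sqrt (w i)) * r i)\<^sup>2 \<partial>count_space I)
    = (\<Sum>i\<in>I. ennreal (1 / w i) * (r i)\<^sup>2)"
    using w assms(1) by (simp add: nn_integral_count_space_finite power_mult_distrib ennreal_power
      less_imp_le power_divide)
  finally show ?thesis .
qed

lemma square_add_ennreal_le: "(a + b)\<^sup>2 \<le> 2 * a\<^sup>2 + 2 * (b::ennreal)\<^sup>2"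
proof (cases "a = top \<or> b = top")
  case True
  then show ?thesis by (auto simp: power2_eq_square ennreal_mult_top)
next
  case False
  then obtain x y where xy: "a = ennreal x" "0 \<le> x" "b = ennreal y" "0 \<le> y"
    by (cases a; cases b) auto
  have "(x + y)\<^sup>2 \<le> 2 * x\<^sup>2 + 2 * y\<^sup>2" using sum_squares_bound[of x y] by (simp add: power2_sum)
  then have "ennreal ((x + y)\<^sup>2) \<le> ennreal (2 * x\<^sup>2 + 2 * y\<^sup>2)" by (rule ennreal_leI)
  moreover have "ennreal (2 * x\<^sup>2 + 2 * y\<^sup>2) = 2 * a\<^sup>2 + 2 * b\<^sup>2"
    using xy by (simp add: ennreal_power ennreal_mult)
  moreover have "ennreal ((x + y)\<^sup>2) = (a + b)\<^sup>2"
    using xy by (simp add: ennreal_power ennreal_plus[symmetric] del: ennreal_plus)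
  ultimately show ?thesis by simp
qed

text \<open>\<open>P k x\<close> dominates the kernel on the Whitney region \<open>U k Q\<close> of the cell \<open>Q\<close> of \<open>x\<close>, and
  \<open>P_bdry\<close> is what the small boundary property of the grid gives for it. The measure \<open>\<mu>\<close> stands
  for \<open>dY / \<delta>(Y)\<close>.\<close>

locale theta_system = dyadic_system \<sigma> D K for \<sigma> :: "'a measure" and D K +
  fixes P :: "int \<Rightarrow> 'a \<Rightarrow> 'a \<Rightarrow> real" and Cp Cb q :: real
    and U :: "int \<Rightarrow> 'a set \<Rightarrow> 'b set" and \<mu> :: "'b measure" and \<psi> :: "'b \<Rightarrow> 'a \<Rightarrow> complex"
      and Cu :: real
  assumes q: "0 < q" "q < 1" and cpos: "0 < Cp" "0 < Cb" "0 < Cu"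
    and P_nonneg: "\<And>k x y. 0 \<le> P k x y"
    and P_sym: "\<And>k x y. P k x y = P k y x"
    and P_meas: "\<And>k. k \<in> K \<Longrightarrow> (\<lambda>(x, y). P k x y) \<in> borel_measurable (\<sigma> \<Otimes>\<^sub>M \<sigma>)"
    and P_bdd: "\<And>k. k \<in> K \<Longrightarrow> \<exists>B. \<forall>x y. P k x y \<le> B"
    and P_mass: "\<And>k x. k \<in> K \<Longrightarrow> x \<in> space \<sigma> \<Longrightarrow> (\<integral>\<^sup>+y. ennreal (P k x y) \<partial>\<sigma>) \<le> ennreal Cp"
    and P_bdry: "\<And>j k z. j \<in> K \<Longrightarrow> j \<le> k \<Longrightarrow> z \<in> space \<sigma> \<Longrightarrow>
       (\<integral>\<^sup>+x. (\<integral>\<^sup>+y. ennreal (P k x y) * indicator (space \<sigma> - cell j z) y \<partial>\<sigma>) * indicator (cell j z)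
         x \<partial>\<sigma>)
         \<le> ennreal (Cb * q ^ nat (k - j)) * emeasure \<sigma> (cell j z)"
    and U_sets: "\<And>k Q. k \<in> K \<Longrightarrow> Q \<in> D k \<Longrightarrow> U k Q \<in> sets \<mu>"
    and U_le: "\<And>k Q. k \<in> K \<Longrightarrow> Q \<in> D k \<Longrightarrow> emeasure \<mu> (U k Q) \<le> ennreal Cu * emeasure \<sigma> Q"
    and \<psi>_meas: "(\<lambda>(Y, y). \<psi> Y y) \<in> borel_measurable (\<mu> \<Otimes>\<^sub>M \<sigma>)"
    and \<psi>_size: "\<And>k x y Y. k \<in> K \<Longrightarrow> x \<in> space \<sigma> \<Longrightarrow> Y \<in> U k (cell k x) \<Longrightarrow> y \<in> space \<sigma> \<Longrightarrow>
       norm (\<psi> Y y) \<le> P k x y"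
    and \<psi>_smooth: "\<And>k j x y y' Y. k \<in> K \<Longrightarrow> k \<le> j \<Longrightarrow> x \<in> space \<sigma> \<Longrightarrow> Y \<in> U k (cell k x) \<Longrightarrow> y \<in> space \<sigma> \<Longrightarrow>
       y' \<in> cell j y \<Longrightarrow> norm (\<psi> Y y - \<psi> Y y') \<le> q ^ nat (j - k) * P k x y"
begin

section \<open>The operator, its positive majorants and the functions it acts on\<close>

definition \<Theta> :: "('a \<Rightarrow> complex) \<Rightarrow> 'b \<Rightarrow> complex" where
  "\<Theta> u Y = (\<integral>y. \<psi> Y y * u y \<partial>\<sigma>)"

definition pint :: "int \<Rightarrow> ('a \<Rightarrow> ennreal) \<Rightarrow> 'a \<Rightarrow> ennreal" where
  "pint k h x = (\<integral>\<^sup>+y. ennreal (P k x y) * h y \<partial>\<sigma>)"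

lemma P_meas' [measurable]: "k \<in> K \<Longrightarrow> (\<lambda>p. P k (fst p) (snd p)) \<in> borel_measurable (\<sigma> \<Otimes>\<^sub>M \<sigma>)"
  using P_meas by (simp add: split_def)

lemma P_meas_right [measurable]: "k \<in> K \<Longrightarrow> x \<in> space \<sigma> \<Longrightarrow> P k x \<in> borel_measurable \<sigma>"
  using measurable_compose_Pair1[OF _ P_meas', of x k] by simp

lemma \<psi>_meas' [measurable]: "(\<lambda>p. \<psi> (fst p) (snd p)) \<in> borel_measurable (\<mu> \<Otimes>\<^sub>M \<sigma>)"
  using \<psi>_meas by (simp add: split_def)

lemma \<psi>_meas_right [measurable]: "Y \<in> space \<mu> \<Longrightarrow> \<psi> Y \<in> borel_measurable \<sigma>"
  using measurable_compose_Pair1[OF _ \<psi>_meas', of Y] by simp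

lemma U_space: "k \<in> K \<Longrightarrow> x \<in> space \<sigma> \<Longrightarrow> Y \<in> U k (cell k x) \<Longrightarrow> Y \<in> space \<mu>"
  using U_sets[OF _ cell_in_D, THEN sets.sets_into_space] by blast

lemma pint2_measurable:
  assumes "k \<in> K" and [measurable]: "(\<lambda>p. h (fst p) (snd p)) \<in> borel_measurable (\<sigma> \<Otimes>\<^sub>M \<sigma>)"
  shows "(\<lambda>x. pint k (h x) x) \<in> borel_measurable \<sigma>"
  unfolding pint_def
  by (rule borel_measurable_nn_integral) (use assms in \<open>simp add: split_def\<close>)

lemma pint_measurable [measurable]:
  assumes "k \<in> K" and [measurable]: "h \<in> borel_measurable \<sigma>"
  shows "pint k h \<in> borel_measurable \<sigma>"
  by (rule pint2_measurable[of k "\<lambda>_. h"]) (use assms in auto)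

lemma pint_mono: "(\<And>y. y \<in> space \<sigma> \<Longrightarrow> h y \<le> h' y) \<Longrightarrow> pint k h x \<le> pint k h' x"
  unfolding pint_def by (intro nn_integral_mono mult_left_mono) auto

lemma pint_add:
  assumes "k \<in> K" "x \<in> space \<sigma>" and [measurable]: "h \<in> borel_measurable \<sigma>" "h' \<in> borel_measurable \<sigma>"
  shows "pint k (\<lambda>y. h y + h' y) x = pint k h x + pint k h' x"
  unfolding pint_def distrib_left using assms by (intro nn_integral_add) auto

lemma pint_cmult:
  assumes "k \<in> K" "x \<in> space \<sigma>" and [measurable]: "h \<in> borel_measurable \<sigma>"
  shows "pint k (\<lambda>y. c * h y) x = c * pint k h x"
  unfolding pint_def mult.left_commute[of _ c] using assms by (intro nn_integral_cmult) auto

lemma pair_\<sigma>: "pair_sigma_finite \<sigma> \<sigma>" ..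

text \<open>Fubini's theorem and the symmetry of \<open>P\<close>.\<close>

lemma pint2_swap:
  assumes k: "k \<in> K" and [measurable]: "(\<lambda>p. h (fst p) (snd p)) \<in> borel_measurable (\<sigma> \<Otimes>\<^sub>M \<sigma>)"
  shows "(\<integral>\<^sup>+x. pint k (h x) x \<partial>\<sigma>) = (\<integral>\<^sup>+y. pint k (\<lambda>x. h x y) y \<partial>\<sigma>)"
proof -
  have "(\<integral>\<^sup>+x. pint k (h x) x \<partial>\<sigma>) = (\<integral>\<^sup>+y. (\<integral>\<^sup>+x. ennreal (P k x y) * h x y \<partial>\<sigma>) \<partial>\<sigma>)"
    unfolding pint_def
    by (rule pair_sigma_finite.Fubini'[OF pair_\<sigma>, symmetric]) (use k in \<open>simp add: split_def\<close>)
  then show ?thesis by (simp add: pint_def P_sym)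
qed

text \<open>After an exchange of variables the mass bound in one variable serves for the other,
  since \<open>P\<close> is symmetric.\<close>

lemma schur:
  assumes k: "k \<in> K" and [measurable]: "h \<in> borel_measurable \<sigma>"
  shows "(\<integral>\<^sup>+x. pint k h x \<partial>\<sigma>) \<le> ennreal Cp * (\<integral>\<^sup>+x. h x \<partial>\<sigma>)"
proof -
  have "(\<integral>\<^sup>+x. pint k h x \<partial>\<sigma>) = (\<integral>\<^sup>+y. pint k (\<lambda>x. h y) y \<partial>\<sigma>)"
    by (rule pint2_swap[OF k]) auto
  also have "\<dots> \<le> (\<integral>\<^sup>+y. ennreal Cp * h y \<partial>\<sigma>)"
  proof (rule nn_integral_mono)
    fix y assume y: "y \<in> space \<sigma>"
    have "pint k (\<lambda>x. h y) y = (\<integral>\<^sup>+x. ennreal (P k y x) \<partial>\<sigma>) * h y"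
      unfolding pint_def by (rule nn_integral_multc) (use k y in measurable)
    also have "\<dots> \<le> ennreal Cp * h y" by (intro mult_right_mono P_mass k y) auto
    finally show "pint k (\<lambda>x. h y) y \<le> ennreal Cp * h y" .
  qed
  also have "\<dots> = ennreal Cp * (\<integral>\<^sup>+x. h x \<partial>\<sigma>)" by (rule nn_integral_cmult) auto
  finally show ?thesis .
qed

text \<open>Cauchy-Schwarz with \<open>P\<close> distributed evenly, as a square root on each
  factor.\<close>

lemma pint_square_le:
  assumes k: "k \<in> K" and x: "x \<in> space \<sigma>" and [measurable]: "h \<in> borel_measurable \<sigma>"
  shows "(pint k h x)\<^sup>2 \<le> ennreal Cp * pint k (\<lambda>y. (h y)\<^sup>2) x"
proof -
  have [measurable]: "P k x \<in> borel_measurable \<sigma>" using k x by measurable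
  have sq: "ennreal (sqrt (P k x y)) * ennreal (sqrt (P k x y)) = ennreal (P k x y)" for y
    using P_nonneg[of k x y] by (simp add: ennreal_mult[symmetric])
  have "(\<integral>\<^sup>+y. ennreal (sqrt (P k x y)) * (ennreal (sqrt (P k x y)) * h y) \<partial>\<sigma>)\<^sup>2
     \<le> (\<integral>\<^sup>+y. (ennreal (sqrt (P k x y)))\<^sup>2 \<partial>\<sigma>) * (\<integral>\<^sup>+y. (ennreal (sqrt (P k x y)) * h y)\<^sup>2 \<partial>\<sigma>)"
    by (rule Cauchy_Schwarz_nn_integral) auto
  also have "(\<integral>\<^sup>+y. ennreal (sqrt (P k x y)) * (ennreal (sqrt (P k x y)) * h y) \<partial>\<sigma>) = pint k h x"
    by (simp add: pint_def mult.assoc[symmetric] sq)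
  also have "(\<integral>\<^sup>+y. (ennreal (sqrt (P k x y)) * h y)\<^sup>2 \<partial>\<sigma>) = pint k (\<lambda>y. (h y)\<^sup>2) x"
    by (simp add: pint_def power_mult_distrib) (simp add: power2_eq_square sq)
  also have "(\<integral>\<^sup>+y. (ennreal (sqrt (P k x y)))\<^sup>2 \<partial>\<sigma>) = (\<integral>\<^sup>+y. ennreal (P k x y) \<partial>\<sigma>)"
    by (simp add: power2_eq_square sq)
  also have "(\<integral>\<^sup>+y. ennreal (P k x y) \<partial>\<sigma>) * pint k (\<lambda>y. (h y)\<^sup>2) x
    \<le> ennreal Cp * pint k (\<lambda>y. (h y)\<^sup>2) x"
    by (intro mult_right_mono P_mass k x) auto
  finally show ?thesis .
qed

text \<open>The class on which \<open>\<Theta>\<close> is given by absolutely convergent integrals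
  over the Whitney regions, so that it is linear there. It contains L^2 functions, constants and the
  functions \<open>b_Q\<close>.\<close>

definition adm :: "('a \<Rightarrow> complex) \<Rightarrow> bool" where
  "adm u \<longleftrightarrow> locint u \<and> (\<forall>k\<in>K. \<forall>x\<in>space \<sigma>. pint k (\<lambda>y. ennreal (norm (u y))) x < \<infinity>)"

lemma adm_locint: "adm u \<Longrightarrow> locint u" by (simp add: adm_def)

lemma adm_measurable [measurable_dest]: "adm u \<Longrightarrow> u \<in> borel_measurable \<sigma>"
  by (simp add: adm_def locint_def)

lemma adm_le:
  assumes f: "f \<in> borel_measurable \<sigma>" and g: "adm g" and h: "adm h"
    and le: "\<And>x. x \<in> space \<sigma> \<Longrightarrow> norm (f x) \<le> norm (g x) + norm (h x)"
  shows "adm f"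
  unfolding adm_def
proof (intro conjI ballI)
  show "locint f" using g h by (intro locint_le[OF f _ _ le]) (auto simp: adm_locint)
  fix k x assume k: "k \<in> K" and x: "x \<in> space \<sigma>"
  have [measurable]: "g \<in> borel_measurable \<sigma>" "h \<in> borel_measurable \<sigma>" using g h
    by (auto simp: adm_measurable)
  have "pint k (\<lambda>y. ennreal (norm (f y))) x
    \<le> pint k (\<lambda>y. ennreal (norm (g y)) + ennreal (norm (h y))) x"
    using le by (intro pint_mono) (auto simp: ennreal_plus[symmetric] simp del: ennreal_plus intro!:
      ennreal_leI)
  also have "\<dots> = pint k (\<lambda>y. ennreal (norm (g y))) x + pint k (\<lambda>y. ennreal (norm (h y))) x"
    by (rule pint_add[OF k x]) auto
  also have "\<dots> < \<infinity>" using g h k x by (simp add: adm_def)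
  finally show "pint k (\<lambda>y. ennreal (norm (f y))) x < \<infinity>" .
qed

lemma adm_diff: "adm f \<Longrightarrow> adm g \<Longrightarrow> adm (\<lambda>x. f x - g x)"
  by (rule adm_le[of _ f g]) (auto simp: adm_measurable norm_triangle_ineq4)

lemma adm_add: "adm f \<Longrightarrow> adm g \<Longrightarrow> adm (\<lambda>x. f x + g x)"
  by (rule adm_le[of _ f g]) (auto simp: adm_measurable norm_triangle_ineq)

lemma adm_indicator: "adm f \<Longrightarrow> A \<in> sets \<sigma> \<Longrightarrow> adm (\<lambda>x. indicat_real A x *\<^sub>R f x)"
  by (rule adm_le[of _ f f]) (auto simp: adm_measurable split: split_indicator)

text \<open>The constant is controlled by the mass of \<open>P\<close> and the integrable part by
  its boundedness. Used with c = 1 for functions in L^p, by Young's inequality, and with c = 0 for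
  bounded functions on a cell.\<close>

lemma adm_of_bound:
  assumes f[measurable]: "f \<in> borel_measurable \<sigma>" and h[measurable]: "h \<in> borel_measurable \<sigma>"
    and fin: "(\<integral>\<^sup>+x. h x \<partial>\<sigma>) < \<infinity>" and le: "\<And>x. x \<in> space \<sigma> \<Longrightarrow> ennreal (norm (f x)) \<le> ennreal c + h x"
    and c: "0 \<le> c" "c \<le> 1"
  shows "adm f"
  unfolding adm_def
proof (intro conjI ballI)
  have "ennreal c \<le> 1" using c by simp
  then show "locint f" using le
    by (intro locint_of_bound[OF f h fin]) (metis add_right_mono order_trans)
  fix k x assume k: "k \<in> K" and x: "x \<in> space \<sigma>"
  have [measurable]: "P k x \<in> borel_measurable \<sigma>" using k x by measurable
  obtain B where B: "\<And>x y. P k x y \<le> B" using P_bdd[OF k] by blast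
  have "pint k (\<lambda>y. ennreal (norm (f y))) x \<le> pint k (\<lambda>y. ennreal c + h y) x"
    using le by (intro pint_mono)
  also have "\<dots> = pint k (\<lambda>y. ennreal c) x + pint k h x"
    by (rule pint_add[OF k x]) auto
  also have "pint k (\<lambda>y. ennreal c) x = (\<integral>\<^sup>+y. ennreal (P k x y) \<partial>\<sigma>) * ennreal c"
    unfolding pint_def by (rule nn_integral_multc) measurable
  also have "\<dots> \<le> ennreal Cp * ennreal c" by (intro mult_right_mono P_mass k x) auto
  also have "pint k h x \<le> (\<integral>\<^sup>+y. ennreal B * h y \<partial>\<sigma>)"
    unfolding pint_def by (intro nn_integral_mono mult_right_mono ennreal_leI B) auto
  also have "\<dots> = ennreal B * (\<integral>\<^sup>+y. h y \<partial>\<sigma>)" by (rule nn_integral_cmult) auto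
  finally have "pint k (\<lambda>y. ennreal (norm (f y))) x
    \<le> ennreal Cp * ennreal c + ennreal B * (\<integral>\<^sup>+y. h y \<partial>\<sigma>)"
    by (simp add: add_mono)
  also have "\<dots> < \<infinity>" using fin by (simp add: ennreal_mult_less_top ennreal_add_less_top)
  finally show "pint k (\<lambda>y. ennreal (norm (f y))) x < \<infinity>" .
qed

lemma adm_const: "adm (\<lambda>x. c)"
  unfolding adm_def
proof (intro conjI ballI locint_const)
  fix k x assume k: "k \<in> K" and x: "x \<in> space \<sigma>"
  have [measurable]: "P k x \<in> borel_measurable \<sigma>" using k x by measurable
  have "pint k (\<lambda>y. ennreal (norm c)) x = (\<integral>\<^sup>+y. ennreal (P k x y) \<partial>\<sigma>) * ennreal (norm c)"
    unfolding pint_def by (rule nn_integral_multc) measurable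
  also have "\<dots> \<le> ennreal Cp * ennreal (norm c)" by (intro mult_right_mono P_mass k x) auto
  also have "\<dots> < \<infinity>" by (simp add: ennreal_mult_less_top)
  finally show "pint k (\<lambda>y. ennreal (norm c)) x < \<infinity>" .
qed

lemma sq_bound: "ennreal (norm (z::complex)) \<le> 1 + ennreal ((norm z)\<^sup>2)"
proof -
  have "0 \<le> (norm z - 1 / 2)\<^sup>2" by simp
  then have "norm z \<le> 1 + (norm z)\<^sup>2" by (simp add: power2_diff power_divide)
  then have "ennreal (norm z) \<le> ennreal (1 + (norm z)\<^sup>2)" by (rule ennreal_leI)
  then show ?thesis by simp
qed

lemma L2_adm:
  assumes [measurable]: "f \<in> borel_measurable \<sigma>" and "(\<integral>\<^sup>+x. sq f x \<partial>\<sigma>) < \<infinity>"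
  shows "adm f"
  by (rule adm_of_bound[of f "sq f" 1]) (use assms sq_bound in auto)

text \<open>No integrability is assumed: the integral of a non-integrable function is 0 by
  convention, and then the bound is trivial.\<close>

lemma \<Theta>_le_gen:
  fixes u v :: "'a \<Rightarrow> complex"
  assumes [measurable]: "v \<in> borel_measurable \<sigma>" "u \<in> borel_measurable \<sigma>"
    and k: "k \<in> K" "x \<in> space \<sigma>" and le: "\<And>y. y \<in> space \<sigma> \<Longrightarrow> norm (v y) \<le> c * P k x y" and c: "0 \<le> c"
  shows "ennreal (norm (\<integral>y. v y * u y \<partial>\<sigma>)) \<le> ennreal c * pint k (\<lambda>y. ennreal (norm (u y))) x"
proof -
  have "ennreal (norm (\<integral>y. v y * u y \<partial>\<sigma>)) \<le> (\<integral>\<^sup>+y. ennreal (norm (v y * u y)) \<partial>\<sigma>)"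
  proof (cases "integrable \<sigma> (\<lambda>y. v y * u y)")
    case True then show ?thesis by (rule integral_norm_bound_ennreal)
  next
    case False then show ?thesis by (simp add: not_integrable_integral_eq)
  qed
  also have "\<dots> \<le> (\<integral>\<^sup>+y. ennreal c * (ennreal (P k x y) * ennreal (norm (u y))) \<partial>\<sigma>)"
  proof (rule nn_integral_mono)
    fix y assume "y \<in> space \<sigma>"
    then have "norm (v y * u y) \<le> c * (P k x y * norm (u y))"
      using mult_right_mono[OF le, of y "norm (u y)"] by (simp add: norm_mult mult.assoc)
    then show "ennreal (norm (v y * u y)) \<le> ennreal c * (ennreal (P k x y) * ennreal (norm (u y)))"
      using c P_nonneg[of k x y] by (simp add: ennreal_mult[symmetric] ennreal_leI)
  qed
  also have "\<dots> = ennreal c * pint k (\<lambda>y. ennreal (norm (u y))) x"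
    unfolding pint_def using k by (intro nn_integral_cmult) measurable
  finally show ?thesis .
qed

lemma \<Theta>_le:
  assumes u[measurable]: "u \<in> borel_measurable \<sigma>" and k: "k \<in> K" "x \<in> space \<sigma>" "Y \<in> U k (cell k x)"
  shows "ennreal (norm (\<Theta> u Y)) \<le> pint k (\<lambda>y. ennreal (norm (u y))) x"
proof -
  have [measurable]: "\<psi> Y \<in> borel_measurable \<sigma>" using U_space[OF k] by measurable
  show ?thesis
    unfolding \<Theta>_def using \<Theta>_le_gen[of "\<psi> Y" u k x 1] \<psi>_size[OF k] k u by simp
qed

lemma \<Theta>_integrable:
  fixes u v :: "'a \<Rightarrow> complex"
  assumes u: "adm u" and k: "k \<in> K" "x \<in> space \<sigma>"
    and v[measurable]: "v \<in> borel_measurable \<sigma>" and le: "\<And>y. y \<in> space \<sigma> \<Longrightarrow> norm (v y) \<le> c * P k x y"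
  shows "integrable \<sigma> (\<lambda>y. v y * u y)"
proof (rule integrableI_bounded)
  have [measurable]: "u \<in> borel_measurable \<sigma>" "P k x \<in> borel_measurable \<sigma>" using u k
    by (auto simp: adm_measurable)
  show "(\<lambda>y. v y * u y) \<in> borel_measurable \<sigma>" by measurable
  have "(\<integral>\<^sup>+y. ennreal (norm (v y * u y)) \<partial>\<sigma>)
    \<le> (\<integral>\<^sup>+y. ennreal \<bar>c\<bar> * (ennreal (P k x y) * ennreal (norm (u y))) \<partial>\<sigma>)"
  proof (rule nn_integral_mono)
    fix y assume y: "y \<in> space \<sigma>"
    have "norm (v y) \<le> \<bar>c\<bar> * P k x y"
      using le[OF y] P_nonneg[of k x y] by (smt (verit) mult_right_mono)
    then have "norm (v y * u y) \<le> \<bar>c\<bar> * (P k x y * norm (u y))"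
      using mult_right_mono[of "norm (v y)" "\<bar>c\<bar> * P k x y" "norm (u y)"]
        by (simp add: norm_mult mult.assoc)
    then show "ennreal (norm (v y * u y))
      \<le> ennreal \<bar>c\<bar> * (ennreal (P k x y) * ennreal (norm (u y)))"
      using P_nonneg[of k x y] by (simp add: ennreal_mult[symmetric] ennreal_leI)
  qed
  also have "\<dots> = ennreal \<bar>c\<bar> * pint k (\<lambda>y. ennreal (norm (u y))) x"
    unfolding pint_def using k by (intro nn_integral_cmult) measurable
  also have "\<dots> < \<infinity>" using u k by (simp add: adm_def ennreal_mult_less_top)
  finally show "(\<integral>\<^sup>+y. ennreal (norm (v y * u y)) \<partial>\<sigma>) < \<infinity>" .
qed

lemma \<psi>u_integrable:
  assumes u: "adm u" and k: "k \<in> K" "x \<in> space \<sigma>" "Y \<in> U k (cell k x)"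
  shows "integrable \<sigma> (\<lambda>y. \<psi> Y y * u y)"
  using U_space[OF k] \<psi>_size[OF k] by (intro \<Theta>_integrable[OF u k(1,2), of _ 1]) auto

lemma \<Theta>_add:
  assumes "adm u" "adm v" and k: "k \<in> K" "x \<in> space \<sigma>" "Y \<in> U k (cell k x)"
  shows "\<Theta> (\<lambda>y. u y + v y) Y = \<Theta> u Y + \<Theta> v Y"
  unfolding \<Theta>_def distrib_left using assms by (intro Bochner_Integration.integral_add \<psi>u_integrable)

lemma \<Theta>_diff:
  assumes "adm u" "adm v" and k: "k \<in> K" "x \<in> space \<sigma>" "Y \<in> U k (cell k x)"
  shows "\<Theta> (\<lambda>y. u y - v y) Y = \<Theta> u Y - \<Theta> v Y"
  unfolding \<Theta>_def right_diff_distrib using assms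
    by (intro Bochner_Integration.integral_diff \<psi>u_integrable)

lemma \<Theta>_sum:
  assumes "finite I" "\<And>i. i \<in> I \<Longrightarrow> adm (u i)" and k: "k \<in> K" "x \<in> space \<sigma>" "Y \<in> U k (cell k x)"
  shows "\<Theta> (\<lambda>y. \<Sum>i\<in>I. u i y) Y = (\<Sum>i\<in>I. \<Theta> (u i) Y)"
  unfolding \<Theta>_def sum_distrib_left using assms
    by (intro Bochner_Integration.integral_sum \<psi>u_integrable)

lemma \<Theta>_const: "\<Theta> (\<lambda>y. c) Y = c * \<Theta> (\<lambda>y. 1) Y"
  unfolding \<Theta>_def by (simp add: mult.commute)

text \<open>Replace the kernel on each cell of generation j by its value at one point of the cell.
  The replaced kernel integrates to zero against \<open>u\<close>, and smoothness bounds the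
  difference of the kernels.\<close>

lemma \<Theta>_fine:
  assumes u: "adm u" and j: "k \<le> j" and z: "\<And>z. z \<in> space \<sigma> \<Longrightarrow> avg j u z = 0"
    and k: "k \<in> K" "x \<in> space \<sigma>" "Y \<in> U k (cell k x)"
  shows "ennreal (norm (\<Theta> u Y)) \<le> ennreal (q ^ nat (j - k)) * pint k (\<lambda>y. ennreal (norm (u y))) x"
proof -
  have jK: "j \<in> K" using K_up k j by blast
  have um[measurable]: "u \<in> borel_measurable \<sigma>" using u by (rule adm_measurable)
  have \<psi>m[measurable]: "\<psi> Y \<in> borel_measurable \<sigma>" using U_space[OF k] by measurable
  \<comment> \<open>The chosen point depends only on the cell, so \<phi> is constant on cells and
    therefore measurable.\<close>
  define \<phi> where "\<phi> y = \<psi> Y (SOME w. w \<in> cell j y)" for y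
  have rep: "(SOME w. w \<in> cell j y) \<in> cell j y" if "y \<in> space \<sigma>" for y
    by (rule someI[of "\<lambda>w. w \<in> cell j y"]) (rule cell_self[OF jK that])
  have \<phi>c: "\<phi> w = \<phi> y" if "y \<in> space \<sigma>" "w \<in> cell j y" for y w
    using cell_cong[OF jK that] by (simp add: \<phi>_def)
  have \<phi>m[measurable]: "\<phi> \<in> borel_measurable \<sigma>"
    by (rule measurable_cellwise[OF jK]) (use \<phi>c in auto)
  have d: "norm (\<psi> Y y - \<phi> y) \<le> q ^ nat (j - k) * P k x y" if "y \<in> space \<sigma>" for y
    unfolding \<phi>_def by (rule \<psi>_smooth[OF k(1) j k(2,3) that rep[OF that]])
  have i1: "integrable \<sigma> (\<lambda>y. (\<psi> Y y - \<phi> y) * u y)"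
    by (rule \<Theta>_integrable[OF u k(1,2) _ d]) auto
  have i2: "integrable \<sigma> (\<lambda>y. \<psi> Y y * u y)" by (rule \<psi>u_integrable[OF u k])
  have i3: "integrable \<sigma> (\<lambda>y. \<phi> y * u y)"
    using Bochner_Integration.integrable_diff[OF i2 i1] by (simp add: algebra_simps)
  have "(\<integral>y. \<phi> y * u y \<partial>\<sigma>) = 0"
  proof (rule integral_cells_zero[OF jK i3])
    fix y assume y: "y \<in> space \<sigma>"
    have "(LINT w:cell j y|\<sigma>. \<phi> w * u w) = (LINT w:cell j y|\<sigma>. \<phi> y * u w)"
      by (intro set_lebesgue_integral_cong) (use \<phi>c[OF y] cell_sets[OF jK y] in auto)
    also have "\<dots> = \<phi> y * (LINT w:cell j y|\<sigma>. u w)" by (simp add: set_lebesgue_integral_def)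
    also have "(LINT w:cell j y|\<sigma>. u w) = 0" using avg_zero_iff[OF jK y] z[OF y] by blast
    finally show "(LINT w:cell j y|\<sigma>. \<phi> w * u w) = 0" by simp
  qed
  then have "\<Theta> u Y = (\<integral>y. (\<psi> Y y - \<phi> y) * u y \<partial>\<sigma>)"
    using i2 i3 unfolding \<Theta>_def left_diff_distrib by (subst Bochner_Integration.integral_diff) auto
  then show ?thesis
    using \<Theta>_le_gen[of "\<lambda>y. \<psi> Y y - \<phi> y" u k x "q ^ nat (j - k)"] d k q by simp
qed

text \<open>Lying in a common cell is the relation given by the countable union of the products Q x
  Q.\<close>

lemma cell_rel_measurable:
  assumes j: "j \<in> K"
  shows "(\<lambda>p. indicator (cell j (fst p)) (snd p) :: ennreal) \<in> borel_measurable (\<sigma> \<Otimes>\<^sub>M \<sigma>)"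
proof -
  have "(\<Union>Q\<in>D j. Q \<times> Q) \<in> sets (\<sigma> \<Otimes>\<^sub>M \<sigma>)"
    using D_sets[OF j] D_countable[OF j] by (intro sets.countable_UN'') auto
  then have m: "(\<lambda>p. indicator (\<Union>Q\<in>D j. Q \<times> Q) p :: ennreal) \<in> borel_measurable (\<sigma> \<Otimes>\<^sub>M \<sigma>)" by simp
  show ?thesis
  proof (rule measurable_cong[THEN iffD1, OF _ m])
    fix p assume "p \<in> space (\<sigma> \<Otimes>\<^sub>M \<sigma>)"
    then have p: "fst p \<in> space \<sigma>" "snd p \<in> space \<sigma>" by (auto simp: space_pair_measure)
    have "p \<in> (\<Union>Q\<in>D j. Q \<times> Q) \<longleftrightarrow> snd p \<in> cell j (fst p)"
    proof
      assume "p \<in> (\<Union>Q\<in>D j. Q \<times> Q)"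
      then obtain Q where "Q \<in> D j" "fst p \<in> Q" "snd p \<in> Q" by (cases p) auto
      then show "snd p \<in> cell j (fst p)" using cell_eq[OF j, of Q "fst p"] by simp
    next
      assume "snd p \<in> cell j (fst p)"
      then show "p \<in> (\<Union>Q\<in>D j. Q \<times> Q)"
        using cell_in_D[OF j p(1)] cell_self[OF j p(1)]
        by (intro UN_I[of "cell j (fst p)"]) (simp_all add: mem_Times_iff)
    qed
    then show "(indicator (\<Union>Q\<in>D j. Q \<times> Q) p :: ennreal) = indicator (cell j (fst p)) (snd p)"
      by (simp add: indicator_def)
  qed
qed

definition off :: "int \<Rightarrow> 'a \<Rightarrow> 'a \<Rightarrow> ennreal" where
  "off j x y = indicator (space \<sigma> - cell j x) y"

lemma off_measurable [measurable]:
  assumes j: "j \<in> K"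
  shows "(\<lambda>p. off j (fst p) (snd p)) \<in> borel_measurable (\<sigma> \<Otimes>\<^sub>M \<sigma>)"
proof -
  have m: "(\<lambda>p. 1 - indicator (cell j (fst p)) (snd p) :: ennreal) \<in> borel_measurable (\<sigma> \<Otimes>\<^sub>M \<sigma>)"
    using cell_rel_measurable[OF j] by measurable
  show ?thesis
    by (rule measurable_cong[THEN iffD1, OF _ m])
      (auto simp: off_def space_pair_measure split: split_indicator)
qed

lemma off_measurable_right [measurable]: "j \<in> K \<Longrightarrow> x \<in> space \<sigma> \<Longrightarrow> off j x \<in> borel_measurable \<sigma>"
  unfolding off_def[abs_def] by measurable

lemma off_sym: "j \<in> K \<Longrightarrow> x \<in> space \<sigma> \<Longrightarrow> y \<in> space \<sigma> \<Longrightarrow> off j x y = off j y x"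
  using cell_sym by (auto simp: off_def split: split_indicator)

lemma off_cong: "j \<in> K \<Longrightarrow> x \<in> space \<sigma> \<Longrightarrow> z \<in> cell j x \<Longrightarrow> off j z = off j x"
  unfolding off_def[abs_def] using cell_cong by simp

lemma pint_off_measurable [measurable]: "j \<in> K \<Longrightarrow> k \<in> K \<Longrightarrow>
  (\<lambda>x. pint k (off j x) x) \<in> borel_measurable \<sigma>"
  by (rule pint2_measurable) auto

text \<open>On one cell \<open>h\<close> is constant and comes out of the integral; what remains is
  the mass of \<open>P\<close> leaving the cell.\<close>

lemma boundary_weight:
  assumes j: "j \<in> K" "j \<le> k" and A: "saturated j A" and h[measurable]: "h \<in> borel_measurable \<sigma>"
    and hc: "\<And>x y. x \<in> A \<Longrightarrow> y \<in> cell j x \<Longrightarrow> h y = h x"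
  shows "(\<integral>\<^sup>+x. h x * pint k (off j x) x * indicator A x \<partial>\<sigma>)
    \<le> ennreal (Cb * q ^ nat (k - j)) * (\<integral>\<^sup>+x. h x * indicator A x \<partial>\<sigma>)"
proof -
  have k: "k \<in> K" using K_up j by blast
  have [measurable]: "A \<in> sets \<sigma>" using saturated_sets[OF j(1) A] .
  let ?c = "ennreal (Cb * q ^ nat (k - j))"
  have "(\<integral>\<^sup>+x. h x * pint k (off j x) x * indicator A x \<partial>\<sigma>) \<le> (\<integral>\<^sup>+x. (?c * h x) * indicator A x \<partial>\<sigma>)"
  proof (rule nn_integral_cells_mono[OF j(1) A])
    fix x assume xA: "x \<in> A"
    then have x: "x \<in> space \<sigma>" using A by (auto simp: saturated_def)
    have "(\<integral>\<^sup>+y. h y * pint k (off j y) y * indicator (cell j x) y \<partial>\<sigma>)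
      = (\<integral>\<^sup>+y. h x * (pint k (off j x) y * indicator (cell j x) y) \<partial>\<sigma>)"
      using off_cong[OF j(1) x] hc[OF xA] by (intro nn_integral_cong) (auto split: split_indicator)
    also have "\<dots> = h x * (\<integral>\<^sup>+y. pint k (off j x) y * indicator (cell j x) y \<partial>\<sigma>)"
      using k j x by (intro nn_integral_cmult) measurable
    also have "\<dots> \<le> h x * (?c * emeasure \<sigma> (cell j x))"
      unfolding pint_def off_def by (intro mult_left_mono P_bdry[OF j x]) simp
    finally have "(\<integral>\<^sup>+y. h y * pint k (off j y) y * indicator (cell j x) y \<partial>\<sigma>)
      \<le> (?c * h x) * emeasure \<sigma> (cell j x)"
      by (simp only: ac_simps)
    also have "\<dots> = (\<integral>\<^sup>+y. (?c * h y) * indicator (cell j x) y \<partial>\<sigma>)"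
      using hc[OF xA] by (intro nn_integral_const_cell[OF j(1) x, symmetric]) simp
    finally show "(\<integral>\<^sup>+y. h y * pint k (off j y) y * indicator (cell j x) y \<partial>\<sigma>)
      \<le> (\<integral>\<^sup>+y. (?c * h y) * indicator (cell j x) y \<partial>\<sigma>)" .
  qed (use k j in measurable)
  also have "\<dots> = ?c * (\<integral>\<^sup>+x. h x * indicator A x \<partial>\<sigma>)"
    unfolding mult.assoc by (rule nn_integral_cmult) auto
  finally show ?thesis .
qed

text \<open>The majorant of \<open>\<Theta>\<close> applied to u - u(x) when \<open>h\<close> = |u|
  is constant on cells of generation j: only points y outside the cell of x count, and there |u(y) -
  u(x)| <= h(y) + h(x).\<close>

definition coarse :: "int \<Rightarrow> int \<Rightarrow> ('a \<Rightarrow> ennreal) \<Rightarrow> 'a \<Rightarrow> ennreal" where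
  "coarse j k h x = pint k (\<lambda>y. (h y + h x) * off j x y) x"

lemma coarse_measurable:
  assumes "j \<in> K" "k \<in> K" and [measurable]: "h \<in> borel_measurable \<sigma>"
  shows "coarse j k h \<in> borel_measurable \<sigma>"
  unfolding coarse_def[abs_def] using assms by (intro pint2_measurable) auto

lemma \<Theta>_coarse:
  assumes u[measurable]: "u \<in> borel_measurable \<sigma>" and j: "j \<in> K" "j \<le> k"
    and c: "\<And>y. y \<in> cell j x \<Longrightarrow> u y = u x" and k: "k \<in> K" "x \<in> space \<sigma>" "Y \<in> U k (cell k x)"
  shows "ennreal (norm (\<Theta> (\<lambda>y. u y - u x) Y)) \<le> coarse j k (\<lambda>y. ennreal (norm (u y))) x"
proof -
  have "ennreal (norm (\<Theta> (\<lambda>y. u y - u x) Y)) \<le> pint k (\<lambda>y. ennreal (norm (u y - u x))) x"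
    by (rule \<Theta>_le[OF _ k]) auto
  also have "\<dots> \<le> coarse j k (\<lambda>y. ennreal (norm (u y))) x"
    unfolding coarse_def
  proof (rule pint_mono)
    fix y assume y: "y \<in> space \<sigma>"
    show "ennreal (norm (u y - u x)) \<le> (ennreal (norm (u y)) + ennreal (norm (u x))) * off j x y"
    proof (cases "y \<in> cell j x")
      case True then show ?thesis using c by simp
    next
      case False
      then show ?thesis using y norm_triangle_ineq4[of "u y" "u x"]
        by (simp add: off_def ennreal_plus[symmetric] ennreal_leI del: ennreal_plus)
    qed
  qed
  finally show ?thesis .
qed

text \<open>Schur's test, with the decay coming from the small mass of \<open>P k\<close> across the boundaries of
  coarse cells.\<close>

lemma coarse_L2:
  assumes j: "j \<in> K" "j \<le> k" and h[measurable]: "h \<in> borel_measurable \<sigma>"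
    and c: "\<And>x y. x \<in> space \<sigma> \<Longrightarrow> y \<in> cell j x \<Longrightarrow> h y = h x"
  shows "(\<integral>\<^sup>+x. (coarse j k h x)\<^sup>2 \<partial>\<sigma>)
    \<le> ennreal (4 * Cp * Cb * q ^ nat (k - j)) * (\<integral>\<^sup>+x. (h x)\<^sup>2 \<partial>\<sigma>)"
proof -
  have k: "k \<in> K" using K_up j by blast
  let ?a = "\<lambda>x. pint k (\<lambda>y. (h y)\<^sup>2 * off j x y) x" and ?b = "\<lambda>x. (h x)\<^sup>2 * pint k (off j x) x"
  have am: "?a \<in> borel_measurable \<sigma>" using j k by (intro pint2_measurable) auto
  have bm: "?b \<in> borel_measurable \<sigma>" using j k by measurable
  \<comment> \<open>Exchanging the variables turns the term with h(y) into the one with h(x), where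
    the weight is the mass leaving the cell.\<close>
  have swap: "(\<integral>\<^sup>+x. ?a x \<partial>\<sigma>) = (\<integral>\<^sup>+x. ?b x \<partial>\<sigma>)"
  proof -
    have "(\<integral>\<^sup>+x. ?a x \<partial>\<sigma>) = (\<integral>\<^sup>+y. pint k (\<lambda>x. (h y)\<^sup>2 * off j x y) y \<partial>\<sigma>)"
      using j k by (intro pint2_swap) auto
    also have "\<dots> = (\<integral>\<^sup>+y. ?b y \<partial>\<sigma>)"
    proof (rule nn_integral_cong)
      fix y assume y: "y \<in> space \<sigma>"
      have "pint k (\<lambda>x. (h y)\<^sup>2 * off j x y) y = pint k (\<lambda>x. (h y)\<^sup>2 * off j y x) y"
        unfolding pint_def using y j by (intro nn_integral_cong) (simp add: off_sym)
      also have "\<dots> = ?b y" using j k y by (intro pint_cmult) auto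
      finally show "pint k (\<lambda>x. (h y)\<^sup>2 * off j x y) y = ?b y" .
    qed
    finally show ?thesis .
  qed
  have "(coarse j k h x)\<^sup>2 \<le> ennreal Cp * (2 * ?a x + 2 * ?b x)" if x: "x \<in> space \<sigma>" for x
  proof -
    have [measurable]: "off j x \<in> borel_measurable \<sigma>" using j x by measurable
    have "(coarse j k h x)\<^sup>2 \<le> ennreal Cp * pint k (\<lambda>y. ((h y + h x) * off j x y)\<^sup>2) x"
      unfolding coarse_def using j x by (intro pint_square_le[OF k x]) measurable
    also have "pint k (\<lambda>y. ((h y + h x) * off j x y)\<^sup>2) x
      \<le> pint k (\<lambda>y. 2 * ((h y)\<^sup>2 * off j x y) + (2 * (h x)\<^sup>2) * off j x y) x"
      using square_add_ennreal_le
        by (intro pint_mono) (auto simp: off_def mult.assoc split: split_indicator)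
    also have "\<dots> = pint k (\<lambda>y. 2 * ((h y)\<^sup>2 * off j x y)) x
      + pint k (\<lambda>y. (2 * (h x)\<^sup>2) * off j x y) x"
      by (rule pint_add[OF k x]) measurable
    also have "pint k (\<lambda>y. 2 * ((h y)\<^sup>2 * off j x y)) x = 2 * ?a x"
      by (rule pint_cmult[OF k x]) measurable
    also have "pint k (\<lambda>y. (2 * (h x)\<^sup>2) * off j x y) x = (2 * (h x)\<^sup>2) * pint k (off j x) x"
      by (rule pint_cmult[OF k x]) measurable
    finally show ?thesis by (simp add: mult_left_mono mult.assoc)
  qed
  then have "(\<integral>\<^sup>+x. (coarse j k h x)\<^sup>2 \<partial>\<sigma>) \<le> (\<integral>\<^sup>+x. ennreal Cp * (2 * ?a x + 2 * ?b x) \<partial>\<sigma>)"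
    by (rule nn_integral_mono)
  also have "\<dots> = ennreal Cp * (2 * (\<integral>\<^sup>+x. ?a x \<partial>\<sigma>) + 2 * (\<integral>\<^sup>+x. ?b x \<partial>\<sigma>))"
    using am bm by (simp add: nn_integral_cmult nn_integral_add)
  also have "\<dots> = ennreal (4 * Cp) * (\<integral>\<^sup>+x. ?b x \<partial>\<sigma>)"
  proof -
    have "2 * B + 2 * B = 4 * B" for B :: ennreal by (simp add: distrib_right[symmetric])
    moreover have "ennreal (4 * Cp) = ennreal Cp * 4" using cpos
      by (simp add: ennreal_mult mult.commute)
    ultimately show ?thesis unfolding swap by (simp only: mult.assoc)
  qed
  also have "(\<integral>\<^sup>+x. ?b x \<partial>\<sigma>) \<le> ennreal (Cb * q ^ nat (k - j)) * (\<integral>\<^sup>+x. (h x)\<^sup>2 \<partial>\<sigma>)"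
    using boundary_weight[OF j saturated_space[OF j(1)], of "\<lambda>x. (h x)\<^sup>2"] c
    unfolding nn_integral_space_indicator by simp
  finally show ?thesis
    using cpos q by (simp add: mult_left_mono mult.assoc[symmetric] ennreal_mult[symmetric])
qed

end

section \<open>Two stopping arguments: large averages and accretive averages\<close>

context dyadic_system
begin

text \<open>The weak type bound for the dyadic maximal function, by descent from the finest
  generation. If the average over the present cell exceeds \<Lambda>, the whole cell is paid for by
  its own integral; if not, the exceptional set is determined by the subcells.\<close>

lemma maximal_inequality:
  assumes k: "k \<in> K" and h[measurable]: "h \<in> borel_measurable \<sigma>" and x: "x \<in> space \<sigma>"
  shows "\<Lambda> * emeasure \<sigma> {y \<in> cell k x. \<exists>i\<in>{k..N}. \<Lambda> < navg i h y}
    \<le> (\<integral>\<^sup>+y. h y * indicator (cell k x) y \<partial>\<sigma>)"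
proof -
  define B where "B j = {y \<in> space \<sigma>. \<exists>i\<in>{j..N}. \<Lambda> < navg i h y}" for j
  have nm[measurable]: "navg i h \<in> borel_measurable \<sigma>" if "k \<le> i" for i
    using K_up[OF k that] by simp
  have Bm[measurable]: "B j \<in> sets \<sigma>" if "k \<le> j" for j
  proof -
    have "B j = (\<Union>i\<in>{j..N}. {y \<in> space \<sigma>. \<Lambda> < navg i h y})" by (auto simp: B_def)
    also have "\<dots> \<in> sets \<sigma>" using that by (intro sets.finite_UN) auto
    finally show ?thesis .
  qed
  have "(\<integral>\<^sup>+y. (\<Lambda> * indicator (B j) y) * indicator (cell j x) y \<partial>\<sigma>)
    \<le> (\<integral>\<^sup>+y. h y * indicator (cell j x) y \<partial>\<sigma>)"
    if "k \<le> j" "j \<le> N + 1" "x \<in> space \<sigma>" for j x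
    using that
  proof (induction "nat (N + 1 - j)" arbitrary: j x)
    case 0
    then have "B j = {}" by (auto simp: B_def)
    then show ?case by simp
  next
    case (Suc d)
    have K: "j \<in> K" "j + 1 \<in> K" using K_up[OF k] Suc by auto
    have [measurable]: "cell j x \<in> sets \<sigma>" using cell_sets K Suc by simp
    show ?case
    proof (cases "\<Lambda> < navg j h x")
      case True
      have "(\<integral>\<^sup>+y. (\<Lambda> * indicator (B j) y) * indicator (cell j x) y \<partial>\<sigma>)
        \<le> (\<integral>\<^sup>+y. \<Lambda> * indicator (cell j x) y \<partial>\<sigma>)"
        by (intro nn_integral_mono) (auto split: split_indicator)
      also have "\<dots> = \<Lambda> * emeasure \<sigma> (cell j x)" by (rule nn_integral_cmult_indicator) simp
      also have "\<dots> \<le> navg j h x * emeasure \<sigma> (cell j x)" using True by (intro mult_right_mono) auto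
      also have "\<dots> = (\<integral>\<^sup>+y. h y * indicator (cell j x) y \<partial>\<sigma>)" using navg_mult K Suc by simp
      finally show ?thesis .
    next
      case False
      have eq: "y \<in> B j \<longleftrightarrow> y \<in> B (j + 1)" if y: "y \<in> cell j x" for y
      proof -
        have "{j..N} = insert j {j+1..N}" using Suc by auto
        moreover have "navg j h y = navg j h x" using navg_cong[OF K(1) _ y] Suc by simp
        ultimately show ?thesis using False by (simp add: B_def)
      qed
      have "(\<integral>\<^sup>+y. (\<Lambda> * indicator (B j) y) * indicator (cell j x) y \<partial>\<sigma>)
        = (\<integral>\<^sup>+y. (\<Lambda> * indicator (B (j+1)) y) * indicator (cell j x) y \<partial>\<sigma>)"
        using eq by (intro nn_integral_cong) (auto split: split_indicator)
      also have "\<dots> \<le> (\<integral>\<^sup>+y. h y * indicator (cell j x) y \<partial>\<sigma>)"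
      proof -
       have [measurable]: "B (j+1) \<in> sets \<sigma>" using Suc by (intro Bm) simp
       show ?thesis
       proof (rule nn_integral_cells_mono[OF K(2)])
        show "saturated (j + 1) (cell j x)" using saturated_cell[OF K(1)] Suc by simp
        fix z assume "z \<in> cell j x"
        then have "z \<in> space \<sigma>" using cell_subset[OF K(1)] Suc by blast
        then show "(\<integral>\<^sup>+y. (\<Lambda> * indicator (B (j+1)) y) * indicator (cell (j+1) z) y \<partial>\<sigma>)
          \<le> (\<integral>\<^sup>+y. h y * indicator (cell (j+1) z) y \<partial>\<sigma>)"
          using Suc by (intro Suc.hyps(1)) auto
       qed measurable
      qed
      finally show ?thesis .
    qed
  qed
  note claim = this
  show ?thesis
  proof (cases "k \<le> N + 1")
    case True
    have [measurable]: "cell k x \<in> sets \<sigma>" "B k \<in> sets \<sigma>" using cell_sets k x by auto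
    have eq: "{y \<in> cell k x. \<exists>i\<in>{k..N}. \<Lambda> < navg i h y} = B k \<inter> cell k x"
      using cell_subset[OF k x] by (auto simp: B_def)
    have "\<Lambda> * emeasure \<sigma> (B k \<inter> cell k x) = (\<integral>\<^sup>+y. \<Lambda> * indicator (B k \<inter> cell k x) y \<partial>\<sigma>)"
      by (simp add: nn_integral_cmult_indicator)
    also have "\<dots> = (\<integral>\<^sup>+y. (\<Lambda> * indicator (B k) y) * indicator (cell k x) y \<partial>\<sigma>)"
      by (intro nn_integral_cong) (auto split: split_indicator)
    also have "\<dots> \<le> (\<integral>\<^sup>+y. h y * indicator (cell k x) y \<partial>\<sigma>)" by (rule claim[OF _ True x]) simp
    finally show ?thesis unfolding eq .
  qed simp
qed

lemma ennreal_integral_le: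
  assumes "integrable \<sigma> v"
  shows "ennreal (\<integral>x. v x \<partial>\<sigma>) \<le> (\<integral>\<^sup>+x. ennreal (v x) \<partial>\<sigma>)"
proof -
  have fin: "(\<integral>\<^sup>+x. ennreal (v x) \<partial>\<sigma>) < top"
    using assms by (simp add: real_integrable_def less_top)
  have "(\<integral>x. v x \<partial>\<sigma>) \<le> enn2real (\<integral>\<^sup>+x. ennreal (v x) \<partial>\<sigma>)"
    unfolding real_lebesgue_integral_def[OF assms] by simp
  then show ?thesis using fin by (metis ennreal_leI ennreal_enn2real)
qed

text \<open>The average of \<open>b\<close> over a cell is carried by the points at which no smaller cell has
  an average with small real part.\<close>

lemma accretive_average_le:
  fixes a :: real
  assumes k: "k \<in> K" and b: "locint b" and x: "x \<in> space \<sigma>" and a: "0 \<le> a" and u: "norm u \<le> 1"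
    and low: "a < Re (u * avg k b x)"
  shows "ennreal (Re (u * avg k b x)) * emeasure \<sigma> (cell k x)
    \<le> (\<integral>\<^sup>+y. (ennreal a + ennreal (norm (b y)) * indicator {y \<in> space \<sigma>. \<forall>i\<in>{k..N}. a < Re
      (u * avg i b y)} y) * indicator (cell k x) y \<partial>\<sigma>)"
proof -
  have bm[measurable]: "b \<in> borel_measurable \<sigma>" using b by (simp add: locint_def)
  define B where "B j = {y \<in> space \<sigma>. \<forall>i\<in>{j..N}. a < Re (u * avg i b y)}" for j
  have am[measurable]: "avg i b \<in> borel_measurable \<sigma>" if "k \<le> i" for i
    using K_up[OF k that] by simp
  have Bm[measurable]: "B j \<in> sets \<sigma>" if "k \<le> j" for j
  proof (cases "j \<le> N")
    case True
    have "B j = (\<Inter>i\<in>{j..N}. {y \<in> space \<sigma>. a < Re (u * avg i b y)})" using True by (auto simp: B_def)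
    also have "\<dots> \<in> sets \<sigma>" using that True by (intro sets.finite_INT) auto
    finally show ?thesis .
  next
    case False
    then have "B j = space \<sigma>" by (auto simp: B_def)
    then show ?thesis by simp
  qed
  let ?v = "\<lambda>j y. ennreal a + ennreal (norm (b y)) * indicator (B j) y"
  have "ennreal (Re (u * avg j b x)) * emeasure \<sigma> (cell j x)
    \<le> (\<integral>\<^sup>+y. ?v j y * indicator (cell j x) y \<partial>\<sigma>)"
    if "k \<le> j" "j \<le> N + 1" "x \<in> space \<sigma>" for j x
    using that
  proof (induction "nat (N + 1 - j)" arbitrary: j x)
    case 0
    then have B: "B j = space \<sigma>" by (auto simp: B_def)
    have jK: "j \<in> K" using K_up[OF k] 0 by simp
    have "Re (u * avg j b x) \<le> norm (u * avg j b x)" by (rule complex_Re_le_cmod)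
    also have "\<dots> \<le> norm (avg j b x)" using mult_right_mono[OF u, of "norm (avg j b x)"]
      by (simp add: norm_mult)
    finally have "ennreal (Re (u * avg j b x)) * emeasure \<sigma> (cell j x)
      \<le> navg j (\<lambda>y. ennreal (norm (b y))) x * emeasure \<sigma> (cell j x)"
      by (intro mult_right_mono order_trans[OF ennreal_leI norm_avg_le] b jK 0) auto
    also have "\<dots> = (\<integral>\<^sup>+y. ennreal (norm (b y)) * indicator (cell j x) y \<partial>\<sigma>)"
      by (rule navg_mult[OF jK 0(4)])
    also have "\<dots> \<le> (\<integral>\<^sup>+y. ?v j y * indicator (cell j x) y \<partial>\<sigma>)"
      unfolding B by (intro nn_integral_mono) (auto split: split_indicator)
    finally show ?case .
  next
    case (Suc d)
    have K: "j \<in> K" "j + 1 \<in> K" using K_up[OF k] Suc by auto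
    have x: "x \<in> space \<sigma>" using Suc by simp
    have [measurable]: "cell j x \<in> sets \<sigma>" using cell_sets K Suc by simp
    show ?case
    \<comment> \<open>A failing cell stops at once, since a times its measure already dominates.
      Otherwise the condition at generation j holds throughout the cell, and the tower property
      passes the average on to the subcells.\<close>
    proof (cases "a < Re (u * avg j b x)")
      case False
      have "ennreal (Re (u * avg j b x)) * emeasure \<sigma> (cell j x)
        \<le> ennreal a * emeasure \<sigma> (cell j x)"
        using False by (intro mult_right_mono ennreal_leI) auto
      also have "\<dots> = (\<integral>\<^sup>+y. ennreal a * indicator (cell j x) y \<partial>\<sigma>)"
        by (simp add: nn_integral_cmult_indicator)
      also have "\<dots> \<le> (\<integral>\<^sup>+y. ?v j y * indicator (cell j x) y \<partial>\<sigma>)"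
        by (intro nn_integral_mono) (auto split: split_indicator)
      finally show ?thesis .
    next
      case True
      have eq: "y \<in> B j \<longleftrightarrow> y \<in> B (j + 1)" if y: "y \<in> cell j x" for y
      proof -
        have "{j..N} = insert j {j+1..N}" using Suc by auto
        moreover have "avg j b y = avg j b x" using avg_cong[OF K(1) x y] by simp
        ultimately show ?thesis using True by (simp add: B_def)
      qed
      let ?w = "\<lambda>y. Re (u * avg (j+1) b y)"
      have "set_integrable \<sigma> (cell j x) (avg (j+1) b)"
        by (rule locint_set_integrable[OF locint_avg[OF b K(2)] K(1) x])
      then have i1: "integrable \<sigma> (\<lambda>y. u * (indicat_real (cell j x) y *\<^sub>R avg (j+1) b y))"
        by (intro integrable_mult_right) (simp add: set_integrable_def)
      have w: "indicat_real (cell j x) y * ?w y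
        = Re (u * (indicat_real (cell j x) y *\<^sub>R avg (j+1) b y))" for y
        by (simp add: algebra_simps)
      have i2: "integrable \<sigma> (\<lambda>y. indicat_real (cell j x) y * ?w y)" unfolding w using i1
        by (rule integrable_Re)
      have "(\<integral>y. indicat_real (cell j x) y * ?w y \<partial>\<sigma>) = Re (u * (LINT y:cell j x|\<sigma>. avg (j+1) b y))"
        unfolding w integral_Re[OF i1] set_lebesgue_integral_def
          by (simp only: integral_mult_right_zero)
      also have "(LINT y:cell j x|\<sigma>. avg (j+1) b y) = avg j b x * measure \<sigma> (cell j x)"
        unfolding set_integral_cell[OF K(1) x] using avg_avg[OF b K(1) _ x, of "j+1"] by simp
      finally have "(\<integral>y. indicat_real (cell j x) y * ?w y \<partial>\<sigma>)
        = Re (u * avg j b x) * measure \<sigma> (cell j x)"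
        by (simp add: mult.assoc[symmetric])
      then have "ennreal (Re (u * avg j b x)) * emeasure \<sigma> (cell j x)
        = ennreal (\<integral>y. indicat_real (cell j x) y * ?w y \<partial>\<sigma>)"
        using True a by (simp add: emeasure_cell[OF K(1) x] ennreal_mult)
      also have "\<dots> \<le> (\<integral>\<^sup>+y. ennreal (indicat_real (cell j x) y * ?w y) \<partial>\<sigma>)"
        by (rule ennreal_integral_le[OF i2])
      also have "\<dots> = (\<integral>\<^sup>+y. ennreal (?w y) * indicator (cell j x) y \<partial>\<sigma>)"
        by (intro nn_integral_cong) (auto split: split_indicator)
      also have "\<dots> \<le> (\<integral>\<^sup>+y. ?v (j+1) y * indicator (cell j x) y \<partial>\<sigma>)"
      proof (rule nn_integral_cells_mono[OF K(2)])
        show "saturated (j + 1) (cell j x)" using saturated_cell[OF K(1)] x by simp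
        show "(\<lambda>y. ennreal (?w y)) \<in> borel_measurable \<sigma>" using Suc am[of "j+1"] by simp
        show "?v (j+1) \<in> borel_measurable \<sigma>" using Suc Bm[of "j+1"] by simp
        fix z assume "z \<in> cell j x"
        then have z: "z \<in> space \<sigma>" using cell_subset[OF K(1) x] by blast
        have "(\<integral>\<^sup>+y. ennreal (?w y) * indicator (cell (j+1) z) y \<partial>\<sigma>)
          = ennreal (?w z) * emeasure \<sigma> (cell (j+1) z)"
          by (rule nn_integral_const_cell[OF K(2) z]) (simp add: avg_cong[OF K(2) z])
        also have "\<dots> \<le> (\<integral>\<^sup>+y. ?v (j+1) y * indicator (cell (j+1) z) y \<partial>\<sigma>)"
          using Suc z by (intro Suc.hyps(1)) auto
        finally show "(\<integral>\<^sup>+y. ennreal (?w y) * indicator (cell (j+1) z) y \<partial>\<sigma>)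
          \<le> (\<integral>\<^sup>+y. ?v (j+1) y * indicator (cell (j+1) z) y \<partial>\<sigma>)" .
      qed
      also have "\<dots> = (\<integral>\<^sup>+y. ?v j y * indicator (cell j x) y \<partial>\<sigma>)"
        using eq by (intro nn_integral_cong) (auto split: split_indicator)
      finally show ?thesis .
    qed
  qed
  note claim = this
  show ?thesis
  proof (cases "k \<le> N + 1")
    case True
    show ?thesis using claim[OF _ True x] by (simp add: B_def)
  next
    case False
    have "claim0": "{y \<in> space \<sigma>. \<forall>i\<in>{k..N}. a < Re (u * avg i b y)} = space \<sigma>" using False by auto
    have "Re (u * avg k b x) \<le> norm (u * avg k b x)" by (rule complex_Re_le_cmod)
    also have "\<dots> \<le> norm (avg k b x)" using mult_right_mono[OF u, of "norm (avg k b x)"]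
      by (simp add: norm_mult)
    finally have "ennreal (Re (u * avg k b x)) * emeasure \<sigma> (cell k x)
      \<le> navg k (\<lambda>y. ennreal (norm (b y))) x * emeasure \<sigma> (cell k x)"
      by (intro mult_right_mono order_trans[OF ennreal_leI norm_avg_le] b k x) auto
    also have "\<dots> = (\<integral>\<^sup>+y. ennreal (norm (b y)) * indicator (cell k x) y \<partial>\<sigma>)"
      by (rule navg_mult[OF k x])
    also have "\<dots> \<le> (\<integral>\<^sup>+y. (ennreal a + ennreal (norm (b y)) * indicator (space \<sigma>) y)
      * indicator (cell k x) y \<partial>\<sigma>)"
      by (intro nn_integral_mono) (auto split: split_indicator)
    finally show ?thesis unfolding claim0 .
  qed
qed

end

section \<open>Square summability of the remainders\<close>

context theta_system
begin

text \<open>\<open>CR\<close> bounds one interaction between scale and piece: 4 Cp Cb for coarse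
  pieces, and Cp^2 / q for fine ones, whose cancellation sits one generation higher.
  \<open>CI\<close> adds the square of a geometric sum with ratio sqrt q.\<close>

definition CR :: real where "CR = 4 * Cp * Cb + Cp\<^sup>2 / q"
definition CI :: real where "CI = (2 / (1 - sqrt q))\<^sup>2 * CR"

lemma CR_pos: "0 < CR" unfolding CR_def using cpos q by (intro add_pos_pos) auto

lemma sqrt_q: "0 < sqrt q" "sqrt q < 1" using q by auto

lemma CI_pos: "0 < CI" unfolding CI_def using CR_pos sqrt_q by (intro mult_pos_pos) auto

text \<open>Schur's test on pairs of generations. Piece i contributes at scale k a term whose
  squared norm carries q^|i-k|. One half of this decay serves as weight in Cauchy-Schwarz, the other
  half makes the sum over k converge. The majorant \<open>\<rho>\<close> does not depend on the
  point of the Whitney region.\<close>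

lemma remainder_bound:
  assumes f[measurable]: "f \<in> borel_measurable \<sigma>" and fin: "(\<integral>\<^sup>+x. sq f x \<partial>\<sigma>) < \<infinity>"
    and m: "m \<in> K" "m \<le> N"
  obtains \<rho> where "\<And>k. k \<in> {m..N} \<Longrightarrow> \<rho> k \<in> borel_measurable \<sigma>"
    and "\<And>k x Y. k \<in> {m..N} \<Longrightarrow> x \<in> space \<sigma> \<Longrightarrow> Y \<in> U k (cell k x) \<Longrightarrow>
      ennreal (norm (\<Theta> (\<lambda>y. f y - avg k f x) Y)) \<le> \<rho> k x"
    and "(\<Sum>k\<in>{m..N}. \<integral>\<^sup>+x. (\<rho> k x)\<^sup>2 \<partial>\<sigma>) \<le> ennreal CI * (\<integral>\<^sup>+x. sq f x \<partial>\<sigma>)"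
proof -
  define I where "I = {m..N+1}"
  define u where "u i = piece m N f i" for i
  have af: "adm f" by (rule L2_adm[OF f fin])
  have lf: "locint f" by (rule adm_locint[OF af])
  have lu: "locint (u i)" if "i \<in> I" for i
    unfolding u_def using that by (intro locint_piece[OF lf m]) (simp add: I_def)
  have um[measurable]: "u i \<in> borel_measurable \<sigma>" if "i \<in> I" for i
    using lu[OF that] by (simp add: locint_def)
  have su: "(\<Sum>i\<in>I. \<integral>\<^sup>+x. sq (u i) x \<partial>\<sigma>) \<le> (\<integral>\<^sup>+x. sq f x \<partial>\<sigma>)"
    unfolding u_def I_def by (rule sum_norm_piece[OF lf m])
  have au: "adm (u i)" if "i \<in> I" for i
  proof (rule L2_adm[OF um[OF that]])
    have "(\<integral>\<^sup>+x. sq (u i) x \<partial>\<sigma>) \<le> (\<Sum>i\<in>I. \<integral>\<^sup>+x. sq (u i) x \<partial>\<sigma>)"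
      by (rule member_le_sum) (use that in \<open>auto simp: I_def\<close>)
    then show "(\<integral>\<^sup>+x. sq (u i) x \<partial>\<sigma>) < \<infinity>" using su fin by (meson le_less_trans)
  qed
  define h where "h i y = ennreal (norm (u i y))" for i y
  have hm[measurable]: "h i \<in> borel_measurable \<sigma>" if "i \<in> I" for i
    using um[OF that] unfolding h_def[abs_def] by measurable
  have h2: "(h i y)\<^sup>2 = sq (u i) y" for i y by (simp add: h_def ennreal_power)
  \<comment> \<open>For i > k the piece has mean zero on cells of generation i - 1, which gives the
    exponent i - 1 - k.\<close>
  define r where "r k i x = (if i \<le> k then coarse i k (h i) x else ennreal (q ^ nat (i - 1 - k))
    * pint k (h i) x)" for k i x
  define \<rho> where "\<rho> k x = (\<Sum>i\<in>I. r k i x)" for k x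
  have IK: "i \<in> K" if "i \<in> I" for i using K_up[OF m(1)] that by (simp add: I_def)
  have kK: "k \<in> K" if "k \<in> {m..N}" for k using K_up[OF m(1)] that by simp
  have uc: "u i y = u i x" if "i \<in> I" "i \<le> N" "x \<in> space \<sigma>" "y \<in> cell i x" for i x y
    unfolding u_def using that by (intro piece_const[OF m(1)]) (auto simp: I_def)
  have rm[measurable]: "r k i \<in> borel_measurable \<sigma>" if "k \<in> {m..N}" "i \<in> I" for k i
    unfolding r_def[abs_def] using coarse_measurable[OF IK[OF that(2)] kK[OF that(1)] hm[OF
      that(2)]]
      pint_measurable[OF kK[OF that(1)] hm[OF that(2)]] by (cases "i \<le> k") auto
  have \<rho>m: "\<rho> k \<in> borel_measurable \<sigma>" if "k \<in> {m..N}" for k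
    unfolding \<rho>_def[abs_def] using rm[OF that] by (intro borel_measurable_sum)
  have bound: "ennreal (norm (\<Theta> (\<lambda>y. f y - avg k f x) Y)) \<le> \<rho> k x"
    if k: "k \<in> {m..N}" and x: "x \<in> space \<sigma>" and Y: "Y \<in> U k (cell k x)" for k x Y
  proof -
    \<comment> \<open>The subtracted constants, for i <= k, add up to \<open>avg k f x\<close>; the
      finer pieces stay as they are.\<close>
    define v where "v i y = u i y - (if i \<le> k then u i x else 0)" for i y
    have av: "adm (v i)" if "i \<in> I" for i
      unfolding v_def[abs_def] by (intro adm_diff au that adm_const)
    have "(\<Sum>i\<in>I. v i y) = f y - avg k f x" for y
    proof -
      have "(\<Sum>i\<in>I. if i \<le> k then u i x else 0) = (\<Sum>i\<in>I \<inter> {i. i \<le> k}. u i x)"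
        using sum.inter_restrict[of I "\<lambda>i. u i x" "{i. i \<le> k}"] by (simp add: I_def)
      also have "I \<inter> {i. i \<le> k} = {m..k}" using k by (auto simp: I_def)
      also have "(\<Sum>i\<in>{m..k}. u i x) = avg k f x"
        unfolding u_def using k by (intro sum_piece_avg) auto
      finally show ?thesis
        unfolding v_def sum_subtractf using sum_piece[OF m(2), of f y] by (simp add: u_def I_def)
    qed
    then have "\<Theta> (\<lambda>y. f y - avg k f x) Y = \<Theta> (\<lambda>y. \<Sum>i\<in>I. v i y) Y" by simp
    also have "\<dots> = (\<Sum>i\<in>I. \<Theta> (v i) Y)"
      by (rule \<Theta>_sum[OF _ av kK[OF k] x Y]) (auto simp: I_def)
    finally have "ennreal (norm (\<Theta> (\<lambda>y. f y - avg k f x) Y)) \<le> ennreal (\<Sum>i\<in>I. norm (\<Theta> (v i) Y))"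
      by (simp add: norm_sum ennreal_leI)
    also have "\<dots> = (\<Sum>i\<in>I. ennreal (norm (\<Theta> (v i) Y)))" by (simp add: sum_ennreal)
    also have "\<dots> \<le> \<rho> k x" unfolding \<rho>_def
    proof (rule sum_mono)
      fix i assume i: "i \<in> I"
      show "ennreal (norm (\<Theta> (v i) Y)) \<le> r k i x"
      proof (cases "i \<le> k")
        case True
        have "v i = (\<lambda>y. u i y - u i x)" using True by (auto simp: v_def)
        moreover have "u i y = u i x" if "y \<in> cell i x" for y using True k
          by (intro uc[OF i _ x that]) auto
        ultimately show ?thesis
          using \<Theta>_coarse[OF um[OF i] IK[OF i] True _ kK[OF k] x Y] True
            by (simp add: r_def h_def[abs_def])
      next
        case False
        then have v: "v i = u i" by (auto simp: v_def)
        have "ennreal (norm (\<Theta> (u i) Y))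
          \<le> ennreal (q ^ nat (i - 1 - k)) * pint k (\<lambda>y. ennreal (norm (u i y))) x"
        proof (rule \<Theta>_fine[OF au[OF i] _ _ kK[OF k] x Y])
          show "k \<le> i - 1" using False by simp
          fix z assume "z \<in> space \<sigma>"
          then show "avg (i - 1) (u i) z = 0"
            unfolding u_def using False i k by (intro avg_piece_zero[OF lf m]) (auto simp: I_def)
        qed
        then show ?thesis unfolding v using False by (simp add: r_def h_def[abs_def])
      qed
    qed
    finally show ?thesis .
  qed
  have rL2: "(\<integral>\<^sup>+x. (r k i x)\<^sup>2 \<partial>\<sigma>) \<le> ennreal (CR * q ^ nat \<bar>i - k\<bar>) * (\<integral>\<^sup>+x. sq (u i) x \<partial>\<sigma>)"
    if k: "k \<in> {m..N}" and i: "i \<in> I" for k i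
  proof (cases "i \<le> k")
    case True
    have "(\<integral>\<^sup>+x. (r k i x)\<^sup>2 \<partial>\<sigma>) = (\<integral>\<^sup>+x. (coarse i k (h i) x)\<^sup>2 \<partial>\<sigma>)" using True
      by (simp add: r_def)
    also have "\<dots> \<le> ennreal (4 * Cp * Cb * q ^ nat (k - i)) * (\<integral>\<^sup>+x. (h i x)\<^sup>2 \<partial>\<sigma>)"
      by (rule coarse_L2[OF IK[OF i] True hm[OF i]]) (use uc[OF i] True k in \<open>auto simp: h_def\<close>)
    also have "\<dots> \<le> ennreal (CR * q ^ nat \<bar>i - k\<bar>) * (\<integral>\<^sup>+x. sq (u i) x \<partial>\<sigma>)"
      unfolding h2 using True q cpos
        by (intro mult_right_mono ennreal_leI) (auto simp: CR_def abs_if)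
    finally show ?thesis .
  next
    case False
    let ?c = "q ^ nat (i - 1 - k)"
    have "(\<integral>\<^sup>+x. (r k i x)\<^sup>2 \<partial>\<sigma>) = (\<integral>\<^sup>+x. (ennreal ?c)\<^sup>2 * (pint k (h i) x)\<^sup>2 \<partial>\<sigma>)"
      using False by (simp add: r_def power_mult_distrib)
    also have "\<dots> \<le> (\<integral>\<^sup>+x. (ennreal ?c)\<^sup>2 * (ennreal Cp * pint k (\<lambda>y. (h i y)\<^sup>2) x) \<partial>\<sigma>)"
      by (intro nn_integral_mono mult_left_mono pint_square_le[OF kK[OF k] _ hm[OF i]]) auto
    also have "\<dots> = (ennreal ?c)\<^sup>2 * (ennreal Cp * (\<integral>\<^sup>+x. pint k (\<lambda>y. (h i y)\<^sup>2) x \<partial>\<sigma>))"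
      using hm[OF i] kK[OF k] by (simp add: nn_integral_cmult)
    also have "\<dots> \<le> (ennreal ?c)\<^sup>2 * (ennreal Cp * (ennreal Cp * (\<integral>\<^sup>+x. (h i x)\<^sup>2 \<partial>\<sigma>)))"
      using hm[OF i] kK[OF k] by (intro mult_left_mono schur) auto
    also have "\<dots> = ennreal (?c\<^sup>2 * Cp\<^sup>2) * (\<integral>\<^sup>+x. sq (u i) x \<partial>\<sigma>)"
      unfolding h2 using cpos q
      by (simp only: mult.assoc[symmetric]) (simp add: ennreal_mult ennreal_power power2_eq_square
        mult.assoc)
    also have "\<dots> \<le> ennreal (CR * q ^ nat \<bar>i - k\<bar>) * (\<integral>\<^sup>+x. sq (u i) x \<partial>\<sigma>)"
    proof (intro mult_right_mono ennreal_leI)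
      \<comment> \<open>The lost generation is compensated by the factor 1 / q in
        \<open>CR\<close>.\<close>
      have n: "nat \<bar>i - k\<bar> = Suc (nat (i - 1 - k))" using False by simp
      have "?c\<^sup>2 * Cp\<^sup>2 \<le> ?c * Cp\<^sup>2"
        using q by (intro mult_right_mono) (auto simp: power2_eq_square mult_left_le power_le_one)
      also have "\<dots> = Cp\<^sup>2 / q * q ^ nat \<bar>i - k\<bar>" unfolding n using q by simp
      also have "\<dots> \<le> CR * q ^ nat \<bar>i - k\<bar>"
        using q cpos by (intro mult_right_mono) (auto simp: CR_def)
      finally show "?c\<^sup>2 * Cp\<^sup>2 \<le> CR * q ^ nat \<bar>i - k\<bar>" .
    qed auto
    finally show ?thesis .
  qed
  define s where "s = sqrt q"
  have s: "0 < s" "s < 1" "s * s = q" using q by (auto simp: s_def)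
  define G where "G = 2 / (1 - s)"
  have G0: "0 \<le> G" using s by (simp add: G_def)
  \<comment> \<open>The square root of the available decay, to be used once in each direction of the
    double sum.\<close>
  define w where "w k i = s ^ nat \<bar>i - k\<bar>" for k i :: int
  have w0: "0 < w k i" for k i using s by (simp add: w_def)
  have G: "(\<Sum>i\<in>J. w k i) \<le> G" "(\<Sum>k\<in>J. w k i) \<le> G" if "finite J" for J k i
  proof -
    show "(\<Sum>i\<in>J. w k i) \<le> G" unfolding w_def G_def by (rule sum_power_abs_diff_le[OF s(1,2) that])
    have "(\<Sum>k\<in>J. w k i) = (\<Sum>k\<in>J. s ^ nat \<bar>k - i\<bar>)" by (simp add: w_def abs_minus_commute)
    also have "\<dots> \<le> G" unfolding G_def by (rule sum_power_abs_diff_le[OF s(1,2) that])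
    finally show "(\<Sum>k\<in>J. w k i) \<le> G" .
  qed
  have L2k: "(\<integral>\<^sup>+x. (\<rho> k x)\<^sup>2 \<partial>\<sigma>) \<le> (\<Sum>i\<in>I. ennreal (G * CR * w k i) * (\<integral>\<^sup>+x. sq (u i) x \<partial>\<sigma>))"
    if k: "k \<in> {m..N}" for k
  proof -
    have "(\<rho> k x)\<^sup>2 \<le> ennreal G * (\<Sum>i\<in>I. ennreal (1 / w k i) * (r k i x)\<^sup>2)" for x
    proof -
      have "(\<rho> k x)\<^sup>2 \<le> (\<Sum>i\<in>I. ennreal (w k i)) * (\<Sum>i\<in>I. ennreal (1 / w k i) * (r k i x)\<^sup>2)"
        unfolding \<rho>_def by (rule weighted_Cauchy_Schwarz_sum) (auto simp: I_def w0)
      also have "(\<Sum>i\<in>I. ennreal (w k i)) = ennreal (\<Sum>i\<in>I. w k i)" using w0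
        by (simp add: sum_ennreal less_imp_le)
      also have "\<dots> * (\<Sum>i\<in>I. ennreal (1 / w k i) * (r k i x)\<^sup>2)
        \<le> ennreal G * (\<Sum>i\<in>I. ennreal (1 / w k i) * (r k i x)\<^sup>2)"
        by (intro mult_right_mono ennreal_leI G) (auto simp: I_def)
      finally show ?thesis .
    qed
    then have "(\<integral>\<^sup>+x. (\<rho> k x)\<^sup>2 \<partial>\<sigma>)
      \<le> (\<integral>\<^sup>+x. ennreal G * (\<Sum>i\<in>I. ennreal (1 / w k i) * (r k i x)\<^sup>2) \<partial>\<sigma>)"
      by (intro nn_integral_mono)
    also have "\<dots> = ennreal G * (\<Sum>i\<in>I. ennreal (1 / w k i) * (\<integral>\<^sup>+x. (r k i x)\<^sup>2 \<partial>\<sigma>))"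
      using rm[OF k] by (simp add: nn_integral_cmult nn_integral_sum)
    also have "\<dots> \<le> ennreal G * (\<Sum>i\<in>I. ennreal (1 / w k i) * (ennreal (CR * q ^ nat \<bar>i - k\<bar>)
      * (\<integral>\<^sup>+x. sq (u i) x \<partial>\<sigma>)))"
      by (intro mult_left_mono sum_mono rL2 k) auto
    also have "\<dots> = (\<Sum>i\<in>I. ennreal (G * CR * w k i) * (\<integral>\<^sup>+x. sq (u i) x \<partial>\<sigma>))"
      unfolding sum_distrib_left
    proof (rule sum.cong[OF refl])
      fix i
      have "q ^ nat \<bar>i - k\<bar> = w k i * w k i" unfolding w_def s(3)[symmetric]
        by (rule power_mult_distrib)
      then have "G * ((1 / w k i) * (CR * q ^ nat \<bar>i - k\<bar>)) = G * CR * w k i" using w0[of k i]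
        by simp
      show "ennreal G * (ennreal (1 / w k i) * (ennreal (CR * q ^ nat \<bar>i - k\<bar>)
        * (\<integral>\<^sup>+x. sq (u i) x \<partial>\<sigma>)))
        = ennreal (G * CR * w k i) * (\<integral>\<^sup>+x. sq (u i) x \<partial>\<sigma>)"
      proof -
        have "ennreal a * (ennreal b * (ennreal c * X)) = ennreal (a * (b * c)) * X"
          if "0 \<le> a" "0 \<le> b" "0 \<le> c" for a b c X
          using that by (simp add: ennreal_mult mult.assoc)
        from this[of G "1 / w k i" "CR * q ^ nat \<bar>i - k\<bar>"]
        show ?thesis using \<open>G * ((1 / w k i) * (CR * q ^ nat \<bar>i - k\<bar>)) = G * CR * w k i\<close> G0 w0[of k
          i] CR_pos q
          by (simp add: less_imp_le)
      qed
    qed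
    finally show ?thesis .
  qed
  have "(\<Sum>k\<in>{m..N}. \<integral>\<^sup>+x. (\<rho> k x)\<^sup>2 \<partial>\<sigma>)
    \<le> (\<Sum>k\<in>{m..N}. \<Sum>i\<in>I. ennreal (G * CR * w k i) * (\<integral>\<^sup>+x. sq (u i) x \<partial>\<sigma>))"
    by (intro sum_mono L2k)
  also have "\<dots> = (\<Sum>i\<in>I. (\<Sum>k\<in>{m..N}. ennreal (G * CR * w k i)) * (\<integral>\<^sup>+x. sq (u i) x \<partial>\<sigma>))"
    by (subst sum.swap) (simp add: sum_distrib_right)
  also have "\<dots> \<le> (\<Sum>i\<in>I. ennreal CI * (\<integral>\<^sup>+x. sq (u i) x \<partial>\<sigma>))"
  proof (intro sum_mono mult_right_mono)
    fix i
    have "(\<Sum>k\<in>{m..N}. ennreal (G * CR * w k i)) = ennreal (\<Sum>k\<in>{m..N}. G * CR * w k i)"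
      using G0 CR_pos w0 by (intro sum_ennreal) (simp add: less_imp_le)
    also have "(\<Sum>k\<in>{m..N}. G * CR * w k i) = G * CR * (\<Sum>k\<in>{m..N}. w k i)"
      by (simp add: sum_distrib_left)
    also have "\<dots> \<le> G * CR * G" using G0 CR_pos by (intro mult_left_mono G) auto
    also have "\<dots> = CI" by (simp add: CI_def G_def s_def power2_eq_square)
    finally show "(\<Sum>k\<in>{m..N}. ennreal (G * CR * w k i)) \<le> ennreal CI" by (simp add: ennreal_leI)
  qed auto
  also have "\<dots> \<le> ennreal CI * (\<integral>\<^sup>+x. sq f x \<partial>\<sigma>)"
    unfolding sum_distrib_left[symmetric] using su by (intro mult_left_mono) auto
  finally show ?thesis using \<rho>m bound by (intro that[of \<rho>]) auto
qed

end

section \<open>Stopping times\<close>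

text \<open>If t > s, multiply t by (t / s)^(p-1) >= 1.\<close>

lemma young_powr_real:
  fixes t s p :: real
  assumes "0 < s" "0 \<le> t" "1 < p"
  shows "t \<le> s + s powr (1 - p) * t powr p"
proof (cases "t \<le> s")
  case True
  moreover have "0 \<le> s powr (1 - p) * t powr p" by simp
  ultimately show ?thesis by linarith
next
  case False
  then have t: "0 < t" "s < t" using assms by auto
  have "1 \<le> (t / s) powr (p - 1)" using t assms by (intro ge_one_powr_ge_zero) auto
  also have "(t / s) powr (p - 1) = t powr (p - 1) * s powr (1 - p)"
    using t assms by (simp add: powr_divide powr_diff field_simps)
  finally have "t * 1 \<le> t * (t powr (p - 1) * s powr (1 - p))" using t
    by (intro mult_left_mono) auto
  also have "\<dots> = s powr (1 - p) * t powr p" using t by (simp add: powr_diff)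
  finally show ?thesis using assms by simp
qed

lemma young_powr_ennreal:
  fixes t s p :: real
  assumes "0 < s" "0 \<le> t" "1 < p"
  shows "ennreal t \<le> ennreal s + ennreal (s powr (1 - p)) * ennreal (t powr p)"
proof -
  have "ennreal t \<le> ennreal (s + s powr (1 - p) * t powr p)"
    by (rule ennreal_leI[OF young_powr_real[OF assms]])
  then show ?thesis using assms by (simp add: ennreal_mult)
qed

context dyadic_system
begin

text \<open>Points whose first bad generation is j. Points that are never bad are assigned to N, so
  that the sets for j in {k..N} partition \<open>Q\<close>.\<close>

definition stopset :: "int \<Rightarrow> int \<Rightarrow> (int \<Rightarrow> 'a \<Rightarrow> bool) \<Rightarrow> 'a set \<Rightarrow> int \<Rightarrow> 'a set" where
  "stopset k N Bad Q j = {y \<in> Q. (\<forall>i\<in>{k..<j}. \<not> Bad i y) \<and> (Bad j y \<or> j = N)}"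

text \<open>Whether a point stops at generation j is decided by the conditions at generations up to
  j, and these are constant on cells of generation j.\<close>

lemma stopset_saturated:
  assumes k: "k \<in> K" and x: "x \<in> space \<sigma>" and j: "k \<le> j"
    and Bad: "\<And>i x y. k \<le> i \<Longrightarrow> x \<in> space \<sigma> \<Longrightarrow> y \<in> cell i x \<Longrightarrow> Bad i y = Bad i x"
  shows "saturated j (stopset k N Bad (cell k x) j)"
  unfolding saturated_def
proof (intro conjI ballI subsetI)
  fix y assume "y \<in> stopset k N Bad (cell k x) j"
  then show "y \<in> space \<sigma>" using cell_subset[OF k x] by (auto simp: stopset_def)
next
  fix y z assume y: "y \<in> stopset k N Bad (cell k x) j" and z: "z \<in> cell j y"
  have ys: "y \<in> space \<sigma>" using y cell_subset[OF k x] by (auto simp: stopset_def)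
  have "Bad i z = Bad i y" if "k \<le> i" "i \<le> j" for i
    using Bad[OF that(1) ys] cell_mono[OF K_up[OF k that(1)] that(2) ys] z by blast
  moreover have "z \<in> cell k x"
    using saturatedD[OF saturated_cell[OF k j x] _ z] y by (simp add: stopset_def)
  ultimately show "z \<in> stopset k N Bad (cell k x) j" using y j by (auto simp: stopset_def)
qed

lemma stopset_disjoint:
  assumes "y \<in> stopset k N Bad Q i" "y \<in> stopset k N Bad Q j" "i \<in> {k..N}" "j \<in> {k..N}"
  shows "i = j"
proof (rule ccontr)
  assume "i \<noteq> j"
  then consider "i < j" | "j < i" by linarith
  then show False
    using assms by cases (auto simp: stopset_def)
qed

lemma stopset_cover:
  assumes "y \<in> Q" "k \<le> N"
  shows "\<exists>j\<in>{k..N}. y \<in> stopset k N Bad Q j"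
proof (cases "\<exists>i\<in>{k..N}. Bad i y")
  case True
  define A where "A = {i\<in>{k..N}. Bad i y}"
  have A: "finite A" unfolding A_def by (rule finite_subset[of _ "{k..N}"]) auto
  have A': "A \<noteq> {}" using True by (auto simp: A_def)
  define j where "j = Min A"
  have j: "j \<in> A" unfolding j_def using A A' by (rule Min_in)
  have "\<not> Bad i y" if "i \<in> {k..<j}" for i
  proof
    assume "Bad i y"
    then have "i \<in> A" using that j by (auto simp: A_def)
    then have "j \<le> i" unfolding j_def using A by simp
    then show False using that by simp
  qed
  then show ?thesis using j assms by (intro bexI[of _ j]) (auto simp: stopset_def A_def)
next
  case False
  then show ?thesis using assms by (intro bexI[of _ N]) (auto simp: stopset_def)
qed

lemma navg_le:
  assumes "k \<in> K" "x \<in> space \<sigma>" "(\<integral>\<^sup>+y. h y * indicator (cell k x) y \<partial>\<sigma>)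
    \<le> c * emeasure \<sigma> (cell k x)"
  shows "navg k h x \<le> c"
  using assms cell_pos[OF assms(1,2)] cell_fin[OF assms(1,2)]
    unfolding navg_mult[OF assms(1,2), symmetric]
  by (simp add: mult.commute[of _ "emeasure \<sigma> _"] ennreal_mult_le_mult_iff)

end

context theta_system
begin

text \<open>The energy of \<open>\<Theta> u\<close> on the Whitney region, spread uniformly over the cell.\<close>

definition En :: "int \<Rightarrow> ('a \<Rightarrow> complex) \<Rightarrow> 'a \<Rightarrow> ennreal" where
  "En k u x = (\<integral>\<^sup>+Y. ennreal ((norm (\<Theta> u Y))\<^sup>2) * indicator (U k (cell k x)) Y \<partial>\<mu>)
    / emeasure \<sigma> (cell k x)"

lemma En_cong: "k \<in> K \<Longrightarrow> x \<in> space \<sigma> \<Longrightarrow> y \<in> cell k x \<Longrightarrow> En k u y = En k u x"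
  by (simp add: En_def cell_cong)

lemma En_measurable [measurable]: "k \<in> K \<Longrightarrow> En k u \<in> borel_measurable \<sigma>"
  by (rule measurable_cellwise) (auto simp: En_cong)

text \<open>Fubini's theorem, with the symmetry of the kernel and of the relation of lying in
  different cells.\<close>

lemma swap_off:
  assumes j: "j \<in> K" and k: "k \<in> K" and [measurable]: "v \<in> borel_measurable \<sigma>"
  shows "(\<integral>\<^sup>+x. pint k (\<lambda>y. v y * off j x y) x \<partial>\<sigma>) = (\<integral>\<^sup>+y. v y * pint k (off j y) y \<partial>\<sigma>)"
proof -
  have "(\<integral>\<^sup>+x. pint k (\<lambda>y. v y * off j x y) x \<partial>\<sigma>) = (\<integral>\<^sup>+y. pint k (\<lambda>x. v y * off j x y) y \<partial>\<sigma>)"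
    using j k by (intro pint2_swap) auto
  also have "\<dots> = (\<integral>\<^sup>+y. v y * pint k (off j y) y \<partial>\<sigma>)"
  proof (rule nn_integral_cong)
    fix y assume y: "y \<in> space \<sigma>"
    have "pint k (\<lambda>x. v y * off j x y) y = pint k (\<lambda>x. v y * off j y x) y"
      unfolding pint_def using y j by (intro nn_integral_cong) (simp add: off_sym)
    also have "\<dots> = v y * pint k (off j y) y" using j k y by (intro pint_cmult) auto
    finally show "pint k (\<lambda>x. v y * off j x y) y = v y * pint k (off j y) y" .
  qed
  finally show ?thesis .
qed

lemma pint_off_le: "k \<in> K \<Longrightarrow> x \<in> space \<sigma> \<Longrightarrow> pint k (off j y) x \<le> ennreal Cp"
  using P_mass[of k x] unfolding pint_def off_def
  by (rule_tac order_trans[OF nn_integral_mono P_mass]) (auto split: split_indicator)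

text \<open>With \<open>s = s0\<close>, the term \<open>s\<^sup>1\<^sup>-\<^sup>p \<bar>b\<bar>\<^sup>p\<close> of Young's inequality takes up at most a quarter
  of the lower bound \<open>1 / C0\<close> for the average of \<open>b\<close>; \<open>\<eta>2\<close> is then the proportion of a cube on
  which the averages of \<open>b\<close> stay large, and \<open>Lam\<close> is the stopping level for the averages of
  \<open>\<bar>b\<bar>\<^sup>p\<close>.\<close>

definition s0 :: "real \<Rightarrow> real \<Rightarrow> real" where "s0 p C0 = (4 * C0\<^sup>2) powr (1 / (p - 1))"
definition \<eta>2 :: "real \<Rightarrow> real \<Rightarrow> real" where "\<eta>2 p C0 = 1 / (4 * C0 * s0 p C0)"
definition Lam :: "real \<Rightarrow> real \<Rightarrow> real" where "Lam p C0 = C0 + 4 * C0 / \<eta>2 p C0"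
text \<open>Bound for the averages of b over stopping cells: |b| <= 1 + |b|^p, and \<open>Cd\<close>
  pays for passing from a stopping cell to its parent, where the average of |b|^p is at most
  \<open>Lam\<close>.\<close>

definition GG :: "real \<Rightarrow> real \<Rightarrow> real \<Rightarrow> real" where "GG p C0 Cd = 1 + Cd * Lam p C0"
text \<open>A common ratio for the two decays of Young's inequality with parameter q^(-d/2), namely
  q^(d/2) and q^(d (p-1)/2).\<close>

definition rr :: "real \<Rightarrow> real" where "rr p = max (sqrt q) (sqrt q powr (p - 1))"
text \<open>The first two summands come from stopping cells coarser than the scale, where boundary
  mass decays; the last one from finer or equal ones, where cancellation decays.\<close>

definition Ch :: "real \<Rightarrow> real \<Rightarrow> real \<Rightarrow> real" where
  "Ch p C0 Cd = (1 + GG p C0 Cd) * Cb + Cp * (Cd * Lam p C0) + 2 * Cp * GG p C0 Cd"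
text \<open>L^1 bound, per unit of measure of the cube, of all errors together: from b outside the
  cube, from the bad parts, and from the squared remainders of the good part.\<close>

definition CH :: "real \<Rightarrow> real \<Rightarrow> real \<Rightarrow> real" where
  "CH p C0 Cd = (Cb + Cp * C0) * (2 / (1 - rr p)) + Ch p C0 Cd * (2 / (1 - rr p))
    + CI * (GG p C0 Cd)\<^sup>2"
text \<open>The level which, by Chebyshev's inequality, the errors exceed on at most a quarter of
  the proportion \<open>\<eta>2\<close>.\<close>

definition L3 :: "real \<Rightarrow> real \<Rightarrow> real \<Rightarrow> real" where "L3 p C0 Cd = 4 * CH p C0 Cd / \<eta>2 p C0"
text \<open>The factor 8 C0^2 is 2 (2 C0)^2: the averages of b are divided out, being at least 1 /
  (2 C0) in modulus, and a sum of two terms is squared.\<close>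

definition LF :: "real \<Rightarrow> real \<Rightarrow> real \<Rightarrow> real \<Rightarrow> real" where
  "LF p C0 Cd L2 = 8 * C0\<^sup>2 * (L2 + Cu * (2 * (L3 p C0 Cd)\<^sup>2 + 2 * L3 p C0 Cd))"

end

text \<open>One cube with its function \<open>b\<close>. The testing condition appears in weak form:
  the energies of \<open>\<Theta> b\<close> exceed \<open>L2\<close> only on a small part of the
  cube. Doubling serves to compare a stopping cell with its parent.\<close>

locale tb_cube = theta_system \<sigma> D K P Cp Cb q U \<mu> \<psi> Cu
  for \<sigma> :: "'a measure" and D K P Cp Cb q and U :: "int \<Rightarrow> 'a set \<Rightarrow> 'b set" and \<mu> \<psi> Cu +
  fixes p C0 Cd L2 :: real and k0 N :: int and x0 :: 'a and b :: "'a \<Rightarrow> complex"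
  assumes p: "1 < p" and C0: "0 < C0" and Cd: "1 \<le> Cd" and L2: "0 \<le> L2"
    and doubling: "\<And>k x. k \<in> K \<Longrightarrow> x \<in> space \<sigma> \<Longrightarrow>
      emeasure \<sigma> (cell k x) \<le> ennreal Cd * emeasure \<sigma> (cell (k + 1) x)"
    and k0: "k0 \<in> K" "k0 \<le> N" and x0: "x0 \<in> space \<sigma>" and b: "adm b"
    and b_p: "(\<integral>\<^sup>+y. ennreal (norm (b y) powr p) \<partial>\<sigma>) \<le> ennreal C0 * emeasure \<sigma> (cell k0 x0)"
    and b_low: "1 / C0 \<le> norm (avg k0 b x0)"
    and test: "emeasure \<sigma> {x \<in> cell k0 x0. ennreal L2 < (\<Sum>k\<in>{k0..N}. En k b x)}
      \<le> ennreal (\<eta>2 p C0 / 4) * emeasure \<sigma> (cell k0 x0)"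
begin

abbreviation "Q \<equiv> cell k0 x0"
abbreviation "S \<equiv> emeasure \<sigma> (cell k0 x0)"
abbreviation "G \<equiv> GG p C0 Cd"
abbreviation "\<Lambda> \<equiv> Lam p C0"
abbreviation "\<eta> \<equiv> \<eta>2 p C0"
abbreviation "r \<equiv> rr p"
definition bp :: "'a \<Rightarrow> ennreal" where "bp y = ennreal (norm (b y) powr p)"
definition Bad :: "int \<Rightarrow> 'a \<Rightarrow> bool" where "Bad i y \<longleftrightarrow> ennreal \<Lambda> < navg i bp y"
definition T :: "int \<Rightarrow> 'a set" where "T = stopset k0 N Bad Q"

lemma const_pos: "0 < s0 p C0" "0 < \<eta>" "C0 \<le> \<Lambda>" "0 < \<Lambda>" "1 \<le> G" "0 < r" "r < 1" "sqrt q
  \<le> r" "sqrt q powr (p - 1) \<le> r"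
proof -
  show s: "0 < s0 p C0" using C0 by (simp add: s0_def)
  show e: "0 < \<eta>" using C0 s by (simp add: \<eta>2_def)
  show "C0 \<le> \<Lambda>" using C0 e by (simp add: Lam_def)
  then show l: "0 < \<Lambda>" using C0 by simp
  show "1 \<le> G" using l Cd by (simp add: GG_def)
  show "0 < r" using sqrt_q by (simp add: rr_def less_max_iff_disj)
  have "sqrt q powr (p - 1) < 1 powr (p - 1)" using sqrt_q p by (intro powr_less_mono2) auto
  then show "r < 1" using sqrt_q by (simp add: rr_def)
  show "sqrt q \<le> r" "sqrt q powr (p - 1) \<le> r" by (auto simp: rr_def)
qed

lemma lb: "locint b" by (rule adm_locint[OF b])

lemma bm [measurable]: "b \<in> borel_measurable \<sigma>" by (rule adm_measurable[OF b])

lemma bp_measurable [measurable]: "bp \<in> borel_measurable \<sigma>"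
  unfolding bp_def[abs_def] by measurable

lemma Qm [measurable]: "Q \<in> sets \<sigma>" by (rule cell_sets[OF k0(1) x0])

lemma Q_space: "y \<in> Q \<Longrightarrow> y \<in> space \<sigma>" using cell_subset[OF k0(1) x0] by blast

lemma levelK: "k0 \<le> k \<Longrightarrow> k \<in> K" using K_up[OF k0(1)] .

lemma Bad_cong: "k0 \<le> i \<Longrightarrow> x \<in> space \<sigma> \<Longrightarrow> y \<in> cell i x \<Longrightarrow> Bad i y = Bad i x"
  by (simp add: Bad_def navg_cong[OF levelK])

lemma T_sat: "j \<in> {k0..N} \<Longrightarrow> saturated j (T j)"
  unfolding T_def by (rule stopset_saturated[OF k0(1) x0 _ Bad_cong]) auto

lemma T_sets [measurable]: "j \<in> {k0..N} \<Longrightarrow> T j \<in> sets \<sigma>"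
  using saturated_sets[OF levelK T_sat] by simp

lemma T_Q: "y \<in> T j \<Longrightarrow> y \<in> Q" by (simp add: T_def stopset_def)

lemma T_disjoint: "y \<in> T i \<Longrightarrow> y \<in> T j \<Longrightarrow> i \<in> {k0..N} \<Longrightarrow> j \<in> {k0..N} \<Longrightarrow> i = j"
  unfolding T_def by (rule stopset_disjoint)

lemma T_cover: "y \<in> Q \<Longrightarrow> \<exists>j\<in>{k0..N}. y \<in> T j"
  unfolding T_def by (rule stopset_cover[OF _ k0(2)])

lemma sum_T:
  fixes F :: "int \<Rightarrow> 'c::comm_monoid_add"
  assumes j: "j \<in> {k0..N}" "y \<in> T j" and z: "\<And>i. i \<in> {k0..N} \<Longrightarrow> y \<notin> T i \<Longrightarrow> F i = 0"
  shows "(\<Sum>i\<in>{k0..N}. F i) = F j"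
proof -
  have "(\<Sum>i\<in>{k0..N}. F i) = (\<Sum>i\<in>{j}. F i)"
  proof (rule sum.mono_neutral_right)
    show "\<forall>i\<in>{k0..N} - {j}. F i = 0"
    proof
      fix i assume i: "i \<in> {k0..N} - {j}"
      then have "y \<notin> T i" using T_disjoint[OF _ j(2), of i] j(1) by blast
      then show "F i = 0" using z i by blast
    qed
  qed (use j in auto)
  then show ?thesis by simp
qed

lemma sum_emeasure_T: "(\<Sum>j\<in>{k0..N}. emeasure \<sigma> (T j)) = S"
proof -
  have "(\<Sum>j\<in>{k0..N}. emeasure \<sigma> (T j)) = emeasure \<sigma> (\<Union>j\<in>{k0..N}. T j)"
    by (rule sum_emeasure) (use T_sets T_disjoint in \<open>auto simp: disjoint_family_on_def\<close>)
  also have "(\<Union>j\<in>{k0..N}. T j) = Q" using T_Q T_cover by auto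
  finally show ?thesis .
qed

lemma young1: "ennreal (norm (b y)) \<le> 1 + bp y"
  using young_powr_ennreal[of 1 "norm (b y)" p] p by (simp add: bp_def)

text \<open>The parent of a stopping cell is not bad, so doubling gives the bound. At the top
  generation, where the parent is out of reach, the L^p bound for \<open>b\<close> takes over,
  because C0 <= \<Lambda>.\<close>

lemma navg_T: assumes j: "j \<in> {k0..N}" and y: "y \<in> T j" shows "navg j bp y \<le> ennreal (Cd * \<Lambda>)"
proof (cases "j = k0")
  case True
  have "navg k0 bp x0 \<le> ennreal C0"
  proof (rule navg_le[OF k0(1) x0])
    have "(\<integral>\<^sup>+y. bp y * indicator Q y \<partial>\<sigma>) \<le> (\<integral>\<^sup>+y. bp y \<partial>\<sigma>)"
      by (intro nn_integral_mono) (auto split: split_indicator)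
    also have "\<dots> \<le> ennreal C0 * S" using b_p by (simp add: bp_def)
    finally show "(\<integral>\<^sup>+y. bp y * indicator Q y \<partial>\<sigma>) \<le> ennreal C0 * S" .
  qed
  also have "navg k0 bp x0 = navg j bp y" using True navg_cong[OF k0(1) x0 T_Q[OF y]] by simp
  also have "C0 \<le> Cd * \<Lambda>" using const_pos Cd mult_right_mono[of 1 Cd \<Lambda>] by linarith
  finally show ?thesis by (simp add: ennreal_leI)
next
  case False
  have K: "j - 1 \<in> K" "j \<in> K" using levelK j False by auto
  have ys: "y \<in> space \<sigma>" using Q_space T_Q y by blast
  have nb: "\<not> Bad (j - 1) y" using y j False by (auto simp: T_def stopset_def)
  show ?thesis
  proof (rule navg_le[OF K(2) ys])
    have "(\<integral>\<^sup>+z. bp z * indicator (cell j y) z \<partial>\<sigma>) \<le> (\<integral>\<^sup>+z. bp z * indicator (cell (j-1) y) z \<partial>\<sigma>)"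
      using cell_mono[OF K(1) _ ys, of j] by (intro nn_integral_mono) (auto split: split_indicator)
    also have "\<dots> = navg (j-1) bp y * emeasure \<sigma> (cell (j-1) y)"
      by (rule navg_mult[OF K(1) ys, symmetric])
    also have "\<dots> \<le> ennreal \<Lambda> * (ennreal Cd * emeasure \<sigma> (cell j y))"
      using nb doubling[OF K(1) ys] by (intro mult_mono) (auto simp: Bad_def)
    also have "\<dots> = ennreal (Cd * \<Lambda>) * emeasure \<sigma> (cell j y)"
      using Cd const_pos by (simp add: ennreal_mult ac_simps)
    finally show "(\<integral>\<^sup>+z. bp z * indicator (cell j y) z \<partial>\<sigma>)
      \<le> ennreal (Cd * \<Lambda>) * emeasure \<sigma> (cell j y)" .
  qed
qed

text \<open>By |b| <= 1 + |b|^p the averages of |b|^p control those of |b|.\<close>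

lemma avg_T: assumes j: "j \<in> {k0..N}" and y: "y \<in> T j" shows "norm (avg j b y) \<le> G"
proof -
  have K: "j \<in> K" using levelK j by auto
  have ys: "y \<in> space \<sigma>" using Q_space T_Q y by blast
  have [measurable]: "cell j y \<in> sets \<sigma>" by (rule cell_sets[OF K ys])
  have "ennreal (norm (avg j b y)) \<le> navg j (\<lambda>y. ennreal (norm (b y))) y"
    by (rule norm_avg_le[OF lb K ys])
  also have "\<dots> \<le> ennreal G"
  proof (rule navg_le[OF K ys])
    have "(\<integral>\<^sup>+z. ennreal (norm (b z)) * indicator (cell j y) z \<partial>\<sigma>)
      \<le> (\<integral>\<^sup>+z. indicator (cell j y) z + bp z * indicator (cell j y) z \<partial>\<sigma>)"
      using young1 by (intro nn_integral_mono) (auto split: split_indicator)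
    also have "\<dots> = emeasure \<sigma> (cell j y) + navg j bp y * emeasure \<sigma> (cell j y)"
      unfolding navg_mult[OF K ys] by (subst nn_integral_add) auto
    also have "\<dots> \<le> emeasure \<sigma> (cell j y) + ennreal (Cd * \<Lambda>) * emeasure \<sigma> (cell j y)"
      by (intro add_left_mono mult_right_mono navg_T[OF j y]) auto
    also have "\<dots> = ennreal G * emeasure \<sigma> (cell j y)"
      using Cd const_pos by (simp add: GG_def distrib_right)
    finally show "(\<integral>\<^sup>+z. ennreal (norm (b z)) * indicator (cell j y) z \<partial>\<sigma>)
      \<le> ennreal G * emeasure \<sigma> (cell j y)" .
  qed
  finally show ?thesis using const_pos by simp
qed

lemma bp_T: assumes j: "j \<in> {k0..N}"
  shows "(\<integral>\<^sup>+y. bp y * indicator (T j) y \<partial>\<sigma>) \<le> ennreal (Cd * \<Lambda>) * emeasure \<sigma> (T j)"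
proof -
  have K: "j \<in> K" using levelK j by auto
  have "(\<integral>\<^sup>+y. bp y * indicator (T j) y \<partial>\<sigma>) \<le> (\<integral>\<^sup>+y. ennreal (Cd * \<Lambda>) * indicator (T j) y \<partial>\<sigma>)"
  proof (rule nn_integral_cells_mono[OF K T_sat[OF j]])
    fix y assume y: "y \<in> T j"
    have ys: "y \<in> space \<sigma>" using Q_space T_Q y by blast
    have "(\<integral>\<^sup>+z. bp z * indicator (cell j y) z \<partial>\<sigma>) = navg j bp y * emeasure \<sigma> (cell j y)"
      by (rule navg_mult[OF K ys, symmetric])
    also have "\<dots> \<le> ennreal (Cd * \<Lambda>) * emeasure \<sigma> (cell j y)"
      by (intro mult_right_mono navg_T[OF j y]) auto
    finally show "(\<integral>\<^sup>+z. bp z * indicator (cell j y) z \<partial>\<sigma>)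
      \<le> (\<integral>\<^sup>+z. ennreal (Cd * \<Lambda>) * indicator (cell j y) z \<partial>\<sigma>)"
      using cell_sets[OF K ys] by (simp add: nn_integral_cmult_indicator)
  qed auto
  then show ?thesis using T_sets[OF j] by (simp add: nn_integral_cmult_indicator)
qed

text \<open>Good and bad part of \<open>b\<close> on \<open>Q\<close>; \<open>T j\<close> is the union of the stopping cells of generation
  \<open>j\<close>.\<close>

definition g :: "'a \<Rightarrow> complex" where
  "g y = (\<Sum>j\<in>{k0..N}. indicat_real (T j) y *\<^sub>R avg j b y)"

definition \<beta> :: "int \<Rightarrow> 'a \<Rightarrow> complex" where
  "\<beta> j y = indicat_real (T j) y *\<^sub>R b y - indicat_real (T j) y *\<^sub>R avg j b y"

lemma g_measurable [measurable]: "g \<in> borel_measurable \<sigma>"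
  unfolding g_def[abs_def] using levelK by (intro borel_measurable_sum borel_measurable_scaleR) auto

lemma g_T: "j \<in> {k0..N} \<Longrightarrow> y \<in> T j \<Longrightarrow> g y = avg j b y"
  unfolding g_def by (subst sum_T[of j]) auto

lemma g_off: "y \<notin> Q \<Longrightarrow> g y = 0"
  unfolding g_def using T_Q[of y] by (intro sum.neutral) (auto simp: indicator_def)

lemma g_bound: "norm (g y) \<le> G * indicat_real Q y"
proof (cases "y \<in> Q")
  case True
  then obtain j where "j \<in> {k0..N}" "y \<in> T j" using T_cover by blast
  then show ?thesis using True avg_T[of j y] g_T[of j y] by simp
qed (simp add: g_off)

lemma g_L2: "(\<integral>\<^sup>+y. sq g y \<partial>\<sigma>) \<le> ennreal (G\<^sup>2) * S"
proof -
  have "(\<integral>\<^sup>+y. sq g y \<partial>\<sigma>) \<le> (\<integral>\<^sup>+y. ennreal (G\<^sup>2) * indicator Q y \<partial>\<sigma>)"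
  proof (rule nn_integral_mono)
    fix y
    have "(norm (g y))\<^sup>2 \<le> (G * indicat_real Q y)\<^sup>2" by (intro power_mono g_bound) simp
    then show "sq g y \<le> ennreal (G\<^sup>2) * indicator Q y"
      by (cases "y \<in> Q") (auto intro: ennreal_leI simp: g_off)
  qed
  then show ?thesis by (simp add: nn_integral_cmult_indicator)
qed

lemma S_fin: "S < \<infinity>" and S_pos: "S \<noteq> 0"
  using cell_fin[OF k0(1) x0] cell_pos[OF k0(1) x0] by (auto simp: less_top)

lemma g_fin: "(\<integral>\<^sup>+y. sq g y \<partial>\<sigma>) < \<infinity>"
proof -
  have "ennreal (G\<^sup>2) * S < \<infinity>" using S_fin by (simp add: ennreal_mult_less_top)
  with g_L2 show ?thesis by (rule le_less_trans)
qed

lemma adm_bounded_on_Q: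
  assumes "v \<in> borel_measurable \<sigma>" "\<And>y. y \<in> space \<sigma> \<Longrightarrow> norm (v y) \<le> c * indicat_real Q y"
  shows "adm v"
proof (rule adm_of_bound[of v "\<lambda>y. ennreal c * indicator Q y" 0])
  show "(\<integral>\<^sup>+y. ennreal c * indicator Q y \<partial>\<sigma>) < \<infinity>"
    using S_fin by (simp add: nn_integral_cmult_indicator ennreal_mult_less_top)
  show "ennreal (norm (v y)) \<le> ennreal 0 + ennreal c * indicator Q y" if "y \<in> space \<sigma>" for y
    using assms(2)[OF that] by (cases "y \<in> Q") (auto intro: ennreal_leI)
qed (use assms in auto)

lemma g_adm: "adm g" by (rule adm_bounded_on_Q[OF g_measurable g_bound])

lemma avgT_adm: assumes j: "j \<in> {k0..N}" shows "adm (\<lambda>y. indicat_real (T j) y *\<^sub>R avg j b y)"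
proof (rule adm_bounded_on_Q[of _ G])
  show "(\<lambda>y. indicat_real (T j) y *\<^sub>R avg j b y) \<in> borel_measurable \<sigma>"
    using levelK j by (intro borel_measurable_scaleR) auto
  show "norm (indicat_real (T j) y *\<^sub>R avg j b y) \<le> G * indicat_real Q y" for y
    using avg_T[OF j, of y] T_Q[of y j] const_pos by (auto split: split_indicator)
qed

lemma \<beta>_adm: "j \<in> {k0..N} \<Longrightarrow> adm (\<beta> j)"
  unfolding \<beta>_def[abs_def] by (intro adm_diff adm_indicator avgT_adm b T_sets)

lemma \<beta>_measurable [measurable]: "j \<in> {k0..N} \<Longrightarrow> \<beta> j \<in> borel_measurable \<sigma>"
  using adm_measurable[OF \<beta>_adm] .

lemma \<beta>_off: "y \<notin> T j \<Longrightarrow> \<beta> j y = 0" by (simp add: \<beta>_def)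

lemma avg_\<beta>: assumes j: "j \<in> {k0..N}" and z: "z \<in> space \<sigma>" shows "avg j (\<beta> j) z = 0"
proof -
  have K: "j \<in> K" using levelK j by auto
  show ?thesis
  proof (cases "z \<in> T j")
    case True
    have "avg j (\<beta> j) z = avg j (\<lambda>y. b y - avg j b y) z"
    proof -
      have "(LINT y:cell j z|\<sigma>. \<beta> j y) = (LINT y:cell j z|\<sigma>. b y - avg j b y)"
        using saturatedD[OF T_sat[OF j] True] cell_sets[OF K z]
        by (intro set_lebesgue_integral_cong) (auto simp: \<beta>_def)
      then show ?thesis by (simp add: avg_def)
    qed
    also have "\<dots> = 0" using avg_diff[OF lb locint_avg[OF lb K] K z] avg_self[OF K z] by simp
    finally show ?thesis .
  next
    case False
    then have "\<beta> j y = 0" if "y \<in> cell j z" for y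
      using saturated_iff[OF K T_sat[OF j] z that] by (simp add: \<beta>_off)
    then show ?thesis by (rule avg_const[OF K z])
  qed
qed

lemma decomp: "y \<in> space \<sigma> \<Longrightarrow> b y = indicat_real (space \<sigma> - Q) y *\<^sub>R b y
  + (g y + (\<Sum>j\<in>{k0..N}. \<beta> j y))"
proof (cases "y \<in> Q")
  case True
  then obtain j where j: "j \<in> {k0..N}" "y \<in> T j" using T_cover by blast
  have s1: "(\<Sum>i\<in>{k0..N}. \<beta> i y) = \<beta> j y" by (rule sum_T[OF j]) (simp add: \<beta>_off)
  have s2: "\<beta> j y = b y - avg j b y" unfolding \<beta>_def using j(2) by simp
  show ?thesis unfolding s1 s2 g_T[OF j] using True by simp
next
  case False
  have "(\<Sum>i\<in>{k0..N}. \<beta> i y) = 0" using False T_Q[of y] by (intro sum.neutral ballI \<beta>_off) blast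
  moreover assume "y \<in> space \<sigma>"
  ultimately show ?thesis using False g_off by simp
qed

text \<open>The points of the cube at which the dyadic maximal function of |b|^p over the window is
  at most \<Lambda>.\<close>

definition good :: "'a \<Rightarrow> bool" where "good x \<longleftrightarrow> x \<in> Q \<and> (\<forall>i\<in>{k0..N}. \<not> Bad i x)"

text \<open>For j < k <= N membership in \<open>T j\<close> means badness rather than the default
  assignment to N, and badness at generation j is shared by all points of the common cell, among
  them x.\<close>

lemma good_T_level:
  assumes x: "good x" and k: "k \<in> {k0..N}" and j: "j \<in> {k0..N}" and y: "y \<in> cell k x" "y \<in> T j"
  shows "k \<le> j"
proof (rule ccontr)
  assume "\<not> k \<le> j"
  then have jk: "j < k" by simp
  have xs: "x \<in> space \<sigma>" using x Q_space by (simp add: good_def)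
  have "Bad j y" using y(2) jk k by (auto simp: T_def stopset_def)
  moreover have "y \<in> cell j x" using cell_mono[OF levelK _ xs, of j k] jk j y(1) by auto
  ultimately have "Bad j x" using Bad_cong[OF _ xs, of j y] j by simp
  then show False using x j by (simp add: good_def)
qed

text \<open>Otherwise x and y would share a bad cell.\<close>

lemma good_T_off:
  assumes x: "good x" and k: "k \<in> {k0..N}" and j: "j \<in> {k0..N}" "j < k" and y: "y \<in> T j"
  shows "y \<notin> cell j x"
proof
  assume "y \<in> cell j x"
  have xs: "x \<in> space \<sigma>" using x Q_space by (simp add: good_def)
  have "Bad j y" using y j k by (auto simp: T_def stopset_def)
  then have "Bad j x" using Bad_cong[OF _ xs \<open>y \<in> cell j x\<close>] j by simp
  then show False using x j by (simp add: good_def)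
qed

text \<open>Each \<open>\<beta> j\<close> has mean zero on the cell of a good point: for k <= j by
  its cancellation, for j < k because it vanishes on that cell.\<close>

lemma avg_g:
  assumes x: "good x" and k: "k \<in> {k0..N}"
  shows "avg k g x = avg k b x"
proof -
  have K: "k \<in> K" using levelK k by auto
  have xs: "x \<in> space \<sigma>" using x Q_space by (simp add: good_def)
  have la: "locint (\<lambda>y. \<Sum>j\<in>J. \<beta> j y)" if "J \<subseteq> {k0..N}" for J
    using finite_subset[OF that finite_atLeastAtMost_int] that
  proof (induction J rule: finite_induct)
    case empty then show ?case by (simp add: locint_const)
  next
    case (insert a J) then show ?case by (simp add: locint_add adm_locint \<beta>_adm)
  qed
  have z: "avg k (\<beta> j) x = 0" if j: "j \<in> {k0..N}" for j
  proof (cases "k \<le> j")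
    case True
    show ?thesis
      by (rule avg_cells_zero[OF adm_locint[OF \<beta>_adm[OF j]] K True xs])
        (use avg_\<beta>[OF j] cell_subset[OF K xs] in blast)
  next
    case False
    have "\<beta> j y = 0" if "y \<in> cell k x" for y
      using good_T_level[OF x k j that] False by (intro \<beta>_off) blast
    then show ?thesis by (rule avg_const[OF K xs])
  qed
  have zs: "avg k (\<lambda>y. \<Sum>j\<in>J. \<beta> j y) x = 0" if "J \<subseteq> {k0..N}" for J
    using finite_subset[OF that finite_atLeastAtMost_int] that
  proof (induction J rule: finite_induct)
    case empty then show ?case using avg_const[OF K xs, of "\<lambda>_. 0" 0] by simp
  next
    case (insert a J)
    then show ?case
      using avg_add[OF adm_locint[OF \<beta>_adm] la K xs, of a J] z by simp
  qed
  have sub: "cell k x \<subseteq> Q"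
    using saturatedD[OF saturated_cell[OF k0(1) _ x0, of k]] x k by (auto simp: good_def)
  have "avg k b x = avg k (\<lambda>y. g y + (\<Sum>j\<in>{k0..N}. \<beta> j y)) x"
  proof -
    have "b y = g y + (\<Sum>j\<in>{k0..N}. \<beta> j y)" if "y \<in> cell k x" for y
      using decomp[OF Q_space[of y]] sub that by auto
    then have "(LINT y:cell k x|\<sigma>. b y) = (LINT y:cell k x|\<sigma>. g y + (\<Sum>j\<in>{k0..N}. \<beta> j y))"
      using cell_sets[OF K xs] by (intro set_lebesgue_integral_cong) auto
    then show ?thesis by (simp add: avg_def)
  qed
  also have "\<dots> = avg k g x"
    using avg_add[OF adm_locint[OF g_adm] la[OF order_refl] K xs] zs[OF order_refl] by simp
  finally show ?thesis by simp
qed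

text \<open>Errors at scale \<open>k\<close> caused by \<open>b\<close> outside \<open>Q\<close> and by \<open>\<beta> j\<close>. For \<open>k \<le> j\<close> the gain comes
  from the cancellation of \<open>\<beta> j\<close>; for \<open>j < k\<close> good points lie outside \<open>T j\<close>, and so the kernel
  has to cross the boundary of a cell.\<close>

definition e :: "int \<Rightarrow> 'a \<Rightarrow> ennreal" where
  "e k x = pint k (\<lambda>y. ennreal (norm (b y)) * off k0 x y) x"

definition h :: "int \<Rightarrow> int \<Rightarrow> 'a \<Rightarrow> ennreal" where
  "h k j x = (if k \<le> j then ennreal (q ^ nat (j - k)) * pint k (\<lambda>y. ennreal (norm (\<beta> j y))) x
     else pint k (\<lambda>y. ennreal (norm (\<beta> j y)) * off j x y) x)"

lemma e_measurable: "k \<in> {k0..N} \<Longrightarrow> e k \<in> borel_measurable \<sigma>"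
  unfolding e_def[abs_def] using levelK k0 by (intro pint2_measurable) auto

lemma h_measurable: assumes k: "k \<in> {k0..N}" "j \<in> {k0..N}" shows "h k j \<in> borel_measurable \<sigma>"
proof -
  have K: "k \<in> K" "j \<in> K" using levelK k by auto
  have [measurable]: "\<beta> j \<in> borel_measurable \<sigma>" using \<beta>_measurable k by simp
  have "(\<lambda>x. pint k (\<lambda>y. ennreal (norm (\<beta> j y)) * off j x y) x) \<in> borel_measurable \<sigma>"
    using K by (intro pint2_measurable) auto
  then show ?thesis unfolding h_def[abs_def] using K by (cases "k \<le> j") auto
qed

text \<open>Split b into its part outside the cube, \<open>g\<close> and the
  \<open>\<beta> j\<close>. At a good point \<open>g\<close> and b have the same average c, so
  \<open>\<Theta> g\<close> is c times \<open>\<Theta> 1\<close> up to the remainder of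
  \<open>g\<close>, and every other term is an error.\<close>

lemma good_pointwise:
  assumes x: "good x" and k: "k \<in> {k0..N}" and Y: "Y \<in> U k (cell k x)"
    and \<rho>: "ennreal (norm (\<Theta> (\<lambda>y. g y - avg k g x) Y)) \<le> R"
  shows "ennreal (norm (avg k b x * \<Theta> (\<lambda>y. 1) Y))
    \<le> ennreal (norm (\<Theta> b Y)) + (e k x + (\<Sum>j\<in>{k0..N}. h k j x) + R)"
proof -
  have K: "k \<in> K" using levelK k by auto
  have xs: "x \<in> space \<sigma>" and xQ: "x \<in> Q" using x Q_space by (auto simp: good_def)
  define c where "c = avg k b x"
  have cg: "avg k g x = c" using avg_g[OF x k] by (simp add: c_def)
  define v where "v y = indicat_real (space \<sigma> - Q) y *\<^sub>R b y" for y
  have av: "adm v" unfolding v_def by (rule adm_indicator[OF b]) auto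
  have as: "adm (\<lambda>y. \<Sum>j\<in>J. \<beta> j y)" if "J \<subseteq> {k0..N}" for J
    using finite_subset[OF that finite_atLeastAtMost_int] that
  proof (induction J rule: finite_induct)
    case empty then show ?case by (simp add: adm_const)
  next
    case (insert a J) then show ?case by (simp add: adm_add \<beta>_adm)
  qed
  have "\<Theta> b Y = \<Theta> (\<lambda>y. v y + (g y + (\<Sum>j\<in>{k0..N}. \<beta> j y))) Y"
    unfolding \<Theta>_def using decomp by (intro Bochner_Integration.integral_cong) (auto simp: v_def)
  also have "\<dots> = \<Theta> v Y + (\<Theta> g Y + (\<Sum>j\<in>{k0..N}. \<Theta> (\<beta> j) Y))"
    using \<Theta>_add[OF av adm_add[OF g_adm as[OF order_refl]] K xs Y] \<Theta>_add[OF g_adm as[OF order_refl] K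
      xs Y]
      \<Theta>_sum[OF _ \<beta>_adm K xs Y, of "{k0..N}"] by simp
  \<comment> \<open>Solved for the main term; the difference with the constant c brings in
    \<open>\<Theta> 1\<close>.\<close>
  finally have eq: "c * \<Theta> (\<lambda>y. 1) Y = \<Theta> b Y - (\<Theta> v Y + (\<Sum>j\<in>{k0..N}. \<Theta> (\<beta> j) Y) + \<Theta> (\<lambda>y. g y - c) Y)"
    using \<Theta>_diff[OF g_adm adm_const K xs Y, of c] \<Theta>_const[of c Y] by simp
  have "norm (c * \<Theta> (\<lambda>y. 1) Y)
    \<le> norm (\<Theta> b Y) + norm (\<Theta> v Y + (\<Sum>j\<in>{k0..N}. \<Theta> (\<beta> j) Y) + \<Theta> (\<lambda>y. g y - c) Y)"
    unfolding eq by (rule norm_triangle_ineq4)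
  also have "\<dots> \<le> norm (\<Theta> b Y) + (norm (\<Theta> v Y) + (\<Sum>j\<in>{k0..N}. norm (\<Theta> (\<beta> j) Y))
    + norm (\<Theta> (\<lambda>y. g y - c) Y))"
    by (intro add_left_mono order_trans[OF norm_triangle_ineq] add_mono norm_sum order_refl)
  finally have "ennreal (norm (c * \<Theta> (\<lambda>y. 1) Y))
    \<le> ennreal (norm (\<Theta> b Y) + (norm (\<Theta> v Y) + (\<Sum>j\<in>{k0..N}. norm (\<Theta> (\<beta> j) Y)) + norm
    (\<Theta> (\<lambda>y. g y - c) Y)))"
    by (rule ennreal_leI)
  also have "\<dots> = ennreal (norm (\<Theta> b Y))
    + (ennreal (norm (\<Theta> v Y)) + (\<Sum>j\<in>{k0..N}. ennreal (norm (\<Theta> (\<beta> j) Y))) + ennreal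
    (norm (\<Theta> (\<lambda>y. g y - c) Y)))"
    by (simp add: sum_nonneg sum_ennreal)
  also have "\<dots> \<le> ennreal (norm (\<Theta> b Y)) + (e k x + (\<Sum>j\<in>{k0..N}. h k j x) + R)"
  proof (intro add_mono order_refl sum_mono)
    have "ennreal (norm (\<Theta> v Y)) \<le> pint k (\<lambda>y. ennreal (norm (v y))) x"
      by (rule \<Theta>_le[OF adm_measurable[OF av] K xs Y])
    also have "\<dots> \<le> e k x" unfolding e_def
      by (rule pint_mono) (auto simp: v_def off_def cell_cong[OF k0(1) x0 xQ] split:
        split_indicator)
    finally show "ennreal (norm (\<Theta> v Y)) \<le> e k x" .
    show "ennreal (norm (\<Theta> (\<lambda>y. g y - c) Y)) \<le> R" using \<rho> cg by simp
    fix j assume j: "j \<in> {k0..N}"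
    show "ennreal (norm (\<Theta> (\<beta> j) Y)) \<le> h k j x"
    proof (cases "k \<le> j")
      case True
      then show ?thesis unfolding h_def using \<Theta>_fine[OF \<beta>_adm[OF j] True avg_\<beta>[OF j] K xs Y] by simp
    next
      case False
      have "ennreal (norm (\<Theta> (\<beta> j) Y)) \<le> pint k (\<lambda>y. ennreal (norm (\<beta> j y))) x"
        by (rule \<Theta>_le[OF \<beta>_measurable[OF j] K xs Y])
      also have "\<dots> \<le> pint k (\<lambda>y. ennreal (norm (\<beta> j y)) * off j x y) x"
      proof (rule pint_mono)
        fix y assume y: "y \<in> space \<sigma>"
        show "ennreal (norm (\<beta> j y)) \<le> ennreal (norm (\<beta> j y)) * off j x y"
        proof (cases "y \<in> T j")
          case True
          then have "off j x y = 1" using good_T_off[OF x k j _ True] False y by (simp add: off_def)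
          then show ?thesis by simp
        qed (simp add: \<beta>_off)
      qed
      finally show ?thesis using False by (simp add: h_def)
    qed
  qed
  finally show ?thesis by (simp add: c_def)
qed

end

lemma ennreal_triple_mult:
  "0 \<le> a \<Longrightarrow> 0 \<le> c \<Longrightarrow> ennreal a * (ennreal c * X) = ennreal (a * c) * X"
  by (simp add: ennreal_mult mult.assoc)

text \<open>Allows \<open>L\<^sup>1\<close> bounds of the errors to replace \<open>L\<^sup>2\<close> bounds.\<close>

lemma sum_squares_le_square_sum:
  fixes a :: "'i \<Rightarrow> ennreal"
  assumes "finite I"
  shows "(\<Sum>i\<in>I. (a i)\<^sup>2) \<le> (\<Sum>i\<in>I. a i)\<^sup>2"
proof -
  have "(\<Sum>i\<in>I. (a i)\<^sup>2) \<le> (\<Sum>i\<in>I. a i * (\<Sum>i\<in>I. a i))"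
    unfolding power2_eq_square by (intro sum_mono mult_left_mono member_le_sum assms) auto
  then show ?thesis by (simp add: sum_distrib_right power2_eq_square)
qed

section \<open>Summing the errors in L^1\<close>

context tb_cube
begin

definition \<theta> :: real where "\<theta> = sqrt q"

lemma \<theta>: "0 < \<theta>" "\<theta> < 1" "\<theta> * \<theta> = q" "\<theta> \<le> r" "\<theta> powr (p - 1) \<le> r" "q \<le> r"
proof -
  show t: "0 < \<theta>" "\<theta> < 1" "\<theta> * \<theta> = q" using q sqrt_q by (auto simp: \<theta>_def)
  show r: "\<theta> \<le> r" "\<theta> powr (p - 1) \<le> r" using const_pos by (auto simp: \<theta>_def)
  have "\<theta> * \<theta> \<le> \<theta> * 1" using t by (intro mult_left_mono) auto
  then show "q \<le> r" using t r by simp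
qed

text \<open>\<open>Ad d\<close> is the parameter s of Young's inequality at a distance of d
  generations, and \<open>Bd d\<close> is s^(1-p).\<close>

definition Ad :: "nat \<Rightarrow> real" where "Ad d = (1 / \<theta>) ^ d"
definition Bd :: "nat \<Rightarrow> real" where "Bd d = (\<theta> powr (p - 1)) ^ d"

lemma ABd: "0 < Ad d" "0 \<le> Bd d" "Bd d \<le> r ^ d" "Ad d * q ^ d \<le> r ^ d" "q ^ d \<le> r ^ d"
proof -
  show "0 < Ad d" "0 \<le> Bd d" using \<theta> by (auto simp: Ad_def Bd_def)
  show "Bd d \<le> r ^ d" "q ^ d \<le> r ^ d" using \<theta> q unfolding Bd_def by (auto intro!: power_mono)
  have "Ad d * q ^ d = ((1 / \<theta>) * q) ^ d" by (simp only: Ad_def power_mult_distrib)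
  also have "(1 / \<theta>) * q = (1 / \<theta>) * (\<theta> * \<theta>)" by (simp only: \<theta>(3))
  also have "\<dots> = \<theta>" using \<theta>(1) by simp
  also have "\<theta> ^ d \<le> r ^ d" using \<theta> by (intro power_mono) auto
  finally show "Ad d * q ^ d \<le> r ^ d" .
qed

text \<open>The scale-dependent Young inequality: both \<open>Ad d * q ^ d\<close> and \<open>Bd d\<close> decay geometrically
  in \<open>d\<close>.\<close>

lemma young_d: "ennreal (norm (b y)) \<le> ennreal (Ad d) + ennreal (Bd d) * bp y"
proof -
  have "(1 / \<theta>) powr (1 - p) = \<theta> powr (p - 1)"
    using \<theta> by (simp add: powr_divide powr_minus_divide[symmetric])
  note eq = this
  have "((1 / \<theta>) ^ d) powr (1 - p) = (\<theta> powr (p - 1)) ^ d"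
  proof (induction d)
    case (Suc d)
    have "(1 / \<theta> * (1 / \<theta>) ^ d) powr (1 - p) = (1 / \<theta>) powr (1 - p) * ((1 / \<theta>) ^ d) powr (1 - p)"
      by (rule powr_mult)
    then show ?case by (simp only: power_Suc eq Suc.IH)
  qed simp
  then have "Ad d powr (1 - p) = Bd d" by (simp only: Ad_def Bd_def)
  then show ?thesis
    using young_powr_ennreal[OF ABd(1)[of d] norm_ge_zero p, of "b y"] by (simp add: bp_def)
qed

text \<open>Apply the scale-dependent Young inequality to b. The constant part meets the boundary
  mass of the cube, giving \<open>Ad d * q ^ d\<close>; the part with |b|^p meets Schur's bound and
  the decay of \<open>Bd d\<close>.\<close>

lemma e_integral:
  assumes k: "k \<in> {k0..N}"
  shows "(\<integral>\<^sup>+x. e k x * indicator Q x \<partial>\<sigma>) \<le> ennreal ((Cb + Cp * C0) * r ^ nat \<bar>k - k0\<bar>) * S"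
proof -
  have K: "k \<in> K" using levelK k by auto
  let ?d = "nat (k - k0)"
  have d: "nat \<bar>k - k0\<bar> = ?d" using k by simp
  have o[measurable]: "(\<lambda>x. pint k (off k0 x) x) \<in> borel_measurable \<sigma>" using k0 K by measurable
  have pb[measurable]: "pint k bp \<in> borel_measurable \<sigma>" using K by measurable
  have "e k x \<le> ennreal (Ad ?d) * pint k (off k0 x) x + ennreal (Bd ?d) * pint k bp x"
    if x: "x \<in> space \<sigma>" for x
  proof -
    have [measurable]: "off k0 x \<in> borel_measurable \<sigma>" using k0 x by measurable
    have "e k x \<le> pint k (\<lambda>y. ennreal (Ad ?d) * off k0 x y + ennreal (Bd ?d) * bp y) x"
      unfolding e_def using young_d by (intro pint_mono) (auto simp: off_def split: split_indicator)
    also have "\<dots> = pint k (\<lambda>y. ennreal (Ad ?d) * off k0 x y) x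
      + pint k (\<lambda>y. ennreal (Bd ?d) * bp y) x"
      by (rule pint_add[OF K x]) measurable
    also have "\<dots> = ennreal (Ad ?d) * pint k (off k0 x) x + ennreal (Bd ?d) * pint k bp x"
      by (intro arg_cong2[of _ _ _ _ "(+)"] pint_cmult[OF K x]) measurable
    finally show ?thesis .
  qed
  then have "(\<integral>\<^sup>+x. e k x * indicator Q x \<partial>\<sigma>)
    \<le> (\<integral>\<^sup>+x. ennreal (Ad ?d) * (1 * pint k (off k0 x) x * indicator Q x) + ennreal (Bd ?d) * pint k
    bp x \<partial>\<sigma>)"
    by (intro nn_integral_mono) (auto split: split_indicator)
  also have "\<dots> = ennreal (Ad ?d) * (\<integral>\<^sup>+x. 1 * pint k (off k0 x) x * indicator Q x \<partial>\<sigma>)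
    + ennreal (Bd ?d) * (\<integral>\<^sup>+x. pint k bp x \<partial>\<sigma>)"
    by (simp add: nn_integral_add nn_integral_cmult)
  also have "\<dots> \<le> ennreal (Ad ?d) * (ennreal (Cb * q ^ ?d) * (\<integral>\<^sup>+x. 1 * indicator Q x \<partial>\<sigma>))
    + ennreal (Bd ?d) * (ennreal Cp * (ennreal C0 * S))"
  proof (intro add_mono mult_left_mono boundary_weight)
    have "(\<integral>\<^sup>+x. pint k bp x \<partial>\<sigma>) \<le> ennreal Cp * (\<integral>\<^sup>+x. bp x \<partial>\<sigma>)" by (rule schur[OF K]) measurable
    also have "\<dots> \<le> ennreal Cp * (ennreal C0 * S)" using b_p
      by (intro mult_left_mono) (auto simp: bp_def)
    finally show "(\<integral>\<^sup>+x. pint k bp x \<partial>\<sigma>) \<le> ennreal Cp * (ennreal C0 * S)" .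
  qed (use k0 k x0 saturated_cell[OF k0(1) order_refl x0] in auto)
  also have "\<dots> = ennreal (Ad ?d * (Cb * q ^ ?d)) * S + ennreal (Bd ?d * (Cp * C0)) * S"
    using ABd[of ?d] cpos q C0 by (simp add: ennreal_triple_mult less_imp_le)
  also have "\<dots> = ennreal (Ad ?d * (Cb * q ^ ?d) + Bd ?d * (Cp * C0)) * S"
    using ABd[of ?d] cpos q C0 by (simp add: distrib_right less_imp_le)
  also have "\<dots> \<le> ennreal ((Cb + Cp * C0) * r ^ nat \<bar>k - k0\<bar>) * S"
  proof (intro mult_right_mono ennreal_leI)
    have "Cb * (Ad ?d * q ^ ?d) + (Cp * C0) * Bd ?d \<le> Cb * r ^ ?d + (Cp * C0) * r ^ ?d"
      using ABd[of ?d] cpos C0 by (intro add_mono mult_left_mono) auto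
    then show "Ad ?d * (Cb * q ^ ?d) + Bd ?d * (Cp * C0) \<le> (Cb + Cp * C0) * r ^ nat \<bar>k - k0\<bar>"
      unfolding d by (simp add: algebra_simps)
  qed auto
  finally show ?thesis .
qed

lemma norm_\<beta>:
  assumes j: "j \<in> {k0..N}"
  shows "ennreal (norm (\<beta> j y)) \<le> (ennreal (norm (b y)) + ennreal G) * indicator (T j) y"
proof (cases "y \<in> T j")
  case True
  have "norm (\<beta> j y) \<le> norm (b y) + G"
    using True avg_T[OF j True] norm_triangle_ineq4[of "b y" "avg j b y"] by (simp add: \<beta>_def)
  then show ?thesis using True const_pos
    by (simp add: ennreal_plus[symmetric] ennreal_leI del: ennreal_plus)
qed (simp add: \<beta>_off)

text \<open>For k <= j the factor q^(j-k) is already there, and Young's inequality with s = 1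
  suffices. For j < k the variables are exchanged; then |b| is split with the parameter of distance
  k - j, the constant part meeting the boundary mass and |b|^p only the total mass.\<close>

lemma h_integral:
  assumes k: "k \<in> {k0..N}" and j: "j \<in> {k0..N}"
  shows "(\<integral>\<^sup>+x. h k j x \<partial>\<sigma>) \<le> ennreal (Ch p C0 Cd * r ^ nat \<bar>k - j\<bar>) * emeasure \<sigma> (T j)"
proof -
  have K: "k \<in> K" "j \<in> K" using levelK k j by auto
  have [measurable]: "T j \<in> sets \<sigma>" "\<beta> j \<in> borel_measurable \<sigma>" using j by auto
  let ?t = "emeasure \<sigma> (T j)" and ?L = "Cd * \<Lambda>"
  have L0: "0 \<le> ?L" using Cd const_pos by simp
  show ?thesis
  proof (cases "k \<le> j")
    case True
    let ?d = "nat (j - k)"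
    have d: "nat \<bar>k - j\<bar> = ?d" using True by simp
    have "(\<integral>\<^sup>+x. h k j x \<partial>\<sigma>) = ennreal (q ^ ?d) * (\<integral>\<^sup>+x. pint k (\<lambda>y. ennreal (norm (\<beta> j y))) x \<partial>\<sigma>)"
      unfolding h_def using True K by (simp add: nn_integral_cmult)
    also have "\<dots> \<le> ennreal (q ^ ?d) * (ennreal Cp * (\<integral>\<^sup>+y. ennreal (norm (\<beta> j y)) \<partial>\<sigma>))"
      by (intro mult_left_mono schur K) auto
    also have "(\<integral>\<^sup>+y. ennreal (norm (\<beta> j y)) \<partial>\<sigma>)
      \<le> (\<integral>\<^sup>+y. ennreal (1 + G) * indicator (T j) y + bp y * indicator (T j) y \<partial>\<sigma>)"
    proof (rule nn_integral_mono)
      fix y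
      have "ennreal (norm (\<beta> j y)) \<le> (ennreal (norm (b y)) + ennreal G) * indicator (T j) y"
        by (rule norm_\<beta>[OF j])
      also have "\<dots> \<le> ((1 + bp y) + ennreal G) * indicator (T j) y"
        by (intro mult_right_mono add_right_mono young1) auto
      also have "\<dots> = ennreal (1 + G) * indicator (T j) y + bp y * indicator (T j) y"
        using const_pos by (simp add: distrib_right ac_simps)
      finally show "ennreal (norm (\<beta> j y)) \<le> ennreal (1 + G) * indicator (T j) y
        + bp y * indicator (T j) y" .
    qed
    also have "\<dots> = ennreal (1 + G) * ?t + (\<integral>\<^sup>+y. bp y * indicator (T j) y \<partial>\<sigma>)"
      by (subst nn_integral_add) (auto simp: nn_integral_cmult_indicator)
    also have "\<dots> \<le> ennreal (1 + G) * ?t + ennreal ?L * ?t" by (intro add_left_mono bp_T j)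
    also have "\<dots> = ennreal (2 * G) * ?t"
    proof -
      have "ennreal (1 + G) * ?t + ennreal ?L * ?t = ennreal ((1 + G) + ?L) * ?t"
        using const_pos L0 by (subst ennreal_plus[of "1 + G"]) (auto simp: distrib_right)
      moreover have "(1 + G) + ?L = 2 * G" by (simp add: GG_def)
      ultimately show ?thesis by simp
    qed
    finally have "(\<integral>\<^sup>+x. h k j x \<partial>\<sigma>) \<le> ennreal (q ^ ?d) * (ennreal Cp * (ennreal (2 * G) * ?t))"
      by (simp add: mult_left_mono)
    also have "\<dots> = ennreal (q ^ ?d * (Cp * (2 * G))) * ?t"
      using q cpos const_pos by (simp add: ennreal_triple_mult less_imp_le)
    also have "\<dots> \<le> ennreal (Ch p C0 Cd * r ^ nat \<bar>k - j\<bar>) * ?t"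
    proof (intro mult_right_mono ennreal_leI)
      have "q ^ ?d * (Cp * (2 * G)) \<le> r ^ ?d * Ch p C0 Cd"
        using ABd[of ?d] cpos const_pos L0 q unfolding Ch_def by (intro mult_mono) auto
      then show "q ^ ?d * (Cp * (2 * G)) \<le> Ch p C0 Cd * r ^ nat \<bar>k - j\<bar>" unfolding d
        by (simp add: mult.commute)
    qed auto
    finally show ?thesis .
  next
    case False
    let ?d = "nat (k - j)"
    have d: "nat \<bar>k - j\<bar> = ?d" and jk: "j \<le> k" using False by auto
    \<comment> \<open>The kernel mass leaving the cell of y. It is bounded by the total mass, and
      its integral over \<open>T j\<close> decays.\<close>
    let ?w = "\<lambda>y. pint k (off j y) y"
    have wm[measurable]: "?w \<in> borel_measurable \<sigma>" using K by measurable
    have "(\<integral>\<^sup>+x. h k j x \<partial>\<sigma>) = (\<integral>\<^sup>+x. pint k (\<lambda>y. ennreal (norm (\<beta> j y)) * off j x y) x \<partial>\<sigma>)"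
      unfolding h_def using False by simp
    also have "\<dots> = (\<integral>\<^sup>+y. ennreal (norm (\<beta> j y)) * ?w y \<partial>\<sigma>)"
      by (rule swap_off[OF K(2,1)]) measurable
    also have "\<dots> \<le> (\<integral>\<^sup>+y. ennreal (Ad ?d + G) * (1 * ?w y * indicator (T j) y)
      + ennreal (Bd ?d * Cp) * (bp y * indicator (T j) y) \<partial>\<sigma>)"
    proof (rule nn_integral_mono)
      fix y assume y: "y \<in> space \<sigma>"
      have "ennreal (norm (\<beta> j y)) * ?w y \<le> ((ennreal (norm (b y)) + ennreal G) * indicator (T j) y)
        * ?w y"
        by (intro mult_right_mono norm_\<beta>[OF j]) auto
      also have "\<dots> \<le> (((ennreal (Ad ?d) + ennreal (Bd ?d) * bp y) + ennreal G) * indicator (T j) y)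
        * ?w y"
        by (intro mult_right_mono add_right_mono young_d) auto
      also have "\<dots> = ennreal (Ad ?d + G) * (1 * ?w y * indicator (T j) y)
        + ennreal (Bd ?d) * ?w y * (bp y * indicator (T j) y)"
        using const_pos ABd[of ?d] by (simp add: distrib_right distrib_left ac_simps)
      also have "\<dots> \<le> ennreal (Ad ?d + G) * (1 * ?w y * indicator (T j) y)
        + ennreal (Bd ?d) * ennreal Cp * (bp y * indicator (T j) y)"
        by (intro add_left_mono mult_right_mono mult_left_mono pint_off_le K y) auto
      finally show "ennreal (norm (\<beta> j y)) * ?w y
        \<le> ennreal (Ad ?d + G) * (1 * ?w y * indicator (T j) y) + ennreal (Bd ?d * Cp) *
        (bp y * indicator (T j) y)"
        using ABd[of ?d] cpos by (simp add: ennreal_mult)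
    qed
    also have "\<dots> = ennreal (Ad ?d + G) * (\<integral>\<^sup>+y. 1 * ?w y * indicator (T j) y \<partial>\<sigma>)
      + ennreal (Bd ?d * Cp) * (\<integral>\<^sup>+y. bp y * indicator (T j) y \<partial>\<sigma>)"
      by (simp add: nn_integral_add nn_integral_cmult)
    also have "\<dots> \<le> ennreal (Ad ?d + G) * (ennreal (Cb * q ^ ?d) * (\<integral>\<^sup>+y. 1 * indicator (T j) y \<partial>\<sigma>))
      + ennreal (Bd ?d * Cp) * (ennreal ?L * ?t)"
      by (intro add_mono mult_left_mono boundary_weight K jk T_sat j bp_T) auto
    also have "\<dots> = ennreal ((Ad ?d + G) * (Cb * q ^ ?d)) * ?t + ennreal ((Bd ?d * Cp) * ?L) * ?t"
      using ABd[of ?d] cpos q C0 const_pos L0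
        by (simp add: ennreal_triple_mult less_imp_le add_nonneg_nonneg del: ennreal_plus)
    also have "\<dots> = ennreal ((Ad ?d + G) * (Cb * q ^ ?d) + (Bd ?d * Cp) * ?L) * ?t"
      using ABd[of ?d] cpos q C0 const_pos L0
        by (subst ennreal_plus) (auto simp: distrib_right less_imp_le intro!: mult_nonneg_nonneg
        add_nonneg_nonneg)
    also have "\<dots> \<le> ennreal (Ch p C0 Cd * r ^ nat \<bar>k - j\<bar>) * ?t"
    proof (intro mult_right_mono ennreal_leI)
      have "Cb * (Ad ?d * q ^ ?d) + (G * Cb) * q ^ ?d + (Cp * ?L) * Bd ?d
        \<le> Cb * r ^ ?d + (G * Cb) * r ^ ?d + (Cp * ?L) * r ^ ?d"
        using ABd[of ?d] cpos C0 const_pos L0 by (intro add_mono mult_left_mono) auto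
      also have "\<dots> \<le> Ch p C0 Cd * r ^ ?d"
        unfolding Ch_def using cpos const_pos by (simp add: algebra_simps)
      finally show "(Ad ?d + G) * (Cb * q ^ ?d) + (Bd ?d * Cp) * ?L \<le> Ch p C0 Cd * r ^ nat \<bar>k - j\<bar>"
        unfolding d by (simp add: algebra_simps)
    qed auto
    finally show ?thesis .
  qed
qed

lemma Ch_pos: "0 < Ch p C0 Cd"
  unfolding Ch_def using cpos const_pos Cd by (intro add_pos_pos) auto

lemma CH_pos: "0 < CH p C0 Cd"
  unfolding CH_def using cpos const_pos Cd Ch_pos CI_pos C0 by (intro add_pos_pos mult_pos_pos) auto

lemma sum_powr_r: "(\<Sum>k\<in>{k0..N}. r ^ nat \<bar>k - j\<bar>) \<le> 2 / (1 - r)"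
  by (rule sum_power_abs_diff_le) (use const_pos in auto)

lemma sum_cmult_r:
  assumes "0 \<le> c"
  shows "(\<Sum>k\<in>{k0..N}. ennreal (c * r ^ nat \<bar>k - j\<bar>) * X) \<le> ennreal (c * (2 / (1 - r))) * X"
proof -
  have "(\<Sum>k\<in>{k0..N}. ennreal (c * r ^ nat \<bar>k - j\<bar>) * X)
    = ennreal (\<Sum>k\<in>{k0..N}. c * r ^ nat \<bar>k - j\<bar>) * X"
    using assms const_pos by (simp add: sum_distrib_right[symmetric] sum_ennreal)
  also have "\<dots> \<le> ennreal (c * (2 / (1 - r))) * X"
    unfolding sum_distrib_left[symmetric]
    using assms by (intro mult_right_mono ennreal_leI mult_left_mono sum_powr_r) auto
  finally show ?thesis .
qed

text \<open>Put Young's inequality with s = \<open>s0\<close> into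
  \<open>accretive_average_le\<close> at half the lower bound. Of 1 / C0, one half goes to a and one
  quarter to |b|^p; the remaining quarter must come from s times the proportion of the set, which is
  therefore at least 1 / (4 C0 s).\<close>

lemma big_accretive_set:
  assumes u: "norm u \<le> 1" and uz: "1 / C0 \<le> Re (u * avg k0 b x0)"
  shows "ennreal \<eta> * S \<le> emeasure \<sigma> {y \<in> Q. \<forall>i\<in>{k0..N}. 1 / (2 * C0) < Re (u * avg i b y)}"
proof -
  define a where "a = 1 / (2 * C0)"
  define A where "A = {y \<in> space \<sigma>. \<forall>i\<in>{k0..N}. a < Re (u * avg i b y)}"
  have am[measurable]: "avg i b \<in> borel_measurable \<sigma>" if "i \<in> {k0..N}" for i using levelK that
    by simp
  have "A = (\<Inter>i\<in>{k0..N}. {y \<in> space \<sigma>. a < Re (u * avg i b y)})" using k0 by (auto simp: A_def)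
  also have "\<dots> \<in> sets \<sigma>" using k0 by (intro sets.finite_INT) auto
  finally have Am[measurable]: "A \<in> sets \<sigma>" .
  have a: "0 < a" "a < 1 / C0" using C0 by (auto simp: a_def field_simps)
  define s where "s = s0 p C0"
  have s: "0 < s" using const_pos by (simp add: s_def)
  \<comment> \<open>The exponent in \<open>s0\<close> is chosen to make this an identity.\<close>
  have sp: "s powr (1 - p) = 1 / (4 * C0\<^sup>2)"
  proof -
    have "1 / (p - 1) * (1 - p) = -1" using p by (simp add: field_simps)
    then have "s powr (1 - p) = (4 * C0\<^sup>2) powr (-1)" unfolding s_def s0_def powr_powr by simp
    then show ?thesis using C0 by (simp add: powr_minus_divide)
  qed
  have "ennreal (1 / C0) * S \<le> ennreal (Re (u * avg k0 b x0)) * S"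
    by (intro mult_right_mono ennreal_leI uz) auto
  also have "\<dots> \<le> (\<integral>\<^sup>+y. (ennreal a + ennreal (norm (b y)) * indicator A y) * indicator Q y \<partial>\<sigma>)"
    unfolding A_def by (rule accretive_average_le[OF k0(1) lb x0 _ u]) (use a uz in auto)
  also have "\<dots> \<le> (\<integral>\<^sup>+y. (ennreal a * indicator Q y + ennreal s * indicator (A \<inter> Q) y)
    + ennreal (1 / (4 * C0\<^sup>2)) * bp y \<partial>\<sigma>)"
  proof (rule nn_integral_mono)
    fix y
    have "ennreal (norm (b y)) \<le> ennreal s + ennreal (1 / (4 * C0\<^sup>2)) * bp y"
      using young_powr_ennreal[OF s norm_ge_zero p, of "b y"] by (simp add: sp bp_def)
    then show "(ennreal a + ennreal (norm (b y)) * indicator A y) * indicator Q y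
      \<le> (ennreal a * indicator Q y + ennreal s * indicator (A \<inter> Q) y) + ennreal (1 / (4 * C0\<^sup>2)) *
        bp y"
      by (cases "y \<in> A"; cases "y \<in> Q") (auto simp: add.assoc add_left_mono)
  qed
  also have "\<dots> = (ennreal a * S + ennreal s * emeasure \<sigma> (A \<inter> Q)) + ennreal (1 / (4 * C0\<^sup>2))
    * (\<integral>\<^sup>+y. bp y \<partial>\<sigma>)"
    by (simp add: nn_integral_add nn_integral_cmult nn_integral_cmult_indicator)
  also have "\<dots> \<le> (ennreal a * S + ennreal s * emeasure \<sigma> (A \<inter> Q)) + ennreal (1 / (4 * C0\<^sup>2))
    * (ennreal C0 * S)"
    using b_p by (intro add_left_mono mult_left_mono) (auto simp: bp_def)
  finally have main: "ennreal (1 / C0) * S \<le> (ennreal a * S + ennreal s * emeasure \<sigma> (A \<inter> Q))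
    + ennreal (1 / (4 * C0\<^sup>2)) * (ennreal C0 * S)" .
  obtain t where t: "S = ennreal t" "0 \<le> t" using S_fin by (cases S) auto
  have "emeasure \<sigma> (A \<inter> Q) \<le> S" by (intro emeasure_mono) auto
  then obtain v where v: "emeasure \<sigma> (A \<inter> Q) = ennreal v" "0 \<le> v" using t
    by (cases "emeasure \<sigma> (A \<inter> Q)") (auto simp: top_unique)
  have "ennreal (1 / C0 * t) \<le> ennreal (a * t + s * v + 1 / (4 * C0\<^sup>2) * (C0 * t))"
    using main t v s a C0 by (simp add: ennreal_mult[symmetric] ennreal_plus[symmetric] del:
      ennreal_plus)
  then have "1 / C0 * t \<le> a * t + s * v + 1 / (4 * C0\<^sup>2) * (C0 * t)"
    using t v s a C0 by (subst (asm) ennreal_le_iff) auto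
  also have "1 / (4 * C0\<^sup>2) * (C0 * t) = t / (4 * C0)" using C0 by (simp add: power2_eq_square)
  also have "a * t = t / (2 * C0)" by (simp add: a_def)
  finally have "t / (4 * C0) \<le> s * v" by (simp add: field_simps)
  then have "t / (4 * C0 * s) \<le> v" using s C0 by (simp add: field_simps)
  then have "\<eta> * t \<le> v" by (simp add: \<eta>2_def s_def)
  then have "ennreal \<eta> * S \<le> emeasure \<sigma> (A \<inter> Q)"
    using t v const_pos by (simp add: ennreal_mult[symmetric] ennreal_leI)
  also have "A \<inter> Q = {y \<in> Q. \<forall>i\<in>{k0..N}. 1 / (2 * C0) < Re (u * avg i b y)}"
    using Q_space by (auto simp: A_def a_def)
  finally show ?thesis .
qed

end

section \<open>Energies of the constant function on a large subset of a cube\<close>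

context theta_system
begin

lemma \<Theta>_measurable: "u \<in> borel_measurable \<sigma> \<Longrightarrow> \<Theta> u \<in> borel_measurable \<mu>"
  unfolding \<Theta>_def[abs_def] by (rule borel_measurable_lebesgue_integral) (simp add: split_def)

text \<open>Integrate the pointwise bound over the Whitney region, whose measure is at most
  \<open>Cu\<close> times that of the cell.\<close>

lemma En_le:
  assumes k: "k \<in> K" and x: "x \<in> space \<sigma>" and v[measurable]: "v \<in> borel_measurable \<sigma>"
    and le: "\<And>Y. Y \<in> U k (cell k x) \<Longrightarrow> ennreal ((norm (\<Theta> u Y))\<^sup>2) \<le> c * ennreal ((norm (\<Theta> v Y))\<^sup>2)
      + R"
  shows "En k u x \<le> c * En k v x + ennreal Cu * R"
proof -
  let ?U = "U k (cell k x)" and ?s = "emeasure \<sigma> (cell k x)"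
  have [measurable]: "?U \<in> sets \<mu>" by (rule U_sets[OF k cell_in_D[OF k x]])
  have [measurable]: "\<Theta> v \<in> borel_measurable \<mu>" by (rule \<Theta>_measurable[OF v])
  have "(\<integral>\<^sup>+Y. ennreal ((norm (\<Theta> u Y))\<^sup>2) * indicator ?U Y \<partial>\<mu>)
     \<le> (\<integral>\<^sup>+Y. c * (ennreal ((norm (\<Theta> v Y))\<^sup>2) * indicator ?U Y) + R * indicator ?U Y \<partial>\<mu>)"
    using le by (intro nn_integral_mono) (auto split: split_indicator)
  also have "\<dots> = c * (\<integral>\<^sup>+Y. ennreal ((norm (\<Theta> v Y))\<^sup>2) * indicator ?U Y \<partial>\<mu>) + R * emeasure \<mu> ?U"
    by (simp add: nn_integral_add nn_integral_cmult nn_integral_cmult_indicator)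
  also have "\<dots> \<le> c * (\<integral>\<^sup>+Y. ennreal ((norm (\<Theta> v Y))\<^sup>2) * indicator ?U Y \<partial>\<mu>) + R * (ennreal Cu * ?s)"
    by (intro add_left_mono mult_left_mono U_le[OF k cell_in_D[OF k x]]) auto
  finally have "En k u x \<le> (c * (\<integral>\<^sup>+Y. ennreal ((norm (\<Theta> v Y))\<^sup>2) * indicator ?U Y \<partial>\<mu>)
    + (ennreal Cu * R) * ?s) / ?s"
    unfolding En_def by (intro divide_right_mono_ennreal) (simp add: ac_simps)
  also have "\<dots> = c * En k v x + ennreal Cu * R"
    unfolding En_def add_divide_distrib_ennreal using cell_pos[OF k x] cell_fin[OF k x]
    by (simp add: ennreal_mult_divide_eq ennreal_times_divide)
  finally show ?thesis .
qed

end

context tb_cube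
begin

text \<open>From the set where the averages of b stay large remove the points with a bad cell, with
  large energies of \<open>\<Theta> b\<close>, or with large errors. At the remaining points
  \<open>good_pointwise\<close> may be divided by the average of b.\<close>

lemma testing_set:
  "\<exists>F\<in>sets \<sigma>. F \<subseteq> Q \<and> ennreal (\<eta> / 4) * S \<le> emeasure \<sigma> F \<and>
     (\<forall>y\<in>F. (\<Sum>i\<in>{k0..N}. En i (\<lambda>_. 1) y) \<le> ennreal (LF p C0 Cd L2))"
proof -
  obtain \<rho> where \<rho>m: "\<And>k. k \<in> {k0..N} \<Longrightarrow> \<rho> k \<in> borel_measurable \<sigma>"
    and \<rho>: "\<And>k x Y. k \<in> {k0..N} \<Longrightarrow> x \<in> space \<sigma> \<Longrightarrow> Y \<in> U k (cell k x) \<Longrightarrow>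
      ennreal (norm (\<Theta> (\<lambda>y. g y - avg k g x) Y)) \<le> \<rho> k x"
    and \<rho>s: "(\<Sum>k\<in>{k0..N}. \<integral>\<^sup>+x. (\<rho> k x)\<^sup>2 \<partial>\<sigma>) \<le> ennreal CI * (\<integral>\<^sup>+x. sq g x \<partial>\<sigma>)"
    using remainder_bound[OF g_measurable g_fin k0] by blast
  define eh where "eh k x = e k x + (\<Sum>j\<in>{k0..N}. h k j x)" for k x
  \<comment> \<open>Errors known in L^1 enter linearly, those known in L^2 as squares, so that a
    single Chebyshev estimate covers both.\<close>
  define H where "H x = (\<Sum>k\<in>{k0..N}. eh k x) + (\<Sum>k\<in>{k0..N}. (\<rho> k x)\<^sup>2)" for x
  have em[measurable]: "e k \<in> borel_measurable \<sigma>" if "k \<in> {k0..N}" for k using e_measurable that .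
  have hm[measurable]: "h k j \<in> borel_measurable \<sigma>" if "k \<in> {k0..N}" "j \<in> {k0..N}" for k j
    using h_measurable that .
  have shm: "(\<lambda>x. \<Sum>j\<in>{k0..N}. h k j x) \<in> borel_measurable \<sigma>" if "k \<in> {k0..N}" for k
    using hm[OF that] by (intro borel_measurable_sum)
  have ehm: "eh k \<in> borel_measurable \<sigma>" if "k \<in> {k0..N}" for k
    unfolding eh_def[abs_def] using em[OF that] shm[OF that] by measurable
  have r2m: "(\<lambda>x. (\<rho> k x)\<^sup>2) \<in> borel_measurable \<sigma>" if "k \<in> {k0..N}" for k using \<rho>m[OF that]
    by measurable
  have s1m: "(\<lambda>x. \<Sum>k\<in>{k0..N}. eh k x) \<in> borel_measurable \<sigma>" using ehm
    by (intro borel_measurable_sum)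
  have s2m: "(\<lambda>x. \<Sum>k\<in>{k0..N}. (\<rho> k x)\<^sup>2) \<in> borel_measurable \<sigma>" using r2m
    by (intro borel_measurable_sum)
  have Hm[measurable]: "H \<in> borel_measurable \<sigma>" unfolding H_def[abs_def] using s1m s2m by measurable
  have HL1: "(\<integral>\<^sup>+x. H x * indicator Q x \<partial>\<sigma>) \<le> ennreal (CH p C0 Cd) * S"
  proof -
    have "(\<integral>\<^sup>+x. H x * indicator Q x \<partial>\<sigma>)
      \<le> (\<integral>\<^sup>+x. (\<Sum>k\<in>{k0..N}. e k x * indicator Q x + (\<Sum>j\<in>{k0..N}. h k j x)) + (\<Sum>k\<in>{k0..N}. (\<rho> k x)\<^sup>2)
      \<partial>\<sigma>)"
      unfolding H_def eh_def by (intro nn_integral_mono) (auto split: split_indicator)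
    also have "\<dots> = (\<integral>\<^sup>+x. (\<Sum>k\<in>{k0..N}. e k x * indicator Q x + (\<Sum>j\<in>{k0..N}. h k j x)) \<partial>\<sigma>)
      + (\<integral>\<^sup>+x. (\<Sum>k\<in>{k0..N}. (\<rho> k x)\<^sup>2) \<partial>\<sigma>)"
    proof (rule nn_integral_add[OF _ s2m])
      show "(\<lambda>x. \<Sum>k\<in>{k0..N}. e k x * indicator Q x + (\<Sum>j\<in>{k0..N}. h k j x)) \<in> borel_measurable \<sigma>"
        using em shm by (intro borel_measurable_sum) auto
    qed
    also have "(\<integral>\<^sup>+x. (\<Sum>k\<in>{k0..N}. e k x * indicator Q x + (\<Sum>j\<in>{k0..N}. h k j x)) \<partial>\<sigma>)
        = (\<Sum>k\<in>{k0..N}. (\<integral>\<^sup>+x. e k x * indicator Q x \<partial>\<sigma>) + (\<Sum>j\<in>{k0..N}. \<integral>\<^sup>+x. h k j x \<partial>\<sigma>))"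
    proof -
      have "(\<integral>\<^sup>+x. (\<Sum>k\<in>{k0..N}. e k x * indicator Q x + (\<Sum>j\<in>{k0..N}. h k j x)) \<partial>\<sigma>)
          = (\<Sum>k\<in>{k0..N}. \<integral>\<^sup>+x. e k x * indicator Q x + (\<Sum>j\<in>{k0..N}. h k j x) \<partial>\<sigma>)"
        using em shm by (intro nn_integral_sum) auto
      also have "\<dots> = (\<Sum>k\<in>{k0..N}. (\<integral>\<^sup>+x. e k x * indicator Q x \<partial>\<sigma>)
        + (\<integral>\<^sup>+x. (\<Sum>j\<in>{k0..N}. h k j x) \<partial>\<sigma>))"
        using em shm by (intro sum.cong refl nn_integral_add) auto
      also have "\<dots> = (\<Sum>k\<in>{k0..N}. (\<integral>\<^sup>+x. e k x * indicator Q x \<partial>\<sigma>)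
        + (\<Sum>j\<in>{k0..N}. \<integral>\<^sup>+x. h k j x \<partial>\<sigma>))"
        using hm by (intro sum.cong refl arg_cong2[of _ _ _ _ "(+)"] nn_integral_sum) auto
      finally show ?thesis .
    qed
    also have "\<dots> = (\<Sum>k\<in>{k0..N}. \<integral>\<^sup>+x. e k x * indicator Q x \<partial>\<sigma>)
      + (\<Sum>j\<in>{k0..N}. \<Sum>k\<in>{k0..N}. \<integral>\<^sup>+x. h k j x \<partial>\<sigma>)"
      \<comment> \<open>The sum over the scales is taken before that over the stopping generations:
        it gives one constant for all j, and the measures of the \<open>T j\<close> then add up to
        that of the cube.\<close>
      unfolding sum.distrib by (subst sum.swap) simp
    also have "(\<integral>\<^sup>+x. (\<Sum>k\<in>{k0..N}. (\<rho> k x)\<^sup>2) \<partial>\<sigma>) = (\<Sum>k\<in>{k0..N}. \<integral>\<^sup>+x. (\<rho> k x)\<^sup>2 \<partial>\<sigma>)"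
      using r2m by (intro nn_integral_sum) auto
    also have "(\<Sum>k\<in>{k0..N}. \<integral>\<^sup>+x. e k x * indicator Q x \<partial>\<sigma>)
      + (\<Sum>j\<in>{k0..N}. \<Sum>k\<in>{k0..N}. \<integral>\<^sup>+x. h k j x \<partial>\<sigma>) + (\<Sum>k\<in>{k0..N}. \<integral>\<^sup>+x. (\<rho> k x)\<^sup>2 \<partial>\<sigma>)
      \<le> ennreal ((Cb + Cp * C0) * (2 / (1 - r))) * S + ennreal (Ch p C0 Cd * (2 / (1 - r))) * S +
        ennreal (CI * G\<^sup>2) * S"
    proof (intro add_mono)
      have "(\<Sum>k\<in>{k0..N}. \<integral>\<^sup>+x. e k x * indicator Q x \<partial>\<sigma>)
        \<le> (\<Sum>k\<in>{k0..N}. ennreal ((Cb + Cp * C0) * r ^ nat \<bar>k - k0\<bar>) * S)"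
        by (intro sum_mono e_integral)
      also have "\<dots> \<le> ennreal ((Cb + Cp * C0) * (2 / (1 - r))) * S"
        using cpos C0 by (intro sum_cmult_r) simp
      finally show "(\<Sum>k\<in>{k0..N}. \<integral>\<^sup>+x. e k x * indicator Q x \<partial>\<sigma>)
        \<le> ennreal ((Cb + Cp * C0) * (2 / (1 - r))) * S" .
      have "(\<Sum>j\<in>{k0..N}. \<Sum>k\<in>{k0..N}. \<integral>\<^sup>+x. h k j x \<partial>\<sigma>)
        \<le> (\<Sum>j\<in>{k0..N}. \<Sum>k\<in>{k0..N}. ennreal (Ch p C0 Cd * r ^ nat \<bar>k - j\<bar>) * emeasure \<sigma> (T j))"
        by (intro sum_mono h_integral)
      also have "\<dots> \<le> (\<Sum>j\<in>{k0..N}. ennreal (Ch p C0 Cd * (2 / (1 - r))) * emeasure \<sigma> (T j))"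
        using Ch_pos by (intro sum_mono sum_cmult_r) simp
      also have "\<dots> = ennreal (Ch p C0 Cd * (2 / (1 - r))) * S"
        unfolding sum_distrib_left[symmetric] sum_emeasure_T ..
      finally show "(\<Sum>j\<in>{k0..N}. \<Sum>k\<in>{k0..N}. \<integral>\<^sup>+x. h k j x \<partial>\<sigma>)
        \<le> ennreal (Ch p C0 Cd * (2 / (1 - r))) * S" .
      have "(\<Sum>k\<in>{k0..N}. \<integral>\<^sup>+x. (\<rho> k x)\<^sup>2 \<partial>\<sigma>) \<le> ennreal CI * (ennreal (G\<^sup>2) * S)"
        by (rule order_trans[OF \<rho>s]) (intro mult_left_mono g_L2, simp)
      then show "(\<Sum>k\<in>{k0..N}. \<integral>\<^sup>+x. (\<rho> k x)\<^sup>2 \<partial>\<sigma>) \<le> ennreal (CI * G\<^sup>2) * S"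
        using CI_pos by (simp add: ennreal_triple_mult)
    qed
    also have "\<dots> = ennreal (CH p C0 Cd) * S"
    proof -
      have nn: "0 \<le> (Cb + Cp * C0) * (2 / (1 - r))" "0 \<le> Ch p C0 Cd * (2 / (1 - r))" "0 \<le> CI * G\<^sup>2"
        using cpos C0 Ch_pos CI_pos const_pos by auto
      have "ennreal c * S + ennreal c' * S + ennreal c'' * S = ennreal (c + c' + c'') * S"
        if "0 \<le> c" "0 \<le> c'" "0 \<le> c''" for c c' c''
        using that by (simp add: distrib_right)
      from this[OF nn] show ?thesis by (simp only: CH_def)
    qed
    finally show ?thesis .
  qed
  \<comment> \<open>A phase that makes the average over the cube positive. Real parts with this
    fixed phase can be averaged over subcells, moduli cannot.\<close>
  obtain u where u: "norm u = 1" "u * avg k0 b x0 = norm (avg k0 b x0)"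
  proof -
    define z where "z = avg k0 b x0"
    have z: "z \<noteq> 0" using b_low C0 by (auto simp: z_def field_simps)
    have "norm (cnj z / norm z) = 1" using z by (simp add: norm_divide)
    moreover have "cnj z / norm z * z = norm z"
    proof -
      have "cnj z * z = of_real (norm z) * of_real (norm z)"
        using complex_norm_square[of z] by (simp add: power2_eq_square mult.commute)
      then show ?thesis using z by (simp add: field_simps)
    qed
    ultimately show ?thesis by (intro that[of "cnj z / norm z"]) (auto simp: z_def)
  qed
  define A where "A = {y \<in> Q. \<forall>i\<in>{k0..N}. 1 / (2 * C0) < Re (u * avg i b y)}"
  have am[measurable]: "avg i b \<in> borel_measurable \<sigma>" if "i \<in> {k0..N}" for i using levelK that
    by simp
  have "A = (\<Inter>i\<in>{k0..N}. {y \<in> space \<sigma>. 1 / (2 * C0) < Re (u * avg i b y)}) \<inter> Q"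
    using k0 Q_space by (auto simp: A_def)
  also have "\<dots> \<in> sets \<sigma>" using k0 by (intro sets.Int sets.finite_INT) auto
  finally have Am[measurable]: "A \<in> sets \<sigma>" .
  have A\<eta>: "ennreal \<eta> * S \<le> emeasure \<sigma> A"
    unfolding A_def by (rule big_accretive_set) (use u b_low in auto)
  define B1 where "B1 = {y \<in> Q. \<exists>i\<in>{k0..N}. ennreal \<Lambda> < navg i bp y}"
  define B3 where "B3 = {x \<in> Q. ennreal L2 < (\<Sum>k\<in>{k0..N}. En k b x)}"
  define B4 where "B4 = {x \<in> Q. ennreal (L3 p C0 Cd) < H x}"
  have nm: "navg i bp \<in> borel_measurable \<sigma>" if "i \<in> {k0..N}" for i using levelK that by simp
  have "B1 = (\<Union>i\<in>{k0..N}. {y \<in> space \<sigma>. ennreal \<Lambda> < navg i bp y}) \<inter> Q"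
    using Q_space by (auto simp: B1_def)
  also have "\<dots> \<in> sets \<sigma>" using nm by (intro sets.Int sets.finite_UN) auto
  finally have B1m[measurable]: "B1 \<in> sets \<sigma>" .
  have Enm: "(\<lambda>x. \<Sum>k\<in>{k0..N}. En k b x) \<in> borel_measurable \<sigma>"
    using levelK by (intro borel_measurable_sum En_measurable) auto
  have "B3 = {x \<in> space \<sigma>. ennreal L2 < (\<Sum>k\<in>{k0..N}. En k b x)} \<inter> Q" using Q_space
    by (auto simp: B3_def)
  also have "\<dots> \<in> sets \<sigma>" using Enm by measurable
  finally have B3m[measurable]: "B3 \<in> sets \<sigma>" .
  have "B4 = {x \<in> space \<sigma>. ennreal (L3 p C0 Cd) < H x} \<inter> Q" using Q_space by (auto simp: B4_def)
  also have "\<dots> \<in> sets \<sigma>" by measurable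
  finally have B4m[measurable]: "B4 \<in> sets \<sigma>" .
  obtain t where t: "S = ennreal t" "0 \<le> t" using S_fin by (cases S) auto
  \<comment> \<open>Chebyshev's inequality for \<open>B1\<close> and \<open>B4\<close>: the level is
    at least 4 / \<eta> times the mean.\<close>
  have small: "emeasure \<sigma> B \<le> ennreal (\<eta> / 4) * S"
    if "B \<in> sets \<sigma>" "B \<subseteq> Q" "ennreal c * emeasure \<sigma> B \<le> ennreal c' * S" "0 < c" "0 \<le> c'" "c'
      \<le> c * (\<eta> / 4)" for B c c'
  proof -
    have "ennreal c * emeasure \<sigma> B \<le> ennreal (c * (\<eta> / 4)) * S"
      by (rule order_trans[OF that(3)]) (intro mult_right_mono ennreal_leI that, simp)
    also have "\<dots> = ennreal c * (ennreal (\<eta> / 4) * S)"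
      using that const_pos by (simp only: ennreal_triple_mult less_imp_le divide_nonneg_pos
        zero_less_numeral)
    finally show ?thesis using that(4) by (simp add: ennreal_mult_le_mult_iff)
  qed
  have s1: "emeasure \<sigma> B1 \<le> ennreal (\<eta> / 4) * S"
  proof (rule small[OF B1m])
    have "ennreal \<Lambda> * emeasure \<sigma> B1 \<le> (\<integral>\<^sup>+y. bp y * indicator Q y \<partial>\<sigma>)"
      unfolding B1_def by (rule maximal_inequality[OF k0(1) bp_measurable x0])
    also have "\<dots> \<le> (\<integral>\<^sup>+y. bp y \<partial>\<sigma>)" by (intro nn_integral_mono) (auto split: split_indicator)
    also have "\<dots> \<le> ennreal C0 * S" using b_p by (simp add: bp_def)
    finally show "ennreal \<Lambda> * emeasure \<sigma> B1 \<le> ennreal C0 * S" .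
    \<comment> \<open>The second summand of \<open>Lam\<close> was put there for this.\<close>
    have "4 * C0 / \<eta> * (\<eta> / 4) \<le> \<Lambda> * (\<eta> / 4)"
      using const_pos C0 by (intro mult_right_mono) (auto simp: Lam_def)
    then show "C0 \<le> \<Lambda> * (\<eta> / 4)" using const_pos by simp
  qed (use const_pos C0 in \<open>auto simp: B1_def\<close>)
  have s3: "emeasure \<sigma> B3 \<le> ennreal (\<eta> / 4) * S" unfolding B3_def by (rule test)
  have s4: "emeasure \<sigma> B4 \<le> ennreal (\<eta> / 4) * S"
  proof (rule small[OF B4m])
    have "ennreal (L3 p C0 Cd) * emeasure \<sigma> B4 = (\<integral>\<^sup>+y. ennreal (L3 p C0 Cd) * indicator B4 y \<partial>\<sigma>)"
      by (simp add: nn_integral_cmult_indicator)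
    also have "\<dots> \<le> (\<integral>\<^sup>+y. H y * indicator Q y \<partial>\<sigma>)"
      by (intro nn_integral_mono) (auto simp: B4_def split: split_indicator)
    also note HL1
    finally show "ennreal (L3 p C0 Cd) * emeasure \<sigma> B4 \<le> ennreal (CH p C0 Cd) * S" .
    show "0 < L3 p C0 Cd" using CH_pos const_pos by (simp add: L3_def)
    show "CH p C0 Cd \<le> L3 p C0 Cd * (\<eta> / 4)" using const_pos by (simp add: L3_def)
  qed (use CH_pos in \<open>auto simp: B4_def\<close>)
  \<comment> \<open>Three exceptional sets take a quarter of \<eta> each, which leaves a
    quarter.\<close>
  define F where "F = A - (B1 \<union> (B3 \<union> B4))"
  have Fm[measurable]: "F \<in> sets \<sigma>" unfolding F_def by measurable
  have FQ: "F \<subseteq> Q" by (auto simp: F_def A_def)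
  have F\<eta>: "ennreal (\<eta> / 4) * S \<le> emeasure \<sigma> F"
  proof -
    have "emeasure \<sigma> A \<le> emeasure \<sigma> (F \<union> (B1 \<union> (B3 \<union> B4)))"
      by (intro emeasure_mono) (auto simp: F_def)
    also have "\<dots> \<le> emeasure \<sigma> F + (emeasure \<sigma> B1 + (emeasure \<sigma> B3 + emeasure \<sigma> B4))"
      by (intro order_trans[OF emeasure_subadditive] add_mono order_refl) auto
    also have "\<dots> \<le> emeasure \<sigma> F
      + (ennreal (\<eta> / 4) * S + (ennreal (\<eta> / 4) * S + ennreal (\<eta> / 4) * S))"
      by (intro add_mono order_refl s1 s3 s4)
    finally have main: "ennreal \<eta> * S
      \<le> emeasure \<sigma> F + (ennreal (\<eta> / 4) * S + (ennreal (\<eta> / 4) * S + ennreal (\<eta> / 4) * S))"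
      using A\<eta> by simp
    have "emeasure \<sigma> F \<le> S" using FQ by (intro emeasure_mono) auto
    then obtain v where v: "emeasure \<sigma> F = ennreal v" "0 \<le> v" using t
      by (cases "emeasure \<sigma> F") (auto simp: top_unique)
    have "ennreal (\<eta> * t) \<le> ennreal (v + (\<eta> / 4 * t + (\<eta> / 4 * t + \<eta> / 4 * t)))"
      using main const_pos t v by (simp add: ennreal_mult[symmetric] ennreal_plus[symmetric] del:
        ennreal_plus)
    then have "\<eta> * t \<le> v + (\<eta> / 4 * t + (\<eta> / 4 * t + \<eta> / 4 * t))"
      using t v const_pos by (subst (asm) ennreal_le_iff) auto
    moreover have "\<eta> / 4 * t = (\<eta> * t) / 4" by simp
    ultimately have "\<eta> / 4 * t \<le> v" by linarith
    then show ?thesis using t v const_pos by (simp add: ennreal_mult[symmetric] ennreal_leI)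
  qed
  have pw: "(\<Sum>i\<in>{k0..N}. En i (\<lambda>_. 1) y) \<le> ennreal (LF p C0 Cd L2)" if y: "y \<in> F" for y
  proof -
    have yQ: "y \<in> Q" using y FQ by auto
    have ys: "y \<in> space \<sigma>" using Q_space yQ .
    \<comment> \<open>Outside \<open>B1\<close> no average of |b|^p exceeds \<Lambda>, which is
      goodness.\<close>
    have gy: "good y" using y yQ by (auto simp: F_def B1_def good_def Bad_def)
    define c where "c = 8 * C0\<^sup>2"
    have c0: "0 \<le> c" by (simp add: c_def)
    define R where "R i = eh i y + \<rho> i y" for i
    have each: "En i (\<lambda>_. 1) y \<le> ennreal c * En i b y + ennreal Cu * (ennreal c * (R i)\<^sup>2)"
      if i: "i \<in> {k0..N}" for i
    proof (rule En_le[OF _ ys bm])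
      show "i \<in> K" using levelK i by simp
      fix Y assume Y: "Y \<in> U i (cell i y)"
      have av: "1 / (2 * C0) \<le> norm (avg i b y)"
      proof -
        have "1 / (2 * C0) < Re (u * avg i b y)" using y i by (auto simp: F_def A_def)
        also have "\<dots> \<le> norm (u * avg i b y)" by (rule complex_Re_le_cmod)
        also have "\<dots> = norm (avg i b y)" using u by (simp add: norm_mult)
        finally show ?thesis by simp
      qed
      have "1 \<le> 2 * C0 * norm (avg i b y)" using av C0 by (simp add: field_simps)
      then have "norm (\<Theta> (\<lambda>_. 1) Y) * 1 \<le> norm (\<Theta> (\<lambda>_. 1) Y) * (2 * C0 * norm (avg i b y))"
        by (rule mult_left_mono) simp
      also have "\<dots> = 2 * C0 * norm (avg i b y * \<Theta> (\<lambda>_. 1) Y)" by (simp add: norm_mult)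
      finally have "ennreal (norm (\<Theta> (\<lambda>_. 1) Y))
        \<le> ennreal (2 * C0 * norm (avg i b y * \<Theta> (\<lambda>_. 1) Y))"
        by (simp add: ennreal_leI)
      also have "\<dots> = ennreal (2 * C0) * ennreal (norm (avg i b y * \<Theta> (\<lambda>_. 1) Y))"
        using C0 by (subst ennreal_mult) auto
      also have "\<dots> \<le> ennreal (2 * C0) * (ennreal (norm (\<Theta> b Y)) + R i)"
        using good_pointwise[OF gy i Y \<rho>[OF i ys Y]]
          by (intro mult_left_mono) (auto simp: R_def eh_def)
      finally have "(ennreal (norm (\<Theta> (\<lambda>_. 1) Y)))\<^sup>2
        \<le> (ennreal (2 * C0) * (ennreal (norm (\<Theta> b Y)) + R i))\<^sup>2"
        by (rule power_mono_ennreal)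
      also have "\<dots> = ennreal (4 * C0\<^sup>2) * (ennreal (norm (\<Theta> b Y)) + R i)\<^sup>2"
        using C0 by (simp add: power_mult_distrib ennreal_power)
      also have "\<dots> \<le> ennreal (4 * C0\<^sup>2) * (2 * (ennreal (norm (\<Theta> b Y)))\<^sup>2 + 2 * (R i)\<^sup>2)"
        by (intro mult_left_mono square_add_ennreal_le) auto
      also have "\<dots> = ennreal c * (ennreal (norm (\<Theta> b Y)))\<^sup>2 + ennreal c * (R i)\<^sup>2"
      proof -
        have "ennreal c = ennreal (4 * C0\<^sup>2) * 2"
        proof -
          have "ennreal (4 * C0\<^sup>2) * ennreal 2 = ennreal (4 * C0\<^sup>2 * 2)"
            by (rule ennreal_mult[symmetric]) auto
          then show ?thesis by (simp add: c_def)
        qed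
        then show ?thesis by (simp only: distrib_left mult.assoc)
      qed
      finally show "ennreal ((norm (\<Theta> (\<lambda>_. 1) Y))\<^sup>2) \<le> ennreal c * ennreal ((norm (\<Theta> b Y))\<^sup>2)
        + ennreal c * (R i)\<^sup>2"
        by (simp add: ennreal_power)
    qed
    have Hy: "H y \<le> ennreal (L3 p C0 Cd)" using y yQ by (auto simp: F_def B4_def)
    have L3p: "0 \<le> L3 p C0 Cd" using CH_pos const_pos by (simp add: L3_def)
    \<comment> \<open>The sum of the linear errors is at most \<open>L3\<close>, hence that of their
      squares at most \<open>L3\<close> squared; the squares of the \<rho> are bounded by
      \<open>L3\<close> directly.\<close>
    have "(\<Sum>i\<in>{k0..N}. (R i)\<^sup>2) \<le> (\<Sum>i\<in>{k0..N}. 2 * (eh i y)\<^sup>2 + 2 * (\<rho> i y)\<^sup>2)"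
      unfolding R_def by (intro sum_mono square_add_ennreal_le)
    also have "\<dots> = 2 * (\<Sum>i\<in>{k0..N}. (eh i y)\<^sup>2) + 2 * (\<Sum>i\<in>{k0..N}. (\<rho> i y)\<^sup>2)"
      by (simp add: sum.distrib sum_distrib_left)
    also have "\<dots> \<le> 2 * (\<Sum>i\<in>{k0..N}. eh i y)\<^sup>2 + 2 * (\<Sum>i\<in>{k0..N}. (\<rho> i y)\<^sup>2)"
      by (intro add_right_mono mult_left_mono sum_squares_le_square_sum) auto
    also have "\<dots> \<le> 2 * (ennreal (L3 p C0 Cd))\<^sup>2 + 2 * ennreal (L3 p C0 Cd)"
    proof (intro add_mono mult_left_mono power_mono_ennreal)
      show "(\<Sum>i\<in>{k0..N}. eh i y) \<le> ennreal (L3 p C0 Cd)" "(\<Sum>i\<in>{k0..N}. (\<rho> i y)\<^sup>2)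
        \<le> ennreal (L3 p C0 Cd)"
        using Hy unfolding H_def by (auto intro: order_trans[rotated])
    qed auto
    also have "\<dots> = ennreal (2 * (L3 p C0 Cd)\<^sup>2 + 2 * L3 p C0 Cd)"
      using L3p by (simp add: ennreal_power ennreal_mult)
    finally have Rs: "(\<Sum>i\<in>{k0..N}. (R i)\<^sup>2) \<le> ennreal (2 * (L3 p C0 Cd)\<^sup>2 + 2 * L3 p C0 Cd)" .
    have "(\<Sum>i\<in>{k0..N}. En i (\<lambda>_. 1) y)
      \<le> (\<Sum>i\<in>{k0..N}. ennreal c * En i b y + ennreal Cu * (ennreal c * (R i)\<^sup>2))"
      by (intro sum_mono each)
    also have "\<dots> = ennreal c * (\<Sum>i\<in>{k0..N}. En i b y)
      + ennreal Cu * (ennreal c * (\<Sum>i\<in>{k0..N}. (R i)\<^sup>2))"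
      by (simp add: sum.distrib sum_distrib_left)
    also have "\<dots> \<le> ennreal c * ennreal L2
      + ennreal Cu * (ennreal c * ennreal (2 * (L3 p C0 Cd)\<^sup>2 + 2 * L3 p C0 Cd))"
      using y yQ by (intro add_mono mult_left_mono Rs) (auto simp: F_def B3_def)
    also have "\<dots> = ennreal (c * L2 + Cu * (c * (2 * (L3 p C0 Cd)\<^sup>2 + 2 * L3 p C0 Cd)))"
      using c0 L2 cpos L3p by (simp add: ennreal_mult[symmetric] ennreal_plus[symmetric] del:
        ennreal_plus)
    also have "c * L2 + Cu * (c * (2 * (L3 p C0 Cd)\<^sup>2 + 2 * L3 p C0 Cd)) = LF p C0 Cd L2"
      by (simp add: LF_def c_def algebra_simps)
    finally show ?thesis .
  qed
  show ?thesis using Fm FQ F\<eta> pw by (intro bexI[of _ F]) auto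
qed

end

section \<open>The abstract local estimate\<close>

context theta_system
begin

text \<open>In the first summand 8 = 2 * 4, with 2 from squaring a sum and 4 from the embedding
  theorem, applied with the constant that \<open>john_nirenberg\<close> gives for the proportion
  \<open>\<eta>2 / 4\<close>. The second summand belongs to the remainders.\<close>

definition CT :: "real \<Rightarrow> real \<Rightarrow> real \<Rightarrow> real \<Rightarrow> real" where
  "CT p C0 Cd L2 = 8 * ((\<bar>LF p C0 Cd L2\<bar> + Cu * Cp\<^sup>2) / (\<eta>2 p C0 / 4)) + 2 * Cu * CI"

lemma En_one_le:
  assumes k: "k \<in> K" and x: "x \<in> space \<sigma>"
  shows "En k (\<lambda>_. 1) x \<le> ennreal (Cu * Cp\<^sup>2)"
proof -
  \<comment> \<open>The integrand is bounded by a constant, so the comparison function of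
    \<open>En_le\<close> gets the coefficient 0.\<close>
  have "En k (\<lambda>_. 1) x \<le> 0 * En k (\<lambda>_. 0) x + ennreal Cu * ennreal (Cp\<^sup>2)"
  proof (rule En_le[OF k x])
    fix Y assume Y: "Y \<in> U k (cell k x)"
    have "ennreal (norm (\<Theta> (\<lambda>_. 1) Y)) \<le> pint k (\<lambda>y. ennreal (norm (1::complex))) x"
      by (rule \<Theta>_le[OF _ k x Y]) auto
    also have "\<dots> \<le> ennreal Cp" using P_mass[OF k x] by (simp add: pint_def)
    finally have "norm (\<Theta> (\<lambda>_. 1) Y) \<le> Cp" using cpos by (simp add: ennreal_le_iff)
    then have "(norm (\<Theta> (\<lambda>_. 1) Y))\<^sup>2 \<le> Cp\<^sup>2" by (rule power_mono) simp
    then show "ennreal ((norm (\<Theta> (\<lambda>_. 1) Y))\<^sup>2) \<le> 0 * ennreal ((norm (\<Theta> (\<lambda>_. 0) Y))\<^sup>2)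
      + ennreal (Cp\<^sup>2)"
      by (simp add: ennreal_leI)
  qed auto
  then show ?thesis using cpos by (simp add: ennreal_mult)
qed

text \<open>The constant does not depend on the window {m..N}, which makes the later exhaustion
  possible. The function \<open>b\<close> is asked for cell by cell and window by window.\<close>

theorem local_Tb_abstract:
  assumes p: "1 < p" and C0: "0 < C0" and Cd: "1 \<le> Cd" and L2: "0 \<le> L2"
    and doubling: "\<And>k x. k \<in> K \<Longrightarrow> x \<in> space \<sigma> \<Longrightarrow>
      emeasure \<sigma> (cell k x) \<le> ennreal Cd * emeasure \<sigma> (cell (k + 1) x)"
    and testing: "\<And>k x N. k \<in> K \<Longrightarrow> x \<in> space \<sigma> \<Longrightarrow> k \<le> N \<Longrightarrow> \<exists>b. adm b \<and>
      (\<integral>\<^sup>+y. ennreal (norm (b y) powr p) \<partial>\<sigma>) \<le> ennreal C0 * emeasure \<sigma> (cell k x) \<and>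
      1 / C0 \<le> norm (avg k b x) \<and>
      emeasure \<sigma> {y \<in> cell k x. ennreal L2 < (\<Sum>i\<in>{k..N}. En i b y)} \<le> ennreal (\<eta>2 p C0 / 4) *
        emeasure \<sigma> (cell k x)"
    and f[measurable]: "f \<in> borel_measurable \<sigma>" and fin: "(\<integral>\<^sup>+x. sq f x \<partial>\<sigma>) < \<infinity>"
    and m: "m \<in> K" "m \<le> N"
  shows "(\<Sum>k\<in>{m..N}. \<integral>\<^sup>+x. En k f x \<partial>\<sigma>) \<le> ennreal (CT p C0 Cd L2) * (\<integral>\<^sup>+x. sq f x \<partial>\<sigma>)"
proof -
  define L where "L = \<bar>LF p C0 Cd L2\<bar>"
  have kK: "k \<in> K" if "k \<in> {m..N}" for k using K_up[OF m(1)] that by simp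
  have s: "0 < s0 p C0" using C0 by (simp add: s0_def)
  have e: "0 < \<eta>2 p C0" using C0 s by (simp add: \<eta>2_def)
  define cc where "cc = (L + Cu * Cp\<^sup>2) / (\<eta>2 p C0 / 4)"
  have cc: "0 < cc" unfolding cc_def L_def using cpos e
    by (intro divide_pos_pos add_nonneg_pos mult_pos_pos) auto
  have carl: "(\<integral>\<^sup>+y. (\<Sum>i\<in>{k..N}. En i (\<lambda>_. 1) y) * indicator (cell k x) y \<partial>\<sigma>)
    \<le> ennreal cc * emeasure \<sigma> (cell k x)"
    if k: "m \<le> k" and x: "x \<in> space \<sigma>" for k x
    unfolding cc_def
  proof (rule john_nirenberg[OF m(1) _ _ _ _ _ _ k x])
    show "0 \<le> Cu * Cp\<^sup>2" "0 \<le> L" "0 < \<eta>2 p C0 / 4" using cpos e by (auto simp: L_def)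
    show "\<And>k x y. k \<in> K \<Longrightarrow> x \<in> space \<sigma> \<Longrightarrow> y \<in> cell k x \<Longrightarrow> En k (\<lambda>_. 1) y = En k (\<lambda>_. 1) x"
      by (rule En_cong)
    show "\<And>k x. k \<in> K \<Longrightarrow> x \<in> space \<sigma> \<Longrightarrow> En k (\<lambda>_. 1) x \<le> ennreal (Cu * Cp\<^sup>2)" by (rule En_one_le)
    fix k x assume k: "m \<le> k" "k \<le> N" and x: "x \<in> space \<sigma>"
    have K: "k \<in> K" using K_up[OF m(1) k(1)] .
    obtain b where b: "adm b" "(\<integral>\<^sup>+y. ennreal (norm (b y) powr p) \<partial>\<sigma>)
      \<le> ennreal C0 * emeasure \<sigma> (cell k x)"
      "1 / C0 \<le> norm (avg k b x)"
      "emeasure \<sigma> {y \<in> cell k x. ennreal L2 < (\<Sum>i\<in>{k..N}. En i b y)}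
        \<le> ennreal (\<eta>2 p C0 / 4) * emeasure \<sigma> (cell k x)"
      using testing[OF K x k(2)] by blast
    interpret B: tb_cube \<sigma> D K P Cp Cb q U \<mu> \<psi> Cu p C0 Cd L2 k N x b
      by unfold_locales (use p C0 Cd L2 doubling K k x b in auto)
    obtain F where F: "F \<in> sets \<sigma>" "F \<subseteq> cell k x" "ennreal (\<eta>2 p C0 / 4) * emeasure \<sigma> (cell k x)
      \<le> emeasure \<sigma> F"
      "\<And>y. y \<in> F \<Longrightarrow> (\<Sum>i\<in>{k..N}. En i (\<lambda>_. 1) y) \<le> ennreal (LF p C0 Cd L2)"
      using B.testing_set by blast
    have "LF p C0 Cd L2 \<le> L" by (simp add: L_def)
    then have "(\<Sum>i\<in>{k..N}. En i (\<lambda>_. 1) y) \<le> ennreal L" if "y \<in> F" for y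
      using F(4)[OF that] ennreal_leI order_trans by blast
    then show "\<exists>F\<in>sets \<sigma>. F \<subseteq> cell k x \<and> ennreal (\<eta>2 p C0 / 4) * emeasure \<sigma> (cell k x)
      \<le> emeasure \<sigma> F \<and>
        (\<forall>y\<in>F. (\<Sum>i\<in>{k..N}. En i (\<lambda>_. 1) y) \<le> ennreal L)"
      using F by blast
  qed
  have emb: "(\<Sum>k\<in>{m..N}. \<integral>\<^sup>+y. En k (\<lambda>_. 1) y * (navg k (\<lambda>y. ennreal (norm (f y))) y)\<^sup>2 \<partial>\<sigma>)
    \<le> ennreal (4 * cc) * (\<integral>\<^sup>+x. sq f x \<partial>\<sigma>)"
    using carleson_embedding[OF m(1) cc, of "\<lambda>y. ennreal (norm (f y))" "\<lambda>k. En k (\<lambda>_. 1)" N] carl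
      En_cong m(2)
    by (simp add: ennreal_power)
  obtain \<rho> where \<rho>m: "\<And>k. k \<in> {m..N} \<Longrightarrow> \<rho> k \<in> borel_measurable \<sigma>"
    and \<rho>: "\<And>k x Y. k \<in> {m..N} \<Longrightarrow> x \<in> space \<sigma> \<Longrightarrow> Y \<in> U k (cell k x) \<Longrightarrow>
      ennreal (norm (\<Theta> (\<lambda>y. f y - avg k f x) Y)) \<le> \<rho> k x"
    and \<rho>s: "(\<Sum>k\<in>{m..N}. \<integral>\<^sup>+x. (\<rho> k x)\<^sup>2 \<partial>\<sigma>) \<le> ennreal CI * (\<integral>\<^sup>+x. sq f x \<partial>\<sigma>)"
    using remainder_bound[OF f fin m] by blast
  have af: "adm f" by (rule L2_adm[OF f fin])
  have each: "En k f x \<le> 2 * (En k (\<lambda>_. 1) x * (navg k (\<lambda>y. ennreal (norm (f y))) x)\<^sup>2)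
    + ennreal Cu * (2 * (\<rho> k x)\<^sup>2)"
    if k: "k \<in> {m..N}" and x: "x \<in> space \<sigma>" for k x
  proof -
    let ?a = "avg k f x" and ?n = "navg k (\<lambda>y. ennreal (norm (f y))) x"
    have K: "k \<in> K" by (rule kK[OF k])
    have "En k f x \<le> (2 * ?n\<^sup>2) * En k (\<lambda>_. 1) x + ennreal Cu * (2 * (\<rho> k x)\<^sup>2)"
    proof (rule En_le[OF K x])
      fix Y assume Y: "Y \<in> U k (cell k x)"
      \<comment> \<open>The constant is pulled out of \<open>\<Theta>\<close>: the first term is the
        Carleson part, the second is covered by \<open>remainder_bound\<close>.\<close>
      have "\<Theta> f Y = ?a * \<Theta> (\<lambda>_. 1) Y + \<Theta> (\<lambda>y. f y - ?a) Y"
        using \<Theta>_diff[OF af adm_const K x Y, of ?a] \<Theta>_const[of ?a Y] by simp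
      then have "norm (\<Theta> f Y) \<le> norm ?a * norm (\<Theta> (\<lambda>_. 1) Y) + norm (\<Theta> (\<lambda>y. f y - ?a) Y)"
        using norm_triangle_ineq[of "?a * \<Theta> (\<lambda>_. 1) Y" "\<Theta> (\<lambda>y. f y - ?a) Y"]
          by (simp add: norm_mult)
      then have "ennreal (norm (\<Theta> f Y))
        \<le> ennreal (norm ?a * norm (\<Theta> (\<lambda>_. 1) Y) + norm (\<Theta> (\<lambda>y. f y - ?a) Y))"
        by (rule ennreal_leI)
      also have "\<dots> = ennreal (norm ?a) * ennreal (norm (\<Theta> (\<lambda>_. 1) Y))
        + ennreal (norm (\<Theta> (\<lambda>y. f y - ?a) Y))"
        by (simp add: ennreal_mult)
      also have "\<dots> \<le> ?n * ennreal (norm (\<Theta> (\<lambda>_. 1) Y)) + \<rho> k x"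
        by (intro add_mono mult_right_mono norm_avg_le[OF adm_locint[OF af] K x] \<rho>[OF k x Y]) auto
      finally have "(ennreal (norm (\<Theta> f Y)))\<^sup>2 \<le> (?n * ennreal (norm (\<Theta> (\<lambda>_. 1) Y)) + \<rho> k x)\<^sup>2"
        by (rule power_mono_ennreal)
      also have "\<dots> \<le> 2 * (?n * ennreal (norm (\<Theta> (\<lambda>_. 1) Y)))\<^sup>2 + 2 * (\<rho> k x)\<^sup>2"
        by (rule square_add_ennreal_le)
      finally show "ennreal ((norm (\<Theta> f Y))\<^sup>2) \<le> (2 * ?n\<^sup>2) * ennreal ((norm (\<Theta> (\<lambda>_. 1) Y))\<^sup>2)
        + 2 * (\<rho> k x)\<^sup>2"
        by (simp add: power_mult_distrib ennreal_power mult.assoc)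
    qed simp
    then show ?thesis by (simp add: ac_simps)
  qed
  have "(\<Sum>k\<in>{m..N}. \<integral>\<^sup>+x. En k f x \<partial>\<sigma>)
    \<le> (\<Sum>k\<in>{m..N}. \<integral>\<^sup>+x. 2 * (En k (\<lambda>_. 1) x * (navg k (\<lambda>y. ennreal (norm (f y))) x)\<^sup>2) + ennreal Cu
      * (2 * (\<rho> k x)\<^sup>2) \<partial>\<sigma>)"
    by (intro sum_mono nn_integral_mono each)
  also have "\<dots> = (\<Sum>k\<in>{m..N}. 2 * (\<integral>\<^sup>+x. En k (\<lambda>_. 1) x * (navg k (\<lambda>y. ennreal (norm (f y))) x)\<^sup>2 \<partial>\<sigma>)
      + ennreal Cu * (2 * (\<integral>\<^sup>+x. (\<rho> k x)\<^sup>2 \<partial>\<sigma>)))"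
  proof (rule sum.cong[OF refl])
    fix k assume k: "k \<in> {m..N}"
    have [measurable]: "En k (\<lambda>_. 1) \<in> borel_measurable \<sigma>"
      "navg k (\<lambda>y. ennreal (norm (f y))) \<in> borel_measurable \<sigma>"
      "\<rho> k \<in> borel_measurable \<sigma>" using kK[OF k] \<rho>m[OF k] by auto
    show "(\<integral>\<^sup>+x. 2 * (En k (\<lambda>_. 1) x * (navg k (\<lambda>y. ennreal (norm (f y))) x)\<^sup>2)
      + ennreal Cu * (2 * (\<rho> k x)\<^sup>2) \<partial>\<sigma>)
      = 2 * (\<integral>\<^sup>+x. En k (\<lambda>_. 1) x * (navg k (\<lambda>y. ennreal (norm (f y))) x)\<^sup>2 \<partial>\<sigma>) + ennreal Cu *
        (2 * (\<integral>\<^sup>+x. (\<rho> k x)\<^sup>2 \<partial>\<sigma>))"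
      by (simp add: nn_integral_add nn_integral_cmult)
  qed
  also have "\<dots> = 2 * (\<Sum>k\<in>{m..N}. \<integral>\<^sup>+x. En k (\<lambda>_. 1) x * (navg k (\<lambda>y. ennreal (norm (f y))) x)\<^sup>2 \<partial>\<sigma>)
      + ennreal Cu * (2 * (\<Sum>k\<in>{m..N}. \<integral>\<^sup>+x. (\<rho> k x)\<^sup>2 \<partial>\<sigma>))"
    by (simp add: sum.distrib sum_distrib_left)
  also have "\<dots> \<le> 2 * (ennreal (4 * cc) * (\<integral>\<^sup>+x. sq f x \<partial>\<sigma>))
    + ennreal Cu * (2 * (ennreal CI * (\<integral>\<^sup>+x. sq f x \<partial>\<sigma>)))"
    by (intro add_mono mult_left_mono emb \<rho>s) auto
  also have "\<dots> = ennreal (8 * cc + 2 * Cu * CI) * (\<integral>\<^sup>+x. sq f x \<partial>\<sigma>)"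
  proof -
    let ?f = "\<integral>\<^sup>+x. sq f x \<partial>\<sigma>"
    have "ennreal 2 * (ennreal (4 * cc) * ?f) = ennreal (8 * cc) * ?f"
      using cc by (subst ennreal_triple_mult) auto
    moreover have "ennreal Cu * (ennreal 2 * (ennreal CI * ?f)) = ennreal (2 * Cu * CI) * ?f"
      using CI_pos cpos by (simp only: ennreal_triple_mult less_imp_le mult_nonneg_nonneg
        zero_less_numeral) (simp add: ac_simps)
    ultimately have "2 * (ennreal (4 * cc) * ?f) + ennreal Cu * (2 * (ennreal CI * ?f))
      = ennreal (8 * cc) * ?f + ennreal (2 * Cu * CI) * ?f"
      by simp
    also have "\<dots> = ennreal (8 * cc + 2 * Cu * CI) * ?f"
      using cc CI_pos cpos by (subst ennreal_plus) (auto simp: distrib_right)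
    finally show ?thesis .
  qed
  also have "8 * cc + 2 * Cu * CI = CT p C0 Cd L2" by (simp add: CT_def cc_def L_def)
  finally show ?thesis .
qed

end

section \<open>Ahlfors--David regular sets with a dyadic grid\<close>

abbreviation gscale :: "int \<Rightarrow> real" where "gscale k \<equiv> 2 powi (- k)"

lemma scale_pos [simp]: "0 < gscale k" by simp

lemma scale_ratio: "j \<le> k \<Longrightarrow> gscale k = gscale j * (1/2) ^ nat (k - j)"
proof -
  assume "j \<le> k"
  then have "gscale k = 2 powi (- j + - int (nat (k - j)))" by simp
  also have "\<dots> = gscale j * 2 powi (- int (nat (k - j)))" by (rule power_int_add) simp
  also have "2 powi (- int (nat (k - j))) = (1/2::real) ^ nat (k - j)"
    by (simp only: power_int_minus power_int_of_nat power_one_over inverse_eq_divide)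
  finally show ?thesis .
qed

lemma scale_mono: "j \<le> k \<Longrightarrow> gscale k \<le> gscale j"
  by (simp add: power_int_increasing)

lemma scale_power: "2 powi (- k * int n) = (gscale k) ^ n"
  by (simp only: power_int_mult power_int_of_nat)

text \<open>Regularity says nothing about balls of radius at least \<open>diam E\<close>. The net \<open>X\<close> serves to
  cover \<open>E\<close> by smaller balls, with a constant depending only on the dimension.\<close>

locale adr_grid =
  fixes n :: nat and C\<^sub>E a\<^sub>0 \<eta>\<^sub>0 c\<^sub>1 c\<^sub>2 c\<^sub>3 :: real
    and E :: "'a::euclidean_space set" and D :: "int \<Rightarrow> 'a set set" and X :: "'a set"
  assumes n: "1 \<le> n" and dim: "DIM('a) = n + 1"
    and pos: "0 < C\<^sub>E" "0 < a\<^sub>0" "0 < \<eta>\<^sub>0" "0 < c\<^sub>1" "0 < c\<^sub>2" "0 < c\<^sub>3"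
    and adr: "ahlfors_david_regular n C\<^sub>E E" and grid: "dyadic_grid n a\<^sub>0 \<eta>\<^sub>0 c\<^sub>1 c\<^sub>2 c\<^sub>3 E D"
    and nondeg: "E \<noteq> {}" "bounded E \<Longrightarrow> 0 < diameter E"
    and net: "finite X" "cball 0 1 \<subseteq> (\<Union>z\<in>X. ball z (1/4))"
begin

abbreviation "\<sigma> \<equiv> surface_measure n E"
abbreviation "K \<equiv> generations c\<^sub>3 E"

text \<open>The summand 1 serves radii below the diameter, and \<open>card X\<close> the total mass
  of a bounded set.\<close>

definition A :: real where "A = C\<^sub>E * (1 + card X)"

lemma closed_E: "closed E" using adr by (simp add: ahlfors_david_regular_def)

lemma E_borel [measurable]: "E \<in> sets borel" using closed_E by simp

lemma space_\<sigma> [simp]: "space \<sigma> = E"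
  by (simp add: surface_measure_def space_restrict_space hausdorff_measure_def)

lemma sets_\<sigma>: "sets \<sigma> = sets (restrict_space borel E)"
  unfolding surface_measure_def by (intro sets_restrict_space_cong) simp

lemma borel_subset_sets: "B \<in> sets borel \<Longrightarrow> B \<subseteq> E \<Longrightarrow> B \<in> sets \<sigma>"
  unfolding sets_\<sigma> by (simp add: sets_restrict_space_iff)

lemma borel_measurable_\<sigma>: "f \<in> borel_measurable borel \<Longrightarrow> f \<in> borel_measurable \<sigma>"
  using measurable_restrict_space1[of f borel borel E] measurable_cong_sets[OF sets_\<sigma> refl, of
    borel] by blast

lemma upper_small:
  assumes "x \<in> E" "0 < r" "bounded E \<Longrightarrow> r < diameter E"
  shows "emeasure \<sigma> (ball x r \<inter> E) \<le> ennreal (C\<^sub>E * r ^ n)"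
  using adr assms unfolding ahlfors_david_regular_def by blast

text \<open>Cover E by balls of radius diam(E) / 4 centred at the points of the scaled net. The
  centres need not lie in E, but a piece that meets E lies in a ball of radius diam(E) / 2 about one
  of its own points, and there regularity applies.\<close>

lemma upper_total:
  assumes bd: "bounded E"
  shows "emeasure \<sigma> E \<le> ennreal (card X * C\<^sub>E * diameter E ^ n)"
proof -
  define d where "d = diameter E"
  have d: "0 < d" using nondeg bd by (simp add: d_def)
  obtain x0 where x0: "x0 \<in> E" using nondeg by blast
  define B where "B z = ball (x0 + d *\<^sub>R z) (d / 4) \<inter> E" for z
  have Bm: "B z \<in> sets \<sigma>" for z unfolding B_def by (rule borel_subset_sets) auto
  have cov: "E \<subseteq> (\<Union>z\<in>X. B z)"
  proof
    fix y assume y: "y \<in> E"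
    have "dist y x0 \<le> d" unfolding d_def by (rule diameter_bounded_bound[OF bd y x0])
    then have "norm (y - x0) / d \<le> 1" using d by (simp add: dist_norm)
    moreover have "norm ((y - x0) /\<^sub>R d) = norm (y - x0) / d" using d
      by (simp add: divide_inverse mult.commute)
    ultimately have "(y - x0) /\<^sub>R d \<in> cball 0 1" by (simp only: mem_cball_0)
    then have "(y - x0) /\<^sub>R d \<in> (\<Union>z\<in>X. ball z (1/4))" using net(2) by blast
    then obtain z where "z \<in> X" "(y - x0) /\<^sub>R d \<in> ball z (1/4)" by blast
    then have z: "z \<in> X" "dist z ((y - x0) /\<^sub>R d) < 1/4" by (simp_all only: mem_ball)
    have "dist (x0 + d *\<^sub>R z) y = d * dist z ((y - x0) /\<^sub>R d)"
    proof -
      have "x0 + d *\<^sub>R z - y = d *\<^sub>R (z - (y - x0) /\<^sub>R d)" using d by (simp add: algebra_simps)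
      then show ?thesis using d by (simp add: dist_norm)
    qed
    also have "\<dots> < d * (1/4)" using z d by (intro mult_strict_left_mono)
    finally have "y \<in> B z" using y by (simp add: B_def)
    then show "y \<in> (\<Union>z\<in>X. B z)" using z by blast
  qed
  have Bz: "emeasure \<sigma> (B z) \<le> ennreal (C\<^sub>E * d ^ n)" for z
  proof (cases "B z = {}")
    case False
    then obtain w where w: "w \<in> B z" by blast
    have "B z \<subseteq> ball w (d / 2) \<inter> E"
    proof
      fix y assume y: "y \<in> B z"
      have "dist w y \<le> dist (x0 + d *\<^sub>R z) w + dist (x0 + d *\<^sub>R z) y" by (rule dist_triangle3)
      also have "\<dots> < d / 4 + d / 4" using w y by (intro add_strict_mono) (auto simp: B_def)
      finally show "y \<in> ball w (d / 2) \<inter> E" using y by (simp add: B_def)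
    qed
    then have "emeasure \<sigma> (B z) \<le> emeasure \<sigma> (ball w (d / 2) \<inter> E)"
      by (intro emeasure_mono borel_subset_sets) auto
    also have "\<dots> \<le> ennreal (C\<^sub>E * (d / 2) ^ n)"
      using w d by (intro upper_small) (auto simp: B_def d_def)
    also have "\<dots> \<le> ennreal (C\<^sub>E * d ^ n)"
      using d pos by (intro ennreal_leI mult_left_mono power_mono) auto
    finally show ?thesis .
  qed simp
  have "emeasure \<sigma> E \<le> emeasure \<sigma> (\<Union>z\<in>X. B z)"
    using cov Bm net(1) by (intro emeasure_mono sets.finite_UN) auto
  also have "\<dots> \<le> (\<Sum>z\<in>X. emeasure \<sigma> (B z))" using Bm net(1)
    by (intro emeasure_subadditive_finite) auto
  also have "\<dots> \<le> (\<Sum>z\<in>X. ennreal (C\<^sub>E * d ^ n))" by (intro sum_mono Bz)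
  also have "\<dots> = ennreal (card X * C\<^sub>E * d ^ n)"
    using pos d by (simp add: ennreal_of_nat_eq_real_of_nat ennreal_mult[symmetric] mult.assoc)
  finally show ?thesis by (simp add: d_def)
qed

lemma A_pos: "0 < A" using pos by (simp add: A_def)

lemma upper_regular:
  assumes "x \<in> E" "0 < r"
  shows "emeasure \<sigma> (ball x r \<inter> E) \<le> ennreal (A * r ^ n)"
proof (cases "bounded E \<longrightarrow> r < diameter E")
  case True
  then have "emeasure \<sigma> (ball x r \<inter> E) \<le> ennreal (C\<^sub>E * r ^ n)" using upper_small assms by blast
  also have "C\<^sub>E * r ^ n \<le> A * r ^ n"
    using pos assms by (intro mult_right_mono) (auto simp: A_def)
  finally show ?thesis by (simp add: ennreal_leI)
next
  case False
  then have b: "bounded E" "diameter E \<le> r" by auto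
  have "emeasure \<sigma> (ball x r \<inter> E) \<le> emeasure \<sigma> E" by (intro emeasure_mono borel_subset_sets) auto
  also have "\<dots> \<le> ennreal (card X * C\<^sub>E * diameter E ^ n)" by (rule upper_total[OF b(1)])
  also have "card X * C\<^sub>E * diameter E ^ n \<le> A * r ^ n"
    using pos b nondeg(2)[OF b(1)] by (intro mult_mono power_mono) (auto simp: A_def algebra_simps)
  finally show ?thesis by (simp add: ennreal_leI)
qed

sublocale sigma_finite_measure \<sigma>
proof
  obtain x0 where x0: "x0 \<in> E" using nondeg by blast
  let ?F = "range (\<lambda>i::nat. ball x0 (real (Suc i)) \<inter> E)"
  show "\<exists>F. countable F \<and> F \<subseteq> sets \<sigma> \<and> \<Union>F = space \<sigma> \<and> (\<forall>a\<in>F. emeasure \<sigma> a \<noteq> \<infinity>)"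
  proof (intro exI[of _ ?F] conjI)
    show "?F \<subseteq> sets \<sigma>" by (auto intro!: borel_subset_sets)
    show "\<Union>?F = space \<sigma>"
    proof (intro equalityI subsetI)
      fix y assume "y \<in> space \<sigma>"
      then have y: "y \<in> E" by simp
      obtain i :: nat where "dist x0 y < i" using reals_Archimedean2 by blast
      then have "y \<in> ball x0 (real (Suc i)) \<inter> E" using y by simp
      then show "y \<in> \<Union>?F" by blast
    qed auto
    show "\<forall>a\<in>?F. emeasure \<sigma> a \<noteq> \<infinity>"
    proof
      fix a assume "a \<in> ?F"
      then obtain i :: nat where a: "a = ball x0 (real (Suc i)) \<inter> E" by blast
      have "emeasure \<sigma> a \<le> ennreal (A * real (Suc i) ^ n)" unfolding a using x0
        by (intro upper_regular) auto
      then show "emeasure \<sigma> a \<noteq> \<infinity>" by (auto simp: top_unique)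
    qed
  qed auto
qed

lemma grid_facts:
  assumes k: "k \<in> K"
  shows grid_borel: "Q \<in> D k \<Longrightarrow> Q \<in> sets borel" and grid_sub: "Q \<in> D k \<Longrightarrow> Q \<subseteq> E"
    and grid_cover: "\<Union>(D k) = E"
    and grid_nested: "k' \<in> K \<Longrightarrow> k < k' \<Longrightarrow> Q \<in> D k \<Longrightarrow> Q' \<in> D k' \<Longrightarrow> Q' \<inter> Q = {} \<or> Q' \<subseteq> Q"
    and grid_parent: "k' \<in> K \<Longrightarrow> k < k' \<Longrightarrow> Q' \<in> D k' \<Longrightarrow> \<exists>!Q. Q \<in> D k \<and> Q' \<subseteq> Q"
    and grid_bounded: "Q \<in> D k \<Longrightarrow> bounded Q" and grid_diam: "Q \<in> D k \<Longrightarrow> diameter Q \<le> c\<^sub>1 * gscale k"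
    and grid_lower: "Q \<in> D k \<Longrightarrow> ennreal (gscale k ^ n / c\<^sub>1) \<le> emeasure \<sigma> Q"
    and grid_upper: "Q \<in> D k \<Longrightarrow> emeasure \<sigma> Q \<le> ennreal (c\<^sub>1 * gscale k ^ n)"
    and grid_ball: "Q \<in> D k \<Longrightarrow> \<exists>x\<in>E. ball x (a\<^sub>0 * gscale k) \<inter> E \<subseteq> Q"
    and grid_bdry: "Q \<in> D k \<Longrightarrow> 0 < \<tau> \<Longrightarrow> \<tau> < a\<^sub>0 \<Longrightarrow>
       emeasure \<sigma> {x\<in>Q. E - Q \<noteq> {} \<and> infdist x (E - Q) \<le> \<tau> * gscale k} \<le> ennreal (c\<^sub>2 * \<tau> powr \<eta>\<^sub>0)
         * emeasure \<sigma> Q"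
proof -
  note g = grid[unfolded dyadic_grid_def Let_def]
  note g1 = g[THEN conjunct1, rule_format, OF k]
    and g2 = g[THEN conjunct2, THEN conjunct1, rule_format, OF k]
    and g3 = g[THEN conjunct2, THEN conjunct2, THEN conjunct1, rule_format, OF k]
    and g4 = g[THEN conjunct2, THEN conjunct2, THEN conjunct2, THEN conjunct1, rule_format, OF k]
    and g5 = g[THEN conjunct2, THEN conjunct2, THEN conjunct2, THEN conjunct2, THEN conjunct1,
      rule_format, OF k, unfolded scale_power]
    and g6 = g[THEN conjunct2, THEN conjunct2, THEN conjunct2, THEN conjunct2, THEN conjunct2, THEN
      conjunct1, rule_format, OF k]
    and g7 = g[THEN conjunct2, THEN conjunct2, THEN conjunct2, THEN conjunct2, THEN conjunct2, THEN
      conjunct2, rule_format, OF k]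
  show "Q \<in> D k \<Longrightarrow> Q \<in> sets borel" "Q \<in> D k \<Longrightarrow> Q \<subseteq> E" by (simp_all add: g1)
  show "\<Union>(D k) = E" using g2 by simp
  show "k' \<in> K \<Longrightarrow> k < k' \<Longrightarrow> Q \<in> D k \<Longrightarrow> Q' \<in> D k' \<Longrightarrow> Q' \<inter> Q = {} \<or> Q' \<subseteq> Q" by (rule g3)
  show "k' \<in> K \<Longrightarrow> k < k' \<Longrightarrow> Q' \<in> D k' \<Longrightarrow> \<exists>!Q. Q \<in> D k \<and> Q' \<subseteq> Q" by (rule g4)
  show "Q \<in> D k \<Longrightarrow> bounded Q" "Q \<in> D k \<Longrightarrow> diameter Q \<le> c\<^sub>1 * gscale k"
    "Q \<in> D k \<Longrightarrow> ennreal (gscale k ^ n / c\<^sub>1) \<le> emeasure \<sigma> Q"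
    "Q \<in> D k \<Longrightarrow> emeasure \<sigma> Q \<le> ennreal (c\<^sub>1 * gscale k ^ n)" by (simp_all only: g5)
  show "Q \<in> D k \<Longrightarrow> \<exists>x\<in>E. ball x (a\<^sub>0 * gscale k) \<inter> E \<subseteq> Q" by (rule g6)
  show "Q \<in> D k \<Longrightarrow> 0 < \<tau> \<Longrightarrow> \<tau> < a\<^sub>0 \<Longrightarrow>
       emeasure \<sigma> {x\<in>Q. E - Q \<noteq> {} \<and> infdist x (E - Q) \<le> \<tau> * gscale k} \<le> ennreal (c\<^sub>2 * \<tau> powr \<eta>\<^sub>0)
         * emeasure \<sigma> Q"
    by (rule g7) simp_all
qed

lemma K_upward: "k \<in> K \<Longrightarrow> k \<le> k' \<Longrightarrow> k' \<in> K"
  using scale_mono[of k k'] by (auto simp: generations_def)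

text \<open>The nesting property compares different generations only. A common point lies in a cube
  of the next generation, which is contained in both cubes and has just one parent.\<close>

lemma grid_disjoint:
  assumes k: "k \<in> K" and Q: "Q \<in> D k" "R \<in> D k" "x \<in> Q" "x \<in> R"
  shows "Q = R"
proof -
  have k1: "k + 1 \<in> K" using K_upward[OF k] by simp
  have "x \<in> E" using grid_sub[OF k Q(1)] Q by blast
  then obtain P where P: "P \<in> D (k + 1)" "x \<in> P" using grid_cover[OF k1] by blast
  have "P \<subseteq> Q" "P \<subseteq> R" using grid_nested[OF k k1 _ _ P(1)] P Q by auto
  then show ?thesis using grid_parent[OF k k1 _ P(1)] Q by auto
qed

text \<open>Each cube contains a surface ball of radius r about some centre, so centres of different
  cubes are at least r apart. The balls of half that radius are then disjoint open sets in Euclidean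
  space.\<close>

lemma grid_countable:
  assumes k: "k \<in> K"
  shows "countable (D k)"
proof -
  define r where "r = a\<^sub>0 * gscale k"
  have r: "0 < r" using pos by (simp add: r_def)
  obtain z where z: "\<And>Q. Q \<in> D k \<Longrightarrow> z Q \<in> E" "\<And>Q. Q \<in> D k \<Longrightarrow> ball (z Q) r \<inter> E \<subseteq> Q"
    using grid_ball[OF k] unfolding r_def by metis
  have zQ: "z Q \<in> Q" if "Q \<in> D k" for Q using z[OF that] r by auto
  have eq: "Q = R" if QR: "Q \<in> D k" "R \<in> D k" "dist (z Q) (z R) < r" for Q R
  proof -
    have "z R \<in> Q" using z(2)[OF QR(1)] z(1)[OF QR(2)] QR(3) by auto
    then show ?thesis using grid_disjoint[OF k QR(1,2)] zQ[OF QR(2)] by blast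
  qed
  have "countable ((\<lambda>Q. ball (z Q) (r/2)) ` D k)"
  proof (rule countable_disjoint_open_subsets)
    show "pairwise disjnt ((\<lambda>Q. ball (z Q) (r/2)) ` D k)"
    proof (rule pairwiseI)
      fix S S' assume S: "S \<in> (\<lambda>Q. ball (z Q) (r/2)) ` D k" "S' \<in> (\<lambda>Q. ball (z Q) (r/2)) ` D k"
        "S \<noteq> S'"
      then obtain Q R where QR: "Q \<in> D k" "R \<in> D k" "S = ball (z Q) (r/2)" "S' = ball (z R) (r/2)"
        by blast
      show "disjnt S S'"
      proof (rule ccontr)
        assume "\<not> disjnt S S'"
        then obtain y where y: "dist (z Q) y < r/2" "dist (z R) y < r/2" using QR
          by (auto simp: disjnt_iff)
        have "dist (z Q) (z R) \<le> dist (z Q) y + dist (z R) y" by (metis dist_commute dist_triangle)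
        then have "dist (z Q) (z R) < r" using y by linarith
        then show False using eq QR S(3) by blast
      qed
    qed
  qed auto
  moreover have "inj_on (\<lambda>Q. ball (z Q) (r/2)) (D k)"
  proof (rule inj_onI)
    fix Q R assume QR: "Q \<in> D k" "R \<in> D k" "ball (z Q) (r/2) = ball (z R) (r/2)"
    then have "z Q \<in> ball (z R) (r/2)" using r by (metis centre_in_ball half_gt_zero)
    then have "dist (z Q) (z R) < r" using r by (simp add: dist_commute)
    then show "Q = R" using eq QR by blast
  qed
  ultimately show ?thesis by (rule countable_image_inj_on)
qed

sublocale dyadic_system \<sigma> D K
proof
  show "\<And>k k'. k \<in> K \<Longrightarrow> k \<le> k' \<Longrightarrow> k' \<in> K" by (rule K_upward)
  show "Q \<in> sets \<sigma>" if "k \<in> K" "Q \<in> D k" for k Q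
    by (rule borel_subset_sets[OF grid_borel[OF that] grid_sub[OF that]])
  show "\<And>k. k \<in> K \<Longrightarrow> countable (D k)" by (rule grid_countable)
  show "\<And>k. k \<in> K \<Longrightarrow> \<Union>(D k) = space \<sigma>" by (simp add: grid_cover)
  show "R \<subseteq> Q" if "k \<in> K" "k \<le> k'" "Q \<in> D k" "R \<in> D k'" "Q \<inter> R \<noteq> {}" for k k' Q R
  proof (cases "k = k'")
    case True
    then show ?thesis using grid_disjoint[of k Q R] that by auto
  next
    case False
    then show ?thesis using grid_nested[of k k' Q R] K_upward[of k k'] that by auto
  qed
  show "emeasure \<sigma> Q \<noteq> 0" if "k \<in> K" "Q \<in> D k" for k Q
  proof
    assume "emeasure \<sigma> Q = 0"
    then have "ennreal (gscale k ^ n / c\<^sub>1) \<le> 0" using grid_lower[OF that] by simp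
    moreover have "0 < gscale k ^ n / c\<^sub>1" using pos by simp
    ultimately show False by (simp add: ennreal_eq_0_iff)
  qed
  show "emeasure \<sigma> Q \<noteq> \<infinity>" if "k \<in> K" "Q \<in> D k" for k Q
    using grid_upper[OF that] by (auto simp: top_unique)
qed

lemma cell_lower: "k \<in> K \<Longrightarrow> x \<in> E \<Longrightarrow> ennreal (gscale k ^ n / c\<^sub>1) \<le> emeasure \<sigma> (cell k x)"
  using grid_lower cell_in_D by simp

lemma cell_upper: "k \<in> K \<Longrightarrow> x \<in> E \<Longrightarrow> emeasure \<sigma> (cell k x) \<le> ennreal (c\<^sub>1 * gscale k ^ n)"
  using grid_upper cell_in_D by simp

lemma cell_dist: "k \<in> K \<Longrightarrow> x \<in> E \<Longrightarrow> y \<in> cell k x \<Longrightarrow> z \<in> cell k x \<Longrightarrow> dist y z \<le> c\<^sub>1 * gscale k"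
  using diameter_bounded_bound[OF grid_bounded[OF _ cell_in_D], of k x y z] grid_diam[OF _
    cell_in_D, of k x]
  by fastforce

text \<open>Both cells have the size of their generation, at the cost of \<open>c\<^sub>1\<close>
  each time and of 2^n for the scale. The summand 1 makes the constant at least 1, as the abstract
  theorem demands.\<close>

lemma cell_doubling:
  assumes k: "k \<in> K" and x: "x \<in> space \<sigma>"
  shows "emeasure \<sigma> (cell k x) \<le> ennreal (1 + c\<^sub>1\<^sup>2 * 2 ^ n) * emeasure \<sigma> (cell (k + 1) x)"
proof -
  have k1: "k + 1 \<in> K" using K_upward[OF k] by simp
  have xE: "x \<in> E" using x by simp
  have s: "gscale k = 2 * gscale (k + 1)" using scale_ratio[of k "k + 1"] by simp
  have "emeasure \<sigma> (cell k x) \<le> ennreal (c\<^sub>1 * gscale k ^ n)" by (rule cell_upper[OF k xE])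
  also have "c\<^sub>1 * gscale k ^ n = (c\<^sub>1\<^sup>2 * 2 ^ n) * (gscale (k + 1) ^ n / c\<^sub>1)"
    unfolding s power_mult_distrib using pos by (simp add: power2_eq_square)
  also have "ennreal \<dots> = ennreal (c\<^sub>1\<^sup>2 * 2 ^ n) * ennreal (gscale (k + 1) ^ n / c\<^sub>1)"
    using pos by (intro ennreal_mult) auto
  also have "\<dots> \<le> ennreal (1 + c\<^sub>1\<^sup>2 * 2 ^ n) * emeasure \<sigma> (cell (k + 1) x)"
    by (intro mult_mono ennreal_leI cell_lower k1 xE) auto
  finally show ?thesis .
qed

text \<open>The size bound of \<psi> as seen from height t above x: there both the distance to y and
  t are dominated by |Y - y|. It is of Poisson type and symmetric in x and y.\<close>

definition pk :: "real \<Rightarrow> real \<Rightarrow> 'a \<Rightarrow> 'a \<Rightarrow> real" where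
  "pk \<alpha> t x y = t powr \<alpha> / (t + dist x y) powr (real n + \<alpha>)"

lemma pk_nonneg: "0 \<le> pk \<alpha> t x y" by (simp add: pk_def)

lemma pk_sym: "pk \<alpha> t x y = pk \<alpha> t y x" by (simp add: pk_def dist_commute)

lemma pk_le: "0 < t \<Longrightarrow> 0 < \<alpha> \<Longrightarrow> pk \<alpha> t x y \<le> t powr \<alpha> / t powr (real n + \<alpha>)"
  unfolding pk_def using zero_le_dist[of x y]
  by (intro divide_left_mono powr_mono2 mult_pos_pos) (auto simp: add_nonneg_eq_0_iff simp del:
    zero_le_dist)

lemma two_powr_neg_less: "0 < a \<Longrightarrow> 2 powr (- a) < (1::real)"
  using powr_less_mono[of "- a" 0 "2::real"] by simp

text \<open>The sum of the geometric series over dyadic shells.\<close>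

definition Mass :: "real \<Rightarrow> real" where "Mass \<alpha> = A * 2 powr (real n + \<alpha>) / (1 - 2 powr (-\<alpha>))"

lemma pk_measurable: "(\<lambda>y. pk \<alpha> t x y) \<in> borel_measurable \<sigma>"
  by (rule borel_measurable_\<sigma>) (simp add: pk_def)

text \<open>On the shell |x - y| ~ 2^i t the kernel is about (2^i)^(-n-\<alpha>) t^(-n) and the
  measure at most A (2^i t)^n, so the shell contributes about 2^(-\<alpha> i).\<close>

lemma pk_mass:
  assumes t: "0 < t" and \<alpha>: "0 < \<alpha>" and x: "x \<in> E"
  shows "(\<integral>\<^sup>+y. ennreal (pk \<alpha> t x y) \<partial>\<sigma>) \<le> ennreal (Mass \<alpha>)"
proof -
  let ?g = "real n + \<alpha>"
  \<comment> \<open>In shell i the distance is only known to be at least 2^(i-1) t; the leading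
    power of 2 pays for this.\<close>
  define c where "c i = 2 powr ?g * (1 / 2 powr ?g) ^ i / t ^ n" for i :: nat
  define B where "B i = ball x (2 ^ i * t) \<inter> E" for i :: nat
  have c0: "0 \<le> c i" for i using t by (simp add: c_def)
  have Bm[measurable]: "B i \<in> sets \<sigma>" for i unfolding B_def by (rule borel_subset_sets) auto
  have tn: "t powr \<alpha> / t powr ?g = 1 / t ^ n"
    using t by (simp add: powr_add powr_realpow)
  have pt: "ennreal (pk \<alpha> t x y) \<le> (\<Sum>i. ennreal (c i) * indicator (B i) y)" if y: "y \<in> E" for y
  proof -
    have ex: "\<exists>i::nat. dist x y < 2 ^ i * t"
    proof -
      obtain i :: nat where "dist x y / t < 2 ^ i" using real_arch_pow[of 2 "dist x y / t"] by auto
      then show ?thesis using t by (auto simp: field_simps)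
    qed
    define i where "i = (LEAST i::nat. dist x y < 2 ^ i * t)"
    have i: "dist x y < 2 ^ i * t" unfolding i_def using ex by (rule LeastI_ex)
    have "pk \<alpha> t x y \<le> c i"
    proof (cases i)
      case 0
      have "pk \<alpha> t x y \<le> 1 / t ^ n" using pk_le[OF t \<alpha>, of x y] by (simp add: tn)
      also have "\<dots> \<le> 2 powr ?g * (1 / t ^ n)"
        using t \<alpha> mult_right_mono[of 1 "2 powr ?g" "1 / t ^ n"] by (simp add: ge_one_powr_ge_zero)
      finally show ?thesis using 0 by (simp add: c_def)
    next
      case (Suc m)
      have "\<not> dist x y < 2 ^ m * t" using not_less_Least[of m "\<lambda>i. dist x y < 2 ^ i * t"] Suc
        by (simp add: i_def)
      then have "2 ^ m * t \<le> t + dist x y" using t by simp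
      then have "pk \<alpha> t x y \<le> t powr \<alpha> / (2 ^ m * t) powr ?g"
        unfolding pk_def using t \<alpha> zero_le_dist[of x y]
        by (intro divide_left_mono powr_mono2 mult_pos_pos) (auto simp: add_nonneg_eq_0_iff simp
          del: zero_le_dist)
      also have "(2 ^ m * t) powr ?g = (2 powr ?g) ^ m * t powr ?g"
        by (simp add: powr_mult powr_realpow[symmetric] powr_powr mult.commute)
      also have "t powr \<alpha> / ((2 powr ?g) ^ m * t powr ?g)
        = (1 / 2 powr ?g) ^ m * (t powr \<alpha> / t powr ?g)"
        by (simp add: power_one_over)
      also have "\<dots> = c i" unfolding tn c_def Suc by simp
      finally show ?thesis .
    qed
    then have "ennreal (pk \<alpha> t x y) \<le> ennreal (c i) * indicator (B i) y"
      using i y by (simp add: B_def ennreal_leI)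
    also have "\<dots> = (\<Sum>j\<in>{i}. ennreal (c j) * indicator (B j) y)"
      by (simp only: sum.insert[OF finite.emptyI] empty_iff sum.empty add_0_right not_False_eq_True)
    also have "\<dots> \<le> (\<Sum>j. ennreal (c j) * indicator (B j) y)" by (intro sum_le_suminf) auto
    finally show ?thesis .
  qed
  have "(\<integral>\<^sup>+y. ennreal (pk \<alpha> t x y) \<partial>\<sigma>) \<le> (\<integral>\<^sup>+y. (\<Sum>i. ennreal (c i) * indicator (B i) y) \<partial>\<sigma>)"
    using pt by (intro nn_integral_mono) simp
  also have "\<dots> = (\<Sum>i. ennreal (c i) * emeasure \<sigma> (B i))"
    by (subst nn_integral_suminf) (auto simp: nn_integral_cmult_indicator)
  also have "\<dots> \<le> (\<Sum>i. ennreal (A * 2 powr ?g * (2 powr (-\<alpha>)) ^ i))"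
  proof (intro suminf_le)
    fix i :: nat
    have "ennreal (c i) * emeasure \<sigma> (B i) \<le> ennreal (c i) * ennreal (A * (2 ^ i * t) ^ n)"
      unfolding B_def using t x by (intro mult_left_mono upper_regular) auto
    also have "\<dots> = ennreal (c i * (A * (2 ^ i * t) ^ n))" using c0 A_pos t
      by (intro ennreal_mult[symmetric]) auto
    also have "c i * (A * (2 ^ i * t) ^ n) = A * 2 powr ?g * ((1 / 2 powr ?g) ^ i * (2 ^ n) ^ i)"
      using t by (simp add: c_def power_mult_distrib power_mult[symmetric] mult.commute)
    also have "(1 / 2 powr ?g) ^ i * (2 ^ n) ^ i = (2 powr (-\<alpha>)) ^ i"
      unfolding power_mult_distrib[symmetric]
      by (rule arg_cong[of _ _ "\<lambda>z. z ^ i"]) (simp add: powr_add powr_minus powr_realpow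
        field_simps)
    finally show "ennreal (c i) * emeasure \<sigma> (B i) \<le> ennreal (A * 2 powr ?g * (2 powr (-\<alpha>)) ^ i)" .
  qed auto
  also have "\<dots> = ennreal (\<Sum>i. A * 2 powr ?g * (2 powr (-\<alpha>)) ^ i)"
    using A_pos two_powr_neg_less[OF \<alpha>]
      by (intro suminf_ennreal2 summable_mult summable_geometric) auto
  also have "(\<Sum>i. A * 2 powr ?g * (2 powr (-\<alpha>)) ^ i) = Mass \<alpha>"
    using \<alpha> two_powr_neg_less[OF \<alpha>]
      by (subst suminf_mult) (auto simp: Mass_def suminf_geometric summable_geometric)
  finally show ?thesis .
qed

lemma Mass_pos: "0 < \<alpha> \<Longrightarrow> 0 < Mass \<alpha>"
  unfolding Mass_def using A_pos
    by (intro divide_pos_pos mult_pos_pos) (auto simp: two_powr_neg_less)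

end

lemma infdist_borel: "(\<lambda>x. infdist x A) \<in> borel_measurable borel"
  by (intro borel_measurable_continuous_onI continuous_intros)

section \<open>Mass of the model kernel across cell boundaries\<close>

context adr_grid
begin

text \<open>With scale ratio \<rho>, a boundary layer of relative width sqrt \<rho> has proportion
  \<rho>^(\<eta>/2), where \<eta> is the exponent of the grid. Beyond the layer the kernel has lost
  (sqrt \<rho>)^(\<alpha>/2) = \<rho>^(\<alpha>/4).\<close>

definition bexp :: "real \<Rightarrow> real" where "bexp \<alpha> = min (\<eta>\<^sub>0 / 2) (\<alpha> / 4)"
definition qq :: "real \<Rightarrow> real" where "qq \<alpha> = 2 powr (- bexp \<alpha>)"
text \<open>The three summands belong to the boundary layer, to its complement in the cell, and to
  scales too close for the small boundary property.\<close>

definition Cbd :: "real \<Rightarrow> real" where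
  "Cbd \<alpha> = Mass \<alpha> * c\<^sub>2 + Mass (\<alpha> / 2) + Mass \<alpha> * a\<^sub>0 powr (- (2 * bexp \<alpha>))"

lemma bexp_pos: "0 < \<alpha> \<Longrightarrow> 0 < bexp \<alpha>" using pos by (simp add: bexp_def)

lemma qq: "0 < \<alpha> \<Longrightarrow> 0 < qq \<alpha>" "0 < \<alpha> \<Longrightarrow> qq \<alpha> < 1"
  using two_powr_neg_less[OF bexp_pos] by (auto simp: qq_def)

lemma half_power_powr:
  fixes e :: real
  shows "((1/2) ^ m) powr e = (2 powr (- e)) ^ m"
proof -
  have "((1/2::real) ^ m) powr e = ((1/2) powr real m) powr e" by (simp add: powr_realpow)
  also have "\<dots> = (1/2) powr (real m * e)" by (simp add: powr_powr)
  also have "\<dots> = 2 powr (- (real m * e))" by (simp add: powr_divide powr_minus_divide)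
  also have "\<dots> = (2 powr (- e)) powr real m" by (simp add: powr_powr mult.commute)
  also have "\<dots> = (2 powr (- e)) ^ m" by (simp add: powr_realpow)
  finally show ?thesis .
qed

lemma Cbd_pos: "0 < \<alpha> \<Longrightarrow> 0 < Cbd \<alpha>"
  unfolding Cbd_def using Mass_pos[of \<alpha>] Mass_pos[of "\<alpha>/2"] pos
  by (intro add_pos_nonneg add_pos_pos mult_pos_pos) auto

text \<open>Half of the exponent \<alpha> is spent on the ratio t / s; the other half keeps the
  kernel integrable.\<close>

lemma pk_far:
  assumes t: "0 < t" and \<alpha>: "0 < \<alpha>" and s: "0 < s" "s \<le> dist x y"
  shows "pk \<alpha> t x y \<le> (t / s) powr (\<alpha> / 2) * pk (\<alpha> / 2) t x y"
proof -
  let ?u = "t + dist x y"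
  have u: "0 < ?u" "s \<le> ?u" using t s by auto
  have "?u powr (real n + \<alpha>) = ?u powr (\<alpha> / 2) * ?u powr (real n + \<alpha> / 2)"
    by (simp add: powr_add[symmetric] add.commute)
  moreover have "t powr \<alpha> = t powr (\<alpha> / 2) * t powr (\<alpha> / 2)" by (simp add: powr_add[symmetric])
  ultimately have "pk \<alpha> t x y = (t / ?u) powr (\<alpha> / 2) * pk (\<alpha> / 2) t x y"
    using t u by (simp add: pk_def powr_divide)
  also have "\<dots> \<le> (t / s) powr (\<alpha> / 2) * pk (\<alpha> / 2) t x y"
    using t u s \<alpha> by (intro mult_right_mono powr_mono2 divide_left_mono pk_nonneg) auto
  finally show ?thesis .
qed

text \<open>Near the boundary use the full mass of the kernel and the smallness of the layer, away
  from it the decay in \<open>pk_far\<close>.\<close>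

lemma boundary_mass:
  assumes \<alpha>: "0 < \<alpha>" and j: "j \<in> K" "j \<le> k" and z: "z \<in> E"
  shows "(\<integral>\<^sup>+x. (\<integral>\<^sup>+y. ennreal (pk \<alpha> (gscale k) x y) * indicator (E - cell j z) y \<partial>\<sigma>)
    * indicator (cell j z) x \<partial>\<sigma>)
    \<le> ennreal (Cbd \<alpha> * qq \<alpha> ^ nat (k - j)) * emeasure \<sigma> (cell j z)"
proof -
  define S where "S = cell j z"
  define t where "t = gscale k"
  define l where "l = gscale j"
  define m where "m = nat (k - j)"
  define \<rho> where "\<rho> = (1/2::real) ^ m"
  define \<epsilon> where "\<epsilon> = bexp \<alpha>"
  have l: "0 < l" and t: "0 < t" by (simp_all add: l_def t_def)
  have tl: "t = l * \<rho>" unfolding t_def l_def \<rho>_def m_def by (rule scale_ratio[OF j(2)])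
  have \<rho>: "0 < \<rho>" "\<rho> \<le> 1" by (auto simp: \<rho>_def power_le_one)
  have \<epsilon>: "0 < \<epsilon>" "\<epsilon> \<le> \<eta>\<^sub>0 / 2" "\<epsilon> \<le> \<alpha> / 4" using bexp_pos[OF \<alpha>] by (auto simp: \<epsilon>_def bexp_def)
  have q: "\<rho> powr \<epsilon> = qq \<alpha> ^ m" unfolding \<rho>_def qq_def \<epsilon>_def by (rule half_power_powr)
  have S[measurable]: "S \<in> sets \<sigma>" unfolding S_def using cell_sets[OF j(1)] z by simp
  have SD: "S \<in> D j" unfolding S_def using cell_in_D[OF j(1)] z by simp
  have SE: "S \<subseteq> E" using grid_sub[OF j(1) SD] .
  define w where "w x = (\<integral>\<^sup>+y. ennreal (pk \<alpha> t x y) * indicator (E - S) y \<partial>\<sigma>)" for x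
  have w1: "w x \<le> ennreal (Mass \<alpha>)" if "x \<in> E" for x
  proof -
    have "w x \<le> (\<integral>\<^sup>+y. ennreal (pk \<alpha> t x y) \<partial>\<sigma>)"
      unfolding w_def by (intro nn_integral_mono) (auto split: split_indicator)
    also have "\<dots> \<le> ennreal (Mass \<alpha>)" by (rule pk_mass[OF t \<alpha> that])
    finally show ?thesis .
  qed
  have M: "0 < Mass \<alpha>" "0 < Mass (\<alpha>/2)" using Mass_pos \<alpha> by auto
  \<comment> \<open>The width of the layer, balanced between making the layer thin and the distance
    beyond it large compared with the scale t.\<close>
  define \<tau> where "\<tau> = \<rho> powr (1/2)"
  have \<tau>: "0 < \<tau>" using \<rho> by (simp add: \<tau>_def)
  have main: "(\<integral>\<^sup>+x. w x * indicator S x \<partial>\<sigma>) \<le> ennreal (Cbd \<alpha> * \<rho> powr \<epsilon>) * emeasure \<sigma> S"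
  proof (cases "\<tau> < a\<^sub>0")
    case True
    define B where "B = {x \<in> S. E - S \<noteq> {} \<and> infdist x (E - S) \<le> \<tau> * l}"
    have [measurable]: "(\<lambda>x. infdist x (E - S)) \<in> borel_measurable borel" by (rule infdist_borel)
    have "{x. infdist x (E - S) \<le> \<tau> * l} \<in> sets borel" by measurable
    then have "{x \<in> E. infdist x (E - S) \<le> \<tau> * l} \<in> sets \<sigma>"
      by (intro borel_subset_sets) (auto simp: Collect_conj_eq)
    \<comment> \<open>A cell that exhausts E needs its own case, because \<open>infdist x {}\<close>
      is 0.\<close>
    moreover have "B = (if E - S = {} then {} else {x \<in> E. infdist x (E - S) \<le> \<tau> * l} \<inter> S)"
      using SE by (auto simp: B_def)
    ultimately have B[measurable]: "B \<in> sets \<sigma>" by auto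
    have w2: "w x \<le> ennreal (\<rho> powr \<epsilon> * Mass (\<alpha>/2))" if x: "x \<in> S" "x \<notin> B" for x
    proof (cases "E - S = {}")
      case True
      show ?thesis unfolding w_def True by simp
    next
      case False
      then have d: "\<tau> * l < infdist x (E - S)" using x by (auto simp: B_def)
      have "w x \<le> (\<integral>\<^sup>+y. ennreal ((t / (\<tau> * l)) powr (\<alpha> / 2)) * ennreal (pk (\<alpha>/2) t x y) \<partial>\<sigma>)"
        unfolding w_def
      proof (rule nn_integral_mono)
        fix y
        show "ennreal (pk \<alpha> t x y) * indicator (E - S) y
          \<le> ennreal ((t / (\<tau> * l)) powr (\<alpha> / 2)) * ennreal (pk (\<alpha>/2) t x y)"
        proof (cases "y \<in> E - S")
          case True
          have "\<tau> * l \<le> dist x y" using d infdist_le[OF True, of x] by linarith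
          then show ?thesis
            using pk_far[OF t \<alpha>, of "\<tau> * l" x y] True \<tau> l
              by (simp add: ennreal_mult'[symmetric] ennreal_leI)
        qed simp
      qed
      also have "\<dots> = ennreal ((t / (\<tau> * l)) powr (\<alpha> / 2)) * (\<integral>\<^sup>+y. ennreal (pk (\<alpha>/2) t x y) \<partial>\<sigma>)"
        using pk_measurable by (intro nn_integral_cmult) measurable
      also have "\<dots> \<le> ennreal ((t / (\<tau> * l)) powr (\<alpha> / 2)) * ennreal (Mass (\<alpha>/2))"
        using x SE \<alpha> by (intro mult_left_mono pk_mass t) auto
      also have "\<dots> = ennreal ((t / (\<tau> * l)) powr (\<alpha> / 2) * Mass (\<alpha>/2))" by (simp add: ennreal_mult')
      also have "t / (\<tau> * l) = \<rho> powr (1/2)"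
      proof -
        have "t / (\<tau> * l) = \<rho> / \<tau>" using l by (simp add: tl)
        also have "\<dots> = \<rho> powr (1 - 1/2)" using \<rho> unfolding \<tau>_def powr_diff by simp
        finally show ?thesis by simp
      qed
      also have "(\<rho> powr (1/2)) powr (\<alpha> / 2) = \<rho> powr (\<alpha> / 4)" by (simp add: powr_powr)
      also have "\<rho> powr (\<alpha> / 4) * Mass (\<alpha>/2) \<le> \<rho> powr \<epsilon> * Mass (\<alpha>/2)"
        using M \<rho> \<epsilon> by (intro mult_right_mono powr_mono') auto
      finally show ?thesis by (simp add: ennreal_leI)
    qed
    have "(\<integral>\<^sup>+x. w x * indicator S x \<partial>\<sigma>)
      \<le> (\<integral>\<^sup>+x. ennreal (Mass \<alpha>) * indicator B x + ennreal (\<rho> powr \<epsilon> * Mass (\<alpha>/2)) * indicator S x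
      \<partial>\<sigma>)"
    proof (rule nn_integral_mono)
      fix x
      show "w x * indicator S x \<le> ennreal (Mass \<alpha>) * indicator B x + ennreal (\<rho> powr \<epsilon> * Mass (\<alpha>/2))
        * indicator S x"
      proof (cases "x \<in> S")
        case xS: True
        show ?thesis
        proof (cases "x \<in> B")
          case True
          have "w x \<le> ennreal (Mass \<alpha>) + ennreal (\<rho> powr \<epsilon> * Mass (\<alpha>/2))"
            using xS SE by (intro add_increasing2 w1) auto
          then show ?thesis using True xS by simp
        next
          case False
          then show ?thesis using w2[OF xS False] xS by simp
        qed
      qed simp
    qed
    also have "\<dots> = ennreal (Mass \<alpha>) * emeasure \<sigma> B + ennreal (\<rho> powr \<epsilon> * Mass (\<alpha>/2)) * emeasure \<sigma> S"
      by (simp add: nn_integral_add nn_integral_cmult_indicator)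
    also have "\<dots> \<le> ennreal (Mass \<alpha>) * (ennreal (c\<^sub>2 * \<tau> powr \<eta>\<^sub>0) * emeasure \<sigma> S)
      + ennreal (\<rho> powr \<epsilon> * Mass (\<alpha>/2)) * emeasure \<sigma> S"
      unfolding B_def l_def by (intro add_right_mono mult_left_mono grid_bdry[OF j(1) SD \<tau> True])
        simp
    also have "\<dots> = ennreal (Mass \<alpha> * (c\<^sub>2 * \<tau> powr \<eta>\<^sub>0) + \<rho> powr \<epsilon> * Mass (\<alpha>/2)) * emeasure \<sigma> S"
      using M pos by (simp add: ennreal_triple_mult distrib_right)
    also have "\<dots> \<le> ennreal (Cbd \<alpha> * \<rho> powr \<epsilon>) * emeasure \<sigma> S"
    proof (intro mult_right_mono ennreal_leI)
      have "\<tau> powr \<eta>\<^sub>0 = \<rho> powr (\<eta>\<^sub>0 / 2)" by (simp add: \<tau>_def powr_powr)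
      also have "\<dots> \<le> \<rho> powr \<epsilon>" using \<rho> \<epsilon> by (intro powr_mono') auto
      finally have "Mass \<alpha> * c\<^sub>2 * \<tau> powr \<eta>\<^sub>0 \<le> Mass \<alpha> * c\<^sub>2 * \<rho> powr \<epsilon>"
        using M pos by (intro mult_left_mono) auto
      moreover have "0 \<le> Mass \<alpha> * a\<^sub>0 powr (- (2 * bexp \<alpha>)) * \<rho> powr \<epsilon>" using M by auto
      ultimately show "Mass \<alpha> * (c\<^sub>2 * \<tau> powr \<eta>\<^sub>0) + \<rho> powr \<epsilon> * Mass (\<alpha>/2) \<le> Cbd \<alpha> * \<rho> powr \<epsilon>"
        unfolding Cbd_def by (simp add: algebra_simps)
    qed auto
    finally show ?thesis .
  next
    case False
    \<comment> \<open>Now \<rho> is at least the square of \<open>a\<^sub>0\<close>, so the two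
      scales are comparable and the total mass suffices.\<close>
    have "a\<^sub>0 powr (2 * \<epsilon>) \<le> \<tau> powr (2 * \<epsilon>)" using False pos \<epsilon> by (intro powr_mono2) auto
    also have "\<tau> powr (2 * \<epsilon>) = \<rho> powr \<epsilon>" by (simp add: \<tau>_def powr_powr)
    finally have "1 \<le> a\<^sub>0 powr (- (2 * \<epsilon>)) * \<rho> powr \<epsilon>"
      using pos by (simp add: powr_minus field_simps)
    then have "Mass \<alpha> * 1 \<le> Mass \<alpha> * (a\<^sub>0 powr (- (2 * \<epsilon>)) * \<rho> powr \<epsilon>)" using M
      by (intro mult_left_mono) auto
    moreover have "0 \<le> Mass \<alpha> * c\<^sub>2 * \<rho> powr \<epsilon>" "0 \<le> Mass (\<alpha>/2) * \<rho> powr \<epsilon>" using M pos by auto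
    ultimately have MC: "Mass \<alpha> \<le> Cbd \<alpha> * \<rho> powr \<epsilon>"
      by (simp add: Cbd_def \<epsilon>_def[symmetric] algebra_simps)
    have "(\<integral>\<^sup>+x. w x * indicator S x \<partial>\<sigma>) \<le> (\<integral>\<^sup>+x. ennreal (Cbd \<alpha> * \<rho> powr \<epsilon>) * indicator S x \<partial>\<sigma>)"
    proof (rule nn_integral_mono)
      fix x
      show "w x * indicator S x \<le> ennreal (Cbd \<alpha> * \<rho> powr \<epsilon>) * indicator S x"
        using w1[of x] SE ennreal_leI[OF MC] by (cases "x \<in> S") (auto intro: order_trans)
    qed
    then show ?thesis by (simp add: nn_integral_cmult_indicator)
  qed
  then show ?thesis unfolding q by (simp add: w_def S_def t_def m_def)
qed

end

section \<open>Cubes and their diameters\<close>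

lemma cube_measurable: "cube c s \<in> sets borel" by (simp add: cube_def)

lemma compact_cube: "compact (cube c s)" by (simp add: cube_def compact_cbox)

lemma centre_in_cube: "0 < s \<Longrightarrow> c \<in> cube c s"
  by (auto simp: cube_def mem_box inner_diff_left inner_add_left)

lemma norm_One_bounds: "1 \<le> norm (One :: 'a::euclidean_space)" "norm (One :: 'a) \<le> DIM('a)"
proof -
  obtain i :: 'a where i: "i \<in> Basis" using nonempty_Basis by blast
  have "\<bar>(One :: 'a) \<bullet> i\<bar> \<le> norm (One :: 'a)" by (rule Basis_le_norm[OF i])
  then show "1 \<le> norm (One :: 'a)" using i by simp
  have "norm (One :: 'a) \<le> (\<Sum>b\<in>Basis. \<bar>(One :: 'a) \<bullet> b\<bar>)" by (rule norm_le_l1)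
  also have "\<dots> = (\<Sum>b\<in>(Basis :: 'a set). 1)" by (intro sum.cong) auto
  finally show "norm (One :: 'a) \<le> DIM('a)" by simp
qed

lemma diameter_cube:
  fixes c :: "'a::euclidean_space" and s :: real
  assumes "0 < s"
  shows "s \<le> diameter (cube c s)" "diameter (cube c s) \<le> DIM('a) * s"
proof -
  have "diameter (cube c s) = dist (c - (s / 2) *\<^sub>R One) (c + (s / 2) *\<^sub>R One)"
    unfolding cube_def using assms
      by (intro diameter_cbox) (auto simp: inner_diff_left inner_add_left)
  also have "\<dots> = norm (s *\<^sub>R (One :: 'a))"
  proof -
    have "c - (s / 2) *\<^sub>R One - (c + (s / 2) *\<^sub>R One) = - (s *\<^sub>R (One :: 'a))"
      by (simp add: algebra_simps flip: scaleR_add_left)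
    then show ?thesis by (simp only: dist_norm norm_minus_cancel)
  qed
  finally have d: "diameter (cube c s) = s * norm (One :: 'a)" using assms by simp
  show "s \<le> diameter (cube c s)" unfolding d using norm_One_bounds(1) assms by simp
  show "diameter (cube c s) \<le> DIM('a) * s" unfolding d
    using mult_left_mono[OF norm_One_bounds(2)[where 'a='a], of s] assms by (simp add: mult.commute)
qed

lemma euclidean_dyadic_cube:
  assumes "I \<in> euclidean_dyadic_cubes"
  obtains c j where "I = cube c (2 powi j)"
proof -
  obtain j m where I: "I = cbox (2 powi j *\<^sub>R m) (2 powi j *\<^sub>R (m + One))"
    using assms by (auto simp: euclidean_dyadic_cubes_def)
  have "I = cube (2 powi j *\<^sub>R m + (2 powi j / 2) *\<^sub>R One) (2 powi j)"
    unfolding I cube_def by (simp add: scaleR_add_right add.assoc flip: scaleR_add_left)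
  then show ?thesis by (rule that)
qed

section \<open>Whitney regions\<close>

locale tb_setting = adr_grid n C\<^sub>E a\<^sub>0 \<eta>\<^sub>0 c\<^sub>1 c\<^sub>2 c\<^sub>3 E D X
  for n :: nat and C\<^sub>E a\<^sub>0 \<eta>\<^sub>0 c\<^sub>1 c\<^sub>2 c\<^sub>3 :: real
    and E :: "'a::euclidean_space set" and D :: "int \<Rightarrow> 'a set set" and X :: "'a set" +
  fixes W :: "'a set set" and \<beta> C\<^sub>\<psi> \<alpha> :: real and \<psi> :: "'a \<Rightarrow> 'a \<Rightarrow> complex"
  assumes \<beta>: "40 * (real n + 1) \<le> \<beta>" and C\<psi>: "0 < C\<^sub>\<psi>" and \<alpha>: "0 < \<alpha>"
    and whitney: "whitney_decomposition E W" and kernel: "square_function_kernel n C\<^sub>\<psi> \<alpha> E \<psi>"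
begin

abbreviation "U \<equiv> whitney_region W \<beta>"

text \<open>Bounds, in units of the scale, the distance from a point of a cell to one of its Whitney
  region: 8 (n + 1) for the Whitney cube, \<beta> + 1 for its distance to the cell,
  \<open>c\<^sub>1\<close> for the cell.\<close>

definition Cg :: real where "Cg = 8 * (real n + 1) + \<beta> + 1 + c\<^sub>1"
text \<open>The scale is at most 2 |Y - y|, hence |x - y| at most (1 + 2 Cg) |Y - y|; together 3 + 2
  Cg.\<close>

definition Bg :: real where "Bg = 3 + 2 * Cg"
definition ex :: real where "ex = real n + \<alpha>"

lemma Cg: "1 \<le> Cg" "0 < Bg" "0 < ex"
  using \<beta> pos n \<alpha> by (auto simp: Cg_def Bg_def ex_def)

lemma W_dyadic: "W \<subseteq> euclidean_dyadic_cubes" and W_cover: "\<Union>W = - E"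
  and W_disjoint: "I \<in> W \<Longrightarrow> J \<in> W \<Longrightarrow> I \<noteq> J \<Longrightarrow> interior I \<inter> interior J = {}"
  and W_dist: "0 < s \<Longrightarrow> cube c s \<in> W \<Longrightarrow> 4 * diameter (cube c s) \<le> setdist (cube c s) E"
    "0 < s \<Longrightarrow> cube c s \<in> W \<Longrightarrow> setdist (cube c s) E \<le> 40 * diameter (cube c s)"
proof -
  note w = whitney[unfolded whitney_decomposition_def]
  show "W \<subseteq> euclidean_dyadic_cubes" "\<Union>W = - E" using w by auto
  show "I \<in> W \<Longrightarrow> J \<in> W \<Longrightarrow> I \<noteq> J \<Longrightarrow> interior I \<inter> interior J = {}"
    by (rule w[THEN conjunct2, THEN conjunct2, THEN conjunct1, rule_format])
  note w4 = w[THEN conjunct2, THEN conjunct2, THEN conjunct2, THEN conjunct1, rule_format]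
  show "4 * diameter (cube c s) \<le> setdist (cube c s) E" "setdist (cube c s) E
    \<le> 40 * diameter (cube c s)"
    if "0 < s" "cube c s \<in> W" for c s using w4[OF conjI[OF that]] by auto
qed

text \<open>The interiors are disjoint, open and nonempty.\<close>

lemma W_countable: "countable W"
proof -
  have int: "interior I \<noteq> {}" if "I \<in> W" for I
  proof -
    have "I \<in> euclidean_dyadic_cubes" using that W_dyadic by blast
    then obtain c j where I: "I = cube c (2 powi j)" by (rule euclidean_dyadic_cube)
    have "c \<in> box (c - (2 powi j / 2) *\<^sub>R One) (c + (2 powi j / 2) *\<^sub>R One)"
      by (auto simp: mem_box inner_diff_left inner_add_left)
    then show ?thesis unfolding I cube_def interior_cbox by blast
  qed
  have "countable (interior ` W)"
  proof (rule countable_disjoint_open_subsets)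
    show "pairwise disjnt (interior ` W)"
      using W_disjoint by (auto simp: pairwise_def disjnt_def)
  qed auto
  moreover have "inj_on interior W"
    using W_disjoint int by (metis inf.idem inj_onI)
  ultimately show ?thesis by (rule countable_image_inj_on)
qed

lemma U_sub: "U k Q \<subseteq> - E"
  using W_cover by (auto simp: whitney_region_def)

lemma U_borel: "U k Q \<in> sets borel"
proof -
  have "{cube c s |c s. 0 < s \<and> cube c s \<in> W \<and> s / 8 \<le> 2 powi (- k) \<and> 2 powi (- k)
    \<le> 8 * s \<and> setdist Q (cube c s) \<le> \<beta> * 2 powi (- k)} \<subseteq> W"
    by auto
  then have "countable {cube c s |c s. 0 < s \<and> cube c s \<in> W \<and> s / 8 \<le> 2 powi (- k) \<and> 2 powi (- k)
    \<le> 8 * s \<and> setdist Q (cube c s) \<le> \<beta> * 2 powi (- k)}"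
    using W_countable countable_subset by blast
  note * = this
  show ?thesis
    unfolding whitney_region_def by (rule sets.countable_Union[OF *]) (auto simp: cube_measurable)
qed

lemma U_geometry:
  assumes k: "k \<in> K" and x: "x \<in> E" and Y: "Y \<in> U k (cell k x)"
  shows "gscale k / 2 \<le> infdist Y E" "infdist Y E \<le> Cg * gscale k" "dist x Y \<le> Cg * gscale k"
proof -
  let ?t = "gscale k"
  obtain c s where cs: "0 < s" "cube c s \<in> W" "s / 8 \<le> ?t" "?t
    \<le> 8 * s" "setdist (cell k x) (cube c s) \<le> \<beta> * ?t" "Y \<in> cube c s"
    using Y unfolding whitney_region_def by blast
  \<comment> \<open>The distance of the cube from E is at least 4 s, and s is at least an eighth of
    the scale.\<close>
  have "4 * s \<le> 4 * diameter (cube c s)" using diameter_cube(1)[OF cs(1), of c] by simp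
  also have "\<dots> \<le> setdist (cube c s) E" by (rule W_dist(1)[OF cs(1,2)])
  also have "\<dots> \<le> setdist {Y} E" using cs(6) by (intro setdist_subset_left) auto
  finally have "4 * s \<le> infdist Y E" by (simp add: infdist_eq_setdist)
  then show "?t / 2 \<le> infdist Y E" using cs(4) by linarith
  have xs: "x \<in> space \<sigma>" using x by simp
  \<comment> \<open>The cell need not be closed, so the distance need not be attained; the extra
    \<open>?t\<close> leaves room for a nearly minimal pair.\<close>
  have "\<exists>q\<in>cell k x. \<exists>z\<in>cube c s. dist q z < \<beta> * ?t + ?t"
  proof (rule ccontr)
    assume "\<not> ?thesis"
    then have "\<beta> * ?t + ?t \<le> setdist (cell k x) (cube c s)"
      using cell_self[OF k xs] cs(6) by (intro le_setdistI) (auto simp: not_less)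
    then show False using cs(5) scale_pos[of k] by linarith
  qed
  then obtain q z where qz: "q \<in> cell k x" "z \<in> cube c s" "dist q z < \<beta> * ?t + ?t" by blast
  have "dist z Y \<le> diameter (cube c s)"
    using qz cs by (intro diameter_bounded_bound) (auto intro: compact_imp_bounded compact_cube)
  also have "\<dots> \<le> DIM('a) * s" by (rule diameter_cube(2)[OF cs(1)])
  also have "\<dots> \<le> DIM('a) * (8 * ?t)" using cs(3) by (intro mult_left_mono) auto
  finally have zY: "dist z Y \<le> (real n + 1) * (8 * ?t)" by (simp add: dim add.commute)
  have xq: "dist x q \<le> c\<^sub>1 * ?t" by (rule cell_dist[OF k x cell_self[OF k xs] qz(1)])
  have "dist x Y \<le> dist x q + dist q z + dist z Y"
    by (meson add_mono dist_triangle dist_triangle_le order_refl order_trans)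
  also have "\<dots> \<le> c\<^sub>1 * ?t + (\<beta> * ?t + ?t) + (real n + 1) * (8 * ?t)" using xq qz(3) zY by linarith
  also have "\<dots> = Cg * ?t" by (simp add: Cg_def algebra_simps)
  finally show xY: "dist x Y \<le> Cg * ?t" .
  show "infdist Y E \<le> Cg * ?t" using infdist_le[OF x, of Y] xY by (simp add: dist_commute)
qed

text \<open>The summands serve the size estimate, the smoothness estimate within its range, and the
  difference of two values outside that range.\<close>

definition CK :: real where
  "CK = C\<^sub>\<psi> * (Cg powr \<alpha> * Bg powr ex + c\<^sub>1 powr \<alpha> * Bg powr ex
      + Cg powr \<alpha> * (Bg powr ex + (4 * Bg * c\<^sub>1) powr ex) * (4 * c\<^sub>1) powr \<alpha>)"

lemma CK_ge: "C\<^sub>\<psi> * (Cg powr \<alpha> * Bg powr ex) \<le> CK" "C\<^sub>\<psi> * (c\<^sub>1 powr \<alpha> * Bg powr ex) \<le> CK"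
  "C\<^sub>\<psi> * (Cg powr \<alpha> * (Bg powr ex + (4 * Bg * c\<^sub>1) powr ex) * (4 * c\<^sub>1) powr \<alpha>) \<le> CK"
  using C\<psi> by (auto simp: CK_def intro!: mult_left_mono add_nonneg_nonneg mult_nonneg_nonneg)

lemma CK_pos: "0 < CK"
proof -
  have "0 < C\<^sub>\<psi> * (Cg powr \<alpha> * Bg powr ex)" using C\<psi> Cg by simp
  then show ?thesis using CK_ge(1) by linarith
qed

lemma \<psi>_bound: "Y \<notin> E \<Longrightarrow> y \<in> E \<Longrightarrow> norm (\<psi> Y y) \<le> C\<^sub>\<psi> * infdist Y E powr \<alpha> / dist Y y powr ex"
  and \<psi>_holder: "Y \<notin> E \<Longrightarrow> y \<in> E \<Longrightarrow> y' \<in> E \<Longrightarrow> 2 * dist y y' \<le> dist Y y \<Longrightarrow>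
    norm (\<psi> Y y - \<psi> Y y') \<le> C\<^sub>\<psi> * dist y y' powr \<alpha> / dist Y y powr ex"
  using kernel unfolding square_function_kernel_def ex_def by auto

lemma kernel_dist:
  assumes k: "k \<in> K" and x: "x \<in> E" and Y: "Y \<in> U k (cell k x)" and y: "y \<in> E"
  shows "gscale k + dist x y \<le> Bg * dist Y y" "gscale k / 2 \<le> dist Y y"
proof -
  note g = U_geometry[OF k x Y]
  have d: "infdist Y E \<le> dist Y y" by (rule infdist_le[OF y])
  then show d2: "gscale k / 2 \<le> dist Y y" using g by linarith
  have "dist x y \<le> dist x Y + dist Y y" by (rule dist_triangle)
  also have "\<dots> \<le> Cg * gscale k + dist Y y" using g by simp
  also have "Cg * gscale k \<le> Cg * (2 * dist Y y)" using d2 Cg by (intro mult_left_mono) auto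
  finally show "gscale k + dist x y \<le> Bg * dist Y y" using d2 by (simp add: Bg_def algebra_simps)
qed

lemma inverse_powr_bound:
  assumes "0 < u" "0 < c" "u \<le> c * v"
  shows "1 / v powr ex \<le> c powr ex / u powr ex"
proof -
  have v: "0 < v" using assms by (metis less_le_trans mult_pos_pos not_less zero_less_mult_pos)
  have "u powr ex \<le> (c * v) powr ex" using assms Cg by (intro powr_mono2) auto
  then have "u powr ex \<le> c powr ex * v powr ex" by (simp add: powr_mult)
  then show ?thesis using assms v by (simp add: field_simps)
qed

definition PP :: "int \<Rightarrow> 'a \<Rightarrow> 'a \<Rightarrow> real" where "PP k x y = CK * pk \<alpha> (gscale k) x y"

lemma PP_alt: "PP k x y = CK * gscale k powr \<alpha> / (gscale k + dist x y) powr ex"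
  by (simp add: PP_def pk_def ex_def)

lemma PP_size:
  assumes k: "k \<in> K" and x: "x \<in> E" and Y: "Y \<in> U k (cell k x)" and y: "y \<in> E"
  shows "norm (\<psi> Y y) \<le> C\<^sub>\<psi> * (Cg powr \<alpha> * Bg powr ex) * gscale k powr \<alpha> / (gscale k
    + dist x y) powr ex"
    and "norm (\<psi> Y y) \<le> PP k x y"
proof -
  let ?t = "gscale k" and ?u = "gscale k + dist x y"
  have u: "0 < ?u" by (simp add: add_pos_nonneg)
  have Yn: "Y \<notin> E" using U_sub Y by blast
  have "norm (\<psi> Y y) \<le> C\<^sub>\<psi> * infdist Y E powr \<alpha> * (1 / dist Y y powr ex)" using \<psi>_bound[OF Yn y]
    by simp
  also have "\<dots> \<le> C\<^sub>\<psi> * (Cg * ?t) powr \<alpha> * (Bg powr ex / ?u powr ex)"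
    using U_geometry[OF k x Y] C\<psi> Cg \<alpha> kernel_dist(1)[OF k x Y y] u
    by (intro mult_mono powr_mono2 inverse_powr_bound mult_left_mono infdist_nonneg)
      (auto intro!: mult_nonneg_nonneg)
  also have "\<dots> = C\<^sub>\<psi> * (Cg powr \<alpha> * Bg powr ex) * ?t powr \<alpha> / ?u powr ex" by (simp add: powr_mult)
  finally show 1: "norm (\<psi> Y y) \<le> C\<^sub>\<psi> * (Cg powr \<alpha> * Bg powr ex) * ?t powr \<alpha> / ?u powr ex" .
  also have "\<dots> \<le> PP k x y"
    unfolding PP_alt by (intro divide_right_mono mult_right_mono CK_ge) auto
  finally show "norm (\<psi> Y y) \<le> PP k x y" .
qed

text \<open>If |y - y'| is too large for the smoothness condition, then |Y - y| is below a multiple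
  of 2^(-j). It is also at least 2^(-k) / 2, so j - k is bounded and the size of both values is
  enough.\<close>

lemma PP_smooth:
  assumes k: "k \<in> K" "k \<le> j" and x: "x \<in> E" and Y: "Y \<in> U k (cell k x)" and y: "y \<in> E"
    and y': "y' \<in> cell j y"
  shows "norm (\<psi> Y y - \<psi> Y y') \<le> qq \<alpha> ^ nat (j - k) * PP k x y"
proof -
  let ?t = "gscale k" and ?u = "gscale k + dist x y" and ?r = "(2 powr (- \<alpha>)) ^ nat (j - k)"
  have u: "0 < ?u" "?t \<le> ?u" by (auto simp: add_pos_nonneg)
  have Yn: "Y \<notin> E" using U_sub Y by blast
  have jK: "j \<in> K" using K_upward k by blast
  have yE: "y' \<in> E" using y' cell_subset[OF jK] y by auto
  have tj: "gscale j = ?t * (1/2) ^ nat (j - k)" by (rule scale_ratio[OF k(2)])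
  have yy: "dist y y' \<le> c\<^sub>1 * gscale j" using cell_dist[OF jK y cell_self[OF jK] y'] y by simp
  have rpos: "0 \<le> ?r" by simp
  have tjp: "(gscale j) powr \<alpha> = ?t powr \<alpha> * ?r" unfolding tj powr_mult half_power_powr ..
  have "norm (\<psi> Y y - \<psi> Y y') \<le> CK * (?r * ?t powr \<alpha> / ?u powr ex)"
  proof (cases "2 * dist y y' \<le> dist Y y")
    case True
    have "norm (\<psi> Y y - \<psi> Y y') \<le> C\<^sub>\<psi> * dist y y' powr \<alpha> * (1 / dist Y y powr ex)"
      using \<psi>_holder[OF Yn y yE True] by simp
    also have "\<dots> \<le> C\<^sub>\<psi> * (c\<^sub>1 * gscale j) powr \<alpha> * (Bg powr ex / ?u powr ex)"
      using yy C\<psi> Cg \<alpha> kernel_dist(1)[OF k(1) x Y y] u pos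
      by (intro mult_mono powr_mono2 inverse_powr_bound mult_left_mono) auto
    also have "\<dots> = (C\<^sub>\<psi> * (c\<^sub>1 powr \<alpha> * Bg powr ex)) * (?r * ?t powr \<alpha> / ?u powr ex)"
      unfolding powr_mult[of c\<^sub>1] tjp by (simp add: ac_simps)
    also have "\<dots> \<le> CK * (?r * ?t powr \<alpha> / ?u powr ex)" by (intro mult_right_mono CK_ge) auto
    finally show ?thesis .
  next
    case False
    have a1: "?t / 2 \<le> dist Y y" "?u \<le> Bg * dist Y y" using kernel_dist[OF k(1) x Y y] by auto
    have a2: "dist Y y \<le> 2 * (c\<^sub>1 * gscale j)" using False yy by linarith
    have "gscale j \<le> ?t" by (rule scale_mono[OF k(2)])
    then have "2 * (c\<^sub>1 * gscale j) \<le> 2 * (c\<^sub>1 * ?t)" using pos by simp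
    with a2 have a3: "dist Y y \<le> 2 * (c\<^sub>1 * ?t)" by linarith
    have "Bg * dist Y y \<le> Bg * (2 * (c\<^sub>1 * ?t))" using a3 Cg by (intro mult_left_mono) auto
    also have "\<dots> = 4 * Bg * c\<^sub>1 * (?t / 2)" by simp
    also have "\<dots> \<le> 4 * Bg * c\<^sub>1 * dist Y y'"
      using kernel_dist(2)[OF k(1) x Y yE] Cg pos by (intro mult_left_mono) auto
    finally have a4: "?u \<le> 4 * Bg * c\<^sub>1 * dist Y y'" using a1 by linarith
    have n1: "norm (\<psi> Y y) \<le> C\<^sub>\<psi> * (Cg powr \<alpha> * Bg powr ex) * ?t powr \<alpha> / ?u powr ex"
      by (rule PP_size(1)[OF k(1) x Y y])
    have "norm (\<psi> Y y') \<le> C\<^sub>\<psi> * infdist Y E powr \<alpha> * (1 / dist Y y' powr ex)"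
      using \<psi>_bound[OF Yn yE] by simp
    also have "\<dots> \<le> C\<^sub>\<psi> * (Cg * ?t) powr \<alpha> * ((4 * Bg * c\<^sub>1) powr ex / ?u powr ex)"
      using U_geometry[OF k(1) x Y] C\<psi> Cg \<alpha> a4 u pos
      by (intro mult_mono powr_mono2 inverse_powr_bound mult_left_mono infdist_nonneg)
        (auto intro!: mult_nonneg_nonneg)
    also have "\<dots> = C\<^sub>\<psi> * (Cg powr \<alpha> * (4 * Bg * c\<^sub>1) powr ex) * ?t powr \<alpha> / ?u powr ex"
      by (simp add: powr_mult[of Cg])
    finally have n2: "norm (\<psi> Y y') \<le> C\<^sub>\<psi> * (Cg powr \<alpha> * (4 * Bg * c\<^sub>1) powr ex) * ?t powr \<alpha>
      / ?u powr ex" .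
    \<comment> \<open>Both bounds for |Y - y| together limit j - k, so the required decay factor can
      be inserted at the cost of a constant.\<close>
    have "?t / 2 \<le> 2 * (c\<^sub>1 * (?t * (1/2) ^ nat (j - k)))" using a1(1) a2 unfolding tj by linarith
    then have "?t * 1 \<le> ?t * (4 * c\<^sub>1 * (1/2) ^ nat (j - k))" by (simp add: algebra_simps)
    then have "1 \<le> 4 * c\<^sub>1 * (1/2) ^ nat (j - k)" by (rule mult_left_le_imp_le) simp
    then have "1 \<le> (4 * c\<^sub>1 * (1/2) ^ nat (j - k)) powr \<alpha>" using \<alpha>
      by (intro ge_one_powr_ge_zero) auto
    also have "\<dots> = (4 * c\<^sub>1) powr \<alpha> * ?r" unfolding powr_mult[of "4 * c\<^sub>1"] half_power_powr ..
    finally have one: "1 \<le> (4 * c\<^sub>1) powr \<alpha> * ?r" .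
    have "norm (\<psi> Y y - \<psi> Y y') \<le> norm (\<psi> Y y) + norm (\<psi> Y y')" by (rule norm_triangle_ineq4)
    also have "\<dots> \<le> (C\<^sub>\<psi> * (Cg powr \<alpha> * (Bg powr ex + (4 * Bg * c\<^sub>1) powr ex)) * ?t powr \<alpha>
      / ?u powr ex) * 1"
      using n1 n2 by (simp add: algebra_simps add_divide_distrib)
    also have "\<dots> \<le> (C\<^sub>\<psi> * (Cg powr \<alpha> * (Bg powr ex + (4 * Bg * c\<^sub>1) powr ex)) * ?t powr \<alpha>
      / ?u powr ex) * ((4 * c\<^sub>1) powr \<alpha> * ?r)"
      using C\<psi> one by (intro mult_left_mono) auto
    also have "\<dots> = (C\<^sub>\<psi> * (Cg powr \<alpha> * (Bg powr ex + (4 * Bg * c\<^sub>1) powr ex) * (4 * c\<^sub>1) powr \<alpha>))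
      * (?r * ?t powr \<alpha> / ?u powr ex)"
      by (simp add: ac_simps)
    also have "\<dots> \<le> CK * (?r * ?t powr \<alpha> / ?u powr ex)" by (intro mult_right_mono CK_ge) auto
    finally show ?thesis .
  qed
  also have "\<dots> = ?r * PP k x y" by (simp add: PP_alt)
  also have "\<dots> \<le> qq \<alpha> ^ nat (j - k) * PP k x y"
  proof (intro mult_right_mono power_mono)
    \<comment> \<open>\<open>bexp\<close> is at most \<alpha> / 4, so smoothness decays at least as
      fast as the boundary mass.\<close>
    show "2 powr (- \<alpha>) \<le> qq \<alpha>" unfolding qq_def bexp_def using \<alpha> by (intro powr_mono) auto
    show "0 \<le> PP k x y" using CK_pos pk_nonneg by (simp add: PP_def)
  qed simp
  finally show ?thesis .
qed

section \<open>The measure dY / delta(Y) on the complement of E\<close>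

definition \<mu> :: "'a measure" where
  "\<mu> = density (restrict_space lebesgue (- E)) (\<lambda>Y. ennreal (1 / infdist Y E))"

lemma E_lebesgue: "- E \<in> sets lebesgue" using E_borel by (intro sets_completionI_sets) auto

lemma sets_\<mu> [measurable_cong]: "sets \<mu> = sets (restrict_space lebesgue (- E))" by (simp add: \<mu>_def)

lemma infdist_measurable: "(\<lambda>Y. infdist Y E) \<in> borel_measurable (restrict_space lebesgue (- E))"
  by (rule measurable_restrict_space1) (rule measurable_completion, simp add: infdist_borel)

definition ws :: real where "ws = unit_ball_vol (real (n + 1))"

lemma U_measurable: "U k Q \<in> sets (restrict_space lebesgue (- E))"
  using U_sub U_borel by (subst sets_restrict_space_iff) (auto simp: E_lebesgue)

lemma ws_pos: "0 < ws" by (simp add: ws_def unit_ball_vol_pos)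

lemma U_volume:
  assumes k: "k \<in> K" and x: "x \<in> E"
  shows "emeasure lebesgue (U k (cell k x)) \<le> ennreal (ws * (Cg * gscale k) ^ (n + 1))"
proof -
  have "emeasure lebesgue (U k (cell k x)) \<le> emeasure lebesgue (cball x (Cg * gscale k))"
    using U_geometry(3)[OF k x] by (intro emeasure_mono) auto
  also have "\<dots> = ennreal (ws * (Cg * gscale k) ^ (n + 1))"
    using emeasure_cball[of "Cg * gscale k" x] Cg by (simp add: ws_def dim)
  finally show ?thesis .
qed

lemma \<mu>_integral:
  assumes F[measurable]: "F \<in> borel_measurable (restrict_space lebesgue (- E))"
  shows "(\<integral>\<^sup>+Y. F Y \<partial>\<mu>) = (\<integral>\<^sup>+Y. ennreal (1 / infdist Y E) * F Y \<partial>restrict_space lebesgue (- E))"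
proof -
  have [measurable]: "(\<lambda>Y. infdist Y E) \<in> borel_measurable (restrict_space lebesgue (- E))"
    by (rule infdist_measurable)
  show ?thesis unfolding \<mu>_def by (rule nn_integral_density) measurable
qed

text \<open>On the region delta is at least half the scale t, and the volume is at most a multiple
  of t^(n+1); the quotient t^n is the size of the cell.\<close>

lemma \<mu>_U:
  assumes k: "k \<in> K" and Q: "Q \<in> D k"
  shows "emeasure \<mu> (U k Q) \<le> ennreal (2 * ws * Cg ^ (n + 1) * c\<^sub>1) * emeasure \<sigma> Q"
proof -
  let ?L = "restrict_space lebesgue (- E)" and ?t = "gscale k"
  obtain x where x: "x \<in> Q" using D_pos[OF k Q] by (metis emeasure_empty ex_in_conv)
  have xE: "x \<in> E" using x grid_sub[OF k Q] by blast
  have cQ: "cell k x = Q" by (rule cell_eq[OF k Q x])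
  have [measurable]: "U k Q \<in> sets ?L" by (rule U_measurable)
  have "emeasure \<mu> (U k Q) = (\<integral>\<^sup>+Y. indicator (U k Q) Y \<partial>\<mu>)"
    by (simp add: sets_\<mu> nn_integral_indicator)
  also have "\<dots> = (\<integral>\<^sup>+Y. ennreal (1 / infdist Y E) * indicator (U k Q) Y \<partial>?L)"
    by (rule \<mu>_integral) measurable
  also have "\<dots> \<le> (\<integral>\<^sup>+Y. ennreal (2 / ?t) * indicator (U k Q) Y \<partial>?L)"
  proof (rule nn_integral_mono)
    fix Y
    show "ennreal (1 / infdist Y E) * indicator (U k Q) Y \<le> ennreal (2 / ?t) * indicator (U k Q) Y"
    proof (cases "Y \<in> U k Q")
      case True
      then have d: "?t / 2 \<le> infdist Y E" using U_geometry(1)[OF k xE] cQ by simp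
      have "0 < infdist Y E" using d scale_pos[of k] by linarith
      then have "1 / infdist Y E \<le> 1 / (?t / 2)" by (intro divide_left_mono[OF d] mult_pos_pos) auto
      then show ?thesis using True by (simp add: ennreal_leI)
    qed simp
  qed
  also have "\<dots> = ennreal (2 / ?t) * emeasure ?L (U k Q)" by (simp add: nn_integral_cmult_indicator)
  also have "emeasure ?L (U k Q) = emeasure lebesgue (U k Q)"
    using U_sub by (intro emeasure_restrict_space) (auto simp: E_lebesgue)
  also have "ennreal (2 / ?t) * emeasure lebesgue (U k Q)
    \<le> ennreal (2 / ?t) * ennreal (ws * (Cg * ?t) ^ (n + 1))"
    using U_volume[OF k xE] cQ by (intro mult_left_mono) auto
  also have "\<dots> = ennreal (2 / ?t * (ws * (Cg * ?t) ^ (n + 1)))"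
    using ws_pos Cg by (intro ennreal_mult[symmetric]) auto
  also have "2 / ?t * (ws * (Cg * ?t) ^ (n + 1)) = (2 * ws * Cg ^ (n + 1) * c\<^sub>1) * (?t ^ n / c\<^sub>1)"
    using pos by (simp add: power_mult_distrib)
  also have "ennreal \<dots> = ennreal (2 * ws * Cg ^ (n + 1) * c\<^sub>1) * ennreal (?t ^ n / c\<^sub>1)"
    using ws_pos Cg pos by (intro ennreal_mult) auto
  also have "\<dots> \<le> ennreal (2 * ws * Cg ^ (n + 1) * c\<^sub>1) * emeasure \<sigma> Q"
    by (intro mult_left_mono grid_lower[OF k Q]) auto
  finally show ?thesis .
qed

text \<open>The single ratio \<open>qq \<alpha>\<close> serves for smoothness and boundary mass
  alike, and \<open>CK\<close> scales the model kernel to dominate \<psi> and its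
  differences.\<close>

sublocale theta_system \<sigma> D K PP "CK * Mass \<alpha>" "CK * Cbd \<alpha>" "qq \<alpha>" U \<mu> \<psi>
  "2 * ws * Cg ^ (n + 1) * c\<^sub>1"
proof
  show "0 < qq \<alpha>" "qq \<alpha> < 1" using qq \<alpha> by auto
  show "0 < CK * Mass \<alpha>" "0 < CK * Cbd \<alpha>" using CK_pos Mass_pos[OF \<alpha>] Cbd_pos[OF \<alpha>] by auto
  show "0 < 2 * ws * Cg ^ (n + 1) * c\<^sub>1" using ws_pos Cg pos by simp
  show "0 \<le> PP k x y" for k x y using CK_pos pk_nonneg by (simp add: PP_def)
  show "PP k x y = PP k y x" for k x y by (simp add: PP_def pk_sym)
  show "(\<lambda>(x, y). PP k x y) \<in> borel_measurable (\<sigma> \<Otimes>\<^sub>M \<sigma>)" for k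
  proof -
    have [measurable]: "(\<lambda>x. x) \<in> borel_measurable \<sigma>" by (rule borel_measurable_\<sigma>) simp
    have "(\<lambda>p. dist (fst p) (snd p)) \<in> borel_measurable (\<sigma> \<Otimes>\<^sub>M \<sigma>)"
      by (rule borel_measurable_dist) (rule measurable_compose[OF measurable_fst], simp, rule
        measurable_compose[OF measurable_snd], simp)
    then show ?thesis unfolding PP_alt split_def by measurable
  qed
  show "\<exists>B. \<forall>x y. PP k x y \<le> B" for k
    using pk_le[OF scale_pos \<alpha>] CK_pos unfolding PP_def by (meson less_imp_le mult_left_mono)
  show "(\<integral>\<^sup>+y. ennreal (PP k x y) \<partial>\<sigma>) \<le> ennreal (CK * Mass \<alpha>)" if "x \<in> space \<sigma>" for k x
  proof -
    have "(\<integral>\<^sup>+y. ennreal (PP k x y) \<partial>\<sigma>) = (\<integral>\<^sup>+y. ennreal CK * ennreal (pk \<alpha> (gscale k) x y) \<partial>\<sigma>)"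
      using CK_pos by (intro nn_integral_cong) (simp add: PP_def ennreal_mult')
    also have "\<dots> = ennreal CK * (\<integral>\<^sup>+y. ennreal (pk \<alpha> (gscale k) x y) \<partial>\<sigma>)"
      using pk_measurable by (intro nn_integral_cmult) measurable
    also have "\<dots> \<le> ennreal CK * ennreal (Mass \<alpha>)" using that
      by (intro mult_left_mono pk_mass \<alpha>) auto
    finally show ?thesis using CK_pos by (simp add: ennreal_mult')
  qed
  show "(\<integral>\<^sup>+x. (\<integral>\<^sup>+y. ennreal (PP k x y) * indicator (space \<sigma> - cell j z) y \<partial>\<sigma>)
    * indicator (cell j z) x \<partial>\<sigma>)
         \<le> ennreal (CK * Cbd \<alpha> * qq \<alpha> ^ nat (k - j)) * emeasure \<sigma> (cell j z)"
    if j: "j \<in> K" "j \<le> k" and z: "z \<in> space \<sigma>" for j k z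
  proof -
    have zE: "z \<in> E" using z by simp
    let ?i = "\<lambda>x. \<integral>\<^sup>+y. ennreal (pk \<alpha> (gscale k) x y) * indicator (E - cell j z) y \<partial>\<sigma>"
    have cm: "E - cell j z \<in> sets \<sigma>" using sets.compl_sets[OF cell_sets[OF j(1) z]] by simp
    have "(\<lambda>p. dist (fst p) (snd p)) \<in> borel_measurable (\<sigma> \<Otimes>\<^sub>M \<sigma>)"
      by (rule borel_measurable_dist) (rule measurable_compose[OF measurable_fst], rule
        borel_measurable_\<sigma>, simp, rule measurable_compose[OF measurable_snd], rule
        borel_measurable_\<sigma>, simp)
    then have im: "?i \<in> borel_measurable \<sigma>"
      unfolding pk_def using cm by (intro borel_measurable_nn_integral) (simp add: split_def)
    have "(\<integral>\<^sup>+y. ennreal (PP k x y) * indicator (space \<sigma> - cell j z) y \<partial>\<sigma>) = ennreal CK * ?i x"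
      for x
    proof -
      have "(\<integral>\<^sup>+y. ennreal (PP k x y) * indicator (space \<sigma> - cell j z) y \<partial>\<sigma>)
        = (\<integral>\<^sup>+y. ennreal CK * (ennreal (pk \<alpha> (gscale k) x y) * indicator (E - cell j z) y) \<partial>\<sigma>)"
        using CK_pos by (intro nn_integral_cong) (simp add: PP_def ennreal_mult' mult.assoc)
      also have "\<dots> = ennreal CK * ?i x"
      proof (rule nn_integral_cmult)
        have [measurable]: "pk \<alpha> (gscale k) x \<in> borel_measurable \<sigma>" by (rule pk_measurable)
        show "(\<lambda>y. ennreal (pk \<alpha> (gscale k) x y) * indicator (E - cell j z) y) \<in> borel_measurable \<sigma>"
          using cm by measurable
      qed
      finally show ?thesis .
    qed
    then have "(\<integral>\<^sup>+x. (\<integral>\<^sup>+y. ennreal (PP k x y) * indicator (space \<sigma> - cell j z) y \<partial>\<sigma>)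
      * indicator (cell j z) x \<partial>\<sigma>)
      = (\<integral>\<^sup>+x. ennreal CK * (?i x * indicator (cell j z) x) \<partial>\<sigma>)" by (simp add: mult.assoc)
    also have "\<dots> = ennreal CK * (\<integral>\<^sup>+x. ?i x * indicator (cell j z) x \<partial>\<sigma>)"
      by (intro nn_integral_cmult borel_measurable_times_ennreal borel_measurable_indicator im
        cell_sets[OF j(1) z])
    also have "\<dots> \<le> ennreal CK * (ennreal (Cbd \<alpha> * qq \<alpha> ^ nat (k - j)) * emeasure \<sigma> (cell j z))"
      by (intro mult_left_mono boundary_mass \<alpha> j zE) auto
    also have "\<dots> = ennreal (CK * Cbd \<alpha> * qq \<alpha> ^ nat (k - j)) * emeasure \<sigma> (cell j z)"
      using CK_pos Cbd_pos[OF \<alpha>] qq[OF \<alpha>] by (subst ennreal_triple_mult) (auto simp: mult.assoc)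
    finally show ?thesis .
  qed
  show "U k Q \<in> sets \<mu>" for k Q unfolding sets_\<mu> by (rule U_measurable)
  show "emeasure \<mu> (U k Q) \<le> ennreal (2 * ws * Cg ^ (n + 1) * c\<^sub>1) * emeasure \<sigma> Q"
    if "k \<in> K" "Q \<in> D k" for k Q
    by (rule \<mu>_U[OF that])
  show "(\<lambda>(Y, y). \<psi> Y y) \<in> borel_measurable (\<mu> \<Otimes>\<^sub>M \<sigma>)"
  proof -
    have "sets (\<mu> \<Otimes>\<^sub>M \<sigma>) = sets (restrict_space lebesgue (- E) \<Otimes>\<^sub>M \<sigma>)"
      by (rule sets_pair_measure_cong[OF sets_\<mu> refl])
    then show ?thesis using kernel unfolding square_function_kernel_def
      by (simp cong: measurable_cong_sets)
  qed
  show "norm (\<psi> Y y) \<le> PP k x y" if "k \<in> K" "x \<in> space \<sigma>" "Y \<in> U k (cell k x)" "y \<in> space \<sigma>"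
    for k x y Y
    using PP_size(2)[of k x Y y] that by simp
  show "norm (\<psi> Y y - \<psi> Y y') \<le> qq \<alpha> ^ nat (j - k) * PP k x y"
    if "k \<in> K" "k \<le> j" "x \<in> space \<sigma>" "Y \<in> U k (cell k x)" "y \<in> space \<sigma>" "y' \<in> cell j y"
      for k j x y y' Y
    using PP_smooth[of k j x Y y y'] that by simp
qed

end

lemma ennreal_powr_ge:
  assumes v: "0 < v" and p: "1 < (p::real)" and a: "ennreal (v powr (2 / p)) \<le> a"
  shows "ennreal v \<le> ennreal_powr a (p / 2)"
proof (cases a)
  case (real r)
  have "v powr (2 / p) \<le> r" using a real by simp
  then have "(v powr (2 / p)) powr (p / 2) \<le> r powr (p / 2)" using p by (intro powr_mono2) auto
  then have "v \<le> r powr (p / 2)" using v p by (simp add: powr_powr)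
  then show ?thesis using real by (simp add: ennreal_powr_def ennreal_leI)
next
  case top
  then show ?thesis by (simp add: ennreal_powr_def)
qed

section \<open>The testing condition on cones in terms of energies\<close>

context tb_setting
begin

lemma Theta_eq: "Theta n E \<psi> f = \<Theta> f"
  by (auto simp: Theta_def \<Theta>_def)

abbreviation L where "L \<equiv> restrict_space lebesgue (- E)"

lemma nn_integral_L: "(\<integral>\<^sup>+Y. F Y \<partial>L) = (\<integral>\<^sup>+Y. F Y * indicator (- E) Y \<partial>lebesgue)"
  by (rule nn_integral_restrict_space) (simp add: E_lebesgue)

lemma \<Theta>_L [measurable]: "u \<in> borel_measurable \<sigma> \<Longrightarrow> \<Theta> u \<in> borel_measurable L"
  using \<Theta>_measurable[of u] by (simp cong: measurable_cong_sets)

lemma inf_L [measurable]: "(\<lambda>Y. infdist Y E) \<in> borel_measurable L"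
  by (rule infdist_measurable)

definition N0 :: real where "N0 = 2 * Cg + 1"

text \<open>Membership in the region of generation i determines 2^(-i) up to a factor 2 Cg, since
  delta(Y) lies between 2^(-i) / 2 and Cg 2^(-i). So d generations after the first one 2^d <= 2 Cg,
  and d < 2^d bounds their number.\<close>

lemma overlap:
  assumes k: "k \<in> K" and x: "x \<in> E" and Y: "Y \<notin> E"
  shows "real (card {i \<in> {k..N}. Y \<in> U i (cell i x)}) \<le> N0"
proof -
  define I where "I = {i \<in> {k..N}. Y \<in> U i (cell i x)}"
  have fI: "finite I" unfolding I_def by (rule finite_subset[of _ "{k..N}"]) auto
  show ?thesis
  proof (cases "I = {}")
    case True
    then have "card I = 0" by simp
    then show ?thesis using Cg unfolding I_def[symmetric] by (simp add: N0_def)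
  next
    case False
    define i0 where "i0 = Min I"
    have i0: "i0 \<in> I" unfolding i0_def by (rule Min_in[OF fI False])
    have K: "i \<in> K" if "i \<in> I" for i using K_upward[OF k] that by (simp add: I_def)
    have YU: "Y \<in> U i (cell i x)" if "i \<in> I" for i using that by (simp add: I_def)
    have "I \<subseteq> {i0..i0 + \<lfloor>2 * Cg\<rfloor>}"
    proof
      fix i assume i: "i \<in> I"
      have le: "i0 \<le> i" unfolding i0_def using fI i by simp
      let ?d = "nat (i - i0)"
      have d1: "gscale i0 / 2 \<le> infdist Y E" by (rule U_geometry(1)[OF K[OF i0] x YU[OF i0]])
      have d2: "infdist Y E \<le> Cg * gscale i" by (rule U_geometry(2)[OF K[OF i] x YU[OF i]])
      have "Cg * gscale i = gscale i0 * (Cg * (1/2) ^ ?d)" unfolding scale_ratio[OF le] by simp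
      moreover have "gscale i0 * (2 * Cg * (1/2) ^ ?d) = 2 * (gscale i0 * (Cg * (1/2) ^ ?d))"
        by simp
      ultimately have "gscale i0 * 1 \<le> gscale i0 * (2 * Cg * (1/2) ^ ?d)"
        using d1 d2 by linarith
      then have "1 \<le> 2 * Cg * (1/2) ^ ?d" by (rule mult_left_le_imp_le) simp
      then have "2 ^ ?d \<le> 2 * Cg" by (simp add: power_one_over field_simps)
      then have "real ?d \<le> 2 * Cg" using of_nat_less_two_power[of ?d, where 'a=real] by linarith
      then have "i - i0 \<le> \<lfloor>2 * Cg\<rfloor>" using le by (simp add: le_floor_iff)
      then show "i \<in> {i0..i0 + \<lfloor>2 * Cg\<rfloor>}" using le by simp
    qed
    then have "card I \<le> card {i0..i0 + \<lfloor>2 * Cg\<rfloor>}" by (intro card_mono) auto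
    also have "\<dots> = nat (\<lfloor>2 * Cg\<rfloor> + 1)" by simp
    finally have "real (card I) \<le> real (nat (\<lfloor>2 * Cg\<rfloor> + 1))" by simp
    also have "\<dots> \<le> N0" using Cg by (simp add: N0_def)
    finally show ?thesis by (simp add: I_def)
  qed
qed

definition Cov :: real where "Cov = c\<^sub>1 * Cg ^ n * N0"

lemma Cov_pos: "0 < Cov" using pos Cg by (simp add: Cov_def N0_def)

text \<open>Write 1 / delta as delta^n / delta^(n+1). On the region delta^n is at most a multiple of
  the measure of the cell, by which the energy is divided.\<close>

lemma En_cone:
  assumes k: "k \<in> K" and x: "x \<in> E" and u[measurable]: "u \<in> borel_measurable \<sigma>"
  shows "En k u x \<le> ennreal (c\<^sub>1 * Cg ^ n)
    * (\<integral>\<^sup>+Y. ennreal ((norm (\<Theta> u Y))\<^sup>2 / infdist Y E ^ (n + 1)) * indicator (U k (cell k x)) Y \<partial>L)"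
proof -
  let ?U = "U k (cell k x)" and ?t = "gscale k" and ?s = "emeasure \<sigma> (cell k x)"
  let ?f = "\<lambda>Y. ennreal ((norm (\<Theta> u Y))\<^sup>2 / infdist Y E ^ (n + 1)) * indicator ?U Y"
  have xs: "x \<in> space \<sigma>" using x by simp
  have [measurable]: "?U \<in> sets L" by (rule U_measurable)
  have "(\<integral>\<^sup>+Y. ennreal ((norm (\<Theta> u Y))\<^sup>2) * indicator ?U Y \<partial>\<mu>)
     = (\<integral>\<^sup>+Y. ennreal (1 / infdist Y E) * (ennreal ((norm (\<Theta> u Y))\<^sup>2) * indicator ?U Y) \<partial>L)"
    by (rule \<mu>_integral) measurable
  also have "\<dots> \<le> (\<integral>\<^sup>+Y. ennreal ((Cg * ?t) ^ n) * ?f Y \<partial>L)"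
  proof (rule nn_integral_mono)
    fix Y
    show "ennreal (1 / infdist Y E) * (ennreal ((norm (\<Theta> u Y))\<^sup>2) * indicator ?U Y)
      \<le> ennreal ((Cg * ?t) ^ n) * ?f Y"
    proof (cases "Y \<in> ?U")
      case True
      let ?d = "infdist Y E"
      have d: "0 < ?d" using U_geometry(1)[OF k x True] scale_pos[of k] by linarith
      have "1 / ?d * (norm (\<Theta> u Y))\<^sup>2 = ?d ^ n * ((norm (\<Theta> u Y))\<^sup>2 / ?d ^ (n + 1))" using d by simp
      also have "\<dots> \<le> (Cg * ?t) ^ n * ((norm (\<Theta> u Y))\<^sup>2 / ?d ^ (n + 1))"
        using d U_geometry(2)[OF k x True] by (intro mult_right_mono power_mono) auto
      finally have "ennreal (1 / ?d * (norm (\<Theta> u Y))\<^sup>2)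
        \<le> ennreal ((Cg * ?t) ^ n * ((norm (\<Theta> u Y))\<^sup>2 / ?d ^ (n + 1)))"
        by (rule ennreal_leI)
      moreover have "ennreal (1 / ?d * (norm (\<Theta> u Y))\<^sup>2)
        = ennreal (1 / ?d) * ennreal ((norm (\<Theta> u Y))\<^sup>2)"
        using d by (intro ennreal_mult) auto
      moreover have "ennreal ((Cg * ?t) ^ n * ((norm (\<Theta> u Y))\<^sup>2 / ?d ^ (n + 1)))
        = ennreal ((Cg * ?t) ^ n) * ennreal ((norm (\<Theta> u Y))\<^sup>2 / ?d ^ (n + 1))"
        using d Cg by (intro ennreal_mult) auto
      ultimately show ?thesis using True by (simp only: indicator_simps mult_1_right)
    qed simp
  qed
  also have "\<dots> = ennreal ((Cg * ?t) ^ n) * (\<integral>\<^sup>+Y. ?f Y \<partial>L)" by (rule nn_integral_cmult) measurable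
  finally have "En k u x \<le> (ennreal ((Cg * ?t) ^ n) * (\<integral>\<^sup>+Y. ?f Y \<partial>L)) / ?s"
    unfolding En_def by (rule divide_right_mono_ennreal)
  also have "\<dots> \<le> ennreal (c\<^sub>1 * Cg ^ n) * (\<integral>\<^sup>+Y. ?f Y \<partial>L)"
  proof -
    have "ennreal ((Cg * ?t) ^ n) = ennreal (c\<^sub>1 * Cg ^ n) * ennreal (?t ^ n / c\<^sub>1)"
      using pos Cg by (subst ennreal_mult[symmetric]) (auto simp: power_mult_distrib)
    also have "\<dots> \<le> ennreal (c\<^sub>1 * Cg ^ n) * ?s" by (intro mult_left_mono cell_lower k x) auto
    finally have X: "ennreal ((Cg * ?t) ^ n) \<le> ennreal (c\<^sub>1 * Cg ^ n) * ?s" .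
    have "ennreal ((Cg * ?t) ^ n) * (\<integral>\<^sup>+Y. ?f Y \<partial>L)
      \<le> (ennreal (c\<^sub>1 * Cg ^ n) * ?s) * (\<integral>\<^sup>+Y. ?f Y \<partial>L)"
      by (rule mult_right_mono[OF X]) simp
    also have "\<dots> = (ennreal (c\<^sub>1 * Cg ^ n) * (\<integral>\<^sup>+Y. ?f Y \<partial>L)) * ?s" by (simp only: ac_simps)
    finally have "ennreal ((Cg * ?t) ^ n) * (\<integral>\<^sup>+Y. ?f Y \<partial>L)
      \<le> (ennreal (c\<^sub>1 * Cg ^ n) * (\<integral>\<^sup>+Y. ?f Y \<partial>L)) * ?s" .
    then have "(ennreal ((Cg * ?t) ^ n) * (\<integral>\<^sup>+Y. ?f Y \<partial>L)) / ?s
      \<le> (ennreal (c\<^sub>1 * Cg ^ n) * (\<integral>\<^sup>+Y. ?f Y \<partial>L)) * ?s / ?s"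
      by (rule divide_right_mono_ennreal)
    also have "\<dots> = ennreal (c\<^sub>1 * Cg ^ n) * (\<integral>\<^sup>+Y. ?f Y \<partial>L)"
      using cell_pos[OF k xs] cell_fin[OF k xs] by (intro ennreal_mult_divide_eq) auto
    finally show ?thesis .
  qed
  finally show ?thesis .
qed

text \<open>The regions attached to x in the window lie in the truncated cone and overlap boundedly
  often.\<close>

lemma cone_bound:
  assumes k: "k \<in> K" and x: "x \<in> E" and u[measurable]: "u \<in> borel_measurable \<sigma>"
  shows "(\<Sum>i\<in>{k..N}. En i u x) \<le> ennreal Cov *
    (\<integral>\<^sup>+Y\<in>truncated_cone c\<^sub>3 E D W \<beta> (cell k x) x. ennreal ((norm (Theta n E \<psi> u Y))\<^sup>2 / infdist Y E
      ^ (n + 1)) \<partial>lebesgue)"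
proof -
  let ?f = "\<lambda>Y. ennreal ((norm (\<Theta> u Y))\<^sup>2 / infdist Y E ^ (n + 1))"
  let ?C = "truncated_cone c\<^sub>3 E D W \<beta> (cell k x) x"
  have xs: "x \<in> space \<sigma>" using x by simp
  have iK: "i \<in> K" if "i \<in> {k..N}" for i using K_upward[OF k] that by simp
  have Um[measurable]: "U i Q \<in> sets L" for i Q by (rule U_measurable)
  \<comment> \<open>A finite union of Whitney regions inside the cone, whose measurability is
    immediate; the full cone is used only as a larger set of integration.\<close>
  define C' where "C' = (\<Union>i\<in>{k..N}. U i (cell i x))"
  have C'm[measurable]: "C' \<in> sets L" unfolding C'_def using Um by (intro sets.finite_UN) auto
  have C'C: "C' \<subseteq> ?C"
  proof
    fix Y assume "Y \<in> C'"
    then obtain i where i: "i \<in> {k..N}" "Y \<in> U i (cell i x)" by (auto simp: C'_def)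
    have "cell i x \<in> D i" "x \<in> cell i x" "cell i x \<subseteq> cell k x"
      using cell_in_D[OF iK[OF i(1)] xs] cell_self[OF iK[OF i(1)] xs] cell_mono[OF k _ xs, of i]
        i(1) by auto
    then show "Y \<in> ?C" unfolding truncated_cone_def using i(2) iK[OF i(1)] by blast
  qed
  have "(\<Sum>i\<in>{k..N}. En i u x)
    \<le> (\<Sum>i\<in>{k..N}. ennreal (c\<^sub>1 * Cg ^ n) * (\<integral>\<^sup>+Y. ?f Y * indicator (U i (cell i x)) Y \<partial>L))"
    by (intro sum_mono En_cone iK x u)
  also have "\<dots> = ennreal (c\<^sub>1 * Cg ^ n) * (\<Sum>i\<in>{k..N}. \<integral>\<^sup>+Y. ?f Y * indicator (U i (cell i x)) Y \<partial>L)"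
    by (rule sum_distrib_left[symmetric])
  also have "(\<Sum>i\<in>{k..N}. \<integral>\<^sup>+Y. ?f Y * indicator (U i (cell i x)) Y \<partial>L)
    = (\<integral>\<^sup>+Y. (\<Sum>i\<in>{k..N}. ?f Y * indicator (U i (cell i x)) Y) \<partial>L)"
    by (rule nn_integral_sum[symmetric]) measurable
  also have "\<dots> \<le> (\<integral>\<^sup>+Y. ennreal N0 * (?f Y * indicator C' Y) \<partial>L)"
  proof (rule nn_integral_mono)
    fix Y assume "Y \<in> space L"
    then have Y: "Y \<notin> E" by (simp add: space_restrict_space)
    define I where "I = {i \<in> {k..N}. Y \<in> U i (cell i x)}"
    have "(\<Sum>i\<in>{k..N}. (indicator (U i (cell i x)) Y :: ennreal)) = (\<Sum>i\<in>I. 1)"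
      unfolding I_def by (rule sum.mono_neutral_cong_right) auto
    also have "\<dots> = ennreal (real (card I))" by (simp add: ennreal_of_nat_eq_real_of_nat)
    also have "\<dots> \<le> ennreal N0 * indicator C' Y"
    proof (cases "I = {}")
      case False
      then have "Y \<in> C'" by (auto simp: I_def C'_def)
      then show ?thesis using overlap[OF k x Y, of N] unfolding I_def[symmetric]
        by (simp add: ennreal_leI)
    qed simp
    finally have "?f Y * (\<Sum>i\<in>{k..N}. indicator (U i (cell i x)) Y)
      \<le> ?f Y * (ennreal N0 * indicator C' Y)"
      by (rule mult_left_mono) simp
    then show "(\<Sum>i\<in>{k..N}. ?f Y * indicator (U i (cell i x)) Y)
      \<le> ennreal N0 * (?f Y * indicator C' Y)"
      unfolding sum_distrib_left mult.left_commute[of "ennreal N0"] .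
  qed
  also have "\<dots> = ennreal N0 * (\<integral>\<^sup>+Y. ?f Y * indicator C' Y \<partial>L)"
    by (rule nn_integral_cmult) measurable
  also have "(\<integral>\<^sup>+Y. ?f Y * indicator C' Y \<partial>L) \<le> (\<integral>\<^sup>+Y. ?f Y * indicator ?C Y \<partial>lebesgue)"
    unfolding nn_integral_L using C'C by (intro nn_integral_mono) (auto split: split_indicator)
  finally have "(\<Sum>i\<in>{k..N}. En i u x)
    \<le> ennreal (c\<^sub>1 * Cg ^ n) * (ennreal N0 * (\<integral>\<^sup>+Y. ?f Y * indicator ?C Y \<partial>lebesgue))"
    by (simp add: mult_left_mono)
  also have "\<dots> = ennreal Cov * (\<integral>\<^sup>+Y. ?f Y * indicator ?C Y \<partial>lebesgue)"
    unfolding Cov_def using pos Cg by (intro ennreal_triple_mult) (auto simp: N0_def)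
  finally show ?thesis by (simp only: Theta_eq)
qed

text \<open>If 4 C0 / \<eta> is the Chebyshev level for the power p/2 of the cone integral, its
  power 2/p is the level for the integral itself and \<open>Cov\<close> times that for the
  energies.\<close>

definition L2c :: "real \<Rightarrow> real \<Rightarrow> real" where "L2c p C0 = Cov * (4 * C0 / \<eta>2 p C0) powr (2 / p)"

text \<open>Chebyshev's inequality for the testing condition turns the strong bound on cones into
  the weak one required by the abstract theorem.\<close>

lemma testing_hypothesis:
  assumes ts: "testing_system n c\<^sub>3 E D W \<beta> \<psi> C0 p b" and p: "1 < p" and C0: "0 < C0"
    and k: "k \<in> K" and x: "x \<in> space \<sigma>"
  shows "\<exists>b. adm b \<and>
      (\<integral>\<^sup>+y. ennreal (norm (b y) powr p) \<partial>\<sigma>) \<le> ennreal C0 * emeasure \<sigma> (cell k x) \<and>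
      1 / C0 \<le> norm (avg k b x) \<and>
      emeasure \<sigma> {y \<in> cell k x. ennreal (L2c p C0) < (\<Sum>i\<in>{k..N}. En i b y)} \<le> ennreal (\<eta>2 p C0 / 4)
        * emeasure \<sigma> (cell k x)"
proof -
  define Q where "Q = cell k x"
  have Q: "Q \<in> dyadic_cubes c\<^sub>3 E D" unfolding Q_def dyadic_cubes_def using cell_in_D[OF k x] k
    by blast
  note t = ts[unfolded testing_system_def Let_def, rule_format, OF Q]
  have bm[measurable]: "b Q \<in> borel_measurable \<sigma>" using t by blast
  have blow: "measure \<sigma> Q / C0 \<le> norm (LINT x:Q|\<sigma>. b Q x)" using t by blast
  have bp: "(\<integral>\<^sup>+x. ennreal (norm (b Q x) powr p) \<partial>\<sigma>) \<le> ennreal C0 * emeasure \<sigma> Q" using t by blast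
  have [measurable]: "Q \<in> sets \<sigma>" unfolding Q_def by (rule cell_sets[OF k x])
  let ?A = "\<lambda>y. \<integral>\<^sup>+Y\<in>truncated_cone c\<^sub>3 E D W \<beta> Q y. ennreal ((norm (Theta n E \<psi> (b Q) Y))\<^sup>2
    / infdist Y E ^ (n + 1)) \<partial>lebesgue"
  have tt: "(\<integral>\<^sup>+y. ennreal_powr (?A y) (p / 2) * indicator Q y \<partial>\<sigma>) \<le> ennreal C0 * emeasure \<sigma> Q"
    using t by blast
  have Qfin: "emeasure \<sigma> Q \<noteq> \<infinity>" unfolding Q_def by (rule cell_fin[OF k x])
  have Qpos: "0 < measure \<sigma> Q" unfolding Q_def by (rule cell_mpos[OF k x])
  have adm: "adm (b Q)"
  proof (rule adm_of_bound[of _ "\<lambda>y. ennreal (norm (b Q y) powr p)" 1])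
    have "ennreal C0 * emeasure \<sigma> Q < \<infinity>" using Qfin by (simp add: ennreal_mult_less_top less_top)
    with bp show "(\<integral>\<^sup>+x. ennreal (norm (b Q x) powr p) \<partial>\<sigma>) < \<infinity>" by (rule le_less_trans)
    show "ennreal (norm (b Q y)) \<le> ennreal 1 + ennreal (norm (b Q y) powr p)" for y
      using young_powr_ennreal[of 1 "norm (b Q y)" p] p by simp
  qed auto
  have low: "1 / C0 \<le> norm (avg k (b Q) x)"
  proof -
    have "norm (avg k (b Q) x) = norm (LINT x:Q|\<sigma>. b Q x) / measure \<sigma> Q"
      using Qpos by (simp add: avg_def Q_def[symmetric] norm_divide)
    moreover have "1 / C0 = (measure \<sigma> Q / C0) / measure \<sigma> Q" using Qpos by simp
    ultimately show ?thesis using divide_right_mono[OF blow, of "measure \<sigma> Q"] Qpos by simp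
  qed
  have s: "0 < s0 p C0" using C0 by (simp add: s0_def)
  have e: "0 < \<eta>2 p C0" using C0 s by (simp add: \<eta>2_def)
  define v where "v = 4 * C0 / \<eta>2 p C0"
  have v: "0 < v" using C0 e by (simp add: v_def)
  define B where "B = {y \<in> Q. ennreal (L2c p C0) < (\<Sum>i\<in>{k..N}. En i (b Q) y)}"
  have "(\<lambda>y. \<Sum>i\<in>{k..N}. En i (b Q) y) \<in> borel_measurable \<sigma>"
    using K_upward[OF k] by (intro borel_measurable_sum En_measurable) auto
  then have "{y \<in> space \<sigma>. ennreal (L2c p C0) < (\<Sum>i\<in>{k..N}. En i (b Q) y)} \<inter> Q \<in> sets \<sigma>"
    by measurable
  moreover have "{y \<in> space \<sigma>. ennreal (L2c p C0) < (\<Sum>i\<in>{k..N}. En i (b Q) y)} \<inter> Q = B"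
    using cell_subset[OF k x] by (auto simp: B_def Q_def)
  ultimately have [measurable]: "B \<in> sets \<sigma>" by simp
  have "ennreal v * emeasure \<sigma> B = (\<integral>\<^sup>+y. ennreal v * indicator B y \<partial>\<sigma>)"
    by (simp add: nn_integral_cmult_indicator)
  also have "\<dots> \<le> (\<integral>\<^sup>+y. ennreal_powr (?A y) (p / 2) * indicator Q y \<partial>\<sigma>)"
  proof (rule nn_integral_mono)
    fix y
    show "ennreal v * indicator B y \<le> ennreal_powr (?A y) (p / 2) * indicator Q y"
    proof (cases "y \<in> B")
      case True
      then have yQ: "y \<in> Q" by (simp add: B_def)
      have y: "y \<in> E" using yQ cell_subset[OF k x] by (auto simp: Q_def)
      have cy: "cell k y = Q" using cell_cong[OF k x] yQ by (simp add: Q_def)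
      \<comment> \<open>On the exceptional set the cone integral is at least v^(2/p), so its power
        p/2 is at least v.\<close>
      have "ennreal Cov * ennreal (v powr (2 / p)) = ennreal (L2c p C0)"
        using Cov_pos by (simp add: L2c_def v_def ennreal_mult)
      also have "\<dots> \<le> (\<Sum>i\<in>{k..N}. En i (b Q) y)" using True by (auto simp: B_def)
      also have "\<dots> \<le> ennreal Cov * ?A y" using cone_bound[OF k y bm, of N] unfolding cy .
      finally have "ennreal (v powr (2 / p)) \<le> ?A y"
        using Cov_pos by (simp add: ennreal_mult_le_mult_iff)
      then show ?thesis using ennreal_powr_ge[OF v p] True yQ by simp
    qed simp
  qed
  also note tt
  also have "ennreal C0 * emeasure \<sigma> Q = ennreal v * (ennreal (\<eta>2 p C0 / 4) * emeasure \<sigma> Q)"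
  proof -
    have "v * (\<eta>2 p C0 / 4) = C0" using e by (simp add: v_def)
    then show ?thesis using v e by (subst ennreal_triple_mult) auto
  qed
  finally have "emeasure \<sigma> B \<le> ennreal (\<eta>2 p C0 / 4) * emeasure \<sigma> Q"
    using v by (simp add: ennreal_mult_le_mult_iff)
  then show ?thesis using adm bp low unfolding B_def Q_def by blast
qed

section \<open>From layers to the whole complement: Whitney layers and far points\<close>

definition V :: "int \<Rightarrow> 'a set" where "V k = (\<Union>Q\<in>D k. U k Q)"

lemma V_sets: "k \<in> K \<Longrightarrow> V k \<in> sets \<mu>"
  unfolding V_def using D_countable U_sets by (intro sets.countable_UN'') auto

text \<open>The union over the cubes is bounded by the sum, and the energy, having been spread
  evenly over each cell, integrates back to the integral over its region.\<close>

lemma layer_bound: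
  assumes k: "k \<in> K" and f[measurable]: "f \<in> borel_measurable \<sigma>"
  shows "(\<integral>\<^sup>+Y. ennreal ((norm (\<Theta> f Y))\<^sup>2) * indicator (V k) Y \<partial>\<mu>) \<le> (\<integral>\<^sup>+x. En k f x \<partial>\<sigma>)"
proof -
  let ?F = "\<lambda>Y. ennreal ((norm (\<Theta> f Y))\<^sup>2)"
  have [measurable]: "\<Theta> f \<in> borel_measurable \<mu>" by (rule \<Theta>_measurable[OF f])
  have "(\<integral>\<^sup>+Y. ?F Y * indicator (V k) Y \<partial>\<mu>)
    \<le> (\<integral>\<^sup>+Y. (\<integral>\<^sup>+Q. ?F Y * indicator (U k Q) Y \<partial>count_space (D k)) \<partial>\<mu>)"
  proof (rule nn_integral_mono)
    fix Y
    show "?F Y * indicator (V k) Y \<le> (\<integral>\<^sup>+Q. ?F Y * indicator (U k Q) Y \<partial>count_space (D k))"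
    proof (cases "Y \<in> V k")
      case True
      then obtain Q where Q: "Q \<in> D k" "Y \<in> U k Q" by (auto simp: V_def)
      have "?F Y * indicator (U k Q) Y \<le> (\<integral>\<^sup>+Q. ?F Y * indicator (U k Q) Y \<partial>count_space (D k))"
        by (rule nn_integral_ge_point[OF Q(1)])
      then show ?thesis using True Q by simp
    qed simp
  qed
  also have "\<dots> = (\<integral>\<^sup>+Q. (\<integral>\<^sup>+Y. ?F Y * indicator (U k Q) Y \<partial>\<mu>) \<partial>count_space (D k))"
    by (rule nn_integral_count_space_nn_integral[OF D_countable[OF k]])
      (use U_sets[OF k] in measurable)
  also have "\<dots> = (\<integral>\<^sup>+Q. (\<integral>\<^sup>+x. En k f x * indicator Q x \<partial>\<sigma>) \<partial>count_space (D k))"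
  proof (rule nn_integral_cong, simp)
    fix Q assume Q: "Q \<in> D k"
    obtain x where x: "x \<in> Q" using D_pos[OF k Q] by (metis emeasure_empty ex_in_conv)
    have xs: "x \<in> space \<sigma>" using x D_subset[OF k Q] by blast
    have cQ: "cell k x = Q" by (rule cell_eq[OF k Q x])
    have "(\<integral>\<^sup>+y. En k f y * indicator (cell k x) y \<partial>\<sigma>) = En k f x * emeasure \<sigma> (cell k x)"
      by (rule nn_integral_const_cell[OF k xs]) (rule En_cong[OF k xs])
    also have "\<dots> = (\<integral>\<^sup>+Y. ?F Y * indicator (U k (cell k x)) Y \<partial>\<mu>)"
      unfolding En_def using cell_pos[OF k xs] cell_fin[OF k xs]
      by (simp add: ennreal_divide_times ennreal_divide_self less_top[symmetric])
    finally show "(\<integral>\<^sup>+Y. ?F Y * indicator (U k Q) Y \<partial>\<mu>) = (\<integral>\<^sup>+x. En k f x * indicator Q x \<partial>\<sigma>)"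
      unfolding cQ by simp
  qed
  also have "\<dots> = (\<integral>\<^sup>+x. En k f x \<partial>\<sigma>)"
    by (rule nn_integral_cells[OF k En_measurable[OF k], symmetric])
  finally show ?thesis .
qed

text \<open>Exhaust the generations by finite sets contained in windows and use continuity from
  below of the measure with density |Theta f|^2.\<close>

lemma near_bound:
  assumes f[measurable]: "f \<in> borel_measurable \<sigma>"
    and C: "\<And>m N. m \<in> K \<Longrightarrow> m \<le> N \<Longrightarrow> (\<Sum>k\<in>{m..N}. \<integral>\<^sup>+x. En k f x \<partial>\<sigma>) \<le> C"
  shows "(\<integral>\<^sup>+Y. ennreal ((norm (\<Theta> f Y))\<^sup>2) * indicator (\<Union>k\<in>K. V k) Y \<partial>\<mu>) \<le> C"
proof -
  let ?F = "\<lambda>Y. ennreal ((norm (\<Theta> f Y))\<^sup>2)"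
  have [measurable]: "\<Theta> f \<in> borel_measurable \<mu>" by (rule \<Theta>_measurable[OF f])
  define J where "J i = K \<inter> {- int i..int i}" for i :: nat
  define A where "A i = (\<Union>k\<in>J i. V k)" for i
  define \<nu> where "\<nu> = density \<mu> ?F"
  have fJ: "finite (J i)" for i by (simp add: J_def)
  have JK: "k \<in> J i \<Longrightarrow> k \<in> K" for k i by (simp add: J_def)
  have Am: "A i \<in> sets \<mu>" for i unfolding A_def using fJ V_sets JK by (intro sets.finite_UN) auto
  have nu: "emeasure \<nu> B = (\<integral>\<^sup>+Y. ?F Y * indicator B Y \<partial>\<mu>)" if "B \<in> sets \<mu>" for B
    unfolding \<nu>_def by (rule emeasure_density[OF _ that]) measurable
  have "emeasure \<nu> (A i) \<le> C" for i
  proof (cases "J i = {}")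
    case True
    then show ?thesis by (simp add: A_def)
  next
    case False
    define m where "m = Min (J i)"
    have m: "m \<in> J i" unfolding m_def by (rule Min_in[OF fJ False])
    have sub: "J i \<subseteq> {m..int i}" unfolding m_def using fJ by (auto simp: J_def)
    have "emeasure \<nu> (A i) \<le> (\<Sum>k\<in>J i. emeasure \<nu> (V k))"
      unfolding A_def using fJ V_sets JK by (intro emeasure_subadditive_finite) (auto simp: \<nu>_def)
    also have "\<dots> \<le> (\<Sum>k\<in>J i. \<integral>\<^sup>+x. En k f x \<partial>\<sigma>)"
      using layer_bound[OF JK f] nu[OF V_sets[OF JK]] by (intro sum_mono) simp
    also have "\<dots> \<le> (\<Sum>k\<in>{m..int i}. \<integral>\<^sup>+x. En k f x \<partial>\<sigma>)" by (rule sum_mono2) (use sub in auto)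
    also have "\<dots> \<le> C" using m sub by (intro C) (auto simp: JK)
    finally show ?thesis .
  qed
  then have "(SUP i. emeasure \<nu> (A i)) \<le> C" by (intro SUP_least)
  moreover have "(SUP i. emeasure \<nu> (A i)) = emeasure \<nu> (\<Union>i. A i)"
  proof (rule SUP_emeasure_incseq)
    show "range A \<subseteq> sets \<nu>" using Am by (auto simp: \<nu>_def)
    show "incseq A" unfolding A_def J_def by (intro monoI UN_mono) auto
  qed
  moreover have UA: "(\<Union>i. A i) = (\<Union>k\<in>K. V k)"
  proof (intro equalityI subsetI)
    fix Y assume "Y \<in> (\<Union>k\<in>K. V k)"
    then obtain k where k: "k \<in> K" "Y \<in> V k" by blast
    then have "k \<in> J (nat \<bar>k\<bar>)" by (simp add: J_def abs_if)
    then show "Y \<in> (\<Union>i. A i)" using k(2) unfolding A_def by blast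
  qed (auto simp: A_def J_def)
  moreover have "(\<Union>i. A i) \<in> sets \<mu>" using Am by (intro sets.countable_UN) auto
  ultimately show ?thesis using nu by metis
qed

text \<open>Let 2^j be the side of the Whitney cube of Y. If -j is an admissible generation, a point
  of E nearest to the cube has a cell whose region contains the cube, by the lower bound on \<beta>.
  If not, 2^j exceeds \<open>c\<^sub>3\<close> diam(E), and delta(Y) is at least 4 * 2^j.\<close>

lemma cover:
  assumes Y: "Y \<notin> E"
  shows "Y \<in> (\<Union>k\<in>K. V k) \<or> (bounded E \<and> 4 * c\<^sub>3 * diameter E \<le> infdist Y E)"
proof -
  obtain I where I: "I \<in> W" "Y \<in> I" using Y W_cover by blast
  have "I \<in> euclidean_dyadic_cubes" using I W_dyadic by blast
  then obtain c j where Ic: "I = cube c (2 powi j)" by (rule euclidean_dyadic_cube)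
  let ?s = "2 powi j :: real"
  have s: "0 < ?s" by simp
  have cW: "cube c ?s \<in> W" using I Ic by simp
  show ?thesis
  proof (cases "- j \<in> K")
    case True
    have "\<exists>z\<in>cube c ?s. \<exists>x\<in>E. dist z x = setdist (cube c ?s) E"
      by (rule setdist_compact_closed[OF compact_cube closed_E]) (use centre_in_cube[OF s] nondeg in
        auto)
    then obtain z x where zx: "z \<in> cube c ?s" "x \<in> E" "dist z x = setdist (cube c ?s) E" by blast
    have xs: "x \<in> space \<sigma>" using zx by simp
    have "setdist (cell (- j) x) (cube c ?s) \<le> dist x z"
      by (rule setdist_le_dist[OF cell_self[OF True xs] zx(1)])
    also have "\<dots> \<le> 40 * diameter (cube c ?s)" using W_dist(2)[OF s cW] zx(3)
      by (simp add: dist_commute)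
    also have "\<dots> \<le> 40 * (DIM('a) * ?s)" using diameter_cube(2)[OF s, of c] by simp
    also have "\<dots> = 40 * (real n + 1) * ?s" by (simp add: dim)
    also have "\<dots> \<le> \<beta> * ?s" using \<beta> by (intro mult_right_mono) auto
    finally have "Y \<in> U (- j) (cell (- j) x)"
      unfolding whitney_region_def using I Ic s
        by (intro UnionI[of "cube c ?s"]) (auto intro!: exI[of _ c] exI[of _ "?s"])
    then have "Y \<in> V (- j)" unfolding V_def using cell_in_D[OF True xs] by blast
    then show ?thesis using True by blast
  next
    case False
    then have b: "bounded E" "c\<^sub>3 * diameter E < ?s" by (auto simp: generations_def)
    have "4 * ?s \<le> 4 * diameter (cube c ?s)" using diameter_cube(1)[OF s, of c] by simp
    also have "\<dots> \<le> setdist (cube c ?s) E" by (rule W_dist(1)[OF s cW])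
    also have "\<dots> \<le> setdist {Y} E" using I Ic by (intro setdist_subset_left) auto
    finally have "4 * ?s \<le> infdist Y E" by (simp add: infdist_eq_setdist)
    then show ?thesis using b by simp
  qed
qed

text \<open>A far point with r <= delta(Y) < 2 r lies within diam(E) + 2 r of any point of E, and
  diam(E) is at most r / (4 \<open>c\<^sub>3\<close>).\<close>

definition kap :: real where "kap = 2 + 1 / (4 * c\<^sub>3)"
definition Cfar :: real where "Cfar = C\<^sub>\<psi>\<^sup>2 * A * (2 * ws * kap ^ (n + 1)) / (4 * c\<^sub>3) ^ n"

text \<open>In dyadic shells of delta the volume r^(n+1) meets the weight r^(-2n-1). What remains is
  r^(-n), summable over r = 2^i R because n >= 1.\<close>

lemma far_volume:
  assumes bd: "bounded E"
  shows "(\<integral>\<^sup>+Y. ennreal (1 / infdist Y E ^ (2 * n + 1)) * indicator {Y. 4 * c\<^sub>3 * diameter E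
    \<le> infdist Y E} Y \<partial>lebesgue)
    \<le> ennreal (2 * ws * kap ^ (n + 1) / (4 * c\<^sub>3 * diameter E) ^ n)"
proof -
  define d where "d = diameter E"
  define R where "R = 4 * c\<^sub>3 * d"
  have d: "0 < d" using nondeg bd by (simp add: d_def)
  have R: "0 < R" using d pos by (simp add: R_def)
  obtain x0 where x0: "x0 \<in> E" using nondeg by blast
  have k: "2 \<le> kap" using pos by (simp add: kap_def)
  define r where "r i = 2 ^ i * R" for i :: nat
  have r: "0 < r i" "R \<le> r i" for i using R by (auto simp: r_def)
  define B where "B i = cball x0 (kap * r i)" for i
  have Bm[measurable]: "B i \<in> sets lebesgue" for i by (simp add: B_def)
  have pt: "ennreal (1 / infdist Y E ^ (2 * n + 1)) * indicator {Y. R \<le> infdist Y E} Y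
      \<le> (\<Sum>i. ennreal (1 / r i ^ (2 * n + 1)) * indicator (B i) Y)" for Y
  proof (cases "R \<le> infdist Y E")
    case True
    let ?\<delta> = "infdist Y E"
    have \<delta>: "0 < ?\<delta>" using True R by linarith
    have ex: "\<exists>i::nat. ?\<delta> < r (Suc i)"
    proof -
      obtain i :: nat where "?\<delta> / R < 2 ^ i" using real_arch_pow[of 2 "?\<delta> / R"] by auto
      then have "?\<delta> < 2 ^ i * R" using R by (simp add: field_simps)
      also have "\<dots> \<le> r (Suc i)" using R by (simp add: r_def)
      finally show ?thesis by blast
    qed
    define i where "i = (LEAST i. ?\<delta> < r (Suc i))"
    have i1: "?\<delta> < r (Suc i)" unfolding i_def using ex by (rule LeastI_ex)
    have i2: "r i \<le> ?\<delta>"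
    proof (cases i)
      case 0 then show ?thesis using True by (simp add: r_def)
    next
      case (Suc m)
      then show ?thesis using not_less_Least[of m "\<lambda>i. ?\<delta> < r (Suc i)"] by (simp add: i_def)
    qed
    obtain e where e: "e \<in> E" "infdist Y E = dist Y e"
      using infdist_attains_inf[OF closed_E nondeg(1)] by blast
    have "dist x0 Y \<le> dist x0 e + dist e Y" by (rule dist_triangle)
    also have "\<dots> \<le> d + r (Suc i)"
      using diameter_bounded_bound[OF bd x0 e(1)] i1 e(2) by (simp add: d_def dist_commute)
    also have "d = R / (4 * c\<^sub>3)" using pos by (simp add: R_def)
    also have "R / (4 * c\<^sub>3) + r (Suc i) \<le> r i / (4 * c\<^sub>3) + r (Suc i)"
      using r[of i] pos by (intro add_right_mono divide_right_mono) auto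
    also have "\<dots> = kap * r i" by (simp add: kap_def r_def algebra_simps)
    finally have YB: "Y \<in> B i" by (simp add: B_def)
    have "1 / ?\<delta> ^ (2 * n + 1) \<le> 1 / r i ^ (2 * n + 1)"
      using i2 r[of i] \<delta> by (intro divide_left_mono power_mono mult_pos_pos zero_less_power) auto
    then have "ennreal (1 / ?\<delta> ^ (2 * n + 1)) * indicator {Y. R \<le> infdist Y E} Y
      \<le> ennreal (1 / r i ^ (2 * n + 1)) * indicator (B i) Y"
      using YB True by (simp add: ennreal_leI del: power_Suc)
    also have "\<dots> = (\<Sum>j\<in>{i}. ennreal (1 / r j ^ (2 * n + 1)) * indicator (B j) Y)"
      by (simp only: sum.insert[OF finite.emptyI] empty_iff sum.empty add_0_right not_False_eq_True)
    also have "\<dots> \<le> (\<Sum>j. ennreal (1 / r j ^ (2 * n + 1)) * indicator (B j) Y)"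
      by (intro sum_le_suminf) auto
    finally show ?thesis .
  qed simp
  have "(\<integral>\<^sup>+Y. ennreal (1 / infdist Y E ^ (2 * n + 1)) * indicator {Y. R \<le> infdist Y E} Y \<partial>lebesgue)
     \<le> (\<integral>\<^sup>+Y. (\<Sum>i. ennreal (1 / r i ^ (2 * n + 1)) * indicator (B i) Y) \<partial>lebesgue)"
    by (intro nn_integral_mono pt)
  also have "\<dots> = (\<Sum>i. ennreal (1 / r i ^ (2 * n + 1)) * emeasure lebesgue (B i))"
    by (subst nn_integral_suminf) (auto simp: nn_integral_cmult_indicator)
  also have "\<dots> \<le> (\<Sum>i. ennreal (ws * kap ^ (n + 1) / R ^ n * (1/2) ^ i))"
  proof (intro suminf_le)
    fix i :: nat
    have "emeasure lebesgue (B i) = ennreal (ws * (kap * r i) ^ (n + 1))"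
      using emeasure_cball[of "kap * r i" x0] k r[of i] by (simp add: B_def ws_def dim)
    then have "ennreal (1 / r i ^ (2 * n + 1)) * emeasure lebesgue (B i)
      = ennreal (1 / r i ^ (2 * n + 1) * (ws * (kap * r i) ^ (n + 1)))"
      using r[of i] k ws_pos by (simp only:) (intro ennreal_mult[symmetric]; simp)
    also have "1 / r i ^ (2 * n + 1) * (ws * (kap * r i) ^ (n + 1))
      = ws * kap ^ (n + 1) * (1 / r i ^ n)"
    proof -
      have "r i ^ (2 * n + 1) = r i ^ (n + 1) * r i ^ n" by (simp add: power_add[symmetric] mult_2)
      moreover have "r i ^ (n + 1) \<noteq> 0" "r i ^ n \<noteq> 0" using r[of i] by auto
      ultimately show ?thesis unfolding power_mult_distrib by (simp add: field_simps)
    qed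
    also have "\<dots> \<le> ws * kap ^ (n + 1) * (1 / (2 ^ i * R ^ n))"
    proof (intro mult_left_mono divide_left_mono)
      \<comment> \<open>Here n >= 1 is used; the ratio 1/2 replaces the sharper one for all
        n.\<close>
      have "(2::real) ^ i * R ^ n \<le> (2 ^ i) ^ n * R ^ n"
        using R n by (intro mult_right_mono self_le_power) auto
      then show "2 ^ i * R ^ n \<le> r i ^ n" by (simp add: r_def power_mult_distrib)
    qed (use ws_pos k R r[of i] in auto)
    also have "\<dots> = ws * kap ^ (n + 1) / R ^ n * (1/2) ^ i" by (simp add: power_one_over)
    finally show "ennreal (1 / r i ^ (2 * n + 1)) * emeasure lebesgue (B i)
      \<le> ennreal (ws * kap ^ (n + 1) / R ^ n * (1/2) ^ i)"
      by (simp add: ennreal_leI del: power_Suc)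
  qed auto
  also have "\<dots> = ennreal (\<Sum>i. ws * kap ^ (n + 1) / R ^ n * (1/2) ^ i)"
    using ws_pos k R by (intro suminf_ennreal2 summable_mult summable_geometric) auto
  also have "(\<Sum>i. ws * kap ^ (n + 1) / R ^ n * (1/2) ^ i) = 2 * ws * kap ^ (n + 1) / R ^ n"
    by (subst suminf_mult) (auto simp: suminf_geometric summable_geometric)
  finally show ?thesis by (simp add: R_def d_def)
qed

text \<open>The size bound gives |\<psi>| <= C delta^(-n), and Cauchy-Schwarz on E costs the total
  mass, a multiple of diam(E)^n. This cancels the factor diam(E)^(-n) of \<open>far_volume\<close>,
  so the constant does not depend on the diameter.\<close>

lemma far_bound:
  assumes bd: "bounded E" and f[measurable]: "f \<in> borel_measurable \<sigma>"
  shows "(\<integral>\<^sup>+Y. ennreal ((norm (\<Theta> f Y))\<^sup>2) * indicator {Y. 4 * c\<^sub>3 * diameter E \<le> infdist Y E} Y \<partial>\<mu>)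
    \<le> ennreal Cfar * (\<integral>\<^sup>+x. sq f x \<partial>\<sigma>)"
proof -
  define d where "d = diameter E"
  have d: "0 < d" using nondeg bd by (simp add: d_def)
  let ?far = "{Y. 4 * c\<^sub>3 * diameter E \<le> infdist Y E}"
  let ?f2 = "\<integral>\<^sup>+x. sq f x \<partial>\<sigma>"
  have [measurable]: "(\<lambda>Y. infdist Y E) \<in> borel_measurable lebesgue"
    by (rule measurable_completion) (simp add: infdist_borel)
  have farm: "?far \<in> sets borel" using infdist_borel[of E] by measurable
  have \<sigma>E: "emeasure \<sigma> E \<le> ennreal (A * d ^ n)"
  proof -
    have "card X * C\<^sub>E * d ^ n \<le> A * d ^ n" using pos d
      by (intro mult_right_mono) (auto simp: A_def algebra_simps)
    then show ?thesis using upper_total[OF bd] unfolding d_def[symmetric]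
      by (meson ennreal_leI order_trans)
  qed
  have L1: "(\<integral>\<^sup>+y. ennreal (norm (f y)) \<partial>\<sigma>)\<^sup>2 \<le> ennreal (A * d ^ n) * ?f2"
  proof -
    have "(\<integral>\<^sup>+y. 1 * ennreal (norm (f y)) \<partial>\<sigma>)\<^sup>2
      \<le> (\<integral>\<^sup>+y. 1\<^sup>2 \<partial>\<sigma>) * (\<integral>\<^sup>+y. (ennreal (norm (f y)))\<^sup>2 \<partial>\<sigma>)"
      by (rule Cauchy_Schwarz_nn_integral) auto
    also have "\<dots> = emeasure \<sigma> E * ?f2" by (simp add: ennreal_power)
    also have "\<dots> \<le> ennreal (A * d ^ n) * ?f2" by (intro mult_right_mono \<sigma>E) auto
    finally show ?thesis by simp
  qed
  have pt: "ennreal ((norm (\<Theta> f Y))\<^sup>2)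
    \<le> ennreal (1 / infdist Y E ^ (2 * n)) * (ennreal (C\<^sub>\<psi>\<^sup>2) * (ennreal (A * d ^ n) * ?f2))"
    if Y: "Y \<notin> E" for Y
  proof -
    let ?\<delta> = "infdist Y E"
    have \<delta>: "0 < ?\<delta>" using Y infdist_pos_not_in_closed[OF closed_E nondeg(1)] by blast
    have \<psi>\<delta>: "norm (\<psi> Y y) \<le> C\<^sub>\<psi> / ?\<delta> ^ n" if y: "y \<in> E" for y
    proof -
      have "norm (\<psi> Y y) \<le> C\<^sub>\<psi> * ?\<delta> powr \<alpha> / dist Y y powr ex" by (rule \<psi>_bound[OF Y y])
      also have "\<dots> \<le> C\<^sub>\<psi> * ?\<delta> powr \<alpha> / ?\<delta> powr ex"
        using \<delta> infdist_le[OF y, of Y] Cg C\<psi>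
          by (intro divide_left_mono powr_mono2 mult_pos_pos mult_nonneg_nonneg) auto
      also have "\<dots> = C\<^sub>\<psi> / ?\<delta> ^ n" using \<delta> by (simp add: ex_def powr_add powr_realpow)
      finally show ?thesis .
    qed
    have "ennreal (norm (\<Theta> f Y)) \<le> (\<integral>\<^sup>+y. ennreal (norm (\<psi> Y y * f y)) \<partial>\<sigma>)"
      unfolding \<Theta>_def
      by (cases "integrable \<sigma> (\<lambda>y. \<psi> Y y * f y)") (auto intro: integral_norm_bound_ennreal simp:
        not_integrable_integral_eq)
    also have "\<dots> \<le> (\<integral>\<^sup>+y. ennreal (C\<^sub>\<psi> / ?\<delta> ^ n) * ennreal (norm (f y)) \<partial>\<sigma>)"
    proof (rule nn_integral_mono)
      fix y assume "y \<in> space \<sigma>"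
      then have "norm (\<psi> Y y * f y) \<le> C\<^sub>\<psi> / ?\<delta> ^ n * norm (f y)"
        unfolding norm_mult using \<psi>\<delta> by (intro mult_right_mono) auto
      then have "ennreal (norm (\<psi> Y y * f y)) \<le> ennreal (C\<^sub>\<psi> / ?\<delta> ^ n * norm (f y))"
        by (rule ennreal_leI)
      also have "\<dots> = ennreal (C\<^sub>\<psi> / ?\<delta> ^ n) * ennreal (norm (f y))" using C\<psi> \<delta>
        by (intro ennreal_mult) auto
      finally show "ennreal (norm (\<psi> Y y * f y)) \<le> ennreal (C\<^sub>\<psi> / ?\<delta> ^ n) * ennreal (norm (f y))" .
    qed
    also have "\<dots> = ennreal (C\<^sub>\<psi> / ?\<delta> ^ n) * (\<integral>\<^sup>+y. ennreal (norm (f y)) \<partial>\<sigma>)"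
      by (rule nn_integral_cmult) measurable
    finally have "(ennreal (norm (\<Theta> f Y)))\<^sup>2
      \<le> (ennreal (C\<^sub>\<psi> / ?\<delta> ^ n) * (\<integral>\<^sup>+y. ennreal (norm (f y)) \<partial>\<sigma>))\<^sup>2"
      by (rule power_mono_ennreal)
    also have "\<dots> = ennreal ((C\<^sub>\<psi> / ?\<delta> ^ n)\<^sup>2) * (\<integral>\<^sup>+y. ennreal (norm (f y)) \<partial>\<sigma>)\<^sup>2"
      using C\<psi> \<delta> by (simp only: power_mult_distrib) (subst ennreal_power; simp)
    also have "\<dots> \<le> ennreal ((C\<^sub>\<psi> / ?\<delta> ^ n)\<^sup>2) * (ennreal (A * d ^ n) * ?f2)"
      by (intro mult_left_mono L1) auto
    also have "(C\<^sub>\<psi> / ?\<delta> ^ n)\<^sup>2 = 1 / ?\<delta> ^ (2 * n) * C\<^sub>\<psi>\<^sup>2"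
      by (simp add: power_divide power_mult[symmetric] mult.commute)
    also have "ennreal \<dots> = ennreal (1 / ?\<delta> ^ (2 * n)) * ennreal (C\<^sub>\<psi>\<^sup>2)" using \<delta>
      by (intro ennreal_mult) auto
    finally show ?thesis by (simp only: ennreal_power norm_ge_zero mult.assoc)
  qed
  have farL: "?far \<inter> - E \<in> sets L" using farm E_lebesgue by (subst sets_restrict_space_iff) auto
  let ?Cc = "ennreal (C\<^sub>\<psi>\<^sup>2) * (ennreal (A * d ^ n) * ?f2)"
  have farL': "(\<lambda>Y. indicator ?far Y :: ennreal) \<in> borel_measurable L"
    by (rule measurable_restrict_space1) (use farm in measurable)
  have "(\<integral>\<^sup>+Y. ennreal ((norm (\<Theta> f Y))\<^sup>2) * indicator ?far Y \<partial>\<mu>)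
     = (\<integral>\<^sup>+Y. ennreal (1 / infdist Y E) * (ennreal ((norm (\<Theta> f Y))\<^sup>2) * indicator ?far Y) \<partial>L)"
    by (rule \<mu>_integral) (use farL' in measurable)
  also have "\<dots> \<le> (\<integral>\<^sup>+Y. ?Cc * (ennreal (1 / infdist Y E ^ (2 * n + 1)) * indicator ?far Y) \<partial>L)"
  proof (rule nn_integral_mono)
    fix Y assume "Y \<in> space L"
    then have Y: "Y \<notin> E" by (simp add: space_restrict_space)
    have "ennreal (1 / infdist Y E) * (ennreal ((norm (\<Theta> f Y))\<^sup>2) * indicator ?far Y)
       \<le> ennreal (1 / infdist Y E) * ((ennreal (1 / infdist Y E ^ (2 * n)) * ?Cc) * indicator ?far
         Y)"
      by (intro mult_left_mono mult_right_mono pt Y) auto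
    also have "\<dots> = ?Cc * ((ennreal (1 / infdist Y E) * ennreal (1 / infdist Y E ^ (2 * n)))
      * indicator ?far Y)"
      by (simp only: ac_simps)
    also have "ennreal (1 / infdist Y E) * ennreal (1 / infdist Y E ^ (2 * n))
      = ennreal (1 / infdist Y E ^ (2 * n + 1))"
      by (subst ennreal_mult[symmetric]) (auto simp: infdist_nonneg)
    finally show "ennreal (1 / infdist Y E) * (ennreal ((norm (\<Theta> f Y))\<^sup>2) * indicator ?far Y)
       \<le> ?Cc * (ennreal (1 / infdist Y E ^ (2 * n + 1)) * indicator ?far Y)" .
  qed
  also have "\<dots> = ?Cc * (\<integral>\<^sup>+Y. ennreal (1 / infdist Y E ^ (2 * n + 1)) * indicator ?far Y \<partial>L)"
    by (rule nn_integral_cmult) (use farL' in measurable)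
  also have "\<dots> \<le> ?Cc * ennreal (2 * ws * kap ^ (n + 1) / (4 * c\<^sub>3 * d) ^ n)"
  proof (rule mult_left_mono)
    have "(\<integral>\<^sup>+Y. ennreal (1 / infdist Y E ^ (2 * n + 1)) * indicator ?far Y \<partial>L)
       \<le> (\<integral>\<^sup>+Y. ennreal (1 / infdist Y E ^ (2 * n + 1)) * indicator ?far Y \<partial>lebesgue)"
      unfolding nn_integral_L by (intro nn_integral_mono) (auto split: split_indicator)
    also note far_volume[OF bd]
    finally show "(\<integral>\<^sup>+Y. ennreal (1 / infdist Y E ^ (2 * n + 1)) * indicator ?far Y \<partial>L)
      \<le> ennreal (2 * ws * kap ^ (n + 1) / (4 * c\<^sub>3 * d) ^ n)"
      by (simp only: d_def)
  qed simp
  also have "\<dots> = ennreal Cfar * ?f2"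
  proof -
    have k: "0 < kap" using pos by (simp add: kap_def add_pos_nonneg)
    let ?a = "C\<^sub>\<psi>\<^sup>2" and ?b = "A * d ^ n" and ?c = "2 * ws * kap ^ (n + 1) / (4 * c\<^sub>3 * d) ^ n"
    have nn: "0 \<le> ?a" "0 \<le> ?b" "0 \<le> ?c" using A_pos d ws_pos k pos by auto
    have "?Cc * ennreal ?c = (ennreal ?a * (ennreal ?b * ennreal ?c)) * ?f2"
      by (simp only: ac_simps)
    also have "ennreal ?a * (ennreal ?b * ennreal ?c) = ennreal (?a * (?b * ?c))"
      using nn by (simp only: ennreal_mult[symmetric] mult_nonneg_nonneg)
    also have "?a * (?b * ?c) = Cfar"
      unfolding Cfar_def using d pos by (simp add: power_mult_distrib)
    finally show ?thesis .
  qed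
  finally show ?thesis .
qed

definition Cfin :: "real \<Rightarrow> real \<Rightarrow> real" where
  "Cfin p C0 = CT p C0 (1 + c\<^sub>1\<^sup>2 * 2 ^ n) (L2c p C0) + Cfar"

lemma square_function_bound:
  assumes ts: "testing_system n c\<^sub>3 E D W \<beta> \<psi> C0 p b" and p: "1 < p" and C0: "0 < C0"
    and f[measurable]: "f \<in> borel_measurable \<sigma>" and fin: "(\<integral>\<^sup>+x. sq f x \<partial>\<sigma>) < \<infinity>"
  shows "(\<integral>\<^sup>+Y\<in>- E. ennreal ((norm (Theta n E \<psi> f Y))\<^sup>2 / infdist Y E) \<partial>lebesgue)
    \<le> ennreal (1 + \<bar>Cfin p C0\<bar>) * (\<integral>\<^sup>+x. sq f x \<partial>\<sigma>)"
proof -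
  let ?F = "\<lambda>Y. ennreal ((norm (\<Theta> f Y))\<^sup>2)" and ?f2 = "\<integral>\<^sup>+x. sq f x \<partial>\<sigma>"
  let ?CT = "CT p C0 (1 + c\<^sub>1\<^sup>2 * 2 ^ n) (L2c p C0)"
  let ?far = "{Y. 4 * c\<^sub>3 * diameter E \<le> infdist Y E}"
  have [measurable]: "\<Theta> f \<in> borel_measurable \<mu>" by (rule \<Theta>_measurable[OF f])
  have s: "0 < s0 p C0" using C0 by (simp add: s0_def)
  have e: "0 < \<eta>2 p C0" using C0 s by (simp add: \<eta>2_def)
  have CT0: "0 \<le> ?CT" unfolding CT_def using e cpos CI_pos ws_pos pos Cg
    by (intro add_nonneg_nonneg mult_nonneg_nonneg divide_nonneg_pos) auto
  have k: "0 < kap" using pos by (simp add: kap_def add_pos_nonneg)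
  have Cf0: "0 \<le> Cfar" unfolding Cfar_def using A_pos ws_pos pos k by auto
  have layers: "(\<Sum>k\<in>{m..N}. \<integral>\<^sup>+x. En k f x \<partial>\<sigma>) \<le> ennreal ?CT * ?f2" if "m \<in> K" "m \<le> N" for m N
    by (rule local_Tb_abstract[OF p C0 _ _ cell_doubling testing_hypothesis[OF ts p C0] f fin that])
      (use Cov_pos in \<open>auto simp: L2c_def\<close>)
  have near: "(\<integral>\<^sup>+Y. ?F Y * indicator (\<Union>k\<in>K. V k) Y \<partial>\<mu>) \<le> ennreal ?CT * ?f2"
    by (rule near_bound[OF f layers])
  have UV: "(\<Union>k\<in>K. V k) \<in> sets \<mu>" using V_sets by (intro sets.countable_UN'') auto
  have total: "(\<integral>\<^sup>+Y. ?F Y \<partial>\<mu>) \<le> ennreal (Cfin p C0) * ?f2"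
  proof (cases "bounded E")
    case False
    have "(\<integral>\<^sup>+Y. ?F Y \<partial>\<mu>) \<le> (\<integral>\<^sup>+Y. ?F Y * indicator (\<Union>k\<in>K. V k) Y \<partial>\<mu>)"
    proof (rule nn_integral_mono)
      fix Y assume "Y \<in> space \<mu>"
      then have "Y \<notin> E" by (simp add: \<mu>_def space_restrict_space)
      then have "Y \<in> (\<Union>k\<in>K. V k)" using cover False by blast
      then show "?F Y \<le> ?F Y * indicator (\<Union>k\<in>K. V k) Y"
        by (simp only: indicator_simps mult_1_right order_refl)
    qed
    also note near
    also have "ennreal ?CT * ?f2 \<le> ennreal (Cfin p C0) * ?f2"
      using Cf0 by (intro mult_right_mono ennreal_leI) (auto simp: Cfin_def)
    finally show ?thesis .
  next
    case True
    have farm: "?far \<inter> - E \<in> sets \<mu>"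
    proof -
      have "?far \<in> sets borel" using infdist_borel[of E] by measurable
      then show ?thesis using E_lebesgue unfolding sets_\<mu> by (subst sets_restrict_space_iff) auto
    qed
    have "(\<integral>\<^sup>+Y. ?F Y \<partial>\<mu>) \<le> (\<integral>\<^sup>+Y. ?F Y * indicator (\<Union>k\<in>K. V k) Y
      + ?F Y * indicator (?far \<inter> - E) Y \<partial>\<mu>)"
    proof (rule nn_integral_mono)
      fix Y assume "Y \<in> space \<mu>"
      then have Y: "Y \<notin> E" by (simp add: \<mu>_def space_restrict_space)
      have c: "Y \<in> (\<Union>k\<in>K. V k) \<or> Y \<in> ?far \<inter> - E" using cover[OF Y] Y by blast
      show "?F Y \<le> ?F Y * indicator (\<Union>k\<in>K. V k) Y + ?F Y * indicator (?far \<inter> - E) Y"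
      proof (cases "Y \<in> (\<Union>k\<in>K. V k)")
        case True
        then show ?thesis by (simp only: indicator_simps mult_1_right) simp
      next
        case False
        with c have "Y \<in> ?far \<inter> - E" by blast
        then show ?thesis by (simp only: indicator_simps mult_1_right) simp
      qed
    qed
    also have "\<dots> = (\<integral>\<^sup>+Y. ?F Y * indicator (\<Union>k\<in>K. V k) Y \<partial>\<mu>)
      + (\<integral>\<^sup>+Y. ?F Y * indicator (?far \<inter> - E) Y \<partial>\<mu>)"
      by (intro nn_integral_add borel_measurable_times_ennreal borel_measurable_indicator[OF UV]
        borel_measurable_indicator[OF farm]) measurable
    also have "(\<integral>\<^sup>+Y. ?F Y * indicator (?far \<inter> - E) Y \<partial>\<mu>) \<le> (\<integral>\<^sup>+Y. ?F Y * indicator ?far Y \<partial>\<mu>)"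
      by (intro nn_integral_mono) (auto split: split_indicator)
    also note far_bound[OF True f]
    finally have "(\<integral>\<^sup>+Y. ?F Y \<partial>\<mu>) \<le> ennreal ?CT * ?f2 + ennreal Cfar * ?f2" using near
      by (meson add_mono order_refl order_trans)
    also have "\<dots> = ennreal (Cfin p C0) * ?f2" unfolding Cfin_def using CT0 Cf0
      by (simp add: distrib_right)
    finally show ?thesis .
  qed
  have "(\<integral>\<^sup>+Y\<in>- E. ennreal ((norm (Theta n E \<psi> f Y))\<^sup>2 / infdist Y E) \<partial>lebesgue)
     = (\<integral>\<^sup>+Y. ennreal ((norm (\<Theta> f Y))\<^sup>2 / infdist Y E) \<partial>L)"
    unfolding nn_integral_L Theta_eq ..
  also have "\<dots> = (\<integral>\<^sup>+Y. ennreal (1 / infdist Y E) * ?F Y \<partial>L)"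
    by (intro nn_integral_cong) (simp add: ennreal_mult'[symmetric] infdist_nonneg)
  also have "\<dots> = (\<integral>\<^sup>+Y. ?F Y \<partial>\<mu>)" by (rule \<mu>_integral[symmetric]) measurable
  also note total
  also have "ennreal (Cfin p C0) * ?f2 \<le> ennreal (1 + \<bar>Cfin p C0\<bar>) * ?f2"
    by (intro mult_right_mono ennreal_leI) auto
  finally show ?thesis .
qed

end

section \<open>The theorem\<close>

text \<open>The point covers itself with diameter 0, and 0 ^ n = 0 for n >= 1.\<close>

lemma hausdorff_outer_singleton: "1 \<le> n \<Longrightarrow> hausdorff_outer n {x} = 0"
proof -
  assume n: "1 \<le> n"
  have "hausdorff_content n \<epsilon> {x} \<le> 0" if "0 < \<epsilon>" for \<epsilon>
  proof -
    have "hausdorff_content n \<epsilon> {x} \<le> (\<Sum>i::nat. hausdorff_gauge n {x})"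
      by (rule hausdorff_content_lower[of _ "\<lambda>_. {x}"]) (use that in auto)
    also have "hausdorff_gauge n {x} = 0" using n by (simp add: hausdorff_gauge_def)
    finally show ?thesis by simp
  qed
  then show ?thesis unfolding hausdorff_outer_def by (auto intro!: antisym SUP_least)
qed

lemma Theta_degenerate:
  fixes E :: "'a::euclidean_space set"
  assumes n: "1 \<le> n" and "E = {} \<or> bounded E \<and> diameter E = 0"
  shows "Theta n E \<psi> f Y = 0"
proof -
  have "E \<subseteq> {SOME x. x \<in> E}"
  proof
    fix y assume y: "y \<in> E"
    then have bd: "bounded E" "diameter E = 0" and s: "(SOME x. x \<in> E) \<in> E" using assms
      by (auto intro: someI)
    have "dist y (SOME x. x \<in> E) \<le> diameter E" by (rule diameter_bounded_bound[OF bd(1) y s])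
    then show "y \<in> {SOME x. x \<in> E}" using bd by simp
  qed
  then obtain x where x: "E \<subseteq> {x}" by blast
  have E: "E \<in> sets borel" using x by (cases "E = {}") (auto simp: subset_singleton_iff)
  have "space (hausdorff_measure n :: 'a measure) = UNIV" by (simp add: hausdorff_measure_def)
  then have "emeasure (surface_measure n E) E = hausdorff_outer n E"
    unfolding surface_measure_def using E
    by (subst emeasure_restrict_space) (simp_all add: emeasure_hausdorff_measure)
  also have "\<dots> \<le> hausdorff_outer n {x}" by (rule hausdorff_outer_mono[OF x])
  finally have "emeasure (surface_measure n E) E = 0" by (simp add: hausdorff_outer_singleton[OF n])
  moreover have sp: "space (surface_measure n E) = E"
    by (simp add: surface_measure_def space_restrict_space hausdorff_measure_def)
  ultimately have "AE y in surface_measure n E. \<psi> Y y * f y = 0"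
    by (intro AE_I'[of E]) (auto simp: null_sets_def, metis sets.top)
  then show ?thesis unfolding Theta_def by (rule integral_eq_zero_AE)
qed

theorem theorem2p25:
  fixes n :: nat and C_E a\<^sub>0 \<eta>\<^sub>0 c\<^sub>1 c\<^sub>2 c\<^sub>3 :: real
  assumes "n \<ge> 1" and "DIM('a::euclidean_space) = n + 1"
    and "C_E > 0" and "a\<^sub>0 > 0" and "\<eta>\<^sub>0 > 0" and "c\<^sub>1 > 0" and "c\<^sub>2 > 0" and "c\<^sub>3 > 0"
  shows "\<exists>\<beta>\<^sub>0>0. \<forall>\<beta>\<ge>\<beta>\<^sub>0. \<forall>C\<^sub>\<psi>>0. \<forall>\<alpha>>0. \<forall>C\<^sub>0>0. \<forall>p>1. \<exists>C>0.
    \<forall>(E :: 'a set) D W \<psi> b.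
      ahlfors_david_regular n C_E E \<longrightarrow>
      dyadic_grid n a\<^sub>0 \<eta>\<^sub>0 c\<^sub>1 c\<^sub>2 c\<^sub>3 E D \<longrightarrow>
      whitney_decomposition E W \<longrightarrow>
      square_function_kernel n C\<^sub>\<psi> \<alpha> E \<psi> \<longrightarrow>
      testing_system n c\<^sub>3 E D W \<beta> \<psi> C\<^sub>0 p b \<longrightarrow>
      (\<forall>f. f \<in> borel_measurable (surface_measure n E) \<longrightarrow>
           (\<integral>\<^sup>+x. ennreal ((norm (f x))\<^sup>2) \<partial>surface_measure n E) < \<infinity> \<longrightarrow>
           (\<integral>\<^sup>+Y\<in>-E. ennreal ((norm (Theta n E \<psi> f Y))\<^sup>2 / infdist Y E) \<partial>lebesgue)
             \<le> ennreal C * (\<integral>\<^sup>+x. ennreal ((norm (f x))\<^sup>2) \<partial>surface_measure n E))"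
proof -
  have "cball 0 1 \<subseteq> (\<Union>z\<in>(UNIV :: 'a set). ball z (1/4))"
  proof
    fix x :: 'a
    have "x \<in> ball x (1/4)" by simp
    then show "x \<in> (\<Union>z\<in>UNIV. ball z (1/4))" by blast
  qed
  \<comment> \<open>The net is fixed before E, so constants involving its cardinality depend on the
    dimension only.\<close>
  then obtain X where X: "finite X" "cball (0::'a) 1 \<subseteq> (\<Union>z\<in>X. ball z (1/4))"
    using compactE_image[OF compact_cball, of UNIV "\<lambda>z. ball z (1/4)" 0 1] open_ball by metis
  show ?thesis
  \<comment> \<open>A Whitney cube of side s has distance at most 40 diameters from E, and its
    diameter is at most (n + 1) s.\<close>
  proof (rule exI[of _ "40 * (real n + 1)"], intro conjI allI impI)
    show "0 < 40 * (real n + 1)" by simp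
    fix \<beta> C\<^sub>\<psi> \<alpha> C\<^sub>0 p :: real
    assume h: "40 * (real n + 1) \<le> \<beta>" "0 < C\<^sub>\<psi>" "0 < \<alpha>" "0 < C\<^sub>0" "1 < p"
    \<comment> \<open>None of E, D, W, \<psi> and b is an argument of \<open>Cfin\<close>, which is
      what the order of the quantifiers demands; 1 plus an absolute value makes the constant
      positive.\<close>
    let ?C = "1 + \<bar>tb_setting.Cfin n C_E a\<^sub>0 \<eta>\<^sub>0 c\<^sub>1 c\<^sub>2 c\<^sub>3 X \<beta> C\<^sub>\<psi> \<alpha> p C\<^sub>0\<bar>"
    have "(\<integral>\<^sup>+Y\<in>- E. ennreal ((norm (Theta n E \<psi> f Y))\<^sup>2 / infdist Y E) \<partial>lebesgue)
        \<le> ennreal ?C * (\<integral>\<^sup>+x. ennreal ((norm (f x))\<^sup>2) \<partial>surface_measure n E)"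
      if E: "ahlfors_david_regular n C_E E" "dyadic_grid n a\<^sub>0 \<eta>\<^sub>0 c\<^sub>1 c\<^sub>2 c\<^sub>3 E D"
        and W: "whitney_decomposition E W" "square_function_kernel n C\<^sub>\<psi> \<alpha> E \<psi>"
        and b: "testing_system n c\<^sub>3 E D W \<beta> \<psi> C\<^sub>0 p b"
        and f: "f \<in> borel_measurable (surface_measure n E)"
          "(\<integral>\<^sup>+x. ennreal ((norm (f x))\<^sup>2) \<partial>surface_measure n E) < \<infinity>"
      for E :: "'a set" and D W \<psi> b f
    proof (cases "E = {} \<or> bounded E \<and> diameter E = 0")
      case True
      then show ?thesis using assms(1) by (simp add: Theta_degenerate)
    next
      case False
      interpret tb_setting n C_E a\<^sub>0 \<eta>\<^sub>0 c\<^sub>1 c\<^sub>2 c\<^sub>3 E D X W \<beta> C\<^sub>\<psi> \<alpha> \<psi>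
      proof unfold_locales
        show "0 < diameter E" if "bounded E" using that False diameter_ge_0[of E] by auto
      qed (use assms E W h X False in auto)
      show ?thesis by (rule square_function_bound[OF b h(5,4) f])
    qed
    then show "\<exists>C>0. \<forall>(E :: 'a set) D W \<psi> b.
      ahlfors_david_regular n C_E E \<longrightarrow>
      dyadic_grid n a\<^sub>0 \<eta>\<^sub>0 c\<^sub>1 c\<^sub>2 c\<^sub>3 E D \<longrightarrow>
      whitney_decomposition E W \<longrightarrow>
      square_function_kernel n C\<^sub>\<psi> \<alpha> E \<psi> \<longrightarrow>
      testing_system n c\<^sub>3 E D W \<beta> \<psi> C\<^sub>0 p b \<longrightarrow>
      (\<forall>f. f \<in> borel_measurable (surface_measure n E) \<longrightarrow>
           (\<integral>\<^sup>+x. ennreal ((norm (f x))\<^sup>2) \<partial>surface_measure n E) < \<infinity> \<longrightarrow>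
           (\<integral>\<^sup>+Y\<in>-E. ennreal ((norm (Theta n E \<psi> f Y))\<^sup>2 / infdist Y E) \<partial>lebesgue)
             \<le> ennreal C * (\<integral>\<^sup>+x. ennreal ((norm (f x))\<^sup>2) \<partial>surface_measure n E))"
      by (intro exI[of _ ?C]) auto
  qed
qed

end
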